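(* There exists a constant $\omega>0$, independent of the parameters $\lambda,R_i^{-1},\alpha_{p_i},\alpha_{ij}$ ($i,j=1,\dots,n$) and of the network scale $n$, such that $$\inf_{(\boldsymbol u;\boldsymbol v;\boldsymbol p)\in\boldsymbol U\times\boldsymbol V\times\boldsymbol P}\ \sup_{(\boldsymbol w;\boldsymbol z;\boldsymbol q)\in\boldsymbol U\times\boldsymbol V\times\boldsymbol P}\frac{\mathcal A((\boldsymbol u;\boldsymbol v;\boldsymbol p),(\boldsymbol w;\boldsymbol z;\boldsymbol q))}{(\|\boldsymbol u\|_{\boldsymbol U}+\|\boldsymbol v\|_{\boldsymbol V}+\|\boldsymbol p\|_{\boldsymbol P})(\|\boldsymbol w\|_{\boldsymbol U}+\|\boldsymbol z\|_{\boldsymbol V}+\|\boldsymbol q\|_{\boldsymbol P})}\ge\omega,$$ where the infimum and supremum are over nonzero elements.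
   Context: Domain and spaces: $\Omega\subset\mathbb R^d$, $d\in\{2,3\}$, is a bounded connected Lipschitz domain; $(\cdot,\cdot)$ and $\|\cdot\|$ are the $L^2(\Omega)$ inner product and norm (for scalar, vector or tensor functions). $\boldsymbol\epsilon(\boldsymbol u)=\frac12(\nabla\boldsymbol u+(\nabla\boldsymbol u)^T)$. $n\ge1$ is an integer (network scale). $\boldsymbol U=H^1_0(\Omega)^d$; $\boldsymbol V_i=H_0(\operatorname{div},\Omega)$ (fields in $L^2(\Omega)^d$ with divergence in $L^2(\Omega)$ and zero normal trace on $\partial\Omega$); $P_i=L^2_0(\Omega)=\{p\in L^2(\Omega):\int_\Omega p\,dx=0\}$, $i=1,\dots,n$; $\boldsymbol V=\boldsymbol V_1\times\dots\times\boldsymbol V_n$, $\boldsymbol P=P_1\times\dots\times P_n$. For $\boldsymbol v=(\boldsymbol v_1,\dots,\boldsymbol v_n)\in\boldsymbol V$, $\operatorname{Div}\boldsymbol v=(\operatorname{div}\boldsymbol v_1,\dots,\operatorname{div}\boldsymbol v_n)^T$; $\boldsymbol p=(p_1,\dots,p_n)^T$. Parameters: constants $\lambda>0$; $R_i^{-1}>0$ and $\alpha_{p_i}\ge0$ for $i=1,\dots,n$; $\alpha_{ij}=\frac{\tau\beta_{ij}}{\alpha_i\alpha_j}\ge0$ for $i,j=1,\dots,n$, where $\tau>0$, $\alpha_i>0$, $\beta_{ij}=\beta_{ji}\ge 0$ for $i\ne j$, and $\beta_{ii}=\sum_{j\neq i}\beta_{ij}$. Set $R^{-1}=\max\{R_1^{-1},\dots,R_n^{-1}\}$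 and $\lambda_0=\max\{1,\lambda\}$. Matrices ($n\times n$): $\Lambda_1$ has diagonal entries $\alpha_{ii}$ and off-diagonal entries $-\alpha_{ij}$; $\Lambda_2=\operatorname{diag}(\alpha_{p_1},\dots,\alpha_{p_n})$; $\Lambda_3=R\,I$; $\Lambda_4$ has all entries equal to $1/\lambda_0$; $\Lambda=\Lambda_1+\Lambda_2+\Lambda_3+\Lambda_4$ (symmetric positive definite). Norms: induced by the inner products $(\boldsymbol u,\boldsymbol w)_{\boldsymbol U}=(\boldsymbol\epsilon(\boldsymbol u),\boldsymbol\epsilon(\boldsymbol w))+\lambda(\operatorname{div}\boldsymbol u,\operatorname{div}\boldsymbol w)$, $(\boldsymbol v,\boldsymbol z)_{\boldsymbol V}=\sum_{i=1}^n(R_i^{-1}\boldsymbol v_i,\boldsymbol z_i)+(\Lambda^{-1}\operatorname{Div}\boldsymbol v,\operatorname{Div}\boldsymbol z)$, $(\boldsymbol p,\boldsymbol q)_{\boldsymbol P}=(\Lambda\boldsymbol p,\boldsymbol q)$. Bilinear form: $$\begin{aligned}\mathcal A((\boldsymbol u;\boldsymbol v;\boldsymbol p),(\boldsymbol w;\boldsymbol z;\boldsymbol q))=&(\boldsymbol\epsilon(\boldsymbol u),\boldsymbol\epsilon(\boldsymbol w))+\lambda(\operatorname{div}\boldsymbol u,\operatorname{div}\boldsymbol w)-\Big(\sum_{i=1}^np_i,\operatorname{div}\boldsymbol w\Big)+\sum_{i=1}^n(R_i^{-1}\boldsymbol v_i,\boldsymbol z_i)-(\boldsymbol p,\operatorname{Div}\boldsymbol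 z)\\&-\Big(\operatorname{div}\boldsymbol u,\sum_{i=1}^nq_i\Big)-(\operatorname{Div}\boldsymbol v,\boldsymbol q)-((\Lambda_1+\Lambda_2)\boldsymbol p,\boldsymbol q).\end{aligned}$$ "Independent of the parameters" means that one constant works for all admissible parameter values and all $n\ge 1$. *)

theory Defs
  imports "HOL-Analysis.Analysis" "Jordan_Normal_Form.Gauss_Jordan_Elimination"
begin

no_notation Matrix.vec_index (infixl \<open>$\<close> 100)
no_notation Matrix.scalar_prod (infix \<open>\<bullet>\<close> 70)

section \<open>Domains\<close>

text \<open>Near every boundary point, in Cartesian coordinates whose last axis points in the
  direction \<open>\<nu>\<close>, the set is the strict epigraph of a Lipschitz function \<open>g\<close> of the remaining
  coordinates (the hyperplane orthogonal to \<open>\<nu>\<close>).\<close>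

definition lipschitz_boundary :: "('a::euclidean_space) set \<Rightarrow> bool" where
  "lipschitz_boundary \<Omega> \<longleftrightarrow>
     (\<forall>x0\<in>frontier \<Omega>. \<exists>r>0. \<exists>\<nu> L. \<exists>g :: 'a \<Rightarrow> real.
        norm \<nu> = 1 \<and> L-lipschitz_on {y. y \<bullet> \<nu> = 0} g \<and>
        \<Omega> \<inter> ball x0 r = {x \<in> ball x0 r. g (x - (x \<bullet> \<nu>) *\<^sub>R \<nu>) < x \<bullet> \<nu>})"

definition bounded_lipschitz_domain :: "('a::euclidean_space) set \<Rightarrow> bool" where
  "bounded_lipschitz_domain \<Omega> \<longleftrightarrow>
     \<Omega> \<noteq> {} \<and> open \<Omega> \<and> connected \<Omega> \<and> bounded \<Omega> \<and> lipschitz_boundary \<Omega>"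

section \<open>Function spaces\<close>

text \<open>Elements of the spaces below are representatives: total functions whose values outside
  \<open>\<Omega>\<close> are irrelevant, and which are identified when they agree almost everywhere in \<open>\<Omega>\<close>.
  For matrix fields the inner product of \<^typ>\<open>real^'n^'m\<close> is the Frobenius product.\<close>

definition L2 :: "('a::euclidean_space) set \<Rightarrow> ('a \<Rightarrow> 'b::euclidean_space) set" where
  "L2 \<Omega> = {f. f \<in> borel_measurable (lebesgue_on \<Omega>) \<and>
              integrable (lebesgue_on \<Omega>) (\<lambda>x. (norm (f x))\<^sup>2)}"

definition L2_inner ::
  "('a::euclidean_space) set \<Rightarrow> ('a \<Rightarrow> 'b::euclidean_space) \<Rightarrow> ('a \<Rightarrow> 'b) \<Rightarrow> real" where
  "L2_inner \<Omega> f g = (LINT x|lebesgue_on \<Omega>. f x \<bullet> g x)"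

definition L20 :: "('a::euclidean_space) set \<Rightarrow> ('a \<Rightarrow> real) set" where
  "L20 \<Omega> = {p \<in> L2 \<Omega>. (LINT x|lebesgue_on \<Omega>. p x) = 0}"

definition zero_ae :: "('a::euclidean_space) set \<Rightarrow> ('a \<Rightarrow> 'b::euclidean_space) \<Rightarrow> bool" where
  "zero_ae \<Omega> f \<longleftrightarrow> (AE x in lebesgue_on \<Omega>. f x = 0)"

primrec C_k :: "nat \<Rightarrow> ('a::euclidean_space \<Rightarrow> real) \<Rightarrow> bool" where
  "C_k 0 f \<longleftrightarrow> continuous_on UNIV f"
| "C_k (Suc k) f \<longleftrightarrow> (\<forall>x. f differentiable (at x)) \<and>
     (\<forall>b\<in>Basis. C_k k (\<lambda>x. frechet_derivative f (at x) b))"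

definition test_functions :: "('a::euclidean_space) set \<Rightarrow> ('a \<Rightarrow> real) set" where
  "test_functions \<Omega> = {\<phi>. (\<forall>k. C_k k \<phi>) \<and>
     compact (closure {x. \<phi> x \<noteq> 0}) \<and> closure {x. \<phi> x \<noteq> 0} \<subseteq> \<Omega>}"

definition grad :: "(real^'d \<Rightarrow> real) \<Rightarrow> real^'d \<Rightarrow> real^'d" where
  "grad \<phi> x = (\<chi> j. frechet_derivative \<phi> (at x) (axis j 1))"

definition is_weak_grad ::
  "(real^'d) set \<Rightarrow> (real^'d \<Rightarrow> real) \<Rightarrow> (real^'d \<Rightarrow> real^'d) \<Rightarrow> bool" where
  "is_weak_grad \<Omega> f G \<longleftrightarrow> (\<forall>\<phi>\<in>test_functions \<Omega>.
     (LINT x|lebesgue_on \<Omega>. f x *\<^sub>R grad \<phi> x) = - (LINT x|lebesgue_on \<Omega>. \<phi> x *\<^sub>R G x))"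

definition is_weak_div ::
  "(real^'d) set \<Rightarrow> (real^'d \<Rightarrow> real^'d) \<Rightarrow> (real^'d \<Rightarrow> real) \<Rightarrow> bool" where
  "is_weak_div \<Omega> v D \<longleftrightarrow> (\<forall>\<phi>\<in>test_functions \<Omega>.
     (LINT x|lebesgue_on \<Omega>. v x \<bullet> grad \<phi> x) = - (LINT x|lebesgue_on \<Omega>. \<phi> x * D x))"

text \<open>Weak derivatives are unique only almost everywhere; a representative is chosen, and all
  quantities below are independent of the choice.\<close>

definition weak_grad :: "(real^'d) set \<Rightarrow> (real^'d \<Rightarrow> real) \<Rightarrow> real^'d \<Rightarrow> real^'d" where
  "weak_grad \<Omega> f = (SOME G. G \<in> L2 \<Omega> \<and> is_weak_grad \<Omega> f G)"

definition weak_div :: "(real^'d) set \<Rightarrow> (real^'d \<Rightarrow> real^'d) \<Rightarrow> real^'d \<Rightarrow> real" where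
  "weak_div \<Omega> v = (SOME D. D \<in> L2 \<Omega> \<and> is_weak_div \<Omega> v D)"

definition H1 :: "(real^'d) set \<Rightarrow> (real^'d \<Rightarrow> real) set" where
  "H1 \<Omega> = {f \<in> L2 \<Omega>. \<exists>G \<in> L2 \<Omega>. is_weak_grad \<Omega> f G}"

definition H1_norm :: "(real^'d) set \<Rightarrow> (real^'d \<Rightarrow> real) \<Rightarrow> real" where
  "H1_norm \<Omega> f = sqrt (L2_inner \<Omega> f f + L2_inner \<Omega> (weak_grad \<Omega> f) (weak_grad \<Omega> f))"

definition H10 :: "(real^'d) set \<Rightarrow> (real^'d \<Rightarrow> real) set" where
  "H10 \<Omega> = {f \<in> H1 \<Omega>. \<exists>\<phi>. (\<forall>k::nat. \<phi> k \<in> test_functions \<Omega>) \<and>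
     (\<lambda>k. H1_norm \<Omega> (\<lambda>x. f x - \<phi> k x)) \<longlonglongrightarrow> 0}"

definition Hdiv :: "(real^'d) set \<Rightarrow> (real^'d \<Rightarrow> real^'d) set" where
  "Hdiv \<Omega> = {v \<in> L2 \<Omega>. \<exists>D \<in> L2 \<Omega>. is_weak_div \<Omega> v D}"

text \<open>The normal trace of a field in \<^term>\<open>Hdiv \<Omega>\<close> is an element of \<open>H\<^sup>-\<^sup>1\<^sup>/\<^sup>2(\<partial>\<Omega>)\<close>, the dual of
  the trace space of \<^term>\<open>H1 \<Omega>\<close>; Green's formula defines its action on the trace of \<open>\<phi>\<close>.\<close>

definition normal_trace ::
  "(real^'d) set \<Rightarrow> (real^'d \<Rightarrow> real^'d) \<Rightarrow> (real^'d \<Rightarrow> real) \<Rightarrow> real" where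
  "normal_trace \<Omega> v \<phi> = L2_inner \<Omega> v (weak_grad \<Omega> \<phi>) + L2_inner \<Omega> (weak_div \<Omega> v) \<phi>"

definition H0div :: "(real^'d) set \<Rightarrow> (real^'d \<Rightarrow> real^'d) set" where
  "H0div \<Omega> = {v \<in> Hdiv \<Omega>. \<forall>\<phi>\<in>H1 \<Omega>. normal_trace \<Omega> v \<phi> = 0}"

definition strain :: "(real^'d) set \<Rightarrow> (real^'d \<Rightarrow> real^'d) \<Rightarrow> real^'d \<Rightarrow> real^'d^'d" where
  "strain \<Omega> u x = (let J = (\<chi> i. weak_grad \<Omega> (\<lambda>y. u y $ i) x) in (1/2) *\<^sub>R (J + transpose J))"

section \<open>Product spaces\<close>

text \<open>Network components are indexed by \<open>{..<n}\<close>; tuples are extensional functions on that set.\<close>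

definition U_space :: "(real^'d) set \<Rightarrow> (real^'d \<Rightarrow> real^'d) set" where
  "U_space \<Omega> = {u. \<forall>i. (\<lambda>x. u x $ i) \<in> H10 \<Omega>}"

definition V_space :: "(real^'d) set \<Rightarrow> nat \<Rightarrow> (nat \<Rightarrow> real^'d \<Rightarrow> real^'d) set" where
  "V_space \<Omega> n = (\<Pi>\<^sub>E i\<in>{..<n}. H0div \<Omega>)"

definition P_space :: "(real^'d) set \<Rightarrow> nat \<Rightarrow> (nat \<Rightarrow> real^'d \<Rightarrow> real) set" where
  "P_space \<Omega> n = (\<Pi>\<^sub>E i\<in>{..<n}. L20 \<Omega>)"

definition nonzero_triples ::
  "(real^'d) set \<Rightarrow> nat \<Rightarrow>
   ((real^'d \<Rightarrow> real^'d) \<times> (nat \<Rightarrow> real^'d \<Rightarrow> real^'d) \<times> (nat \<Rightarrow> real^'d \<Rightarrow> real)) set" where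
  "nonzero_triples \<Omega> n = {(u, v, p). u \<in> U_space \<Omega> \<and> v \<in> V_space \<Omega> n \<and> p \<in> P_space \<Omega> n \<and>
     \<not> (zero_ae \<Omega> u \<and> (\<forall>i<n. zero_ae \<Omega> (v i)) \<and> (\<forall>i<n. zero_ae \<Omega> (p i)))}"

definition Div :: "(real^'d) set \<Rightarrow> (nat \<Rightarrow> real^'d \<Rightarrow> real^'d) \<Rightarrow> nat \<Rightarrow> real^'d \<Rightarrow> real" where
  "Div \<Omega> v = (\<lambda>i. weak_div \<Omega> (v i))"

definition L2_inner_tuple ::
  "('a::euclidean_space) set \<Rightarrow> nat \<Rightarrow> (nat \<Rightarrow> 'a \<Rightarrow> real) \<Rightarrow> (nat \<Rightarrow> 'a \<Rightarrow> real) \<Rightarrow> real" where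
  "L2_inner_tuple \<Omega> n p q = (\<Sum>i<n. L2_inner \<Omega> (p i) (q i))"

definition mat_app :: "real mat \<Rightarrow> (nat \<Rightarrow> 'a \<Rightarrow> real) \<Rightarrow> nat \<Rightarrow> 'a \<Rightarrow> real" where
  "mat_app M p = (\<lambda>i x. \<Sum>j<dim_col M. M $$ (i, j) * p j x)"

section \<open>Parameters\<close>

text \<open>Here \<open>\<lambda>\<close> is written \<open>lam\<close>, \<open>Rinv i\<close> stands for \<open>R\<^sub>i\<close> to the power \<open>-1\<close>, \<open>ap i\<close> for
  \<open>\<alpha>\<^sub>p\<^sub>i\<close> and \<open>am i j\<close> for \<open>\<alpha>\<^sub>i\<^sub>j\<close>.\<close>

definition admissible ::
  "nat \<Rightarrow> real \<Rightarrow> (nat \<Rightarrow> real) \<Rightarrow> (nat \<Rightarrow> real) \<Rightarrow> (nat \<Rightarrow> nat \<Rightarrow> real) \<Rightarrow> bool" where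
  "admissible n lam Rinv ap am \<longleftrightarrow>
     lam > 0 \<and> (\<forall>i<n. Rinv i > 0) \<and> (\<forall>i<n. ap i \<ge> 0) \<and>
     (\<exists>\<tau> \<alpha> \<beta>. \<tau> > 0 \<and> (\<forall>i<n. \<alpha> i > 0) \<and>
        (\<forall>i<n. \<forall>j<n. i \<noteq> j \<longrightarrow> \<beta> i j = \<beta> j i \<and> \<beta> i j \<ge> 0) \<and>
        (\<forall>i<n. \<beta> i i = (\<Sum>j\<in>{..<n} - {i}. \<beta> i j)) \<and>
        (\<forall>i<n. \<forall>j<n. am i j = \<tau> * \<beta> i j / (\<alpha> i * \<alpha> j)))"

definition Lam1 :: "nat \<Rightarrow> (nat \<Rightarrow> nat \<Rightarrow> real) \<Rightarrow> real mat" where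
  "Lam1 n am = Matrix.mat n n (\<lambda>(i, j). if i = j then am i i else - am i j)"

definition Lam2 :: "nat \<Rightarrow> (nat \<Rightarrow> real) \<Rightarrow> real mat" where
  "Lam2 n ap = Matrix.mat n n (\<lambda>(i, j). if i = j then ap i else 0)"

definition Lam3 :: "nat \<Rightarrow> (nat \<Rightarrow> real) \<Rightarrow> real mat" where
  "Lam3 n Rinv = inverse (Max (Rinv ` {..<n})) \<cdot>\<^sub>m 1\<^sub>m n"

definition Lam4 :: "nat \<Rightarrow> real \<Rightarrow> real mat" where
  "Lam4 n lam = Matrix.mat n n (\<lambda>(i, j). 1 / max 1 lam)"

definition Lam ::
  "nat \<Rightarrow> real \<Rightarrow> (nat \<Rightarrow> real) \<Rightarrow> (nat \<Rightarrow> real) \<Rightarrow> (nat \<Rightarrow> nat \<Rightarrow> real) \<Rightarrow> real mat" where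
  "Lam n lam Rinv ap am = Lam1 n am + Lam2 n ap + Lam3 n Rinv + Lam4 n lam"

section \<open>Norms and bilinear form\<close>

definition U_inner ::
  "(real^'d) set \<Rightarrow> real \<Rightarrow> (real^'d \<Rightarrow> real^'d) \<Rightarrow> (real^'d \<Rightarrow> real^'d) \<Rightarrow> real" where
  "U_inner \<Omega> lam u w =
     L2_inner \<Omega> (strain \<Omega> u) (strain \<Omega> w) + lam * L2_inner \<Omega> (weak_div \<Omega> u) (weak_div \<Omega> w)"

definition V_inner ::
  "(real^'d) set \<Rightarrow> nat \<Rightarrow> real \<Rightarrow> (nat \<Rightarrow> real) \<Rightarrow> (nat \<Rightarrow> real) \<Rightarrow> (nat \<Rightarrow> nat \<Rightarrow> real) \<Rightarrow>
   (nat \<Rightarrow> real^'d \<Rightarrow> real^'d) \<Rightarrow> (nat \<Rightarrow> real^'d \<Rightarrow> real^'d) \<Rightarrow> real" where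
  "V_inner \<Omega> n lam Rinv ap am v z =
     (\<Sum>i<n. Rinv i * L2_inner \<Omega> (v i) (z i)) +
     L2_inner_tuple \<Omega> n (mat_app (the (mat_inverse (Lam n lam Rinv ap am))) (Div \<Omega> v)) (Div \<Omega> z)"

definition P_inner ::
  "(real^'d) set \<Rightarrow> nat \<Rightarrow> real \<Rightarrow> (nat \<Rightarrow> real) \<Rightarrow> (nat \<Rightarrow> real) \<Rightarrow> (nat \<Rightarrow> nat \<Rightarrow> real) \<Rightarrow>
   (nat \<Rightarrow> real^'d \<Rightarrow> real) \<Rightarrow> (nat \<Rightarrow> real^'d \<Rightarrow> real) \<Rightarrow> real" where
  "P_inner \<Omega> n lam Rinv ap am p q = L2_inner_tuple \<Omega> n (mat_app (Lam n lam Rinv ap am) p) q"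

definition norm_sum ::
  "(real^'d) set \<Rightarrow> nat \<Rightarrow> real \<Rightarrow> (nat \<Rightarrow> real) \<Rightarrow> (nat \<Rightarrow> real) \<Rightarrow> (nat \<Rightarrow> nat \<Rightarrow> real) \<Rightarrow>
   (real^'d \<Rightarrow> real^'d) \<Rightarrow> (nat \<Rightarrow> real^'d \<Rightarrow> real^'d) \<Rightarrow> (nat \<Rightarrow> real^'d \<Rightarrow> real) \<Rightarrow> real" where
  "norm_sum \<Omega> n lam Rinv ap am u v p =
     sqrt (U_inner \<Omega> lam u u) + sqrt (V_inner \<Omega> n lam Rinv ap am v v) +
     sqrt (P_inner \<Omega> n lam Rinv ap am p p)"

definition A_form ::
  "(real^'d) set \<Rightarrow> nat \<Rightarrow> real \<Rightarrow> (nat \<Rightarrow> real) \<Rightarrow> (nat \<Rightarrow> real) \<Rightarrow> (nat \<Rightarrow> nat \<Rightarrow> real) \<Rightarrow>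
   (real^'d \<Rightarrow> real^'d) \<Rightarrow> (nat \<Rightarrow> real^'d \<Rightarrow> real^'d) \<Rightarrow> (nat \<Rightarrow> real^'d \<Rightarrow> real) \<Rightarrow>
   (real^'d \<Rightarrow> real^'d) \<Rightarrow> (nat \<Rightarrow> real^'d \<Rightarrow> real^'d) \<Rightarrow> (nat \<Rightarrow> real^'d \<Rightarrow> real) \<Rightarrow> real" where
  "A_form \<Omega> n lam Rinv ap am u v p w z q =
     L2_inner \<Omega> (strain \<Omega> u) (strain \<Omega> w)
     + lam * L2_inner \<Omega> (weak_div \<Omega> u) (weak_div \<Omega> w)
     - L2_inner \<Omega> (\<lambda>x. \<Sum>i<n. p i x) (weak_div \<Omega> w)
     + (\<Sum>i<n. Rinv i * L2_inner \<Omega> (v i) (z i))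
     - L2_inner_tuple \<Omega> n p (Div \<Omega> z)
     - L2_inner \<Omega> (weak_div \<Omega> u) (\<lambda>x. \<Sum>i<n. q i x)
     - L2_inner_tuple \<Omega> n (Div \<Omega> v) q
     - L2_inner_tuple \<Omega> n (mat_app (Lam1 n am + Lam2 n ap) p) q"

end

theory Submission
 imports Defs
begin

text \<open>The crux is a uniform version of Necas' inequality: if \<open>p\<close> has mean zero and
 \<open>\<bar>\<integral> p div w\<bar> \<le> M \<parallel>grad w\<parallel>\<close> for all test fields \<open>w\<close>, then \<open>\<parallel>p\<parallel> \<le> A M\<close>. On a cube,
 \<open>div w = r\<close> is solved by the gradient of an inverse Laplacian of a cosine polynomial near \<open>r\<close>;
 a cutoff leaves an error with one more derivative, which is removed by integrating
 along the coordinate axes one after the other. Adding up such fields over finitely many cubes of bounded overlap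
 bounds the sum of the squared oscillations of \<open>p\<close> on these cubes, and chains of cubes bound \<open>p\<close> on compact sets. Near the boundary, cubes of size comparable to the distance
 control \<open>p(x) - p(x + \<sigma> \<nu>)\<close>, and comparing a dyadic layer with the next one, which consists of two
 of its translates, gains a factor \<open>3/4\<close>, so that the layers can be summed.

 For the theorem, choose test fields \<open>W\<close>, \<open>W\<^sub>i\<close> with \<open>(div W, s) = \<parallel>s\<parallel>^2\<close> for \<open>s = \<Sum>p\<^sub>i\<close> and
 \<open>(div W\<^sub>i, p\<^sub>i) = \<parallel>p\<^sub>i\<parallel>^2\<close>, and test with \<open>w = u - \<delta>/\<lambda>\<^sub>0 W\<close>, \<open>z\<^sub>i = v\<^sub>i - \<delta> R W\<^sub>i\<close> and
 \<open>q = - p - \<kappa> y\<close>, where \<open>\<Lambda> y = Div v\<close>. Young's inequality absorbs the cross terms for small \<open>\<delta>\<close> and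
 \<open>\<kappa>\<close> that depend only on the dimension and on the inf-sup constant. The norms are definite without
 Korn's inequality, because the diagonal of the strain controls \<open>u\<close> by Poincare's inequality.\<close>

text \<open>Uniformity in the parameters comes from matching weights. Using W as a displacement
  costs at most a fixed multiple of \<lambda>0 |s|^2 in the squared norm of U, so the factor
  \<delta>/\<lambda>0 turns this into \<delta>^2 |s|^2/\<lambda>0, the weight that \<Lambda>4 gives
  to s. The flux correction costs Rinv_i R^2 |p_i|^2 \<le> R |p_i|^2 and, as \<Lambda> \<ge> R I, at
  most R |div W_i|^2 for its divergence, which is the weight of \<Lambda>3. Testing with v alone
  does not see Div v; the term with y supplies its \<Lambda>-inverse norm. Necas' inequality enters
  by contraposition: if no test field reached |s|/(A+1) times its gradient norm, then |s| \<le> A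
  |s|/(A+1). The fields found in this way are smooth with compact support, hence lie in U and in
  H0div at once. The factor 3/4 is half of the 3/2 in a^2 \<le> 3 (a-b)^2 + (3/2) b^2: the integrals
  over the two disjoint translates add up to that over one layer, so averaging the two estimates
  halves the constant.\<close>

lemmas int_cong = Bochner_Integration.integral_cong
lemmas int_add = Bochner_Integration.integral_add
lemmas int_sum = Bochner_Integration.integral_sum
lemmas int_diff = Bochner_Integration.integral_diff
lemmas intble_sum = Bochner_Integration.integrable_sum
lemmas intble_add = Bochner_Integration.integrable_add
lemmas intble_bound = Bochner_Integration.integrable_bound
lemmas intble_diff = Bochner_Integration.integrable_diff
lemmas cart_eq_iff = Finite_Cartesian_Product.vec_eq_iff

subsection \<open>Smooth functions\<close>

definition Cinf :: "('a::euclidean_space => real) => bool" where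
 "Cinf f \<longleftrightarrow> (\<forall>k. C_k k f)"

lemma C_k_SucI:
 assumes "\<And>x. (f has_derivative D x) (at x)" and "\<And>b. b \<in> Basis ==> C_k k (\<lambda>x. D x b)"
 shows "C_k (Suc k) f"
proof -
 have "frechet_derivative f (at x) = D x" for x
  using frechet_derivative_at[OF assms(1)] by simp
 with assms show ?thesis
  by (auto simp: differentiable_def)
qed

lemma C_k_SucD:
 assumes "C_k (Suc k) f"
 shows "(f has_derivative frechet_derivative f (at x)) (at x)"
  and "b \<in> Basis ==> C_k k (\<lambda>x. frechet_derivative f (at x) b)"
 using assms by (auto simp: frechet_derivative_works)

lemma C_k_pred: "C_k (Suc k) f ==> C_k k f"
proof (induction k arbitrary: f)
 case 0
 thus ?case
  by (auto intro!: continuous_at_imp_continuous_on differentiable_imp_continuous_within)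
next
 case (Suc k)
 show ?case
  using C_k_SucD[OF Suc.prems] Suc.IH by (intro C_k_SucI) auto
qed

lemma C_k_const: "C_k k (\<lambda>x. c)"
proof (induction k arbitrary: c)
 case (Suc k)
 thus ?case by (intro C_k_SucI[where D = "\<lambda>_ _. 0"]) auto
qed auto

lemma C_k_add: "C_k k f ==> C_k k g ==> C_k k (\<lambda>x. f x + g x)"
proof (induction k arbitrary: f g)
 case 0 thus ?case by (auto intro: continuous_intros)
next
 case (Suc k)
 show ?case
  by (rule C_k_SucI[where D = "\<lambda>x v. frechet_derivative f (at x) v + frechet_derivative g (at x) v"])
   (auto intro!: has_derivative_add Suc.IH C_k_SucD Suc.prems)
qed

lemma C_k_mult: "C_k k f ==> C_k k g ==> C_k k (\<lambda>x. f x * g x)"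
proof (induction k arbitrary: f g)
 case 0 thus ?case by (auto intro: continuous_intros)
next
 case (Suc k)
 show ?case
  by (rule C_k_SucI[where D = "\<lambda>x v. f x * frechet_derivative g (at x) v + frechet_derivative f (at x) v * g x"])
   (auto intro!: has_derivative_mult C_k_add Suc.IH C_k_SucD Suc.prems C_k_pred[OF Suc.prems(1)] C_k_pred[OF Suc.prems(2)])
qed

lemma C_k_real_SucI:
 fixes f :: "real => real"
 assumes "\<And>x. (f has_real_derivative f' x) (at x)" and "C_k k f'"
 shows "C_k (Suc k) f"
 using assms
 by (intro C_k_SucI[where D = "\<lambda>x v. f' x * v"]) (auto simp: has_field_derivative_def)

lemma C_k_real_SucD:
 fixes f :: "real => real"
 assumes "C_k (Suc k) f"
 obtains f' where "\<And>x. (f has_real_derivative f' x) (at x)" and "C_k k f'"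
proof
 show "(f has_real_derivative frechet_derivative f (at x) 1) (at x)" for x
 proof -
  have "linear (frechet_derivative f (at x))"
   using C_k_SucD(1)[OF assms] has_derivative_linear by blast
  hence "frechet_derivative f (at x) v = frechet_derivative f (at x) 1 * v" for v
   using linear_scale[of "frechet_derivative f (at x)" v 1] by simp
  hence "frechet_derivative f (at x) = (*) (frechet_derivative f (at x) 1)" by (rule ext)
  with C_k_SucD(1)[OF assms, of x] show ?thesis
   unfolding has_field_derivative_def by simp
 qed
 show "C_k k (\<lambda>x. frechet_derivative f (at x) 1)"
  using C_k_SucD(2)[OF assms, of 1] by simp
qed

lemma C_k_compose_affine:
 fixes h :: "real => real" and a :: "'a::euclidean_space"
 shows "C_k k h ==> C_k k (\<lambda>x. h (a \<bullet> x + c))"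
proof (induction k arbitrary: h)
 case 0
 thus ?case by (auto intro!: continuous_on_compose2[of UNIV h] continuous_intros)
next
 case (Suc k)
 obtain h' where h': "\<And>x. (h has_real_derivative h' x) (at x)" "C_k k h'"
  using C_k_real_SucD[OF Suc.prems] by blast
 show ?case
 proof (rule C_k_SucI[where D = "\<lambda>x v. h' (a \<bullet> x + c)*(a \<bullet> v)"])
  show "((\<lambda>x. h (a \<bullet> x + c)) has_derivative (\<lambda>v. h' (a \<bullet> x + c)*(a \<bullet> v))) (at x)" for x
   using h'(1)[of "a \<bullet> x + c"] unfolding has_field_derivative_def
   by (rule has_derivative_compose[rotated]) (auto intro!: derivative_eq_intros)
  show "C_k k (\<lambda>x. h' (a \<bullet> x + c)*(a \<bullet> b))" for b
   using Suc.IH[OF h'(2)] by (intro C_k_mult C_k_const)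
 qed
qed

lemma Cinf_const [simp, intro]: "Cinf (\<lambda>x. c)"
 and Cinf_add [intro]: "Cinf f ==> Cinf g ==> Cinf (\<lambda>x. f x + g x)"
 and Cinf_mult [intro]: "Cinf f ==> Cinf g ==> Cinf (\<lambda>x. f x * g x)"
 by (auto simp: Cinf_def C_k_const C_k_add C_k_mult)

lemma Cinf_uminus [intro]: "Cinf f ==> Cinf (\<lambda>x. - f x)"
 using Cinf_mult[of "\<lambda>_. -1" f] by simp

lemma Cinf_diff [intro]: "Cinf f ==> Cinf g ==> Cinf (\<lambda>x. f x - g x)"
 using Cinf_add[of f "\<lambda>x. - g x"] by auto

lemma Cinf_sum [intro]: "(\<And>i. i \<in> I ==> Cinf (f i)) ==> Cinf (\<lambda>x. \<Sum>i\<in>I. f i x)"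
 by (induction I rule: infinite_finite_induct) (auto intro: Cinf_add)

lemma Cinf_prod [intro]: "(\<And>i. i \<in> I ==> Cinf (f i)) ==> Cinf (\<lambda>x. \<Prod>i\<in>I. f i x)"
 by (induction I rule: infinite_finite_induct) (auto intro: Cinf_mult)

lemma Cinf_compose_affine: "Cinf h ==> Cinf (\<lambda>x. h (a \<bullet> x + c))"
 by (auto simp: Cinf_def C_k_compose_affine)

text \<open>Differentiation maps the family into itself, \<open>s\<close> giving the index of the
  derivative, so the induction on the order of differentiability runs for all members at once. It is
  applied to the combinations of sin and cos and to the flat functions below.\<close>

lemma Cinf_real_sequence:
 fixes F :: "'p => real => real"
 assumes "\<And>p x. (F p has_real_derivative F (s p) x) (at x)"
 shows "Cinf (F p)"
 unfolding Cinf_def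
proof
 fix k show "C_k k (F p)"
 proof (induction k arbitrary: p)
  case 0
  show ?case
   using assms by (auto intro!: continuous_at_imp_continuous_on DERIV_isCont)
 next
  case (Suc k)
  show ?case by (rule C_k_real_SucI[OF assms Suc.IH])
 qed
qed

lemma Cinf_realI:
 fixes f :: "real => real"
 assumes "\<And>x. (f has_real_derivative f' x) (at x)" and "Cinf f'"
 shows "Cinf f"
 unfolding Cinf_def
proof
 fix k
 show "C_k k f"
  using C_k_real_SucI[OF assms(1), of k] assms(2) C_k_pred unfolding Cinf_def by blast
qed

lemma Cinf_inner: "Cinf (\<lambda>x. a \<bullet> x)"
proof -
 have "Cinf (\<lambda>x::real. x)"
  by (rule Cinf_realI[of _ "\<lambda>_. 1"]) (auto intro!: derivative_eq_intros)
 from Cinf_compose_affine[OF this, of a 0] show ?thesis by simp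
qed

lemma Cinf_sin: "Cinf (sin :: real => real)" and Cinf_cos: "Cinf (cos :: real => real)"
proof -
 have "Cinf (\<lambda>x. a * sin x + b * cos x :: real)" for a b
  using Cinf_real_sequence[of "\<lambda>q x. fst q * sin x + snd q * cos x :: real" "\<lambda>q. (- snd q, fst q)" "(a, b)"]
  by (force intro!: derivative_eq_intros)
 from this[of 1 0] this[of 0 1] show "Cinf (sin :: real => real)" "Cinf (cos :: real => real)"
  by auto
qed

lemma Cinf_has_derivative:
 "Cinf f ==> (f has_derivative frechet_derivative f (at x)) (at x)"
 unfolding Cinf_def by (rule C_k_SucD(1)[of 0]) blast

lemma linear_eq_sum_Basis:
 fixes F :: "'a::euclidean_space => real"
 assumes "linear F"
 shows "F v = (\<Sum>b\<in>Basis. (v \<bullet> b) * F b)"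
proof -
 have "F v = F (\<Sum>b\<in>Basis. (v \<bullet> b)*\<^sub>R b)" by (simp add: euclidean_representation)
 also have "\<dots> = (\<Sum>b\<in>Basis. (v \<bullet> b) * F b)"
  using assms by (simp add: linear_sum linear_scale)
 finally show ?thesis .
qed

lemma Cinf_frechet_derivative: "Cinf f ==> Cinf (\<lambda>x. frechet_derivative f (at x) v)"
proof -
 assume f: "Cinf f"
 have lin: "linear (frechet_derivative f (at x))" for x
  using Cinf_has_derivative[OF f] has_derivative_linear by blast
 have "frechet_derivative f (at x) v = (\<Sum>b\<in>Basis. (v \<bullet> b) * frechet_derivative f (at x) b)" for x
  by (rule linear_eq_sum_Basis[OF lin])
 moreover have "Cinf (\<lambda>x. frechet_derivative f (at x) b)" if "b \<in> Basis" for b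
  using f that C_k_SucD(2) unfolding Cinf_def by blast
 ultimately show ?thesis by (auto intro!: Cinf_sum Cinf_mult)
qed

lemma Cinf_continuous: "Cinf f ==> continuous_on S f"
 using C_k.simps(1) continuous_on_subset unfolding Cinf_def by blast

text \<open>The derivatives of \<open>exp (-1/x)\<close> on \<open>x > 0\<close> are polynomials in \<open>1/x\<close> times \<open>exp (-1/x)\<close>.\<close>

definition poly_flat :: "real poly => real => real" where
 "poly_flat p x = (if x > 0 then poly p (1/x) * exp (- (1/x)) else 0)"

lemma poly_flat_tendsto_0: "(poly_flat p \<longlongrightarrow> 0) (at_right 0)"
proof -
 have "((\<lambda>y. poly p y * exp (- y)) \<longlongrightarrow> 0) at_top"
 proof -
  have "((\<lambda>y. coeff p i*(y^i/exp y)) \<longlongrightarrow> coeff p i*0) at_top" for i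
   by (intro tendsto_intros tendsto_power_div_exp_0)
  hence "((\<lambda>y. \<Sum>i\<le>degree p. coeff p i*(y^i/exp y)) \<longlongrightarrow> (\<Sum>i\<le>degree p. 0)) at_top"
   by (intro tendsto_sum) simp
  moreover have "(\<Sum>i\<le>degree p. coeff p i*(y^i/exp y)) = poly p y * exp (- y)" for y
   by (simp add: poly_altdef exp_minus sum_distrib_right field_simps sum_divide_distrib)
  ultimately show ?thesis by simp
 qed
 moreover have "filterlim (\<lambda>x::real. 1/x) at_top (at_right 0)"
  using filterlim_inverse_at_top_right by (simp add: inverse_eq_divide)
 ultimately have "((\<lambda>x. poly p (1/x) * exp (- (1/x))) \<longlongrightarrow> 0) (at_right 0)"
  by (rule filterlim_compose)
 thus ?thesis
  by (rule Lim_transform_eventually)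
   (auto simp: poly_flat_def eventually_at_right_less intro: eventually_mono[OF eventually_at_right_less])
qed

text \<open>For x > 0 the chain rule gives x^-2 (p - p')(1/x) exp(-1/x), which explains the
  polynomial X^2 (p - p'). For x < 0 everything is zero, so only the origin needs a limit.\<close>

lemma poly_flat_deriv:
 "(poly_flat p has_real_derivative poly_flat ([:0, 0, 1:]*(p - pderiv p)) x) (at x)"
proof -
 consider "x > 0" | "x < 0" | "x = 0" by linarith
 thus ?thesis
 proof cases
  case 1
  have "((\<lambda>x. poly p (1/x) * exp (- (1/x))) has_real_derivative
    poly_flat ([:0, 0, 1:]*(p - pderiv p)) x) (at x)"
   using 1
   by (auto intro!: derivative_eq_intros DERIV_chain2[OF poly_DERIV] simp: poly_flat_def field_simps power2_eq_square)
  thus ?thesis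
   by (rule DERIV_cong_ev[THEN iffD1, OF refl _ refl, rotated])
    (use 1 in \<open>auto simp: poly_flat_def intro!: eventually_nhds_in_open[THEN eventually_mono, of "{0<..}"]\<close>)
 next
  case 2
  have "((\<lambda>x. 0::real) has_real_derivative poly_flat ([:0, 0, 1:]*(p - pderiv p)) x) (at x)"
   using 2 by (auto simp: poly_flat_def)
  thus ?thesis
   by (rule DERIV_cong_ev[THEN iffD1, OF refl _ refl, rotated])
    (use 2 in \<open>auto simp: poly_flat_def intro!: eventually_nhds_in_open[THEN eventually_mono, of "{..<0}"]\<close>)
 next
  case 3
  \<comment> \<open>Multiplying the polynomial by X divides the function by h, so the difference
    quotient at 0 is the flat function of X p, whose limit is known.\<close>
  have "((\<lambda>h. (poly_flat p (0 + h) - poly_flat p 0)/h) \<longlongrightarrow> 0) (at_right 0)"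
   using poly_flat_tendsto_0[of "[:0, 1:] * p"]
   by (rule Lim_transform_eventually)
    (auto simp: poly_flat_def field_simps intro: eventually_mono[OF eventually_at_right_less])
  moreover have "((\<lambda>h. (poly_flat p (0 + h) - poly_flat p 0)/h) \<longlongrightarrow> 0) (at_left 0)"
   by (rule Lim_transform_eventually[OF tendsto_const])
    (auto simp: poly_flat_def eventually_at_filter)
  ultimately have "((\<lambda>h. (poly_flat p (0 + h) - poly_flat p 0)/h) \<longlongrightarrow> 0) (at 0)"
   by (simp add: filterlim_split_at)
  with 3 show ?thesis
   by (simp add: DERIV_def poly_flat_def)
 qed
qed

lemma Cinf_poly_flat: "Cinf (poly_flat p)"
 by (rule Cinf_real_sequence[of poly_flat "\<lambda>p. [:0, 0, 1:]*(p - pderiv p)"]) (rule poly_flat_deriv)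

definition bump01 :: "real => real" where
 "bump01 x = poly_flat 1 x * poly_flat 1 (1 - x)"

lemma Cinf_bump01: "Cinf bump01"
proof -
 have "Cinf (\<lambda>x::real. poly_flat 1 ((-1) \<bullet> x + 1))"
  by (intro Cinf_compose_affine Cinf_poly_flat)
 thus ?thesis
  unfolding bump01_def[abs_def] by (intro Cinf_mult Cinf_poly_flat) (simp add: algebra_simps)
qed

lemma bump01_nonneg: "bump01 x \<ge> 0"
 and bump01_pos: "0 < x ==> x < 1 ==> bump01 x > 0"
 and bump01_eq_0: "x \<le> 0 \<or> x \<ge> 1 ==> bump01 x = 0"
 by (auto simp: bump01_def poly_flat_def)

text \<open>\<open>S\<close> is the primitive of a bump on (0,1), divided by its total mass. The
  derivative belongs to the conclusion because, rescaled, it becomes the profile of mass one along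
  coordinate lines; its positivity inside (0,1) makes that profile nonzero at the centre of the
  cube.\<close>

lemma smooth_step_exists:
 obtains S S' :: "real => real" where
  "Cinf S" "Cinf S'" "\<And>x. (S has_real_derivative S' x) (at x)"
  "\<And>x. 0 \<le> S x" "\<And>x. S x \<le> 1" "\<And>x. x \<le> 0 ==> S x = 0" "\<And>x. x \<ge> 1 ==> S x = 1"
  "\<And>x. 0 \<le> S' x" "\<And>x. 0 < x ==> x < 1 ==> 0 < S' x" "\<And>x. x \<le> 0 \<or> x \<ge> 1 ==> S' x = 0"
proof -
 \<comment> \<open>The lower limit -1 lies to the left of the support, so every x \<ge> 0 is
   interior to {-1..x+1}, where the fundamental theorem is applied.\<close>
 define F where "F x = integral {-1..x} bump01" for x
 have cont: "continuous_on A bump01" for A by (rule Cinf_continuous[OF Cinf_bump01])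
 have int: "bump01 integrable_on {a..b}" for a b
  by (rule integrable_continuous_real[OF cont])
 have F0: "F x = 0" if "x \<le> 0" for x
  unfolding F_def using that
  by (subst integral_cong[where g = "\<lambda>_. 0"]) (auto simp: bump01_eq_0)
 have deriv: "(F has_real_derivative bump01 x) (at x)" for x
 proof (cases "x < 0")
  case True
  have "((\<lambda>x. 0::real) has_real_derivative bump01 x) (at x)"
   using True by (auto simp: bump01_eq_0)
  thus ?thesis
   by (rule DERIV_cong_ev[THEN iffD1, OF refl _ refl, rotated])
    (use True in \<open>auto simp: F0 intro!: eventually_nhds_in_open[THEN eventually_mono, of "{..<0}"]\<close>)
 next
  case False
  have "(F has_real_derivative bump01 x) (at x within {-1..x+1})"
   unfolding F_def using False by (intro integral_has_real_derivative cont) auto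
  thus ?thesis
   using False by (subst (asm) at_within_interior) auto
 qed
 have mono: "F x \<le> F y" if "x \<le> y" for x y
  by (rule DERIV_nonneg_imp_nondecreasing[OF that]) (use deriv bump01_nonneg in blast)
 have F1: "F x = F 1" if "x \<ge> 1" for x
 proof (cases "x = 1")
  case False
  with that have "1 < x" by simp
  from MVT2[OF this, of F bump01] deriv obtain z where "1 < z" "F x - F 1 = (x - 1) * bump01 z" by blast
  thus ?thesis by (simp add: bump01_eq_0)
 qed auto
 have pos: "F 1 > 0"
 proof -
  have "0 < (1::real)" by simp
  from MVT2[OF this, of F bump01] deriv obtain z where "0 < z" "z < 1" "F 1 - F 0 = (1 - 0) * bump01 z" by blast
  thus ?thesis using bump01_pos[of z] F0[of 0] by simp
 qed
 show ?thesis
 proof (rule that[of "\<lambda>x. F x/F 1" "\<lambda>x. bump01 x/F 1"])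
  show D: "((\<lambda>x. F x/F 1) has_real_derivative bump01 x/F 1) (at x)" for x
   using deriv by (rule DERIV_cdivide)
  show B: "Cinf (\<lambda>x. bump01 x/F 1)"
   using Cinf_mult[OF Cinf_bump01 Cinf_const[of "1/F 1"]] by simp
  show "Cinf (\<lambda>x. F x/F 1)" by (rule Cinf_realI[OF D B])
  show "0 \<le> F x/F 1" for x
   using pos mono[of "min x 0" x] F0[of "min x 0"] by auto
  show "F x/F 1 \<le> 1" for x
   using pos mono[of x "max x 1"] F1[of "max x 1"] by auto
  show "F x/F 1 = 0" if "x \<le> 0" for x using F0[OF that] by simp
  show "F x/F 1 = 1" if "x \<ge> 1" for x using F1[OF that] pos by simp
  show "0 \<le> bump01 x/F 1" for x using bump01_nonneg[of x] pos by simp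
  show "0 < bump01 x/F 1" if "0 < x" "x < 1" for x using bump01_pos[OF that] pos by simp
  show "bump01 x/F 1 = 0" if "x \<le> 0 \<or> x \<ge> 1" for x using bump01_eq_0[OF that] by simp
 qed
qed

text \<open>For linear \<open>B\<close>, \<open>L\<close> this covers both the integral along a full coordinate line and the
 primitive \<open>\<integral>\<^sub>0\<^bsup>x_j\<^esup>\<close>, after rescaling the integration variable.\<close>

lemma has_derivative_line_integral:
 fixes f :: "'a::euclidean_space => real" and B L :: "'a => 'a"
 assumes f: "Cinf f" and B: "bounded_linear B" and L: "bounded_linear L"
 shows "((\<lambda>x. integral {0..1::real} (\<lambda>t. t^m * f (B x + b + t*\<^sub>R (L x + l)))) has_derivative
   (\<lambda>v. \<Sum>i\<in>Basis. (B v \<bullet> i) * integral {0..1} (\<lambda>t. t^m * frechet_derivative f (at (B x + b + t*\<^sub>R (L x + l))) i)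
    + (L v \<bullet> i) * integral {0..1} (\<lambda>t. t^Suc m * frechet_derivative f (at (B x + b + t*\<^sub>R (L x + l))) i))) (at x)"
proof -
 let ?A = "\<lambda>x t. B x + b + t*\<^sub>R (L x + l)"
 let ?f' = "\<lambda>y. frechet_derivative f (at y)"
 interpret B: bounded_linear B by fact
 interpret L: bounded_linear L by fact
 have lin: "linear (?f' x)" for x
  using Cinf_has_derivative[OF f] has_derivative_linear by blast
 have comp: "?f' y v = (\<Sum>i\<in>Basis. (v \<bullet> i) * ?f' y i)" for y v
  by (rule linear_eq_sum_Basis[OF lin])
 define D where "D x t = (\<Sum>i\<in>Basis. (t^m * ?f' (?A x t) i)*\<^sub>R Blinfun (\<lambda>v. B v \<bullet> i + t*(L v \<bullet> i)))" for x t
 have bl: "bounded_linear (\<lambda>v. B v \<bullet> i + t*(L v \<bullet> i))" for i t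
  by (intro bounded_linear_add bounded_linear_compose[OF bounded_linear_inner_left B]
    bounded_linear_compose[OF bounded_linear_mult_right] bounded_linear_compose[OF bounded_linear_inner_left L])
 have Dapp: "blinfun_apply (D x t) v = t^m * ?f' (?A x t) (B v + t*\<^sub>R L v)" for x t v
  by (subst comp) (simp add: D_def blinfun.sum_left blinfun.scaleR_left bounded_linear_Blinfun_apply[OF bl]
    inner_add_left sum_distrib_left mult_ac)
 have "continuous_on UNIV (\<lambda>x. ?f' x i)" for i by (intro Cinf_continuous Cinf_frechet_derivative f)
 hence contf': "continuous_on S (\<lambda>z. ?f' (g z) i)" if "continuous_on S g" for S i and g :: "'c::topological_space => 'a"
  using that by (rule continuous_on_compose2) auto
 have contf: "continuous_on S (\<lambda>z. f (g z))" if "continuous_on S g" for S and g :: "'c::topological_space => 'a"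
  using Cinf_continuous[OF f, of UNIV] that by (rule continuous_on_compose2) auto
 have contA: "continuous_on S (\<lambda>z. ?A (fst z) (snd z))" for S
  by (intro continuous_intros B.continuous_on L.continuous_on)
 have blin: "Blinfun (\<lambda>v. B v \<bullet> i + t*(L v \<bullet> i)) = Blinfun (\<lambda>v. B v \<bullet> i) + t*\<^sub>R Blinfun (\<lambda>v. L v \<bullet> i)" for i t
  by (rule blinfun_eqI) (simp add: bounded_linear_Blinfun_apply bl blinfun.add_left blinfun.scaleR_left
    bounded_linear_compose[OF bounded_linear_inner_left B] bounded_linear_compose[OF bounded_linear_inner_left L])
 have "((\<lambda>x. integral (cbox 0 1) (\<lambda>t. t^m * f (?A x t))) has_derivative integral (cbox 0 1) (D x)) (at x within UNIV)"
 proof (rule leibniz_rule)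
  show "((\<lambda>x. t^m * f (?A x t)) has_derivative blinfun_apply (D x t)) (at x within UNIV)" for x t
  proof -
   have "((\<lambda>x. ?A x t) has_derivative (\<lambda>v. B v + t*\<^sub>R L v)) (at x)"
    by (auto intro!: derivative_eq_intros B.has_derivative L.has_derivative)
   from has_derivative_compose[OF this Cinf_has_derivative[OF f]]
   have "((\<lambda>x. t^m * f (?A x t)) has_derivative (\<lambda>v. t^m * ?f' (?A x t) (B v + t*\<^sub>R L v))) (at x)"
    by (rule has_derivative_mult_right)
   thus ?thesis by (simp add: Dapp[abs_def])
  qed
  show "(\<lambda>t. t^m * f (?A x t)) integrable_on cbox 0 1" for x
   by (intro integrable_continuous continuous_intros contf)
  show "continuous_on (UNIV \<times> cbox 0 1) (\<lambda>(x, t). D x t)"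
   unfolding D_def blin split_beta
   by (intro continuous_intros contf' contA)
 qed auto
 moreover have "blinfun_apply (integral (cbox 0 1) (D x)) v =
   (\<Sum>i\<in>Basis. (B v \<bullet> i) * integral {0..1} (\<lambda>t. t^m * ?f' (?A x t) i)
    + (L v \<bullet> i) * integral {0..1} (\<lambda>t. t^Suc m * ?f' (?A x t) i))" for v
 proof -
  have contD: "continuous_on {0..1} (D x)"
   unfolding D_def blin by (intro continuous_intros contf')
  have "blinfun_apply (integral (cbox 0 1) (D x)) v = integral {0..1} (\<lambda>t. blinfun_apply (D x t) v)"
   using blinfun_apply_integral[OF integrable_continuous_real[OF contD]] by simp
  also have "\<dots> = integral {0..1} (\<lambda>t. \<Sum>i\<in>Basis. (B v \<bullet> i)*(t^m * ?f' (?A x t) i)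
    + (L v \<bullet> i)*(t^Suc m * ?f' (?A x t) i))"
   unfolding Dapp by (subst comp) (simp add: inner_add_left sum_distrib_left algebra_simps)
  also have "\<dots> = (\<Sum>i\<in>Basis. integral {0..1} (\<lambda>t. (B v \<bullet> i)*(t^m * ?f' (?A x t) i)
    + (L v \<bullet> i)*(t^Suc m * ?f' (?A x t) i)))"
   by (intro integral_sum integrable_continuous_real continuous_intros contf') auto
  also have "\<dots> = (\<Sum>i\<in>Basis. (B v \<bullet> i) * integral {0..1} (\<lambda>t. t^m * ?f' (?A x t) i)
    + (L v \<bullet> i) * integral {0..1} (\<lambda>t. t^Suc m * ?f' (?A x t) i))"
   by (subst integral_add) (auto intro!: sum.cong integrable_continuous_real continuous_intros contf')
  finally show ?thesis .
 qed
 hence "blinfun_apply (integral (cbox 0 1) (D x)) = (\<lambda>v. \<Sum>i\<in>Basis.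
    (B v \<bullet> i) * integral {0..1} (\<lambda>t. t^m * ?f' (?A x t) i)
    + (L v \<bullet> i) * integral {0..1} (\<lambda>t. t^Suc m * ?f' (?A x t) i))" by (rule ext)
 ultimately show ?thesis
  by simp
qed

lemma Cinf_line_integral:
 fixes f :: "'a::euclidean_space => real" and B L :: "'a => 'a"
 assumes f: "Cinf f" and B: "bounded_linear B" and L: "bounded_linear L"
 shows "Cinf (\<lambda>x. integral {0..1::real} (\<lambda>t. f (B x + b + t*\<^sub>R (L x + l))))"
proof -
 \<comment> \<open>The weight t^m makes the induction close: a derivative that falls on t L x raises
   m by one, so m has to vary.\<close>
 have "C_k k (\<lambda>x. integral {0..1::real} (\<lambda>t. t^m * f (B x + b + t*\<^sub>R (L x + l))))" if "Cinf f" for k m f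
  using that
 proof (induction k arbitrary: m f)
  case 0
  thus ?case
   using has_derivative_line_integral[OF 0 B L, of m b l, THEN has_derivative_continuous]
   by (auto intro!: continuous_at_imp_continuous_on)
 next
  case (Suc k)
  have S: "C_k k (\<lambda>x. \<Sum>i\<in>I. g i x)" if "\<And>i. i \<in> I ==> C_k k (g i)" for I :: "'a set" and g :: "'a => 'a => real"
   using that by (induction I rule: infinite_finite_induct) (auto intro: C_k_add C_k_const)
  show ?case
   by (rule C_k_SucI[OF has_derivative_line_integral[OF Suc.prems B L]])
    (intro S C_k_add C_k_mult C_k_const Suc.IH Cinf_frechet_derivative Suc.prems)
 qed
 from this[OF f, of _ 0] show ?thesis by (simp add: Cinf_def)
qed

subsection \<open>Square integrable functions\<close>

text \<open>The measure is a parameter because two are in use: \<open>lborel\<close> for the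
  calculus of compactly supported functions and \<open>lebesgue_on\<close> for the function
  spaces.\<close>

definition sqint :: "'a measure => ('a => real) => bool" where
 "sqint M f \<longleftrightarrow> f \<in> borel_measurable M \<and> integrable M (\<lambda>x. (f x)^2)"

definition nrm2 :: "'a measure => ('a => real) => real" where
 "nrm2 M f = sqrt (LINT x|M. (f x)^2)"

abbreviation "sqb \<equiv> sqint lborel"
abbreviation "nm \<equiv> nrm2 lborel"

lemma sqint_measurable [dest]: "sqint M f ==> f \<in> borel_measurable M"
 and sqint_integrable_square: "sqint M f ==> integrable M (\<lambda>x. (f x)^2)"
 by (auto simp: sqint_def)

lemma sqint_bound:
 assumes "f \<in> borel_measurable M" "sqint M g" "\<And>x. x \<in> space M ==> \<bar>f x\<bar> \<le> \<bar>g x\<bar>"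
 shows "sqint M f"
 unfolding sqint_def
proof
 have "integrable M (\<lambda>x. (g x)^2)" using assms(2) by (simp add: sqint_def)
 thus "integrable M (\<lambda>x. (f x)^2)"
  by (rule intble_bound)
   (use assms in \<open>auto simp: abs_le_square_iff intro!: AE_I2\<close>)
qed fact

lemma sqint_mult_integrable:
 assumes "sqint M f" "sqint M g"
 shows "integrable M (\<lambda>x. f x * g x)"
proof (rule intble_bound)
 show "integrable M (\<lambda>x. (f x)^2 + (g x)^2)"
  using assms by (auto simp: sqint_def)
 have "\<bar>a * b\<bar> \<le> a^2 + b^2" for a b :: real
 proof -
  have "2*(\<bar>a\<bar>*\<bar>b\<bar>) \<le> a^2 + b^2"
   using sum_squares_bound[of "\<bar>a\<bar>" "\<bar>b\<bar>"] by (simp add: mult.assoc)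
  moreover have "0 \<le> \<bar>a\<bar>*\<bar>b\<bar>" by simp
  ultimately show ?thesis unfolding abs_mult by linarith
 qed
 thus "AE x in M. norm (f x * g x) \<le> norm ((f x)^2 + (g x)^2)" by (auto intro!: AE_I2)
qed (use assms in \<open>auto simp: sqint_def\<close>)

lemma sqint_scale: "sqint M f ==> sqint M (\<lambda>x. c * f x)"
 by (auto simp: sqint_def power_mult_distrib)

lemma sqint_add:
 assumes "sqint M f" "sqint M g" shows "sqint M (\<lambda>x. f x + g x)"
 unfolding sqint_def
proof
 have "integrable M (\<lambda>x. (f x)^2 + (g x)^2 + 2*(f x * g x))"
  using assms sqint_mult_integrable[OF assms]
  by (intro intble_add integrable_mult_right) (auto simp: sqint_def)
 thus "integrable M (\<lambda>x. (f x + g x)^2)"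
  by (simp add: power2_sum mult.assoc)
qed (intro borel_measurable_add sqint_measurable assms)

lemma sqint_zero [simp]: "sqint M (\<lambda>x. 0)"
 by (simp add: sqint_def)

lemma sqint_uminus: "sqint M f ==> sqint M (\<lambda>x. - f x)"
 using sqint_scale[of M f "-1"] by simp

lemma sqint_diff: "sqint M f ==> sqint M g ==> sqint M (\<lambda>x. f x - g x)"
 using sqint_add[of M f "\<lambda>x. - g x"] by (simp add: sqint_uminus)

lemma sqint_sum: "(\<And>i. i \<in> I ==> sqint M (f i)) ==> sqint M (\<lambda>x. \<Sum>i\<in>I. f i x)"
 by (induction I rule: infinite_finite_induct) (auto intro: sqint_add)

lemma sqint_indicator:
 assumes "sqint M f" "A \<in> sets M" shows "sqint M (\<lambda>x. indicator A x * f x)"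
proof (rule sqint_bound[OF _ assms(1)])
 show "(\<lambda>x. indicator A x * f x) \<in> borel_measurable M"
  by (intro borel_measurable_times borel_measurable_indicator sqint_measurable assms)
qed (simp split: split_indicator)

lemma nrm2_nonneg [simp]: "0 \<le> nrm2 M f"
 by (simp add: nrm2_def integral_nonneg_AE)

lemma nrm2_square: "(nrm2 M f)^2 = (LINT x|M. (f x)^2)"
 by (simp add: nrm2_def integral_nonneg_AE)

lemma nrm2_uminus [simp]: "nrm2 M (\<lambda>x. - f x) = nrm2 M f"
 by (simp add: nrm2_def)

lemma nrm2_zero [simp]: "nrm2 M (\<lambda>x. 0) = 0"
 by (simp add: nrm2_def)

lemma nrm2_scale: "nrm2 M (\<lambda>x. c * f x) = \<bar>c\<bar> * nrm2 M f"
 by (simp add: nrm2_def power_mult_distrib real_sqrt_mult)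

lemma nrm2_abs [simp]: "nrm2 M (\<lambda>x. \<bar>f x\<bar>) = nrm2 M f"
 by (simp add: nrm2_def)

text \<open>The discriminant argument shared by the Cauchy-Schwarz inequality in L^2 and the one for
  matrix forms. The case c = 0 is separate: an affine function that is bounded below has slope
  zero.\<close>

lemma quadratic_nonneg_imp:
 fixes a b c :: real
 assumes "\<And>t. 0 \<le> a + 2 * t * b + t^2 * c" and "0 \<le> c"
 shows "b^2 \<le> a * c"
proof (cases "c = 0")
 case True
 have "b = 0"
 proof (rule ccontr)
  assume "b \<noteq> 0"
  \<comment> \<open>At this t the affine function takes the value -1.\<close>
  with True assms(1)[of "- (a + 1)/(2 * b)"] show False by (simp add: field_simps)
 qed
 with True show ?thesis by simp
next
 case False
 with assms(2) have c: "c > 0" by simp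
 have "0 \<le> a + 2*(- b/c) * b + (- b/c)^2 * c" by (rule assms(1))
 also have "\<dots> = a - b^2/c" using c by (simp add: field_simps power2_eq_square)
 finally show ?thesis using c by (simp add: field_simps)
qed

lemma L2_Cauchy_Schwarz:
 assumes f: "sqint M f" and g: "sqint M g"
 shows "\<bar>LINT x|M. f x * g x\<bar> \<le> nrm2 M f * nrm2 M g"
proof -
 have "0 \<le> (LINT x|M. (f x)^2) + 2 * t*(LINT x|M. f x * g x) + t^2*(LINT x|M. (g x)^2)" for t
 proof -
  have "0 \<le> (LINT x|M. (f x + t * g x)^2)" by (rule integral_nonneg_AE) auto
  also have "(\<lambda>x. (f x + t * g x)^2) = (\<lambda>x. (f x)^2 + 2 * t*(f x * g x) + t^2*(g x)^2)"
   by (auto simp: power2_sum power_mult_distrib)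
  also have "(LINT x|M. (f x)^2 + 2 * t*(f x * g x) + t^2*(g x)^2) =
    (LINT x|M. (f x)^2) + 2 * t*(LINT x|M. f x * g x) + t^2*(LINT x|M. (g x)^2)"
   using f g sqint_mult_integrable[OF f g] by (simp add: sqint_def)
  finally show ?thesis .
 qed
 from quadratic_nonneg_imp[OF this]
 have "(LINT x|M. f x * g x)^2 \<le> (nrm2 M f * nrm2 M g)^2"
  by (simp add: power_mult_distrib nrm2_square integral_nonneg_AE)
 thus ?thesis
  by (simp add: abs_le_square_iff[symmetric])
qed

lemma nrm2_triangle:
 assumes f: "sqint M f" and g: "sqint M g"
 shows "nrm2 M (\<lambda>x. f x + g x) \<le> nrm2 M f + nrm2 M g"
proof (rule power2_le_imp_le)
 have "(nrm2 M (\<lambda>x. f x + g x))^2 = (LINT x|M. (f x)^2 + (g x)^2 + 2*(f x * g x))"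
  by (simp add: nrm2_square power2_sum mult.assoc)
 also have "\<dots> = (nrm2 M f)^2 + (nrm2 M g)^2 + 2*(LINT x|M. f x * g x)"
  using f g sqint_mult_integrable[OF f g] by (simp add: sqint_def nrm2_square)
 also have "\<dots> \<le> (nrm2 M f + nrm2 M g)^2"
  using L2_Cauchy_Schwarz[OF f g] by (simp add: power2_sum)
 finally show "(nrm2 M (\<lambda>x. f x + g x))^2 \<le> (nrm2 M f + nrm2 M g)^2" .
qed auto

lemma nrm2_triangle_diff:
 assumes "sqint M f" "sqint M g"
 shows "nrm2 M (\<lambda>x. f x - g x) \<le> nrm2 M f + nrm2 M g"
 using nrm2_triangle[of M f "\<lambda>x. - g x"] assms by (simp add: sqint_uminus)

lemma nrm2_sum:
 assumes "\<And>i. i \<in> I ==> sqint M (f i)"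
 shows "nrm2 M (\<lambda>x. \<Sum>i\<in>I. f i x) \<le> (\<Sum>i\<in>I. nrm2 M (f i))"
 using assms
proof (induction I rule: infinite_finite_induct)
 case (insert a I)
 thus ?case
  using nrm2_triangle[of M "f a" "\<lambda>x. \<Sum>i\<in>I. f i x"] sqint_sum[of I M f] by simp
qed auto

lemma nrm2_mono:
 assumes "sqint M g" "f \<in> borel_measurable M" "\<And>x. x \<in> space M ==> \<bar>f x\<bar> \<le> \<bar>g x\<bar>"
 shows "nrm2 M f \<le> nrm2 M g"
 unfolding nrm2_def
 using assms sqint_bound[OF assms(2,1,3)]
 by (auto intro!: real_sqrt_le_mono integral_mono simp: sqint_def abs_le_square_iff)

lemma nrm2_mult_bound:
 assumes "sqint M f" "h \<in> borel_measurable M" "\<And>x. x \<in> space M ==> \<bar>h x\<bar> \<le> B"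
 shows "sqint M (\<lambda>x. h x * f x)" "nrm2 M (\<lambda>x. h x * f x) \<le> \<bar>B\<bar> * nrm2 M f"
proof -
 have b: "\<bar>h x * f x\<bar> \<le> \<bar>\<bar>B\<bar> * f x\<bar>" if "x \<in> space M" for x
  using assms(3)[OF that] by (auto simp: abs_mult intro!: mult_right_mono)
 have m: "(\<lambda>x. h x * f x) \<in> borel_measurable M" using assms by auto
 show "sqint M (\<lambda>x. h x * f x)"
  by (rule sqint_bound[OF m sqint_scale[OF assms(1)] b])
 show "nrm2 M (\<lambda>x. h x * f x) \<le> \<bar>B\<bar> * nrm2 M f"
  using nrm2_mono[OF sqint_scale[OF assms(1)] m b] by (simp add: nrm2_scale)
qed

lemma nrm2_eq_0_iff:
 assumes "sqint M f"
 shows "nrm2 M f = 0 \<longleftrightarrow> (AE x in M. f x = 0)"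
 using assms integral_nonneg_eq_0_iff_AE[of M "\<lambda>x. (f x)^2"]
 by (simp add: nrm2_def sqint_def)

lemma nrm2_cong_AE:
 assumes "f \<in> borel_measurable M" "g \<in> borel_measurable M" "AE x in M. f x = g x"
 shows "nrm2 M f = nrm2 M g"
 unfolding nrm2_def
 using assms by (intro arg_cong[of _ _ sqrt] integral_cong_AE) auto

subsection \<open>Compactly supported smooth functions\<close>

abbreviation pd :: "(real^'d => real) => 'd => real^'d => real" where
 "pd f j \<equiv> \<lambda>x. frechet_derivative f (at x) (axis j 1)"

text \<open>The set \<open>K\<close> is carried along instead of the support, so that sums, products
  and, for closed \<open>K\<close>, derivatives stay in the same class.\<close>

definition tf :: "(real^'d) set => (real^'d => real) => bool" where
 "tf K f \<longleftrightarrow> Cinf f \<and> (\<forall>x. x \<notin> K \<longrightarrow> f x = 0)"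

lemma tf_Cinf: "tf K f ==> Cinf f" and tf_eq_0: "tf K f ==> x \<notin> K ==> f x = 0"
 by (auto simp: tf_def)

lemma tf_mono: "tf K f ==> K \<subseteq> K' ==> tf K' f"
 by (auto simp: tf_def)

lemma tf_zero [simp]: "tf K (\<lambda>x. 0)"
 by (simp add: tf_def)

lemma tf_add: "tf K f ==> tf K g ==> tf K (\<lambda>x. f x + g x)"
 and tf_diff: "tf K f ==> tf K g ==> tf K (\<lambda>x. f x - g x)"
 and tf_mult: "tf K f ==> Cinf h ==> tf K (\<lambda>x. h x * f x)"
 and tf_mult2: "tf K f ==> Cinf h ==> tf K (\<lambda>x. f x * h x)"
 by (auto simp: tf_def)

lemma tf_scale: "tf K f ==> tf K (\<lambda>x. c * f x)"
 by (auto intro: tf_mult)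

lemma tf_sum: "(\<And>i. i \<in> I ==> tf K (f i)) ==> tf K (\<lambda>x. \<Sum>i\<in>I. f i x)"
 by (auto simp: tf_def intro!: Cinf_sum sum.neutral)

lemma pd_eqI: "(f has_derivative D) (at x) ==> pd f j x = D (axis j 1)"
 using frechet_derivative_at[of f D x] by simp

lemma pd_add: "Cinf f ==> Cinf g ==> pd (\<lambda>x. f x + g x) j x = pd f j x + pd g j x"
 by (rule pd_eqI, intro has_derivative_add Cinf_has_derivative)

lemma pd_diff: "Cinf f ==> Cinf g ==> pd (\<lambda>x. f x - g x) j x = pd f j x - pd g j x"
 by (rule pd_eqI, intro has_derivative_diff Cinf_has_derivative)

lemma pd_mult: "Cinf f ==> Cinf g ==> pd (\<lambda>x. f x * g x) j x = f x * pd g j x + pd f j x * g x"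
 by (rule pd_eqI, intro has_derivative_mult Cinf_has_derivative)

lemma pd_scale: "Cinf f ==> pd (\<lambda>x. c * f x) j x = c * pd f j x"
 by (rule pd_eqI, intro has_derivative_mult_right Cinf_has_derivative)

lemma pd_sum: "(\<And>i. i \<in> I ==> Cinf (f i)) ==> pd (\<lambda>x. \<Sum>i\<in>I. f i x) j x = (\<Sum>i\<in>I. pd (f i) j x)"
 by (rule pd_eqI, intro has_derivative_sum Cinf_has_derivative)

lemma pd_const [simp]: "pd (\<lambda>x. c) j x = 0"
 by (rule pd_eqI[of _ "\<lambda>_. 0"]) simp

lemma Cinf_nth: "Cinf (\<lambda>x::real^'d. x$i)"
 using Cinf_inner[of "axis i (1::real)"] by (simp add: inner_axis' inner_real_def)

lemma has_derivative_nth: "((\<lambda>x::real^'d. x$i) has_derivative (\<lambda>v. v$i)) F"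
 by (rule bounded_linear_imp_has_derivative) (rule bounded_linear_vec_nth)

lemma pd_compose_nth:
 assumes "\<And>t. (h has_real_derivative h' t) (at t)"
 shows "pd (\<lambda>x::real^'d. h (x$i)) j x = (if i = j then h' (x$i) else 0)"
proof -
 have "((\<lambda>x::real^'d. h (x$i)) has_derivative (\<lambda>v. h' (x$i)*(v$i))) (at x)"
  using has_derivative_compose[OF has_derivative_nth assms[of "x$i", unfolded has_field_derivative_def]] .
 from pd_eqI[OF this, of j] show ?thesis by (simp add: axis_def)
qed

lemma Cinf_compose_nth: "Cinf h ==> Cinf (\<lambda>x::real^'d. h (x$i))"
 using Cinf_compose_affine[of h "axis i (1::real)" 0] by (simp add: inner_axis' inner_real_def)

lemma Cinf_pd: "Cinf f ==> Cinf (pd f j)"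
 by (rule Cinf_frechet_derivative)

lemma pd_eq_0_outside:
 assumes "closed K" "\<And>x. x \<notin> K ==> f x = 0" "x \<notin> K"
 shows "pd f j x = 0"
proof -
 have "(f has_derivative (\<lambda>v. 0)) (at x)"
 proof (rule has_derivative_transform_within_open)
  show "((\<lambda>x. 0) has_derivative (\<lambda>v. 0)) (at x)" by simp
  show "open (- K)" using assms(1) by (simp add: open_Compl)
 qed (use assms in auto)
 from pd_eqI[OF this] show ?thesis by simp
qed

lemma tf_pd: "tf K f ==> closed K ==> tf K (pd f j)"
 using pd_eq_0_outside[of K f] by (auto simp: tf_def Cinf_pd)

lemma tf_borel: "tf K f ==> f \<in> borel_measurable borel"
 by (auto intro!: borel_measurable_continuous_onI Cinf_continuous simp: tf_def)

lemma tf_bounded: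
 assumes "tf K f" "compact K"
 obtains B where "B > 0" "\<And>x. \<bar>f x\<bar> \<le> B"
proof -
 have "compact (f ` K)"
  using assms by (intro compact_continuous_image Cinf_continuous) (auto simp: tf_def)
 then obtain B where B: "B > 0" "\<forall>x\<in>f ` K. norm x \<le> B"
  using compact_imp_bounded bounded_pos by blast
 hence "\<bar>f x\<bar> \<le> B" for x
  using assms(1) by (cases "x \<in> K") (auto simp: tf_def)
 with B(1) show ?thesis using that by blast
qed

lemma tf_integrable:
 assumes "tf K f" "compact K"
 shows "integrable lborel f"
proof -
 have "integrable lborel (\<lambda>x. indicator K x*\<^sub>R f x)"
  using assms by (intro borel_integrable_compact Cinf_continuous) (auto simp: tf_def)
 moreover have "(\<lambda>x. indicator K x*\<^sub>R f x) = f"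
  using assms by (auto simp: tf_def fun_eq_iff split: split_indicator)
 ultimately show ?thesis by simp
qed

lemma tf_sqint:
 assumes "tf K f" "compact K"
 shows "sqb f"
 unfolding sqint_def power2_eq_square
proof
 show "f \<in> borel_measurable lborel" using tf_borel[OF assms(1)] by simp
 show "integrable lborel (\<lambda>x. f x * f x)"
  by (rule tf_integrable[OF tf_mult[OF assms(1) tf_Cinf[OF assms(1)]] assms(2)])
qed

lemma lborel_integral_translation:
 fixes f :: "'a::euclidean_space => real"
 assumes "f \<in> borel_measurable borel"
 shows "(LBINT x. f (c + x)) = (LBINT x. f x)"
proof -
 have "(LBINT x. f x) = (LINT x|distr lborel borel ((+) c). f x)"
  by (simp add: lborel_distr_plus)
 also have "\<dots> = (LBINT x. f (c + x))"
  using assms by (subst integral_distr) auto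
 finally show ?thesis by simp
qed

lemma lborel_integrable_translation:
 fixes f :: "'a::euclidean_space => real"
 assumes "f \<in> borel_measurable borel"
 shows "integrable lborel (\<lambda>x. f (c + x)) \<longleftrightarrow> integrable lborel f"
proof -
 have "integrable lborel f \<longleftrightarrow> integrable (distr lborel borel ((+) c)) f"
  by (simp add: lborel_distr_plus)
 also have "\<dots> \<longleftrightarrow> integrable lborel (\<lambda>x. f (c + x))"
  using assms by (subst integrable_distr_eq) auto
 finally show ?thesis by simp
qed

lemma Cinf_line_MVT:
 fixes f :: "real^'d => real"
 assumes "Cinf f" "t > 0"
 obtains s where "0 < s" "s < t" "f (x + t*\<^sub>R axis j 1) - f x = t * pd f j (x + s*\<^sub>R axis j 1)"
proof -
 have "((\<lambda>s. f (x + s*\<^sub>R axis j 1)) has_real_derivative pd f j (x + s*\<^sub>R axis j 1)) (at s)" for s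
 proof -
  have "((\<lambda>s. f (x + s*\<^sub>R axis j 1)) has_derivative
   (\<lambda>h. frechet_derivative f (at (x + s*\<^sub>R axis j 1)) (h*\<^sub>R axis j 1))) (at s)"
   by (rule has_derivative_compose[OF _ Cinf_has_derivative[OF assms(1)]])
    (auto intro!: derivative_eq_intros)
  moreover have "linear (frechet_derivative f (at (x + s*\<^sub>R axis j 1)))"
   using Cinf_has_derivative[OF assms(1)] has_derivative_linear by blast
  ultimately show ?thesis
   unfolding has_field_derivative_def by (simp add: linear_scale mult.commute[of _ "pd f j _"])
 qed
 from MVT2[OF assms(2), of "\<lambda>s. f (x + s*\<^sub>R axis j 1)" "\<lambda>s. pd f j (x + s*\<^sub>R axis j 1)"] this
 obtain s where "0 < s" "s < t" "f (x + t*\<^sub>R axis j 1) - f (x + 0*\<^sub>R axis j 1) = (t - 0) * pd f j (x + s*\<^sub>R axis j 1)"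
  by blast
 with that show ?thesis by simp
qed

text \<open>Difference quotients have integral zero by translation invariance, and they converge to
  the derivative with a common bound on a bounded set.\<close>

lemma integral_pd_eq_0:
 fixes f :: "real^'d => real"
 assumes f: "tf K f" and K: "compact K"
 shows "(LBINT x. pd f j x) = 0"
proof -
 have clK: "closed K" using K compact_imp_closed by blast
 obtain B where B: "B > 0" "\<And>x. \<bar>pd f j x\<bar> \<le> B"
  using tf_bounded[OF tf_pd[OF f clK] K] by blast
 obtain R where R: "\<And>x. x \<in> K ==> norm x \<le> R"
  using K compact_imp_bounded bounded_iff by metis
 let ?q = "\<lambda>n x. (f (x + (1/real (Suc n))*\<^sub>R axis j 1) - f x) * Suc n"
 have "(\<lambda>n. LBINT x. ?q n x) \<longlonglongrightarrow> (LBINT x. pd f j x)"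
 \<comment> \<open>The increments 1/(n+1) are at most 1, so all quotients vanish outside the ball of
   radius R + 1; inside, the mean value theorem bounds them by B.\<close>
 proof (rule integral_dominated_convergence[where w = "\<lambda>x. indicator (cball 0 (R + 1)) x * B"])
  show "AE x in lborel. (\<lambda>n. ?q n x) \<longlonglongrightarrow> pd f j x"
  proof (rule AE_I2)
   fix x :: "real^'d"
   have lin: "linear (frechet_derivative f (at x))"
    using Cinf_has_derivative[OF tf_Cinf[OF f]] has_derivative_linear by blast
   have "((\<lambda>s. f (x + s*\<^sub>R axis j 1)) has_derivative
     (\<lambda>h. frechet_derivative f (at (x + 0*\<^sub>R axis j 1)) (h*\<^sub>R axis j 1))) (at 0)"
    by (rule has_derivative_compose[OF _ Cinf_has_derivative[OF tf_Cinf[OF f]]])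
     (auto intro!: derivative_eq_intros)
   hence "((\<lambda>s. f (x + s*\<^sub>R axis j 1)) has_real_derivative pd f j x) (at 0)"
    using lin unfolding has_field_derivative_def by (simp add: linear_scale mult.commute[of _ "pd f j _"])
   hence "((\<lambda>h. (f (x + h*\<^sub>R axis j 1) - f x)/h) \<longlongrightarrow> pd f j x) (at 0)"
    by (simp add: DERIV_def)
   moreover have "filterlim (\<lambda>n. 1/real (Suc n)) (at 0) sequentially"
    using LIMSEQ_inverse_real_of_nat by (auto simp: filterlim_at inverse_eq_divide)
   ultimately have "(\<lambda>n. (f (x + (1/real (Suc n))*\<^sub>R axis j 1) - f x)/(1/real (Suc n))) \<longlonglongrightarrow> pd f j x"
    by (rule filterlim_compose)
   thus "(\<lambda>n. ?q n x) \<longlonglongrightarrow> pd f j x" by simp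
  qed
  show "AE x in lborel. norm (?q n x) \<le> indicator (cball 0 (R + 1)) x * B" for n
  proof (rule AE_I2)
   fix x :: "real^'d"
   show "norm (?q n x) \<le> indicator (cball 0 (R + 1)) x * B"
   proof (cases "x \<in> cball 0 (R + 1)")
    case True
    obtain s where "f (x + (1/real (Suc n))*\<^sub>R axis j 1) - f x = (1/real (Suc n)) * pd f j (x + s*\<^sub>R axis j 1)"
     by (rule Cinf_line_MVT[OF tf_Cinf[OF f], where t = "1/real (Suc n)" and x = x and j = j]) (simp, rule that)
    hence "?q n x = pd f j (x + s*\<^sub>R axis j 1)" by simp
    with True B(2) show ?thesis by simp
   next
    case False
    define e :: "real^'d" where "e = (1/real (Suc n))*\<^sub>R axis j 1"
    have "norm e \<le> 1" by (simp add: e_def)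
    moreover have "norm x \<le> norm (x + e) + norm e"
     using norm_triangle_ineq4[of "x + e" e] by simp
    ultimately have "x \<notin> K" "x + e \<notin> K"
     using False R[of x] R[of "x + e"] by auto
    hence "f x = 0" "f (x + (1/real (Suc n))*\<^sub>R axis j 1) = 0"
     using tf_eq_0[OF f] by (auto simp: e_def)
    with False show ?thesis by simp
   qed
  qed
  show "integrable lborel (\<lambda>x. indicator (cball 0 (R + 1)) x * B)"
   by (intro integrable_mult_left integrable_real_indicator) (auto intro!: emeasure_bounded_finite[unfolded infinity_ennreal_def])
 qed (use tf_borel[OF f] tf_borel[OF tf_pd[OF f clK]] in auto)
 moreover have "(LBINT x. ?q n x) = 0" for n
 proof -
  have "integrable lborel (\<lambda>x. f ((1/real (Suc n))*\<^sub>R axis j 1 + x))"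
   by (simp only: lborel_integrable_translation[OF tf_borel[OF f]] tf_integrable[OF f K])
  hence "(LBINT x. f (x + (1/real (Suc n))*\<^sub>R axis j 1) - f x) = 0"
   using lborel_integral_translation[OF tf_borel[OF f], of "(1/real (Suc n))*\<^sub>R axis j 1"] tf_integrable[OF f K]
   by (simp add: add.commute)
  thus ?thesis by (simp del: of_nat_Suc)
 qed
 ultimately have "(\<lambda>n. 0) \<longlonglongrightarrow> (LBINT x. pd f j x)" by (simp only:)
 from LIMSEQ_unique[OF this tendsto_const] show ?thesis .
qed

text \<open>Integrate the j-th derivative of x_j f^2, which is f^2 + 2 x_j f times the j-th
  derivative of f. Only this one derivative appears on the right, a feature on which both the
  coordinatewise construction and the definiteness of the strain norm rely.\<close>

lemma tf_Poincare:
 fixes f :: "real^'d => real"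
 assumes f: "tf K f" and K: "compact K" and R: "\<And>x. x \<in> K ==> \<bar>x$j\<bar> \<le> R"
 shows "nm f \<le> 2*\<bar>R\<bar> * nm (pd f j)"
proof -
 have clK: "closed K" using K compact_imp_closed by blast
 note C = tf_Cinf[OF f]
 \<comment> \<open>The coordinate is unbounded on the whole space; truncated to \<open>K\<close> it
   is a bounded multiplier, and nothing changes in products with f.\<close>
 let ?xf = "\<lambda>x. (if x \<in> K then x$j else 0)"
 have Km: "K \<in> sets borel" using clK by simp
 have xf: "(\<lambda>x. ?xf x) \<in> borel_measurable lborel" using Km by measurable
 have "pd (\<lambda>x. x$j*(f x * f x)) j x = (f x)^2 + 2*(f x*(?xf x * pd f j x))" for x
 proof -
  have "pd (\<lambda>x. x$j) j x = 1" using pd_compose_nth[where h = "\<lambda>t. t" and h' = "\<lambda>_. 1" and i = j and j = j and x = x] by auto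
  hence "pd (\<lambda>x. x$j*(f x * f x)) j x = (f x)^2 + 2*(f x*(x$j * pd f j x))"
   unfolding pd_mult[OF Cinf_nth Cinf_mult[OF C C]] pd_mult[OF C C]
   by (simp add: power2_eq_square algebra_simps)
  thus ?thesis using tf_eq_0[OF f, of x] by auto
 qed
 moreover have "(LBINT x. pd (\<lambda>x. x$j*(f x * f x)) j x) = 0"
  by (rule integral_pd_eq_0[OF tf_mult[OF tf_mult[OF f C] Cinf_nth] K])
 ultimately have "(LBINT x. (f x)^2 + 2*(f x*(?xf x * pd f j x))) = 0"
  by (simp only:)
 moreover note b = nrm2_mult_bound[OF tf_sqint[OF tf_pd[OF f clK, of j] K] xf, of "\<bar>R\<bar>"]
 have sq: "sqb (\<lambda>x. ?xf x * pd f j x)"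
  by (rule b(1)) (use R in force)
 have le: "nm (\<lambda>x. ?xf x * pd f j x) \<le> \<bar>\<bar>R\<bar>\<bar> * nm (pd f j)"
  by (rule b(2)) (use R in force)
 ultimately have "(nm f)^2 = - 2*(LBINT x. f x*(?xf x * pd f j x))"
  using sqint_mult_integrable[OF tf_sqint[OF f K] sq] tf_sqint[OF f K]
  by (simp add: nrm2_square sqint_def)
 also have "\<dots> \<le> 2*(nm f * nm (\<lambda>x. ?xf x * pd f j x))"
  using L2_Cauchy_Schwarz[OF tf_sqint[OF f K] sq] by linarith
 also have "\<dots> \<le> 2*(nm f*(\<bar>R\<bar> * nm (pd f j)))"
  using le by (intro mult_left_mono) auto
 finally have "nm f * nm f \<le> nm f*(2*\<bar>R\<bar> * nm (pd f j))"
  by (simp add: power2_eq_square mult_ac)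
 thus ?thesis
  by (cases "nm f = 0") (auto simp: less_le)
qed

subsection \<open>Trigonometric polynomials on a cube\<close>

text \<open>\<open>lborel\<close> is by definition the image of the product measure over the basis,
  so product functions integrate factor by factor. This is the source of the orthogonality
  relations.\<close>

lemma integral_lborel_prod_Basis:
 fixes g :: "'a::euclidean_space => real => real"
 assumes g: "\<And>b. b \<in> Basis ==> integrable lborel (g b)"
 shows "integrable lborel (\<lambda>x. \<Prod>b\<in>Basis. g b (x \<bullet> b))"
  and "(LBINT x. (\<Prod>b\<in>Basis. g b (x \<bullet> b))) = (\<Prod>b\<in>Basis. (LBINT t. g b t))"
proof -
 interpret product_sigma_finite "\<lambda>_::'a. lborel :: real measure" ..
 have meas: "(\<lambda>x::'a. \<Prod>b\<in>Basis. g b (x \<bullet> b)) \<in> borel_measurable borel"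
 proof (rule borel_measurable_prod)
  fix b :: 'a assume "b \<in> Basis"
  hence [measurable]: "g b \<in> borel_measurable borel" using g by auto
  show "(\<lambda>x::'a. g b (x \<bullet> b)) \<in> borel_measurable borel" by measurable
 qed
 have T: "(\<lambda>f. \<Sum>b\<in>Basis. f b*\<^sub>R b) \<in> measurable (\<Pi>\<^sub>M b\<in>Basis::'a set. lborel) borel"
  by measurable
 have eq: "(\<Prod>b\<in>Basis. g b ((\<Sum>b\<in>Basis. f b*\<^sub>R b) \<bullet> b)) = (\<Prod>b\<in>Basis. g b (f b))" for f
  by simp
 show "integrable lborel (\<lambda>x. \<Prod>b\<in>Basis. g b (x \<bullet> b))"
  unfolding lborel_def[where 'a = 'a] integrable_distr_eq[OF T[unfolded lborel_eq_real] meas]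
  using product_integrable_prod[OF finite_Basis g] by (simp add: lborel_eq_real)
 show "(LBINT x. (\<Prod>b\<in>Basis. g b (x \<bullet> b))) = (\<Prod>b\<in>Basis. (LBINT t. g b t))"
  unfolding lborel_def[where 'a = 'a] integral_distr[OF T[unfolded lborel_eq_real] meas]
  using product_integral_prod[OF finite_Basis g] by (simp add: lborel_eq_real)
qed

lemma integral_lborel_prod_vec:
 fixes f :: "'d::finite => real => real"
 assumes "\<And>i. integrable lborel (f i)"
 shows "integrable lborel (\<lambda>x::real^'d. \<Prod>i\<in>UNIV. f i (x$i))"
  and "(LBINT x. (\<Prod>i\<in>UNIV. f i ((x::real^'d)$i))) = (\<Prod>i\<in>UNIV. (LBINT t. f i t))"
proof -
 define ax :: "'d => real^'d" where "ax i = axis i 1" for i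
 have inj: "inj ax" by (auto simp: inj_def ax_def axis_eq_axis)
 have B: "Basis = range ax" by (auto simp: Basis_vec_def ax_def)
 define g where "g b = f (inv_into UNIV ax b)" for b
 have gi: "integrable lborel (g b)" for b using assms by (simp add: g_def)
 have g: "g (ax i) = f i" for i by (simp add: g_def inv_f_f[OF inj])
 have xi: "x \<bullet> ax i = x$i" for x i by (simp add: ax_def inner_axis)
 have "(\<Prod>b\<in>Basis. g b (x \<bullet> b)) = (\<Prod>i\<in>UNIV. f i (x$i))" for x
  unfolding B by (simp add: prod.reindex[OF inj] g xi)
 moreover have "(\<Prod>b\<in>Basis. (LBINT t. g b t)) = (\<Prod>i\<in>UNIV. (LBINT t. f i t))"
  unfolding B by (simp add: prod.reindex[OF inj] g)
 ultimately show "integrable lborel (\<lambda>x::real^'d. \<Prod>i\<in>UNIV. f i (x$i))"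
  and "(LBINT x. (\<Prod>i\<in>UNIV. f i ((x::real^'d)$i))) = (\<Prod>i\<in>UNIV. (LBINT t. f i t))"
  using integral_lborel_prod_Basis[of g] gi by simp_all
qed

definition cubepi :: "(real^'d) set" where
 "cubepi = {x. \<forall>i. 0 \<le> x$i \<and> x$i \<le> pi}"

lemma cubepi_cbox: "cubepi = cbox 0 (\<chi> i. pi)"
 by (auto simp: cubepi_def mem_box_cart)

lemma compact_cubepi: "compact cubepi" and sets_cubepi [measurable]: "cubepi \<in> sets borel"
 by (auto simp: cubepi_cbox)

lemma indicator_cubepi: "indicator cubepi x = (\<Prod>i\<in>UNIV. indicator {0..pi} (x$i) :: real)"
proof (cases "x \<in> cubepi")
 case False
 then obtain i where "x$i \<notin> {0..pi}" by (auto simp: cubepi_def)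
 hence "(\<Prod>i\<in>UNIV. indicator {0..pi} (x$i) :: real) = 0" by (intro prod_zero) (auto intro!: exI[of _ i] simp: indicator_def)
 with False show ?thesis by simp
qed (auto simp: cubepi_def)

definition trig1 :: "bool => nat => real => real" where
 "trig1 b m t = (if b then sin (real m * t) else cos (real m * t))"

text \<open>\<open>S\<close> lists the coordinates that carry a sine, the others carry a cosine; a
  derivative in direction j toggles the membership of j.\<close>

definition trig :: "'d set => ('d => nat) => real^'d => real" where
 "trig S k x = (\<Prod>i\<in>UNIV. trig1 (i \<in> S) (k i) (x$i))"

lemma trig1_deriv:
 "(trig1 b m has_real_derivative (if b then real m else - real m) * trig1 (\<not> b) m t) (at t)"
 unfolding trig1_def by (cases b) (auto intro!: derivative_eq_intros)

lemma Cinf_trig1: "Cinf (trig1 b m)"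
proof (cases b)
 case True
 have "trig1 b m = (\<lambda>t. sin (real m \<bullet> t + 0))" using True by (auto simp: trig1_def)
 thus ?thesis using Cinf_compose_affine[OF Cinf_sin, of "real m" 0] by simp
next
 case False
 have "trig1 b m = (\<lambda>t. cos (real m \<bullet> t + 0))" using False by (auto simp: trig1_def)
 thus ?thesis using Cinf_compose_affine[OF Cinf_cos, of "real m" 0] by simp
qed

lemma Cinf_trig: "Cinf (trig S k)"
 unfolding trig_def[abs_def] by (intro Cinf_prod Cinf_compose_nth Cinf_trig1)

lemma pd_prod_nth:
 fixes h :: "'d::finite => real => real"
 assumes "\<And>i t. (h i has_real_derivative h' i t) (at t)"
 shows "pd (\<lambda>x. \<Prod>i\<in>UNIV. h i (x$i)) j x = h' j (x$j)*(\<Prod>i\<in>UNIV - {j}. h i (x$i))"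
proof -
 have "((\<lambda>x::real^'d. h i (x$i)) has_derivative (\<lambda>v. h' i (x$i)*(v$i))) (at x)" for i
  using has_derivative_compose[OF has_derivative_nth assms[of i "x$i", unfolded has_field_derivative_def]] .
 hence "((\<lambda>x::real^'d. \<Prod>i\<in>UNIV. h i (x$i)) has_derivative
   (\<lambda>v. \<Sum>i\<in>UNIV. h' i (x$i)*(v$i)*(\<Prod>l\<in>UNIV - {i}. h l (x$l)))) (at x)"
  by (intro has_derivative_prod)
 from pd_eqI[OF this, of j] have "pd (\<lambda>x. \<Prod>i\<in>UNIV. h i (x$i)) j x =
   (\<Sum>i\<in>UNIV. h' i (x$i)*(axis j 1$i)*(\<Prod>l\<in>UNIV - {i}. h l (x$l)))" .
 also have "\<dots> = (\<Sum>i\<in>UNIV. if i = j then h' j (x$j)*(\<Prod>i\<in>UNIV - {j}. h i (x$i)) else 0)"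
  by (rule sum.cong) (auto simp: axis_def)
 finally show ?thesis by simp
qed

lemma pd_trig:
 "pd (trig S k) j x = (if j \<in> S then real (k j) * trig (S - {j}) k x else - real (k j) * trig (insert j S) k x)"
proof -
 have "pd (trig S k) j x = (if j \<in> S then real (k j) else - real (k j)) * trig1 (j \<notin> S) (k j) (x$j) *
   (\<Prod>i\<in>UNIV - {j}. trig1 (i \<in> S) (k i) (x$i))"
  unfolding trig_def[abs_def] by (subst pd_prod_nth[OF trig1_deriv]) simp
 moreover have "trig S' k x = trig1 (j \<in> S') (k j) (x$j)*(\<Prod>i\<in>UNIV - {j}. trig1 (i \<in> S') (k i) (x$i))" for S'
  unfolding trig_def by (subst prod.remove[of UNIV j]) auto
 moreover have "(\<Prod>i\<in>UNIV - {j}. trig1 (i \<in> S - {j}) (k i) (x$i)) = (\<Prod>i\<in>UNIV - {j}. trig1 (i \<in> S) (k i) (x$i))"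
  "(\<Prod>i\<in>UNIV - {j}. trig1 (i \<in> insert j S) (k i) (x$i)) = (\<Prod>i\<in>UNIV - {j}. trig1 (i \<in> S) (k i) (x$i))"
  by (auto intro!: prod.cong)
 ultimately show ?thesis by auto
qed

lemma integral_cos_pi:
 "(LBINT t. indicator {0..pi} t * cos (real_of_int m * t)) = (if m = 0 then pi else 0)"
proof (cases "m = 0")
 case False
 have "(LBINT t. indicator {0..pi} t*\<^sub>R cos (real_of_int m * t)) =
   sin (real_of_int m * pi)/real_of_int m - sin (real_of_int m*0)/real_of_int m"
  using False
  by (intro integral_FTC_atLeastAtMost)
   (auto intro!: derivative_eq_intros continuous_intros simp flip: has_real_derivative_iff_has_vector_derivative)
 thus ?thesis using False by (simp add: mult.commute[of _ pi])
qed simp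

lemma integrable_indicator_continuous:
 fixes f :: "real => real"
 assumes "continuous_on UNIV f"
 shows "integrable lborel (\<lambda>t. indicator {a..b} t * f t)"
 using borel_integrable_compact[of "{a..b}" f] assms continuous_on_subset[OF assms] by auto

lemma integral_trig1:
 "(LBINT t. indicator {0..pi} t*(trig1 b m t * trig1 b n t)) =
   (if m \<noteq> n then 0 else if m = 0 then (if b then 0 else pi) else pi/2)"
proof -
 let ?s = "if b then -1 else 1 :: real"
 have "trig1 b m t * trig1 b n t =
   (cos (real_of_int (int m - int n) * t) + ?s * cos (real_of_int (int m + int n) * t))/2" for t
  by (auto simp: trig1_def cos_add cos_diff algebra_simps)
 hence "(LBINT t. indicator {0..pi} t*(trig1 b m t * trig1 b n t)) =
   (LBINT t. (indicator {0..pi} t * cos (real_of_int (int m - int n) * t)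
    + ?s*(indicator {0..pi} t * cos (real_of_int (int m + int n) * t)))/2)"
  by (intro int_cong) (auto simp: algebra_simps split: split_indicator)
 also have "\<dots> = ((LBINT t. indicator {0..pi} t * cos (real_of_int (int m - int n) * t))
    + ?s*(LBINT t. indicator {0..pi} t * cos (real_of_int (int m + int n) * t)))/2"
  by (subst integral_divide_zero, subst int_add)
   (auto intro!: integrable_indicator_continuous continuous_intros simp del: of_int_add of_int_diff)
 finally show ?thesis
  unfolding integral_cos_pi by auto
qed

lemma trig_orthogonal:
 fixes k l :: "'d::finite => nat"
 shows "(LBINT x. indicator cubepi x*(trig S k x * trig S l x)) =
  (if k = l then (\<Prod>i\<in>UNIV. if k i = 0 then (if i \<in> S then 0 else pi) else pi/2) else 0)"
proof -
 have "indicator cubepi x*(trig S k x * trig S l x) =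
   (\<Prod>i\<in>UNIV. indicator {0..pi} (x$i)*(trig1 (i \<in> S) (k i) (x$i) * trig1 (i \<in> S) (l i) (x$i)))" for x
  by (simp add: indicator_cubepi trig_def prod.distrib)
 hence "(LBINT x. indicator cubepi x*(trig S k x * trig S l x)) =
   (\<Prod>i\<in>UNIV. (LBINT t. indicator {0..pi} t*(trig1 (i \<in> S) (k i) t * trig1 (i \<in> S) (l i) t)))"
  by (simp only:) (intro integral_lborel_prod_vec(2) integrable_indicator_continuous continuous_intros
    Cinf_continuous Cinf_trig1)
 also have "\<dots> = (if k = l then (\<Prod>i\<in>UNIV. if k i = 0 then (if i \<in> S then 0 else pi) else pi/2) else 0)"
 proof (cases "k = l")
  case False
  then obtain i where "k i \<noteq> l i" by auto
  hence "\<exists>i\<in>UNIV. (if k i \<noteq> l i then 0 else if k i = 0 then (if i \<in> S then 0 else pi) else pi/2) = 0"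
   by (intro bexI[of _ i]) simp_all
  hence "(\<Prod>i\<in>UNIV. if k i \<noteq> l i then 0 else if k i = 0 then (if i \<in> S then 0 else pi) else pi/2) = 0"
   by (rule prod_zero[OF finite])
  with False show ?thesis unfolding integral_trig1 by simp
 qed (simp add: integral_trig1)
 finally show ?thesis .
qed

abbreviation onQ :: "(real^'d => real) => real^'d => real" where
 "onQ f \<equiv> \<lambda>x. indicator cubepi x * f x"

lemma onQ_integrable:
 assumes "continuous_on UNIV f" shows "integrable lborel (onQ f)"
 using borel_integrable_compact[OF compact_cubepi continuous_on_subset[OF assms]] by simp

lemma onQ_sqint:
 assumes f: "continuous_on UNIV f" shows "sqb (onQ f)"
 unfolding sqint_def
proof
 have "(\<lambda>x. (indicator cubepi x * f x)^2) = onQ (\<lambda>x. (f x)^2)"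
  by (auto simp: fun_eq_iff split: split_indicator)
 thus "integrable lborel (\<lambda>x. (indicator cubepi x * f x)^2)"
  using onQ_integrable[of "\<lambda>x. (f x)^2"] f by (simp add: continuous_intros)
qed (use onQ_integrable[OF f] in auto)

lemma trig_sum_norm:
 fixes c :: "('d::finite => nat) => real"
 assumes "finite F"
 shows "(nm (onQ (\<lambda>x. \<Sum>k\<in>F. c k * trig S k x)))^2 =
  (\<Sum>k\<in>F. (c k)^2*(\<Prod>i\<in>UNIV. if k i = 0 then (if i \<in> S then 0 else pi) else pi/2))"
proof -
 have cont: "continuous_on A (trig S k)" for A and k :: "'d => nat" by (rule Cinf_continuous[OF Cinf_trig])
 have int: "integrable lborel (\<lambda>x. indicator cubepi x*(trig S k x * trig S l x))" for k l :: "'d => nat"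
  using onQ_integrable[of "\<lambda>x. trig S k x * trig S l x"] by (simp add: continuous_intros cont)
 have "(onQ (\<lambda>x. \<Sum>k\<in>F. c k * trig S k x) x)^2 =
   (\<Sum>k\<in>F. \<Sum>l\<in>F. c k * c l*(indicator cubepi x*(trig S k x * trig S l x)))" for x
  by (auto simp: power2_eq_square sum_product mult_ac split: split_indicator)
 hence "(nm (onQ (\<lambda>x. \<Sum>k\<in>F. c k * trig S k x)))^2 =
   (\<Sum>k\<in>F. \<Sum>l\<in>F. c k * c l*(LBINT x. indicator cubepi x*(trig S k x * trig S l x)))"
  using int by (simp add: nrm2_square)
 also have "\<dots> = (\<Sum>k\<in>F. \<Sum>l\<in>F. if k = l then (c k)^2*(\<Prod>i\<in>UNIV. if k i = 0 then (if i \<in> S then 0 else pi) else pi/2) else 0)"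
  unfolding trig_orthogonal by (intro sum.cong refl) (auto simp: power2_eq_square)
 finally show ?thesis using assms by simp
qed

text \<open>By orthogonality both sides are weighted sums of squared coefficients. A zero frequency
  weighs pi under a cosine and 0 under a sine, every other frequency pi/2, so turning cosines into
  sines and shrinking coefficients cannot increase the norm.\<close>

lemma trig_multiplier_norm:
 fixes c a :: "('d::finite => nat) => real"
 assumes "finite F" "\<And>k. k \<in> F ==> \<bar>a k\<bar> \<le> 1"
 shows "nm (onQ (\<lambda>x. \<Sum>k\<in>F. (c k * a k) * trig S k x))
  \<le> nm (onQ (\<lambda>x. \<Sum>k\<in>F. c k * trig {} k x))"
proof (rule power2_le_imp_le)
 show "(nm (onQ (\<lambda>x. \<Sum>k\<in>F. (c k * a k) * trig S k x)))^2
  \<le> (nm (onQ (\<lambda>x. \<Sum>k\<in>F. c k * trig {} k x)))^2"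
  unfolding trig_sum_norm[OF assms(1)]
 proof (intro sum_mono mult_mono prod_nonneg ballI prod_mono)
  fix k assume k: "k \<in> F"
  have "(a k)^2 \<le> 1" using assms(2)[OF k] by (simp add: abs_square_le_1)
  thus "(c k * a k)^2 \<le> (c k)^2"
   by (simp add: power_mult_distrib mult_left_le)
 qed auto
qed simp

text \<open>On coefficients the field is the multiplier k_i/|k|^2 and its gradient is k_i k_j/|k|^2
  up to sign; all of these are at most 1 in absolute value. The zero frequency is excluded because
  |k|^2 vanishes there.\<close>

lemma trig_div_solution:
 fixes c :: "('d::finite => nat) => real"
 assumes F: "finite F" "(\<lambda>_. 0) \<notin> F"
 defines "T \<equiv> \<lambda>x. \<Sum>k\<in>F. c k * trig {} k x"
 obtains w :: "'d => real^'d => real" where "\<And>i. Cinf (w i)" "\<And>x. (\<Sum>i\<in>UNIV. pd (w i) i x) = T x"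
  "\<And>i. nm (onQ (w i)) \<le> nm (onQ T)"
  "\<And>i j. nm (onQ (pd (w i) j)) \<le> nm (onQ T)"
proof -
 define m where "m k = (\<Sum>i\<in>UNIV. (real (k i))^2)" for k :: "'d => nat"
 have m_ge: "(real (k i))^2 \<le> m k" for k i
  unfolding m_def by (rule member_le_sum) auto
 have m1: "real (k i) * real (k j)/m k \<le> 1" for k i j
 proof -
  have "real (k i) * real (k j) \<le> m k"
   using m_ge[of k i] m_ge[of k j] sum_squares_bound[of "real (k i)" "real (k j)"] by simp
  thus ?thesis by (cases "m k = 0") (auto simp: divide_le_eq_1 m_def sum_nonneg less_le)
 qed
 have m0: "0 \<le> m k" for k by (simp add: m_def sum_nonneg)
 \<comment> \<open>Frequencies are integers, so k_i \<le> k_i^2 \<le> |k|^2; this bounds the field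
   itself, not only its gradient.\<close>
 have m2: "real (k i)/m k \<le> 1" for k i
 proof -
  have "real (k i) \<le> (real (k i))^2" by (cases "k i") (auto simp: power2_eq_square)
  with m_ge[of k i] have "real (k i) \<le> m k" by linarith
  thus ?thesis using m0[of k] by (cases "m k = 0") (auto simp: divide_le_eq_1 less_le)
 qed
 define w where "w i x = (\<Sum>k\<in>F. (c k*(real (k i)/m k)) * trig {i} k x)" for i x
 have Cw: "Cinf (w i)" for i
  unfolding w_def[abs_def] by (intro Cinf_sum Cinf_mult Cinf_const Cinf_trig)
 have pdw: "pd (w i) j x = (\<Sum>k\<in>F. (c k*(real (k i)/m k)) * pd (trig {i} k) j x)" for i j x
  unfolding w_def[abs_def]
  by (subst pd_sum) (intro Cinf_mult Cinf_const Cinf_trig, intro sum.cong refl pd_scale Cinf_trig)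
 have "(\<Sum>i\<in>UNIV. pd (w i) i x) = T x" for x
 proof -
  have "(\<Sum>i\<in>UNIV. pd (w i) i x) = (\<Sum>k\<in>F. \<Sum>i\<in>UNIV. c k*((real (k i))^2/m k) * trig {} k x)"
   unfolding pdw sum.swap[of _ UNIV F]
   by (intro sum.cong refl) (simp add: pd_trig power2_eq_square)
  also have "\<dots> = (\<Sum>k\<in>F. c k*((\<Sum>i\<in>UNIV. (real (k i))^2)/m k) * trig {} k x)"
   by (simp add: sum_distrib_left sum_distrib_right sum_divide_distrib)
  also have "\<dots> = T x"
   unfolding T_def
  proof (rule sum.cong)
   fix k assume "k \<in> F"
   with F(2) have "k \<noteq> (\<lambda>_. 0)" by auto
   then obtain i where "k i \<noteq> 0" by auto
   hence "m k \<noteq> 0" using m_ge[of k i] by auto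
   thus "c k*((\<Sum>i\<in>UNIV. (real (k i))^2)/m k) * trig {} k x = c k * trig {} k x"
    by (simp add: m_def)
  qed simp
  finally show ?thesis .
 qed
 moreover have "nm (onQ (w i)) \<le> nm (onQ T)" for i
  unfolding w_def T_def using m2 m0 by (intro trig_multiplier_norm F) auto
 moreover have "nm (onQ (pd (w i) j)) \<le> nm (onQ T)" for i j
 proof -
  have eq: "pd (w i) j x = (\<Sum>k\<in>F. (c k*(if i = j then real (k i) * real (k j)/m k else - (real (k i) * real (k j)/m k)))
    * trig (if i = j then {} else {i, j}) k x)" for x
   unfolding pdw by (intro sum.cong) (auto simp: pd_trig insert_commute)
  have "\<bar>real (k i) * real (k j)/m k\<bar> \<le> 1" for k
   using m1[of k i j] m0[of k] by simp
  thus ?thesis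
   unfolding T_def eq by (intro trig_multiplier_norm F) auto
 qed
 ultimately show ?thesis using that Cw by blast
qed

section \<open>Density of cosine polynomials in L^2 of the cube\<close>

lemma tendsto_nrm2_0I:
 assumes "(\<lambda>n. LINT x|M. (f n x)^2) \<longlonglongrightarrow> 0"
 shows "(\<lambda>n::nat. nrm2 M (f n)) \<longlonglongrightarrow> 0"
 using tendsto_real_sqrt[OF assms] by (simp add: nrm2_def)

lemma nrm2_clip_tendsto:
 assumes r: "sqint M r"
 shows "(\<lambda>n. nrm2 M (\<lambda>x. r x - max (- real n) (min (real n) (r x)))) \<longlonglongrightarrow> 0"
proof (rule tendsto_nrm2_0I)
 have "(\<lambda>n. LINT x|M. (r x - max (- real n) (min (real n) (r x)))^2) \<longlonglongrightarrow> (LINT x|M. 0)"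
 proof (rule integral_dominated_convergence[where w = "\<lambda>x. (r x)^2"])
  show "AE x in M. (\<lambda>n. (r x - max (- real n) (min (real n) (r x)))^2) \<longlonglongrightarrow> 0"
  proof (rule AE_I2)
   fix x
   obtain N :: nat where N: "\<bar>r x\<bar> \<le> real N" using real_arch_simple by blast
   have "eventually (\<lambda>n. 0 = (r x - max (- real n) (min (real n) (r x)))^2) sequentially"
    using eventually_ge_at_top[of N]
   proof eventually_elim
    case (elim n)
    hence "\<bar>r x\<bar> \<le> real n" using N by linarith
    thus ?case by auto
   qed
   thus "(\<lambda>n. (r x - max (- real n) (min (real n) (r x)))^2) \<longlonglongrightarrow> 0"
    by (rule Lim_transform_eventually[OF tendsto_const])
  qed
  show "AE x in M. norm ((r x - max (- real n) (min (real n) (r x)))^2) \<le> (r x)^2" for n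
   by (rule AE_I2) (auto simp: abs_le_square_iff[symmetric] max_def min_def)
 qed (use r in \<open>auto simp: sqint_def\<close>)
 thus "(\<lambda>n. LINT x|M. (r x - max (- real n) (min (real n) (r x)))^2) \<longlonglongrightarrow> 0" by simp
qed

text \<open>A measurable function is an almost everywhere limit of continuous ones. Clipping these
  at B leaves the limit unchanged and yields a dominating function on the cube.\<close>

lemma L2_dense_continuous_bounded:
 fixes r :: "real^'d => real"
 assumes r: "r \<in> borel_measurable lborel" and B: "\<And>x. \<bar>r x\<bar> \<le> B" and e: "e > 0"
 shows "\<exists>g. continuous_on UNIV g \<and> nm (onQ (\<lambda>x. r x - g x)) < e"
proof -
 have "r \<in> borel_measurable lebesgue" using r by (intro measurable_completion) simp
 hence "r measurable_on UNIV" by (simp add: lebesgue_measurable_imp_measurable_on)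
 then obtain N g where N: "negligible N" and g: "\<And>n. continuous_on UNIV (g n)"
  and lim: "\<And>x. x \<notin> N ==> (\<lambda>n. g n x) \<longlonglongrightarrow> r x"
  by (auto simp: measurable_on_def)
 have "0 \<le> B" using B[of undefined] by linarith
 define h where "h n x = max (- B) (min B (g n x))" for n x
 have ch: "continuous_on UNIV (h n)" for n
  unfolding h_def by (intro continuous_intros g)
 hence bh: "h n \<in> borel_measurable borel" for n by (rule borel_measurable_continuous_onI)
 have bd: "\<bar>r x - h n x\<bar> \<le> 2 * B" for n x
  using B[of x] \<open>0 \<le> B\<close> by (auto simp: h_def)
 have mb: "(\<lambda>x. (onQ (\<lambda>x. r x - h n x) x)^2) \<in> borel_measurable borel" for n
  using r bh by measurable
 have "(\<lambda>n. LINT x|lebesgue. (onQ (\<lambda>x. r x - h n x) x)^2) \<longlonglongrightarrow> (LINT x|(lebesgue :: (real^'d) measure). 0)"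
 proof (rule integral_dominated_convergence[where w = "\<lambda>x::real^'d. indicator cubepi x*(2 * B)^2"])
  have "N \<in> null_sets lebesgue" using N by (simp add: negligible_iff_null_sets)
  thus "AE x in lebesgue. (\<lambda>n. (onQ (\<lambda>x. r x - h n x) x)^2) \<longlonglongrightarrow> 0"
  proof (rule AE_I')
   show "{x \<in> space lebesgue. \<not> (\<lambda>n. (onQ (\<lambda>x. r x - h n x) x)^2) \<longlonglongrightarrow> 0} \<subseteq> N"
   proof (rule ccontr)
    assume "\<not> ?thesis"
    then obtain x where x: "x \<notin> N" "\<not> (\<lambda>n. (onQ (\<lambda>x. r x - h n x) x)^2) \<longlonglongrightarrow> 0" by auto
    have "(\<lambda>n. h n x) \<longlonglongrightarrow> max (- B) (min B (r x))"
     unfolding h_def by (intro tendsto_intros lim x)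
    also have "max (- B) (min B (r x)) = r x" using B[of x] by auto
    finally have "(\<lambda>n. (onQ (\<lambda>x. r x - h n x) x)^2) \<longlonglongrightarrow> (indicator cubepi x*(r x - r x))^2"
     by (intro tendsto_intros)
    with x(2) show False by simp
   qed
  qed
  show "AE x in lebesgue. norm ((onQ (\<lambda>x. r x - h n x) x)^2) \<le> indicator cubepi x*(2 * B)^2" for n
  proof (rule AE_I2)
   fix x :: "real^'d"
   have "(r x - h n x)^2 \<le> (2 * B)^2"
    using bd[of x n] \<open>0 \<le> B\<close> by (subst abs_le_square_iff[symmetric]) simp
   thus "norm ((onQ (\<lambda>x. r x - h n x) x)^2) \<le> indicator cubepi x*(2 * B)^2"
    by (simp split: split_indicator)
  qed
  have "integrable lborel (onQ (\<lambda>x::real^'d. (2 * B)^2))"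
   by (rule onQ_integrable) simp
  thus "integrable lebesgue (\<lambda>x::real^'d. indicator cubepi x*(2 * B)^2)"
   by (subst integrable_completion) auto
  show "(\<lambda>x. (onQ (\<lambda>x. r x - h n x) x)^2) \<in> borel_measurable lebesgue" for n
   using mb by (intro measurable_completion) simp
 qed simp
 hence "(\<lambda>n. LBINT x. (onQ (\<lambda>x. r x - h n x) x)^2) \<longlonglongrightarrow> 0"
  using mb by (simp add: integral_completion)
 hence "(\<lambda>n. nm (onQ (\<lambda>x. r x - h n x))) \<longlonglongrightarrow> 0"
  by (rule tendsto_nrm2_0I)
 from order_tendstoD(2)[OF this e] obtain n where "nm (onQ (\<lambda>x. r x - h n x)) < e"
  by (auto simp: eventually_sequentially)
 with ch show ?thesis by blast
qed

lemma L2_dense_continuous: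
 fixes r :: "real^'d => real"
 assumes r: "sqb r" and e: "e > 0"
 shows "\<exists>g. continuous_on UNIV g \<and> nm (onQ (\<lambda>x. r x - g x)) < e"
proof -
 have "e/2 > 0" using e by simp
 from order_tendstoD(2)[OF nrm2_clip_tendsto[OF r] this] obtain n where
  n: "nm (\<lambda>x. r x - max (- real n) (min (real n) (r x))) < e/2"
  by (auto simp: eventually_sequentially)
 define s where "s x = max (- real n) (min (real n) (r x))" for x
 have rm: "r \<in> borel_measurable lborel" using r by auto
 have sm: "s \<in> borel_measurable lborel" unfolding s_def using rm by measurable
 obtain g where g: "continuous_on UNIV g" "nm (onQ (\<lambda>x. s x - g x)) < e/2"
 proof -
  have "\<bar>s x\<bar> \<le> real n" for x unfolding s_def by auto
  from L2_dense_continuous_bounded[OF sm this \<open>e/2 > 0\<close>] that show ?thesis by blast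
 qed
 have sq1: "sqb (\<lambda>x. r x - s x)"
 proof (rule sqint_bound[OF _ r])
  show "(\<lambda>x. r x - s x) \<in> borel_measurable lborel" by (intro borel_measurable_diff rm sm)
  show "\<bar>r x - s x\<bar> \<le> \<bar>r x\<bar>" for x unfolding s_def by (simp add: max_def min_def)
 qed
 have gm: "g \<in> borel_measurable lborel" using borel_measurable_continuous_onI[OF g(1)] by simp
 have "sqb (\<lambda>x. onQ (\<lambda>_. real n) x - onQ g x)"
  by (intro sqint_diff onQ_sqint g(1)) simp
 have sqs: "sqb (onQ s)"
 proof (rule sqint_bound[OF _ onQ_sqint[of "\<lambda>_. real n"]])
  show "onQ s \<in> borel_measurable lborel" using sm by measurable
  show "\<bar>onQ s x\<bar> \<le> \<bar>onQ (\<lambda>_. real n) x\<bar>" for x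
   unfolding s_def by (auto split: split_indicator)
 qed simp
 have sq2: "sqb (onQ (\<lambda>x. s x - g x))"
  using sqint_diff[OF sqs onQ_sqint[OF g(1)]] by (simp add: right_diff_distrib)
 have sq1': "sqb (onQ (\<lambda>x. r x - s x))"
  using sqint_indicator[OF sq1, of cubepi] by simp
 have "nm (onQ (\<lambda>x. r x - s x)) \<le> nm (\<lambda>x. r x - s x)"
  by (rule nrm2_mono[OF sq1]) (use sq1' in \<open>auto split: split_indicator\<close>)
 moreover have "nm (onQ (\<lambda>x. r x - g x)) \<le> nm (onQ (\<lambda>x. r x - s x)) + nm (onQ (\<lambda>x. s x - g x))"
  using nrm2_triangle[OF sq1' sq2] by (simp add: algebra_simps)
 ultimately have "nm (onQ (\<lambda>x. r x - g x)) < e"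
  using n g(2) unfolding s_def[symmetric] by linarith
 with g(1) show ?thesis by blast
qed

definition cos_poly :: "(real^'d => real) set" where
 "cos_poly = {f. \<exists>F c. finite F \<and> f = (\<lambda>x. \<Sum>k\<in>F. c k * trig {} k x)}"

lemma cos_polyI:
 assumes "finite F" "\<And>x. f x = (\<Sum>k\<in>F. c k * trig {} k x)"
 shows "f \<in> cos_poly"
proof -
 have "f = (\<lambda>x. \<Sum>k\<in>F. c k * trig {} k x)" by (rule ext) (rule assms(2))
 with assms(1) show ?thesis
  unfolding cos_poly_def by (intro CollectI exI[of _ F] exI[of _ c] conjI)
qed

lemma cos_polyE:
 assumes "f \<in> cos_poly"
 obtains F c where "finite F" "f = (\<lambda>x. \<Sum>k\<in>F. c k * trig {} k x)"
 using assms unfolding cos_poly_def by (elim CollectE exE conjE)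

lemma cos_poly_trig: "trig {} k \<in> cos_poly"
 by (rule cos_polyI[of "{k}" _ "\<lambda>_. 1"]) auto

lemma cos_poly_scale: "f \<in> cos_poly ==> (\<lambda>x. a * f x) \<in> cos_poly"
proof -
 assume "f \<in> cos_poly"
 then obtain F c where F: "finite F" "f = (\<lambda>x. \<Sum>k\<in>F. c k * trig {} k x)" by (rule cos_polyE)
 show ?thesis
  by (rule cos_polyI[OF F(1), of _ "\<lambda>k. a * c k"]) (simp add: F(2) sum_distrib_left mult.assoc)
qed

lemma cos_poly_add:
 assumes "f \<in> cos_poly" "g \<in> cos_poly" shows "(\<lambda>x. f x + g x) \<in> cos_poly"
proof -
 obtain F c where F: "finite F" "f = (\<lambda>x. \<Sum>k\<in>F. c k * trig {} k x)"
  using assms(1) by (rule cos_polyE)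
 obtain G d where G: "finite G" "g = (\<lambda>x. \<Sum>k\<in>G. d k * trig {} k x)"
  using assms(2) by (rule cos_polyE)
 have "f x + g x = (\<Sum>k\<in>F \<union> G. ((if k \<in> F then c k else 0) + (if k \<in> G then d k else 0)) * trig {} k x)" for x
 proof -
  have "f x = (\<Sum>k\<in>F \<union> G. (if k \<in> F then c k else 0) * trig {} k x)"
   unfolding F(2) using F(1) G(1) by (intro sum.mono_neutral_cong_left) auto
  moreover have "g x = (\<Sum>k\<in>F \<union> G. (if k \<in> G then d k else 0) * trig {} k x)"
   unfolding G(2) using F(1) G(1) by (intro sum.mono_neutral_cong_left) auto
  ultimately show ?thesis by (simp add: distrib_right sum.distrib)
 qed
 thus ?thesis
  using F(1) G(1) by (intro cos_polyI[of "F \<union> G"]) auto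
qed

lemma cos_poly_sum: "finite I ==> (\<And>i. i \<in> I ==> f i \<in> cos_poly) ==> (\<lambda>x. \<Sum>i\<in>I. f i x) \<in> cos_poly"
proof (induction I rule: finite_induct)
 case empty
 show ?case using cos_poly_scale[OF cos_poly_trig, of 0] by simp
qed (auto intro: cos_poly_add)

text \<open>The formula 2 cos a cos b = cos (a+b) + cos (a-b) is used in every coordinate, and the
  product of the resulting two-term sums is expanded over the set of coordinates that take the sum.
  Thus cosine polynomials form an algebra.\<close>

lemma cos_poly_trig_mult: "(\<lambda>x. trig {} k x * trig {} l x) \<in> cos_poly"
proof -
 have cs: "cos (real (if a \<le> b then b - a else a - b) * t) = cos (real a * t - real b * t)" for a b t
 proof (cases "a \<le> b")
  case True
  hence "real (b - a) * t = - (real a * t - real b * t)" by (simp add: of_nat_diff algebra_simps)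
  with True show ?thesis by (simp only: if_True cos_minus)
 qed (simp add: of_nat_diff algebra_simps)
 \<comment> \<open>Sum of the two frequencies on \<open>A\<close>, absolute value of their
   difference elsewhere; the case distinction keeps it a natural number.\<close>
 define m where "m A i = (if i \<in> A then k i + l i else if k i \<le> l i then l i - k i else k i - l i)" for A and i :: 'a
 have "trig {} k x * trig {} l x =
   (\<Sum>A\<in>Pow UNIV. (1/2^CARD('a)) * trig {} (m A) x)" for x
 proof -
  have "trig {} k x * trig {} l x = (\<Prod>i\<in>UNIV. (1/2)*(cos (real (k i + l i) * x$i)
    + cos (real (if k i \<le> l i then l i - k i else k i - l i) * x$i)))"
   unfolding trig_def trig1_def cs
   by (simp add: prod.distrib[symmetric] cos_diff cos_add distrib_right)
  also have "\<dots> = (1/2^CARD('a))*(\<Prod>i\<in>UNIV. cos (real (k i + l i) * x$i)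
    + cos (real (if k i \<le> l i then l i - k i else k i - l i) * x$i))"
   by (simp add: prod.distrib prod_dividef power_divide)
  also have "\<dots> = (1/2^CARD('a))*(\<Sum>A\<in>Pow UNIV. (\<Prod>i\<in>A. cos (real (k i + l i) * x$i))
    *(\<Prod>i\<in>UNIV - A. cos (real (if k i \<le> l i then l i - k i else k i - l i) * x$i)))"
   by (subst prod_add) auto
  also have "(\<Sum>A\<in>Pow UNIV. (\<Prod>i\<in>A. cos (real (k i + l i) * x$i))
    *(\<Prod>i\<in>UNIV - A. cos (real (if k i \<le> l i then l i - k i else k i - l i) * x$i))) = (\<Sum>A\<in>Pow UNIV. trig {} (m A) x)"
  proof (rule sum.cong)
   fix A :: "'a set" assume "A \<in> Pow UNIV"
   have "trig {} (m A) x = (\<Prod>i\<in>A. trig1 False (m A i) (x$i))*(\<Prod>i\<in>UNIV - A. trig1 False (m A i) (x$i))"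
    unfolding trig_def by (subst prod.subset_diff[of A]) (auto simp: mult.commute)
   thus "(\<Prod>i\<in>A. cos (real (k i + l i) * x$i))
    *(\<Prod>i\<in>UNIV - A. cos (real (if k i \<le> l i then l i - k i else k i - l i) * x$i)) = trig {} (m A) x"
    by (simp add: trig1_def m_def)
  qed simp
  finally show ?thesis by (simp add: sum_distrib_left)
 qed
 moreover have "(\<lambda>x. \<Sum>A\<in>Pow UNIV. (1/2^CARD('a)) * trig {} (m A) x) \<in> cos_poly"
  by (intro cos_poly_sum cos_poly_scale cos_poly_trig) simp
 ultimately show ?thesis by simp
qed

lemma cos_poly_mult:
 assumes "f \<in> cos_poly" "g \<in> cos_poly" shows "(\<lambda>x. f x * g x) \<in> cos_poly"
proof -
 obtain F c where F: "finite F" "f = (\<lambda>x. \<Sum>k\<in>F. c k * trig {} k x)"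
  using assms(1) by (rule cos_polyE)
 obtain G d where G: "finite G" "g = (\<lambda>x. \<Sum>k\<in>G. d k * trig {} k x)"
  using assms(2) by (rule cos_polyE)
 have "f x * g x = (\<Sum>k\<in>F. \<Sum>l\<in>G. (c k * d l)*(trig {} k x * trig {} l x))" for x
  by (simp add: F(2) G(2) sum_product mult_ac)
 moreover have "(\<lambda>x. \<Sum>k\<in>F. \<Sum>l\<in>G. (c k * d l)*(trig {} k x * trig {} l x)) \<in> cos_poly"
  by (intro cos_poly_sum F(1) G(1) cos_poly_scale cos_poly_trig_mult)
 ultimately show ?thesis by simp
qed

lemma cos_poly_Cinf: "f \<in> cos_poly ==> Cinf f"
 by (erule cos_polyE) (simp add: Cinf_sum Cinf_mult Cinf_trig)

lemma trig_zero [simp]: "trig {} (\<lambda>_. 0) x = 1"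
 by (simp add: trig_def trig1_def)

text \<open>\<open>cos\<close> is injective on [0,pi], so the cosines of the coordinates separate
  the points of the closed cube and Stone-Weierstrass applies. This fixes the side length
  pi.\<close>

lemma cos_poly_dense_continuous:
 assumes "continuous_on cubepi g" "e > 0"
 shows "\<exists>T\<in>cos_poly. \<forall>x\<in>cubepi. \<bar>g x - T x\<bar> < e"
proof -
 interpret function_ring_on cos_poly "cubepi :: (real^'a) set"
 proof
  show "compact (cubepi :: (real^'a) set)" by (rule compact_cubepi)
  show "continuous_on cubepi f" if "f \<in> cos_poly" for f :: "real^'a => real"
   by (rule Cinf_continuous[OF cos_poly_Cinf[OF that]])
  show "(\<lambda>_::real^'a. c) \<in> cos_poly" for c
   using cos_poly_scale[OF cos_poly_trig[of "\<lambda>_. 0"], of c] by simp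
  show "\<exists>f\<in>cos_poly. f x \<noteq> f y" if xy: "x \<in> cubepi" "y \<in> cubepi" "x \<noteq> y" for x y :: "real^'a"
  proof -
   obtain i where i: "x$i \<noteq> y$i" using xy(3) by (auto simp: cart_eq_iff)
   have "trig {} (\<lambda>j. if j = i then 1 else 0) z = cos (z$i)" for z :: "real^'a"
   proof -
    have "trig {} (\<lambda>j. if j = i then 1 else 0) z = (\<Prod>j\<in>UNIV. if j = i then cos (z$i) else 1)"
     unfolding trig_def by (rule prod.cong) (auto simp: trig1_def)
    thus ?thesis by simp
   qed
   moreover have "cos (x$i) \<noteq> cos (y$i)"
    using i xy(1,2) cos_inj_pi[of "x$i" "y$i"] by (auto simp: cubepi_def)
   ultimately show ?thesis by (intro bexI[OF _ cos_poly_trig[of "\<lambda>j. if j = i then 1 else 0"]]) simp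
  qed
 qed (auto intro: cos_poly_add cos_poly_mult)
 show ?thesis using Stone_Weierstrass_basic[OF assms] by blast
qed

lemma cos_poly_dense:
 fixes r :: "real^'d => real"
 assumes r: "sqb r" and e: "e > 0"
 shows "\<exists>T\<in>cos_poly. nm (onQ (\<lambda>x. r x - T x)) < e"
proof -
 obtain g where g: "continuous_on UNIV g" "nm (onQ (\<lambda>x. r x - g x)) < e/2"
  using L2_dense_continuous[OF r, of "e/2"] e by auto
 let ?V = "nm (onQ (\<lambda>x::real^'d. 1))"
 \<comment> \<open>A uniform error q costs at most q times the norm of 1; adding 1 to that norm
   keeps the denominator positive.\<close>
 define q where "q = e/(2*(?V + 1))"
 have pos: "q > 0" unfolding q_def using e by (simp add: add_nonneg_pos)
 obtain T where T: "T \<in> cos_poly" "\<And>x. x \<in> cubepi ==> \<bar>g x - T x\<bar> < q"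
  using cos_poly_dense_continuous[OF continuous_on_subset[OF g(1)] pos] by blast
 have cT: "continuous_on UNIV T" by (rule Cinf_continuous[OF cos_poly_Cinf[OF T(1)]])
 have gT: "sqb (onQ (\<lambda>x. g x - T x))" by (intro onQ_sqint continuous_intros g cT)
 have rg: "sqb (onQ (\<lambda>x. r x - g x))"
  using sqint_diff[OF sqint_indicator[OF r, of cubepi] onQ_sqint[OF g(1)]] by (simp add: right_diff_distrib)
 have "nm (onQ (\<lambda>x. g x - T x)) \<le> nm (\<lambda>x::real^'d. q * onQ (\<lambda>x. 1) x)"
 proof (rule nrm2_mono)
  show "sqb (\<lambda>x::real^'d. q * onQ (\<lambda>x. 1) x)"
   by (intro sqint_scale onQ_sqint) simp
  show "\<bar>onQ (\<lambda>x. g x - T x) x\<bar> \<le> \<bar>q * onQ (\<lambda>x. 1) x\<bar>" for x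
   using T(2)[of x] pos by (auto split: split_indicator)
 qed (use gT in auto)
 also have "\<dots> = q * ?V" using pos by (simp only: nrm2_scale abs_of_pos)
 also have "\<dots> \<le> e/2" 
 proof -
  have "?V + 1 \<noteq> 0" using nrm2_nonneg[of lborel "onQ (\<lambda>x::real^'d. 1)"] by linarith
  hence "q*(?V + 1) = e/2" by (simp add: q_def field_simps)
  with pos show ?thesis by (simp add: distrib_left)
 qed
 finally have "nm (onQ (\<lambda>x. r x - T x)) < e"
  using nrm2_triangle[OF rg gT] g(2) by (simp add: algebra_simps)
 with T(1) show ?thesis by blast
qed

text \<open>Subtracting its mean from an approximating polynomial at most doubles the error.\<close>

lemma cos_poly_dense_mean_zero:
 fixes r :: "real^'d => real"
 assumes r: "sqb r" and r0: "(LBINT x. onQ r x) = 0" and e: "e > 0"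
 obtains F c where "finite F" "(\<lambda>_. 0) \<notin> F"
  "nm (onQ (\<lambda>x. r x - (\<Sum>k\<in>F. c k * trig {} k x))) < e"
proof -
 obtain T where T: "T \<in> cos_poly" "nm (onQ (\<lambda>x. r x - T x)) < e/2"
  using cos_poly_dense[OF r, of "e/2"] e by auto
 obtain F c where F: "finite F" "T = (\<lambda>x. \<Sum>k\<in>F. c k * trig {} k x)"
  using T(1) by (rule cos_polyE)
 let ?z = "(\<lambda>_. 0) :: 'd => nat"
 define a where "a = (if ?z \<in> F then c ?z else 0)"
 define T' where "T' x = (\<Sum>k\<in>F - {?z}. c k * trig {} k x)" for x
 have TT': "T x = T' x + a" for x
  using F(1) by (auto simp: F(2) T'_def a_def sum.remove)
 have cT: "continuous_on UNIV T" by (rule Cinf_continuous[OF cos_poly_Cinf[OF T(1)]])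
 have cT': "continuous_on UNIV T'"
  unfolding T'_def[abs_def] by (intro continuous_intros Cinf_continuous Cinf_trig)
 have sr: "sqb (onQ r)" using sqint_indicator[OF r, of cubepi] by simp
 have s1: "sqb (onQ (\<lambda>x::real^'d. 1))" by (rule onQ_sqint) simp
 have srT: "sqb (onQ (\<lambda>x. r x - T x))"
  using sqint_diff[OF sr onQ_sqint[OF cT]] by (simp add: right_diff_distrib)
 let ?V = "nm (onQ (\<lambda>x::real^'d. 1))"
 have V2: "?V^2 = (LBINT x. onQ (\<lambda>x::real^'d. 1) x)"
  unfolding nrm2_square by (intro int_cong) (auto split: split_indicator)
 have T'0: "(LBINT x. onQ T' x) = 0"
 proof -
  have "(LBINT x. onQ T' x) = (LBINT x. (\<Sum>k\<in>F - {?z}. c k*(indicator cubepi x*(trig {} k x * trig {} ?z x))))"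
   by (intro int_cong) (auto simp: T'_def sum_distrib_left mult_ac)
  also have "\<dots> = (\<Sum>k\<in>F - {?z}. (LBINT x. c k*(indicator cubepi x*(trig {} k x * trig {} ?z x))))"
   by (intro int_sum integrable_mult_right onQ_integrable continuous_intros Cinf_continuous Cinf_trig)
  also have "\<dots> = 0"
   unfolding integral_mult_right_zero trig_orthogonal by (intro sum.neutral) auto
  finally show ?thesis .
 qed
 have i1: "integrable lborel (\<lambda>x. onQ (\<lambda>x. 1) x * onQ r x)"
  by (rule sqint_mult_integrable[OF s1 sr])
 have i2: "integrable lborel (onQ (\<lambda>x::real^'d. 1))" by (rule onQ_integrable) simp
 have i3: "integrable lborel (onQ T')" by (rule onQ_integrable[OF cT'])
 have ri: "integrable lborel (onQ r)"
  using i1 by (rule Bochner_Integration.integrable_cong[THEN iffD1, rotated 2]) (auto split: split_indicator)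
 \<comment> \<open>Paired with 1, the mean-free parts r and T' drop out and only the constant
   coefficient a of T remains, so Cauchy-Schwarz bounds the norm of that constant by the
   error.\<close>
 have "(LBINT x. onQ (\<lambda>x. 1) x * onQ (\<lambda>x. r x - T x) x) = (LBINT x. onQ r x - onQ T' x - a * onQ (\<lambda>x. 1) x)"
  by (intro int_cong) (auto simp: TT' split: split_indicator)
 also have "\<dots> = - a * ?V^2"
  using ri i2 i3 r0 T'0 V2 by simp
 finally have "\<bar>a\<bar> * ?V^2 \<le> ?V * nm (onQ (\<lambda>x. r x - T x))"
  using L2_Cauchy_Schwarz[OF s1 srT] by (simp add: abs_mult)
 hence "\<bar>a\<bar> * ?V \<le> nm (onQ (\<lambda>x. r x - T x))"
  by (cases "?V = 0") (auto simp: power2_eq_square less_le mult.assoc[symmetric] mult.commute[of ?V])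
 hence aV: "nm (\<lambda>x::real^'d. a * onQ (\<lambda>x. 1) x) < e/2"
  unfolding nrm2_scale using T(2) by linarith
 have "onQ (\<lambda>x. r x - T' x) x = onQ (\<lambda>x. r x - T x) x + a * onQ (\<lambda>x. 1) x" for x
  by (simp add: TT' algebra_simps)
 hence "nm (onQ (\<lambda>x. r x - T' x)) < e"
  using nrm2_triangle[OF srT sqint_scale[OF s1], of a] aV T(2) by simp
 thus ?thesis
  using that[of "F - {?z}" c] F(1) by (simp add: T'_def)
qed

subsection \<open>Solving the divergence equation with loss of one derivative\<close>

text \<open>Replacing a coordinate is written as an affine map, so that the differentiation rule for
  line integrals applies.\<close>

definition upd :: "real^'d => 'd => real => real^'d" where
 "upd x j s = x + (s - x$j)*\<^sub>R axis j 1"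

lemma upd_nth [simp]: "upd x j s$i = (if i = j then s else x$i)"
 by (simp add: upd_def axis_def)

definition line_int :: "'d => (real^'d => real) => real^'d => real" where
 "line_int j f x = pi * integral {0..1} (\<lambda>t. f (upd x j (pi * t)))"

definition prim_int :: "'d => (real^'d => real) => real^'d => real" where
 "prim_int j f x = x$j * integral {0..1} (\<lambda>t. f (upd x j (x$j * t)))"

text \<open>The middle one of three concentric cubes: data live in \<open>mid_cube\<close>, cutoffs
  and all compactly supported fields in \<open>icube\<close>, and trigonometric polynomials are
  estimated on \<open>cubepi\<close>.\<close>

definition icube :: "(real^'d) set" where
 "icube = {x. \<forall>i. pi/6 \<le> x$i \<and> x$i \<le> 5 * pi/6}"

lemma icube_cbox: "icube = cbox (\<chi> i. pi/6) (\<chi> i. 5 * pi/6)"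
 by (auto simp: icube_def mem_box_cart)

lemma compact_icube: "compact icube" and closed_icube: "closed icube"
 by (auto simp: icube_cbox)

lemma icube_subset: "icube \<subseteq> cubepi"
proof
 fix x :: "real^'d" assume x: "x \<in> icube"
 have "0 \<le> x$i \<and> x$i \<le> pi" for i
 proof -
  have "pi/6 \<le> x$i" "x$i \<le> 5 * pi/6" using x by (auto simp: icube_def)
  thus ?thesis using pi_gt_zero by linarith
 qed
 thus "x \<in> cubepi" by (simp add: cubepi_def)
qed

lemma bounded_linear_drop_coord: "bounded_linear (\<lambda>x::real^'d. x - (x$j)*\<^sub>R axis j 1)"
 and bounded_linear_coord: "bounded_linear (\<lambda>x::real^'d. (x$j)*\<^sub>R axis j (1::real))"
 by (intro bounded_linear_sub bounded_linear_ident bounded_linear_scaleR_const bounded_linear_vec_nth)+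

lemma upd_line: "upd x j (pi * t) = (x - (x$j)*\<^sub>R axis j 1) + 0 + t*\<^sub>R (0 + pi*\<^sub>R axis j 1)"
 and upd_prim: "upd x j (x$j * t) = (x - (x$j)*\<^sub>R axis j 1) + 0 + t*\<^sub>R ((x$j)*\<^sub>R axis j 1 + 0)"
 by (simp_all add: upd_def algebra_simps)

lemma Cinf_line_int: "Cinf f ==> Cinf (line_int j f)"
 unfolding line_int_def[abs_def] upd_line
 by (intro Cinf_mult Cinf_const Cinf_line_integral bounded_linear_drop_coord bounded_linear_zero)

lemma Cinf_prim_int: "Cinf f ==> Cinf (prim_int j f)"
 unfolding prim_int_def[abs_def] upd_prim
 by (intro Cinf_mult Cinf_nth Cinf_line_integral bounded_linear_drop_coord bounded_linear_coord)

lemma sum_Basis_axis: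
 fixes g :: "real^'d => real"
 shows "(\<Sum>i\<in>Basis. (axis l 1 \<bullet> i) * g i) = g (axis l 1)"
proof -
 have "(\<Sum>i\<in>Basis. (axis l 1 \<bullet> i) * g i) = (\<Sum>i\<in>Basis. if i = axis l 1 then g i else 0)"
  by (rule sum.cong) (auto simp: inner_Basis)
 thus ?thesis by simp
qed

lemma axis_drop: "axis l 1 - (axis l 1$j)*\<^sub>R axis j 1 = (if l = j then 0 else axis l (1::real))"
 and axis_keep: "(axis l 1$j)*\<^sub>R axis j 1 = (if l = j then axis j (1::real) else 0)"
 by (auto simp: axis_def cart_eq_iff)

lemma pd_line_int:
 fixes f :: "real^'d => real"
 assumes f: "Cinf f"
 shows "pd (line_int j f) l x = (if l = j then 0 else line_int j (pd f l) x)"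
proof -
 note D = has_derivative_mult_right[OF has_derivative_line_integral[OF f bounded_linear_drop_coord[of j] bounded_linear_zero,
   where m = 0 and b = 0 and l = "pi*\<^sub>R axis j 1" and x = x], of pi]
 from pd_eqI[OF D, of l]
 have "pd (line_int j f) l x = pi*(\<Sum>i\<in>Basis. (axis l 1 - (axis l 1$j)*\<^sub>R axis j 1) \<bullet> i *
   integral {0..1} (\<lambda>t. frechet_derivative f (at (upd x j (pi * t))) i))"
  unfolding line_int_def[abs_def] upd_line by simp
 also have "\<dots> = (if l = j then 0 else line_int j (pd f l) x)"
  unfolding axis_drop by (simp add: line_int_def sum_Basis_axis)
 finally show ?thesis .
qed

lemma pd_prim_int:
 fixes f :: "real^'d => real"
 assumes f: "Cinf f"
 shows "pd (prim_int j f) l x = (if l = j then f x else prim_int j (pd f l) x)"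
proof -
 let ?I = "\<lambda>x. integral {0..1} (\<lambda>t. f (upd x j (x$j * t)))"
 note D = has_derivative_line_integral[OF f bounded_linear_drop_coord[of j] bounded_linear_coord[of j],
   where m = 0 and b = 0 and l = 0 and x = x]
 have I: "pd ?I l x = (\<Sum>i\<in>Basis. (axis l 1 - (axis l 1$j)*\<^sub>R axis j 1) \<bullet> i *
   integral {0..1} (\<lambda>t. frechet_derivative f (at (upd x j (x$j * t))) i)
   + ((axis l 1$j)*\<^sub>R axis j 1) \<bullet> i * integral {0..1} (\<lambda>t. t * frechet_derivative f (at (upd x j (x$j * t))) i))"
  using pd_eqI[OF D, of l] unfolding upd_prim by simp
 have "Cinf ?I" unfolding upd_prim by (intro Cinf_line_integral f bounded_linear_drop_coord bounded_linear_coord)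
 hence P: "pd (prim_int j f) l x = x$j * pd ?I l x + pd (\<lambda>x. x$j) l x * ?I x"
  unfolding prim_int_def[abs_def] by (intro pd_mult Cinf_nth)
 have N: "pd (\<lambda>x. x$j) l x = (if l = j then 1 else 0)"
  using pd_compose_nth[where h = "\<lambda>t. t" and h' = "\<lambda>_. 1" and i = j and j = l and x = x] by auto
 show ?thesis
 proof (cases "l = j")
  case False
  thus ?thesis
   unfolding P N I axis_drop axis_keep by (simp add: prim_int_def sum_Basis_axis)
 next
  case True
  have fc: "continuous_on S (\<lambda>t. f (upd x j (x$j * t)))" for S
   unfolding upd_def by (intro continuous_on_compose2[OF Cinf_continuous[OF f, of UNIV]] continuous_intros) auto
  have dc: "continuous_on S (\<lambda>t. pd f j (upd x j (x$j * t)))" for S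
   unfolding upd_def
   by (intro continuous_on_compose2[OF Cinf_continuous[OF Cinf_pd[OF f], of UNIV]] continuous_intros) auto
  \<comment> \<open>The two terms produced by differentiating x_j times the rescaled integral are
    together the t-derivative of t f, which integrates to f(x).\<close>
  have der: "((\<lambda>t. t * f (upd x j (x$j * t))) has_vector_derivative
    f (upd x j (x$j * t)) + x$j*(t * pd f j (upd x j (x$j * t)))) (at t within {0..1})" for t
  proof -
   have "((\<lambda>t. f (upd x j (x$j * t))) has_derivative
     (\<lambda>s. frechet_derivative f (at (upd x j (x$j * t))) ((x$j * s)*\<^sub>R axis j 1))) (at t)"
    by (rule has_derivative_compose[OF _ Cinf_has_derivative[OF f]])
     (auto simp: upd_def intro!: derivative_eq_intros)
   moreover have "linear (frechet_derivative f (at (upd x j (x$j * t))))"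
    using Cinf_has_derivative[OF f] has_derivative_linear by blast
   hence "(\<lambda>s. frechet_derivative f (at (upd x j (x$j * t))) ((x$j * s)*\<^sub>R axis j 1)) =
     (*) (x$j * pd f j (upd x j (x$j * t)))"
    by (intro ext) (simp add: linear_scale mult_ac)
   ultimately have "((\<lambda>t. f (upd x j (x$j * t))) has_real_derivative x$j * pd f j (upd x j (x$j * t))) (at t)"
    unfolding has_field_derivative_def by simp
   hence "((\<lambda>t. t * f (upd x j (x$j * t))) has_real_derivative
    f (upd x j (x$j * t)) + x$j*(t * pd f j (upd x j (x$j * t)))) (at t)"
    by (auto intro!: derivative_eq_intros)
   thus ?thesis
    by (simp add: has_real_derivative_iff_has_vector_derivative has_vector_derivative_at_within)
  qed
  have "((\<lambda>t. f (upd x j (x$j * t)) + x$j*(t * pd f j (upd x j (x$j * t)))) has_integral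
    1 * f (upd x j (x$j*1)) - 0 * f (upd x j (x$j*0))) {0..1}"
   by (rule fundamental_theorem_of_calculus) (use der in auto)
  hence "integral {0..1} (\<lambda>t. f (upd x j (x$j * t)) + x$j*(t * pd f j (upd x j (x$j * t)))) = f x"
   by (simp add: integral_unique upd_def)
  moreover have "integral {0..1} (\<lambda>t. f (upd x j (x$j * t)) + x$j*(t * pd f j (upd x j (x$j * t))))
   = ?I x + x$j * integral {0..1} (\<lambda>t. t * pd f j (upd x j (x$j * t)))"
   by (subst integral_add) (auto intro!: integrable_continuous_real continuous_intros fc dc)
  ultimately show ?thesis
   unfolding P N I axis_drop axis_keep using True by (simp add: sum_Basis_axis)
 qed
qed

lemma line_int_upd [simp]: "line_int j f (upd x j s) = line_int j f x"
proof -
 have "upd (upd x j s) j t = upd x j t" for t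
  by (simp add: cart_eq_iff)
 thus ?thesis by (simp add: line_int_def)
qed

lemma prim_int_upd_pi: "prim_int j f (upd x j pi) = line_int j f x"
proof -
 have "upd (upd x j pi) j t = upd x j t" for t
  by (simp add: cart_eq_iff)
 thus ?thesis by (simp add: line_int_def prim_int_def)
qed

lemma int_outside_other:
 assumes "tf icube f" "i \<noteq> j" "x$i < pi/6 \<or> 5 * pi/6 < x$i"
 shows "line_int j f x = 0" "prim_int j f x = 0"
proof -
 have "upd x j s \<notin> icube" for s
  using assms(2,3) by (auto simp: icube_def intro!: exI[of _ i])
 hence "f (upd x j s) = 0" for s using tf_eq_0[OF assms(1)] by blast
 thus "line_int j f x = 0" "prim_int j f x = 0" by (auto simp: line_int_def prim_int_def)
qed

lemma prim_int_below:
 assumes "tf icube f" "x$j < pi/6"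
 shows "prim_int j f x = 0"
proof -
 have "f (upd x j (x$j * t)) = 0" if "t \<in> {0..1}" for t
 proof (rule tf_eq_0[OF assms(1)])
  have "x$j * t < pi/6"
  proof (cases "x$j \<le> 0")
   case True
   hence "x$j * t \<le> 0" using that by (simp add: mult_nonpos_nonneg)
   thus ?thesis using pi_gt_zero by linarith
  next
   case False
   hence "x$j * t \<le> x$j" using that by (simp add: mult_left_le)
   thus ?thesis using assms(2) by linarith
  qed
  thus "upd x j (x$j * t) \<notin> icube"
   by (auto simp: icube_def not_le intro!: exI[of _ j])
 qed
 hence "integral {0..1} (\<lambda>t. f (upd x j (x$j * t))) = integral {0..1} (\<lambda>t::real. 0)"
  by (intro integral_cong) auto
 thus ?thesis by (simp add: prim_int_def)
qed

text \<open>Above \<open>icube\<close> the j-derivative of the primitive is f = 0, so the primitive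
  is constant along the axis there; at x_j = pi it is the integral over the full line.\<close>

lemma prim_int_above:
 assumes f: "tf icube f" and x: "x$j > 5 * pi/6"
 shows "prim_int j f x = line_int j f x"
proof -
 have const: "prim_int j f (y + t*\<^sub>R axis j 1) = prim_int j f y" if y: "y$j > 5 * pi/6" "t > 0" for y t
 proof -
  obtain s where s: "0 < s" "s < t"
   "prim_int j f (y + t*\<^sub>R axis j 1) - prim_int j f y = t * pd (prim_int j f) j (y + s*\<^sub>R axis j 1)"
   using Cinf_line_MVT[OF Cinf_prim_int[OF tf_Cinf[OF f]] y(2)] by metis
  have "y + s*\<^sub>R axis j 1 \<notin> icube"
   using y(1) s(1) by (auto simp: icube_def not_le intro!: exI[of _ j])
  hence "f (y + s*\<^sub>R axis j 1) = 0" by (rule tf_eq_0[OF f])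
  with s(3) show ?thesis by (simp add: pd_prim_int[OF tf_Cinf[OF f]])
 qed
 have u: "upd x j pi = x + (pi - x$j)*\<^sub>R axis j 1" by (simp add: upd_def)
 have "prim_int j f x = prim_int j f (upd x j pi)"
 proof -
  consider "x$j < pi" | "x$j = pi" | "x$j > pi" by linarith
  thus ?thesis
  proof cases
   case 1
   thus ?thesis using const[OF x, of "pi - x$j"] by (simp add: u)
  next
   case 2
   thus ?thesis by (simp add: u)
  next
   case 3
   have "upd x j pi$j > 5 * pi/6" using pi_gt_zero by simp
   from const[OF this, of "x$j - pi"] 3 show ?thesis
    by (simp add: u algebra_simps)
  qed
 qed
 thus ?thesis by (simp add: prim_int_upd_pi)
qed

text \<open>Testing with \<open>a(x_j) (\<integral>\<^sub>0\<^bsup>x_j\<^esup> f)^2\<close> for a compactly supported decreasing weight \<open>a\<close> gives the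
 \<open>L^2\<close> bound for line integrals without Fubini's theorem.\<close>

lemma line_int_bound:
 fixes f :: "real^'d => real"
 assumes f: "tf icube f"
 shows "nm (onQ (line_int j f)) \<le> 6 * pi * nm f"
proof -
 obtain S S' :: "real => real" where S: "Cinf S" "Cinf S'" "\<And>x. (S has_real_derivative S' x) (at x)"
  "\<And>x. 0 \<le> S x" "\<And>x. S x \<le> 1" "\<And>x. x \<le> 0 ==> S x = 0" "\<And>x. x \<ge> 1 ==> S x = 1"
  "\<And>x. 0 \<le> S' x" "\<And>x. 0 < x ==> x < 1 ==> 0 < S' x" "\<And>x. x \<le> 0 \<or> x \<ge> 1 ==> S' x = 0"
  by (rule smooth_step_exists, rule that)
 \<comment> \<open>The cutoff s falls from 1 to 0 on [2 pi, 3 pi], so the weight (3 pi - t) s(t) has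
   derivative -1 up to 2 pi and a nonpositive derivative everywhere. Integrating the j-derivative of
   a J^2 therefore bounds J^2 up to height 2 pi by the integral of 2 a f J.\<close>
 define s where "s t = 1 - S (t/pi - 2)" for t
 define s' where "s' t = - S' (t/pi - 2)/pi" for t
 define a where "a t = (3 * pi - t) * s t" for t
 define a' where "a' t = - s t + (3 * pi - t) * s' t" for t
 have sd: "(s has_real_derivative s' t) (at t)" for t
  unfolding s_def s'_def by (auto intro!: derivative_eq_intros DERIV_chain2[OF S(3)])
 have ad: "(a has_real_derivative a' t) (at t)" for t
  unfolding a_def a'_def by (auto intro!: derivative_eq_intros sd)
 have "Cinf (\<lambda>t. S ((1/pi) \<bullet> t + (- 2)))" by (rule Cinf_compose_affine[OF S(1)])
 hence Cs: "Cinf s" unfolding s_def[abs_def] by (intro Cinf_diff Cinf_const) simp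
 have Cid: "Cinf (\<lambda>t::real. t)" using Cinf_inner[of "1::real"] by simp
 have Ca: "Cinf a" unfolding a_def[abs_def] by (intro Cinf_mult Cinf_diff Cinf_const Cid Cs)
 have s01: "0 \<le> s t" "s t \<le> 1" for t using S(4,5) by (auto simp: s_def)
 have s_lo: "s t = 1" "s' t = 0" if "t \<le> 2 * pi" for t
 proof -
  have "t/pi - 2 \<le> 0" using that pi_gt_zero by (simp add: field_simps)
  thus "s t = 1" "s' t = 0" using S(6,10) by (auto simp: s_def s'_def)
 qed
 have s_hi: "s t = 0" "s' t = 0" if "t \<ge> 3 * pi" for t
 proof -
  have "t/pi - 2 \<ge> 1" using that pi_gt_zero by (simp add: field_simps)
  thus "s t = 0" "s' t = 0" using S(7,10) by (auto simp: s_def s'_def)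
 qed
 have a'le: "a' t \<le> 0" for t
 proof (cases "t \<le> 3 * pi")
  case True
  have "(3 * pi - t) * s' t \<le> 0" using True S(8) by (auto simp: s'_def mult_le_0_iff)
  with s01(1)[of t] show ?thesis by (simp add: a'_def)
 next
  case False
  thus ?thesis using s_hi[of t] by (simp add: a'_def)
 qed
 have a'1: "a' t = - 1" if "t \<le> 2 * pi" for t using s_lo[OF that] by (simp add: a'_def)
 define J where "J = prim_int j f"
 have CJ: "Cinf J" unfolding J_def by (rule Cinf_prim_int[OF tf_Cinf[OF f]])
 \<comment> \<open>\<open>K\<close> carries a J^2, and \<open>Y\<close> contains every point with
   x_j \<le> 2 pi at which J is nonzero.\<close>
 define K where "K = (cbox (\<chi> i. pi/6) (\<chi> i. 3 * pi) :: (real^'d) set)"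
 define Y where "Y = (cbox (\<chi> i. pi/6) (\<chi> i. 2 * pi) :: (real^'d) set)"
 have K: "compact K" by (simp add: K_def)
 \<comment> \<open>For larger x_j the primitive keeps the value of the line integral; there the
   weight vanishes instead.\<close>
 have J0: "J x = 0" if "x \<notin> K" "x$j \<le> 3 * pi" for x
 proof -
  obtain i where i: "x$i < pi/6 \<or> 3 * pi < x$i"
  proof -
   have "\<not> (\<forall>i. pi/6 \<le> x$i \<and> x$i \<le> 3 * pi)" using \<open>x \<notin> K\<close> by (simp add: K_def mem_box_cart)
   with that show ?thesis by (meson not_le)
  qed
  show ?thesis
  proof (cases "i = j")
   case True
   with i that(2) show ?thesis unfolding J_def by (intro prim_int_below[OF f]) auto
  next
   case False
   with i show ?thesis unfolding J_def using pi_gt_zero by (intro int_outside_other(2)[OF f False]) auto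
  qed
 qed
 have "tf K (\<lambda>x. a (x$j)*(J x * J x))"
  unfolding tf_def
 proof (intro conjI allI impI Cinf_mult Cinf_compose_nth Ca CJ)
  fix x :: "real^'d" assume "x \<notin> K"
  thus "a (x$j)*(J x * J x) = 0"
   using J0[of x] s_hi(1)[of "x$j"] by (cases "x$j \<le> 3 * pi") (auto simp: a_def)
 qed
 from integral_pd_eq_0[OF this K, of j]
 have I0: "(LBINT x. pd (\<lambda>x. a (x$j)*(J x * J x)) j x) = 0" .
 have tfK: "tf K (\<lambda>x. a (x$j)*(J x * J x))" by fact
 have pdj: "pd (\<lambda>x. a (x$j)*(J x * J x)) j x = a' (x$j)*(J x)^2 + 2*(a (x$j) * f x * J x)" for x
 proof -
  have "pd J j x = f x" unfolding J_def by (simp add: pd_prim_int[OF tf_Cinf[OF f]])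
  moreover have "pd (\<lambda>x. a (x$j)) j x = a' (x$j)" by (simp add: pd_compose_nth[OF ad])
  ultimately show ?thesis
   unfolding pd_mult[OF Cinf_compose_nth[OF Ca] Cinf_mult[OF CJ CJ]] pd_mult[OF CJ CJ]
   by (simp add: power2_eq_square algebra_simps)
 qed
 have tfaf: "tf icube (\<lambda>x. a (x$j) * f x)" by (rule tf_mult[OF f Cinf_compose_nth[OF Ca]])
 have tfafJ: "tf icube (\<lambda>x. a (x$j) * f x * J x)"
  by (rule tf_mult2[OF tfaf CJ])
 have i1: "integrable lborel (pd (\<lambda>x. a (x$j)*(J x * J x)) j)"
  by (rule tf_integrable[OF tf_pd[OF tfK compact_imp_closed[OF K]] K])
 have i2: "integrable lborel (\<lambda>x. a (x$j) * f x * J x)" by (rule tf_integrable[OF tfafJ compact_icube])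
 have "integrable lborel (\<lambda>x. 2*(a (x$j) * f x * J x) - pd (\<lambda>x. a (x$j)*(J x * J x)) j x)"
  by (intro intble_diff integrable_mult_right i1 i2)
 hence i3: "integrable lborel (\<lambda>x. - a' (x$j)*(J x)^2)" unfolding pdj by simp
 have eq: "(LBINT x. - a' (x$j)*(J x)^2) = 2*(LBINT x. a (x$j) * f x * J x)"
 proof -
  have "(LBINT x. - a' (x$j)*(J x)^2) =
   (LBINT x. 2*(a (x$j) * f x * J x) - pd (\<lambda>x. a (x$j)*(J x * J x)) j x)"
   unfolding pdj by (intro int_cong) auto
  also have "\<dots> = 2*(LBINT x. a (x$j) * f x * J x)"
   using i1 i2 I0 by (subst int_diff) auto
  finally show ?thesis .
 qed
 have Ysq: "sqb (\<lambda>x. indicator Y x * J x)"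
 proof -
  have "integrable lborel (\<lambda>x. indicator Y x*\<^sub>R (J x)^2)"
   by (intro borel_integrable_compact continuous_intros Cinf_continuous CJ) (simp add: Y_def)
  moreover have "(\<lambda>x. indicator Y x*\<^sub>R (J x)^2) = (\<lambda>x. (indicator Y x * J x)^2)"
   by (auto simp: fun_eq_iff split: split_indicator)
  moreover have "J \<in> borel_measurable borel" by (intro borel_measurable_continuous_onI Cinf_continuous CJ)
  moreover have "Y \<in> sets borel" by (simp add: Y_def)
  ultimately show ?thesis by (auto simp: sqint_def)
 qed
 let ?I = "nm (\<lambda>x. indicator Y x * J x)"
 have inY: "icube \<subseteq> Y"
 proof
  fix x :: "real^'d" assume x: "x \<in> icube"
  have "pi/6 \<le> x$i \<and> x$i \<le> 2 * pi" for i
  proof -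
   have "pi/6 \<le> x$i" "x$i \<le> 5 * pi/6" using x by (auto simp: icube_def)
   thus ?thesis using pi_gt_zero by linarith
  qed
  thus "x \<in> Y" by (simp add: Y_def mem_box_cart)
 qed
 have "?I^2 \<le> (LBINT x. - a' (x$j)*(J x)^2)"
  unfolding nrm2_square
 proof (rule integral_mono[OF sqint_integrable_square[OF Ysq] i3])
  fix x :: "real^'d"
  show "(indicator Y x * J x)^2 \<le> - a' (x$j)*(J x)^2"
  proof (cases "x \<in> Y")
   case True
   hence "x$j \<le> 2 * pi" by (auto simp: Y_def mem_box_cart)
   with True show ?thesis by (simp add: a'1)
  next
   case False
   thus ?thesis using a'le[of "x$j"] by (simp add: mult_nonpos_nonneg)
  qed
 qed
 also have "\<dots> = 2*(LBINT x. (a (x$j) * f x)*(indicator Y x * J x))"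
  unfolding eq using tf_eq_0[OF f] inY
  by (intro arg_cong[where f = "\<lambda>z. 2 * z"] int_cong) (auto split: split_indicator)
 also have "\<dots> \<le> 2*(nm (\<lambda>x. a (x$j) * f x) * ?I)"
  using L2_Cauchy_Schwarz[OF tf_sqint[OF tfaf compact_icube] Ysq] by linarith
 also have "nm (\<lambda>x. a (x$j) * f x) \<le> 3 * pi * nm f"
 proof -
  have "\<bar>a (x$j) * f x\<bar> \<le> \<bar>3 * pi * f x\<bar>" for x
  proof (cases "x \<in> icube")
   case True
   hence "pi/6 \<le> x$j" "x$j \<le> 5 * pi/6" by (auto simp: icube_def)
   hence "0 \<le> x$j" "x$j \<le> 2 * pi" using pi_gt_zero by linarith+
   hence "\<bar>a (x$j)\<bar> \<le> 3 * pi" using s_lo(1)[of "x$j"] by (simp add: a_def)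
   thus ?thesis by (simp add: abs_mult mult_right_mono)
  qed (simp add: tf_eq_0[OF f])
  from nrm2_mono[OF sqint_scale[OF tf_sqint[OF f compact_icube]] _ this]
  show ?thesis using tf_borel[OF tfaf] by (simp add: nrm2_scale abs_mult)
 qed
 finally have "?I * ?I \<le> ?I*(6 * pi * nm f)"
  by (simp add: power2_eq_square mult_right_mono mult_left_mono algebra_simps)
 hence I: "?I \<le> 6 * pi * nm f"
  by (cases "?I = 0") (auto simp: less_le)
 let ?E = "line_int j f"
 have CE: "Cinf ?E" by (rule Cinf_line_int[OF tf_Cinf[OF f]])
 have bE: "?E \<in> borel_measurable borel" by (intro borel_measurable_continuous_onI Cinf_continuous CE)
 \<comment> \<open>The line integral does not depend on x_j, so the cube may be moved by pi in
   direction j. There x_j lies in [pi, 2 pi], the primitive has reached the line integral, and the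
   bound on \<open>Y\<close> applies.\<close>
 let ?g = "\<lambda>x. (indicator cubepi (x - pi*\<^sub>R axis j 1) * ?E x)^2"
 have bg: "?g \<in> borel_measurable borel" using bE by measurable
 have shift: "?g (pi*\<^sub>R axis j 1 + x) = (onQ ?E x)^2" for x
 proof -
  have "pi*\<^sub>R axis j 1 + x = upd x j (x$j + pi)" by (simp add: upd_def)
  hence "?E (pi*\<^sub>R axis j 1 + x) = ?E x" by simp
  thus ?thesis by simp
 qed
 have "integrable lborel (\<lambda>x. ?g (pi*\<^sub>R axis j 1 + x))"
  unfolding shift by (rule sqint_integrable_square[OF onQ_sqint[OF Cinf_continuous[OF CE]]])
 hence ig: "integrable lborel ?g" unfolding lborel_integrable_translation[OF bg] .
 have "(nm (onQ ?E))^2 = (LBINT x. ?g x)"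
  unfolding nrm2_square shift[symmetric] by (rule lborel_integral_translation[OF bg])
 also have "\<dots> \<le> ?I^2"
  unfolding nrm2_square
 proof (rule integral_mono[OF ig sqint_integrable_square[OF Ysq]])
  fix x :: "real^'d"
  show "?g x \<le> (indicator Y x * J x)^2"
  proof (cases "x - pi*\<^sub>R axis j 1 \<in> cubepi")
   case True
   hence xj: "pi \<le> x$j" "x$j \<le> 2 * pi" by (auto simp: cubepi_def axis_def dest!: spec[of _ j])
   hence EJ: "?E x = J x"
    unfolding J_def using pi_gt_zero by (intro prim_int_above[OF f, symmetric]) linarith
   show ?thesis
   proof (cases "x \<in> Y")
    case False
    then obtain i where i: "x$i < pi/6 \<or> 2 * pi < x$i"
    proof -
     have "\<not> (\<forall>i. pi/6 \<le> x$i \<and> x$i \<le> 2 * pi)" using \<open>x \<notin> Y\<close> by (simp add: Y_def mem_box_cart)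
     with that show ?thesis by (meson not_le)
    qed
    with xj have "i \<noteq> j" using pi_gt_zero by auto
    moreover have "x$i < pi/6 \<or> 5 * pi/6 < x$i" using i pi_gt_zero by linarith
    ultimately have "?E x = 0" by (rule int_outside_other(1)[OF f])
    thus ?thesis by simp
   qed (use EJ in \<open>simp split: split_indicator\<close>)
  qed simp
 qed
 finally have "nm (onQ ?E) \<le> ?I" by (rule power2_le_imp_le) simp
 with I show ?thesis by linarith
qed

section \<open>Smooth right-hand sides, treated one coordinate at a time\<close>

definition H1sum :: "(real^'d => real) => real" where
 "H1sum f = nm f + (\<Sum>l\<in>UNIV. nm (pd f l))"

lemma H1sum_nonneg [simp]: "0 \<le> H1sum f"
 by (simp add: H1sum_def sum_nonneg)

lemma nrm2_le_H1sum: "nm f \<le> H1sum f" and nrm2_pd_le_H1sum: "nm (pd f l) \<le> H1sum f"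
proof -
 show "nm f \<le> H1sum f" by (simp add: H1sum_def sum_nonneg)
 have "nm (pd f l) \<le> (\<Sum>l\<in>UNIV. nm (pd f l))" by (rule member_le_sum) auto
 thus "nm (pd f l) \<le> H1sum f"
  unfolding H1sum_def using nrm2_nonneg[of lborel f] by linarith
qed

lemma Cinf_realE:
 fixes f :: "real => real"
 assumes "Cinf f"
 obtains f' where "Cinf f'" "\<And>x. (f has_real_derivative f' x) (at x)"
proof
 show "Cinf (\<lambda>x. frechet_derivative f (at x) 1)" by (rule Cinf_frechet_derivative[OF assms])
 show "(f has_real_derivative frechet_derivative f (at x) 1) (at x)" for x
 proof -
  obtain f' where f': "\<And>x. (f has_real_derivative f' x) (at x)"
   using C_k_real_SucD[of 0 f] assms unfolding Cinf_def by blast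
  hence "(f has_derivative (*) (f' x)) (at x)" by (simp add: has_field_derivative_def)
  hence "frechet_derivative f (at x) = (*) (f' x)" by (rule frechet_derivative_at[symmetric])
  with f' show ?thesis by simp
 qed
qed

lemma not_icubeE:
 assumes "x \<notin> icube"
 obtains i where "x$i < pi/6 \<or> 5 * pi/6 < x$i"
proof -
 have "\<exists>i. \<not> (pi/6 \<le> x$i \<and> x$i \<le> 5 * pi/6)" using assms by (simp add: icube_def)
 then obtain i where "\<not> (pi/6 \<le> x$i \<and> x$i \<le> 5 * pi/6)" ..
 hence "x$i < pi/6 \<or> 5 * pi/6 < x$i" by linarith
 thus ?thesis by (rule that)
qed

text \<open>The primitive fails to have compact support only because it ends at the line integral;
  subtracting \<theta>(x_j) times that value repairs this. In the j-derivative the repair leaves the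
  error \<rho>(x_j) times the line integral, and the other derivatives pass through to f.\<close>

lemma pd_prim_error:
 fixes f :: "real^'d => real"
 assumes f: "tf icube f"
  and th: "Cinf \<theta>" "\<And>t. (\<theta> has_real_derivative \<rho> t) (at t)"
   "\<And>t. t < pi/6 ==> \<theta> t = 0" "\<And>t. t > 5 * pi/6 ==> \<theta> t = 1"
  and rh: "Cinf \<rho>" "\<And>t. t < pi/6 \<or> t > 5 * pi/6 ==> \<rho> t = 0"
 shows "tf icube (\<lambda>x. \<rho> (x$j) * line_int j f x)"
  "tf icube (\<lambda>x. prim_int j f x - \<theta> (x$j) * line_int j f x)"
  "pd (\<lambda>x. prim_int j f x - \<theta> (x$j) * line_int j f x) l x =
   (if l = j then f x - \<rho> (x$j) * line_int j f x
    else prim_int j (pd f l) x - \<theta> (x$j) * line_int j (pd f l) x)"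
proof -
 note C = tf_Cinf[OF f]
 show "tf icube (\<lambda>x. \<rho> (x$j) * line_int j f x)"
  unfolding tf_def
 proof (intro conjI allI impI Cinf_mult Cinf_compose_nth rh(1) Cinf_line_int C)
  fix x :: "real^'d" assume "x \<notin> icube"
  then obtain i where "x$i < pi/6 \<or> 5 * pi/6 < x$i" by (rule not_icubeE)
  thus "\<rho> (x$j) * line_int j f x = 0"
   using rh(2)[of "x$j"] int_outside_other(1)[OF f, of i j x] by (cases "i = j") auto
 qed
 show "tf icube (\<lambda>x. prim_int j f x - \<theta> (x$j) * line_int j f x)"
  unfolding tf_def
 proof (intro conjI allI impI Cinf_diff Cinf_mult Cinf_compose_nth th(1) Cinf_line_int Cinf_prim_int C)
  fix x :: "real^'d" assume "x \<notin> icube"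
  then obtain i where i: "x$i < pi/6 \<or> 5 * pi/6 < x$i" by (rule not_icubeE)
  show "prim_int j f x - \<theta> (x$j) * line_int j f x = 0"
  proof (cases "i = j")
   case True
   with i show ?thesis
    using prim_int_below[OF f] prim_int_above[OF f] th(3,4) by auto
  next
   case False
   thus ?thesis using int_outside_other[OF f False i] by simp
  qed
 qed
 have "pd (\<lambda>x. prim_int j f x - \<theta> (x$j) * line_int j f x) l x =
   pd (prim_int j f) l x - (\<theta> (x$j) * pd (line_int j f) l x + pd (\<lambda>x. \<theta> (x$j)) l x * line_int j f x)"
  unfolding pd_diff[OF Cinf_prim_int[OF C] Cinf_mult[OF Cinf_compose_nth[OF th(1)] Cinf_line_int[OF C]]]
   pd_mult[OF Cinf_compose_nth[OF th(1)] Cinf_line_int[OF C]] ..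
 thus "pd (\<lambda>x. prim_int j f x - \<theta> (x$j) * line_int j f x) l x =
   (if l = j then f x - \<rho> (x$j) * line_int j f x
    else prim_int j (pd f l) x - \<theta> (x$j) * line_int j (pd f l) x)"
  by (simp add: pd_prim_int[OF C] pd_line_int[OF C] pd_compose_nth[OF th(2)])
qed

lemma cube_profile_exists:
 obtains \<theta> \<rho> \<rho>' :: "real => real" and M where
  "Cinf \<theta>" "\<And>t. (\<theta> has_real_derivative \<rho> t) (at t)"
  "\<And>t. t < pi/6 ==> \<theta> t = 0" "\<And>t. t > 5 * pi/6 ==> \<theta> t = 1"
  "Cinf \<rho>" "\<And>t. t < pi/6 \<or> t > 5 * pi/6 ==> \<rho> t = 0"
  "\<And>t. (\<rho> has_real_derivative \<rho>' t) (at t)"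
  "M \<ge> 0" "\<And>t. \<bar>\<rho> t\<bar> \<le> M" "\<And>t. \<bar>\<rho>' t\<bar> \<le> M" "Cinf \<rho>'"
  "\<And>t. t < pi/6 \<or> t > 5 * pi/6 ==> \<rho>' t = 0"
  "\<rho> (pi/2) \<noteq> 0"
proof -
 obtain S S' :: "real => real" where S: "Cinf S" "Cinf S'" "\<And>x. (S has_real_derivative S' x) (at x)"
  "\<And>x. 0 \<le> S x" "\<And>x. S x \<le> 1" "\<And>x. x \<le> 0 ==> S x = 0" "\<And>x. x \<ge> 1 ==> S x = 1"
  "\<And>x. 0 \<le> S' x" "\<And>x. 0 < x ==> x < 1 ==> 0 < S' x" "\<And>x. x \<le> 0 \<or> x \<ge> 1 ==> S' x = 0"
  by (rule smooth_step_exists, rule that)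
 \<comment> \<open>The map t -> a t - 1/4 takes [pi/6, 5 pi/6] to [0,1].\<close>
 define a where "a = 3/(2 * pi)"
 have a: "a > 0" by (simp add: a_def)
 define \<theta> where "\<theta> t = S (a \<bullet> t + - (1/4))" for t
 define \<rho> where "\<rho> t = a * S' (a \<bullet> t + - (1/4))" for t
 have arg: "a * t - 1/4 = (t - pi/6) * a" for t by (simp add: a_def field_simps)
 have lo: "a * t - 1/4 \<le> 0" if "t \<le> pi/6" for t
  unfolding arg using that a by (simp add: mult_nonpos_nonneg)
 have hi: "a * t - 1/4 \<ge> 1" if "t \<ge> 5 * pi/6" for t
 proof -
  have "(t - pi/6) * a \<ge> (5 * pi/6 - pi/6) * a" using that a by (intro mult_right_mono) auto
  thus ?thesis unfolding arg by (simp add: a_def field_simps)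
 qed
 have Cr: "Cinf \<rho>" unfolding \<rho>_def[abs_def] by (intro Cinf_mult Cinf_const Cinf_compose_affine S)
 have r0: "\<rho> t = 0" if "t < pi/6 \<or> t > 5 * pi/6" for t
  using that lo[of t] hi[of t] S(10)[of "a * t - 1/4"] by (auto simp: \<rho>_def)
 obtain \<rho>' where r': "Cinf \<rho>'" "\<And>t. (\<rho> has_real_derivative \<rho>' t) (at t)"
  using Cinf_realE[OF Cr] by blast
 have r'0: "\<rho>' t = 0" if "t < pi/6 \<or> t > 5 * pi/6" for t
 proof -
  have "eventually (\<lambda>s. \<rho> s = 0) (nhds t)"
  proof (rule eventually_mono)
   show "eventually (\<lambda>s. s \<in> {..<pi/6} \<union> {5*pi/6<..}) (nhds t)"
    by (rule eventually_nhds_in_open) (use that in auto)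
   show "\<rho> s = 0" if "s \<in> {..<pi/6} \<union> {5*pi/6<..}" for s
    using that by (intro r0) auto
  qed
  hence "(\<rho> has_real_derivative 0) (at t)"
   by (subst DERIV_cong_ev[OF refl _ refl, where g = "\<lambda>_. 0"]) auto
  from DERIV_unique[OF r'(2) this] show ?thesis .
 qed
 have bnd: "\<exists>M\<ge>0. \<forall>t. \<bar>g t\<bar> \<le> M" if g: "Cinf g" "\<And>t. t < pi/6 \<or> t > 5 * pi/6 ==> g t = 0" for g :: "real => real"
 proof -
  have "compact (g ` {pi/6..5*pi/6})" by (intro compact_continuous_image Cinf_continuous g) auto
  then obtain M where M: "M > 0" "\<forall>y\<in>g ` {pi/6..5*pi/6}. norm y \<le> M"
   using compact_imp_bounded bounded_pos by blast
  have "\<bar>g t\<bar> \<le> M" for t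
  proof (cases "t \<in> {pi/6..5*pi/6}")
   case True
   hence "norm (g t) \<le> M" using M(2) by blast
   thus ?thesis by simp
  next
   case False
   hence "g t = 0" by (intro g(2)) auto
   with M(1) show ?thesis by simp
  qed
  with M(1) show ?thesis by (intro exI[of _ M] conjI allI) auto
 qed
 obtain M1 where M1: "M1 \<ge> 0" "\<And>t. \<bar>\<rho> t\<bar> \<le> M1" using bnd[OF Cr r0] by blast
 obtain M2 where M2: "M2 \<ge> 0" "\<And>t. \<bar>\<rho>' t\<bar> \<le> M2" using bnd[OF r'(1) r'0] by blast
 show ?thesis
 proof (rule that[of \<theta> \<rho> \<rho>' "M1 + M2"])
  show "Cinf \<theta>" unfolding \<theta>_def[abs_def] by (intro Cinf_compose_affine S)
  show "(\<theta> has_real_derivative \<rho> t) (at t)" for t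
  proof -
   have "((\<lambda>t. S (a * t + - (1/4))) has_real_derivative S' (a * t + - (1/4)) * a) (at t)"
    by (rule DERIV_chain2[OF S(3)]) (auto intro!: derivative_eq_intros)
   thus ?thesis by (simp add: \<theta>_def[abs_def] \<rho>_def mult.commute)
  qed
  show "\<theta> t = 0" if "t < pi/6" for t using lo[of t] that S(6) by (simp add: \<theta>_def)
  show "\<theta> t = 1" if "t > 5 * pi/6" for t using hi[of t] that S(7) by (simp add: \<theta>_def)
  have arg: "a \<bullet> (pi/2) + - (1/4) = 1/2" by (simp add: a_def field_simps)
  have "\<rho> (pi/2) = a * S' (1/2)" unfolding \<rho>_def arg ..
  thus "\<rho> (pi/2) \<noteq> 0" using a S(9)[of "1/2"] by simp
  show "\<bar>\<rho> t\<bar> \<le> M1 + M2" for t using M1(2)[of t] M2(1) by linarith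
  show "\<bar>\<rho>' t\<bar> \<le> M1 + M2" for t using M2(2)[of t] M1(1) by linarith
  show "0 \<le> M1 + M2" using M1 M2 by linarith
 qed (fact Cr r' r0 r'0)+
qed

text \<open>The corrected primitive serves as v. What remains of f depends on x_j only through
  \<rho>(x_j), at the price of one derivative: the bounds involve the H1 size of f rather than its
  L^2 norm.\<close>

lemma coordinate_step:
 obtains \<rho> :: "real => real" and C where "C \<ge> 0" "Cinf \<rho>" "\<rho> (pi/2) \<noteq> 0"
  "\<And>t. t < pi/6 \<or> t > 5 * pi/6 ==> \<rho> t = 0" "(LBINT t. \<rho> t) = 1"
  "\<And>(j::'d::finite) f. tf icube f ==> \<exists>v e. tf icube v \<and> tf icube e \<and>
    (\<forall>x. e x = \<rho> (x$j) * line_int j f x) \<and> (\<forall>x. f x = pd v j x + e x) \<and>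
    (\<forall>l. nm (pd v l) \<le> C * H1sum f) \<and> H1sum e \<le> C * H1sum f"
proof -
 obtain \<theta> \<rho> \<rho>' :: "real => real" and M where
  th: "Cinf \<theta>" "\<And>t. (\<theta> has_real_derivative \<rho> t) (at t)"
   "\<And>t. t < pi/6 ==> \<theta> t = 0" "\<And>t. t > 5 * pi/6 ==> \<theta> t = 1"
  and rh: "Cinf \<rho>" "\<And>t. t < pi/6 \<or> t > 5 * pi/6 ==> \<rho> t = 0"
  and r': "\<And>t. (\<rho> has_real_derivative \<rho>' t) (at t)"
  and M: "M \<ge> 0" "\<And>t. \<bar>\<rho> t\<bar> \<le> M" "\<And>t. \<bar>\<rho>' t\<bar> \<le> M"
  and r'': "Cinf \<rho>'" "\<And>t. t < pi/6 \<or> t > 5 * pi/6 ==> \<rho>' t = 0"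
  and half: "\<rho> (pi/2) \<noteq> 0"
  by (rule cube_profile_exists, rule that)
 define N where "N = 6 * pi * M"
 have N: "N \<ge> 0" using M(1) by (simp add: N_def)
 have bound: "nm (\<lambda>x. g (x$j) * line_int j f x) \<le> N * nm f"
  if f: "tf icube f" and g: "Cinf g" "\<And>t. t < pi/6 \<or> t > 5 * pi/6 ==> g t = 0" "\<And>t. \<bar>g t\<bar> \<le> M"
  for g and f :: "real^'d => real" and j
 proof -
  have C: "Cinf (\<lambda>x. g (x$j) * line_int j f x)"
   by (intro Cinf_mult Cinf_compose_nth g Cinf_line_int tf_Cinf[OF f])
  have z: "g (x$j) * line_int j f x = 0" if "x \<notin> cubepi" for x
  proof -
   have "x \<notin> icube" by (rule contra_subsetD[OF icube_subset that])
   then obtain i where "x$i < pi/6 \<or> 5 * pi/6 < x$i" by (rule not_icubeE)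
   thus ?thesis
    using g(2)[of "x$j"] int_outside_other(1)[OF f, of i j x] by (cases "i = j") auto
  qed
  have "nm (\<lambda>x. g (x$j) * line_int j f x) \<le> nm (\<lambda>x. M * onQ (line_int j f) x)"
  proof (rule nrm2_mono)
   show "sqb (\<lambda>x. M * onQ (line_int j f) x)"
    by (intro sqint_scale onQ_sqint Cinf_continuous Cinf_line_int tf_Cinf[OF f])
   show "\<bar>g (x$j) * line_int j f x\<bar> \<le> \<bar>M * onQ (line_int j f) x\<bar>" for x
    using z[of x] g(3)[of "x$j"] M(1)
    by (cases "x \<in> cubepi") (auto simp: abs_mult intro!: mult_right_mono)
   show "(\<lambda>x. g (x$j) * line_int j f x) \<in> borel_measurable lborel"
    using borel_measurable_continuous_onI[OF Cinf_continuous[OF C]] by simp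
  qed
  also have "\<dots> \<le> M*(6 * pi * nm f)"
   using M(1) line_int_bound[OF f] by (simp add: nrm2_scale mult_left_mono)
  finally show ?thesis by (simp add: N_def mult_ac)
 qed
 define C where "C = (2 * pi + 1)*(1 + N) + (1 + real CARD('d)) * N"
 have C0: "C \<ge> 0" using N by (simp add: C_def)
 have CN: "(1 + real CARD('d)) * N \<le> C" and CP: "2 * pi*(1 + N) \<le> C" and C1: "1 + N \<le> C"
  using N pi_gt_zero mult_nonneg_nonneg[of "1 + real CARD('d)" N] mult_nonneg_nonneg[of pi "1 + N"]
  by (simp_all add: C_def distrib_right)
 have int1: "(LBINT t. \<rho> t) = 1"
 proof -
  have "(LBINT t. indicator {0..pi} t*\<^sub>R \<rho> t) = \<theta> pi - \<theta> 0"
  proof (rule integral_FTC_atLeastAtMost)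
   show "(\<theta> has_vector_derivative \<rho> t) (at t within {0..pi})" for t
    unfolding has_real_derivative_iff_has_vector_derivative[symmetric]
    by (rule has_field_derivative_at_within[OF th(2)])
   show "continuous_on {0..pi} \<rho>" by (rule Cinf_continuous[OF rh(1)])
  qed simp
  moreover have "(\<lambda>t. indicator {0..pi} t*\<^sub>R \<rho> t) = \<rho>"
  proof
   fix t :: real
   have "t < pi/6 \<or> t > 5 * pi/6" if "t \<notin> {0..pi}" using that pi_gt_zero by auto
   thus "indicator {0..pi} t*\<^sub>R \<rho> t = \<rho> t" using rh(2)[of t] by (auto split: split_indicator)
  qed
  moreover have "\<theta> pi = 1" "\<theta> 0 = 0" using th(3,4) pi_gt_zero by auto
  ultimately show ?thesis by simp
 qed
 have step: "\<exists>v e. tf icube v \<and> tf icube e \<and>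
    (\<forall>x. e x = \<rho> (x$j) * line_int j f x) \<and> (\<forall>x. f x = pd v j x + e x) \<and>
    (\<forall>l. nm (pd v l) \<le> C * H1sum f) \<and> H1sum e \<le> C * H1sum f"
  if f: "tf icube f" for j :: 'd and f
 proof -
  let ?R = "\<lambda>g x. \<rho> (x$j) * line_int j g x"
  let ?V = "\<lambda>g x. prim_int j g x - \<theta> (x$j) * line_int j g x"
  have fl: "tf icube (pd f l)" for l by (rule tf_pd[OF f closed_icube])
  have V: "tf icube (?R g)" "tf icube (?V g)"
   "pd (?V g) l x = (if l = j then g x - ?R g x else ?V (pd g l) x)"
   if g: "tf icube g" for g l x
  proof -
   show "tf icube (?R g)" by (rule pd_prim_error(1)[OF g]; fact th rh)
   show "tf icube (?V g)" by (rule pd_prim_error(2)[OF g]; fact th rh)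
   show "pd (?V g) l x = (if l = j then g x - ?R g x else ?V (pd g l) x)"
    by (rule pd_prim_error(3)[OF g]; fact th rh)
  qed
  have diff: "nm (\<lambda>x. g x - ?R g x) \<le> (1 + N) * nm g" if g: "tf icube g" for g
  proof -
   have "nm (\<lambda>x. g x - ?R g x) \<le> nm g + nm (?R g)"
    by (intro nrm2_triangle_diff tf_sqint[OF g compact_icube] tf_sqint[OF V(1)[OF g] compact_icube])
   with bound[OF g rh(1,2) M(2), of j] show ?thesis by (simp add: distrib_right)
  qed
  have pdR: "pd (?R f) l x = (if l = j then \<rho>' (x$j) * line_int j f x else ?R (pd f l) x)" for l x
   using tf_Cinf[OF f] rh(1)
   by (simp add: pd_mult Cinf_compose_nth Cinf_line_int pd_compose_nth[OF r'] pd_line_int)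
  have "nm (pd (?V f) l) \<le> C * H1sum f" for l
  proof (cases "l = j")
   case True
   hence "nm (pd (?V f) l) \<le> (1 + N) * nm f"
    using diff[OF f] by (simp add: V(3)[OF f])
   also have "\<dots> \<le> C * H1sum f" using C1 N nrm2_le_H1sum[of f] by (intro mult_mono) auto
   finally show ?thesis .
  next
   case False
   \<comment> \<open>The l-derivative of the corrected primitive is the corrected primitive of
     \<open>pd f l\<close>. Poincare's inequality in direction j reduces it to its j-derivative,
     that is, \<open>pd f l\<close> minus \<rho> times a line integral.\<close>
   have "nm (?V (pd f l)) \<le> 2*\<bar>pi\<bar> * nm (pd (?V (pd f l)) j)"
   proof (rule tf_Poincare[OF V(2)[OF fl] compact_icube])
    fix x :: "real^'d" assume "x \<in> icube"
    hence "0 \<le> x$j \<and> x$j \<le> pi" using icube_subset by (auto simp: cubepi_def)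
    thus "\<bar>x$j\<bar> \<le> pi" by auto
   qed
   also have "\<dots> \<le> 2 * pi*((1 + N) * nm (pd f l))"
    using diff[OF fl[of l]] by (simp add: V(3)[OF fl] mult_left_mono)
   also have "\<dots> = 2 * pi*(1 + N) * nm (pd f l)" by simp
   also have "\<dots> \<le> C * H1sum f" using CP C0 N nrm2_pd_le_H1sum[of f l] by (intro mult_mono) auto
   finally show ?thesis using False by (simp add: V(3)[OF f])
  qed
  moreover have "H1sum (?R f) \<le> C * H1sum f"
  proof -
   have "nm (pd (?R f) l) \<le> N * H1sum f" for l
   proof (cases "l = j")
    case True
    hence "nm (pd (?R f) l) \<le> N * nm f"
     using bound[OF f r'' M(3), of j] by (simp add: pdR)
    also have "\<dots> \<le> N * H1sum f" using N nrm2_le_H1sum by (rule mult_left_mono[rotated])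
    finally show ?thesis .
   next
    case False
    hence "nm (pd (?R f) l) \<le> N * nm (pd f l)"
     using bound[OF fl[of l] rh(1,2) M(2), of j] by (simp add: pdR)
    also have "\<dots> \<le> N * H1sum f" using N nrm2_pd_le_H1sum by (rule mult_left_mono[rotated])
    finally show ?thesis .
   qed
   hence "(\<Sum>l\<in>UNIV. nm (pd (?R f) l)) \<le> real CARD('d)*(N * H1sum f)"
    using sum_bounded_above[of UNIV "\<lambda>l. nm (pd (?R f) l)" "N * H1sum f"] by simp
   moreover have "nm (?R f) \<le> N * H1sum f"
    using bound[OF f rh(1,2) M(2), of j] mult_left_mono[OF nrm2_le_H1sum[of f] N] by linarith
   ultimately have "H1sum (?R f) \<le> N * H1sum f + real CARD('d)*(N * H1sum f)"
    unfolding H1sum_def[of "?R f"] by linarith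
   also have "\<dots> = (1 + real CARD('d)) * N * H1sum f" by (simp add: distrib_right)
   also have "\<dots> \<le> C * H1sum f" by (intro mult_right_mono CN) simp
   finally show ?thesis .
  qed
  moreover have "f x = pd (?V f) j x + ?R f x" for x by (simp add: V(3)[OF f])
  ultimately show ?thesis
   using V(1,2)[OF f] by (intro exI[of _ "?V f"] exI[of _ "?R f"]) blast
 qed
 show ?thesis by (rule that[of C \<rho>]; fact C0 rh half int1 step)
qed

lemma tf_icube_integral_pd:
 assumes "tf icube f" shows "(LBINT x. pd f j x) = 0"
 by (rule integral_pd_eq_0[OF assms compact_icube])

text \<open>Once all coordinates are treated, the remainder is a multiple of the product b of the
  profiles. Derivatives of compactly supported functions have integral zero, so the multiple is the
  integral of e, hence zero. The function b is exported because it serves to correct the mean of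
  other data.\<close>

lemma div_solve_smooth:
 obtains C b where "C \<ge> 0" "tf (icube :: (real^'d) set) b" "(LBINT x. b x) = 1"
  "\<And>e :: real^'d => real. tf icube e ==> (LBINT x. e x) = 0 ==>
   \<exists>v. (\<forall>i. tf icube (v i)) \<and> (\<forall>x. e x = (\<Sum>i\<in>UNIV. pd (v i) i x)) \<and>
    (\<forall>i l. nm (pd (v i) l) \<le> C * H1sum e)"
proof -
 obtain \<rho> :: "real => real" and C where C: "C \<ge> 0" and rho: "Cinf \<rho>" "\<rho> (pi/2) \<noteq> 0"
  "\<And>t. t < pi/6 \<or> t > 5 * pi/6 ==> \<rho> t = 0" and int1: "(LBINT t. \<rho> t) = 1"
  and step: "\<And>(j::'d) f. tf icube f ==> \<exists>v e. tf icube v \<and> tf icube e \<and>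
    (\<forall>x. e x = \<rho> (x$j) * line_int j f x) \<and> (\<forall>x. f x = pd v j x + e x) \<and>
    (\<forall>l. nm (pd v l) \<le> C * H1sum f) \<and> H1sum e \<le> C * H1sum f"
  by (rule coordinate_step[where 'd = 'd], rule that)
 define b where "b S x = (\<Prod>i\<in>S. \<rho> (x$i))" for S and x :: "real^'d"
 \<comment> \<open>The last conjunct says that the remainder is a function of the coordinates
   outside S times \<open>b S\<close>. It is cross-multiplied because \<rho> has zeros.\<close>
 have "\<exists>K\<ge>0. \<forall>e. tf icube e \<longrightarrow> (\<exists>v eS. (\<forall>i. tf icube (v i)) \<and> tf icube eS \<and>
   (\<forall>x. e x = (\<Sum>i\<in>S. pd (v i) i x) + eS x) \<and> (\<forall>i l. nm (pd (v i) l) \<le> K * H1sum e) \<and>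
   H1sum eS \<le> K * H1sum e \<and> (\<forall>x y. (\<forall>i. i \<notin> S \<longrightarrow> x$i = y$i) \<longrightarrow> eS x * b S y = eS y * b S x))"
  for S :: "'d set"
 proof (induction S rule: finite_induct[OF finite])
  case 1
  show ?case
  proof (intro exI[of _ 1] conjI allI impI)
   fix e :: "real^'d => real" assume e: "tf icube e"
   show "\<exists>v eS. (\<forall>i. tf icube (v i)) \<and> tf icube eS \<and>
    (\<forall>x. e x = (\<Sum>i\<in>{}. pd (v i) i x) + eS x) \<and> (\<forall>i l. nm (pd (v i) l) \<le> 1 * H1sum e) \<and>
    H1sum eS \<le> 1 * H1sum e \<and> (\<forall>x y. (\<forall>i. i \<notin> {} \<longrightarrow> x$i = y$i) \<longrightarrow> eS x * b {} y = eS y * b {} x)"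
   proof (rule exI[of _ "\<lambda>i x. 0"], rule exI[of _ e], intro conjI allI impI)
    fix x y :: "real^'d" assume "\<forall>i. i \<notin> {} \<longrightarrow> x$i = y$i"
    hence "x = y" by (simp add: cart_eq_iff)
    thus "e x * b {} y = e y * b {} x" by simp
   qed (use e in auto)
  qed simp
 next
  case (2 j S)
  then obtain K where K: "K \<ge> 0" and IH: "\<And>e. tf icube e ==> \<exists>v eS. (\<forall>i. tf icube (v i)) \<and> tf icube eS \<and>
   (\<forall>x. e x = (\<Sum>i\<in>S. pd (v i) i x) + eS x) \<and> (\<forall>i l. nm (pd (v i) l) \<le> K * H1sum e) \<and>
   H1sum eS \<le> K * H1sum e \<and> (\<forall>x y. (\<forall>i. i \<notin> S \<longrightarrow> x$i = y$i) \<longrightarrow> eS x * b S y = eS y * b S x)"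
   by blast
  show ?case
  proof (intro exI[of _ "K + C * K"] conjI allI impI)
   show "0 \<le> K + C * K" using K C by simp
   fix e :: "real^'d => real" assume e: "tf icube e"
   from IH[OF e] obtain v eS where v: "\<And>i. tf icube (v i)" and eS: "tf icube eS"
    and dec: "\<And>x. e x = (\<Sum>i\<in>S. pd (v i) i x) + eS x"
    and vb: "\<And>i l. nm (pd (v i) l) \<le> K * H1sum e" and eb: "H1sum eS \<le> K * H1sum e"
    and inv: "\<And>x y. (\<And>i. i \<notin> S ==> x$i = y$i) ==> eS x * b S y = eS y * b S x"
    by blast
   from step[OF eS, of j] obtain u e' where u: "tf icube u" and e': "tf icube e'"
    and e'_def: "\<And>x. e' x = \<rho> (x$j) * line_int j eS x" and dec': "\<And>x. eS x = pd u j x + e' x"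
    and ub: "\<And>l. nm (pd u l) \<le> C * H1sum eS" and e'b: "H1sum e' \<le> C * H1sum eS"
    by blast
   have CK: "C * H1sum eS \<le> C * K * H1sum e" using eb C by (simp add: mult.assoc mult_left_mono)
   have le1: "C * K * H1sum e \<le> (K + C * K) * H1sum e" and le2: "K * H1sum e \<le> (K + C * K) * H1sum e"
    using K C by (simp_all add: distrib_right)
   have bind: "b S (upd x j s) = b S x" for x s
    unfolding b_def using 2(2) by (intro prod.cong) auto
   have cont: "continuous_on {0..1} (\<lambda>t. eS (upd x j (pi * t)))" for x
    unfolding upd_def
    by (intro continuous_on_compose2[OF Cinf_continuous[OF tf_Cinf[OF eS], of UNIV]] continuous_intros) auto
   show "\<exists>v eS. (\<forall>i. tf icube (v i)) \<and> tf icube eS \<and>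
    (\<forall>x. e x = (\<Sum>i\<in>insert j S. pd (v i) i x) + eS x) \<and> (\<forall>i l. nm (pd (v i) l) \<le> (K + C * K) * H1sum e) \<and>
    H1sum eS \<le> (K + C * K) * H1sum e \<and>
    (\<forall>x y. (\<forall>i. i \<notin> insert j S \<longrightarrow> x$i = y$i) \<longrightarrow> eS x * b (insert j S) y = eS y * b (insert j S) x)"
   proof (rule exI[of _ "v(j := u)"], rule exI[of _ e'], intro conjI allI impI)
    show "tf icube ((v(j := u)) i)" for i using v u by simp
    show "tf icube e'" by fact
    show "nm (pd ((v(j := u)) i) l) \<le> (K + C * K) * H1sum e" for i l
     using vb[of i l] ub[of l] CK le1 le2 by auto
    show "H1sum e' \<le> (K + C * K) * H1sum e" using e'b CK le1 by linarith
    show "e x = (\<Sum>i\<in>insert j S. pd ((v(j := u)) i) i x) + e' x" for x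
    proof -
     have "(\<Sum>i\<in>insert j S. pd ((v(j := u)) i) i x) = pd u j x + (\<Sum>i\<in>S. pd ((v(j := u)) i) i x)"
      using 2(1,2) by simp
     also have "(\<Sum>i\<in>S. pd ((v(j := u)) i) i x) = (\<Sum>i\<in>S. pd (v i) i x)"
      using 2(2) by (intro sum.cong) auto
     finally show ?thesis using dec[of x] dec'[of x] by simp
    qed
    fix x y :: "real^'d" assume xy: "\<forall>i. i \<notin> insert j S \<longrightarrow> x$i = y$i"
    \<comment> \<open>With coordinate j set to the same s, the two points agree outside S, so the
      induction hypothesis applies; integration over s carries the identity over to the line
      integrals.\<close>
    have pt: "eS (upd x j s) * b S y = eS (upd y j s) * b S x" for s
    proof -
     have "eS (upd x j s) * b S (upd y j s) = eS (upd y j s) * b S (upd x j s)"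
      by (rule inv) (use xy in auto)
     thus ?thesis by (simp add: bind)
    qed
    have "line_int j eS x * b S y = pi * integral {0..1} (\<lambda>t. eS (upd x j (pi * t)) * b S y)"
     unfolding line_int_def by simp
    also have "\<dots> = line_int j eS y * b S x"
     unfolding line_int_def pt by simp
    finally have "line_int j eS x * b S y = line_int j eS y * b S x" .
    hence "\<rho> (x$j)*\<rho> (y$j)*(line_int j eS x * b S y) = \<rho> (x$j)*\<rho> (y$j)*(line_int j eS y * b S x)"
     by simp
    thus "e' x * b (insert j S) y = e' y * b (insert j S) x"
     using 2(1,2) by (simp add: e'_def b_def mult_ac)
   qed
  qed
 qed
 from this[of UNIV] obtain K where K: "K \<ge> 0" and sol: "\<And>e. tf icube e ==> \<exists>v eS. (\<forall>i. tf icube (v i)) \<and> tf icube eS \<and>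
   (\<forall>x. e x = (\<Sum>i\<in>UNIV. pd (v i) i x) + eS x) \<and> (\<forall>i l. nm (pd (v i) l) \<le> K * H1sum e) \<and>
   H1sum eS \<le> K * H1sum e \<and> (\<forall>x y. (\<forall>i. i \<notin> UNIV \<longrightarrow> x$i = y$i) \<longrightarrow> eS x * b UNIV y = eS y * b UNIV x)"
  by blast
 have tb: "tf icube (b UNIV)"
  unfolding tf_def
 proof (intro conjI allI impI)
  show "Cinf (b UNIV)" unfolding b_def[abs_def] by (intro Cinf_prod Cinf_compose_nth rho)
  fix x :: "real^'d" assume "x \<notin> icube"
  then obtain i where "x$i < pi/6 \<or> 5 * pi/6 < x$i" by (rule not_icubeE)
  hence "\<rho> (x$i) = 0" by (rule rho(3)[OF disj_forward]) auto
  thus "b UNIV x = 0" unfolding b_def by (intro prod_zero bexI[of _ i]) auto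
 qed
 have rint: "integrable lborel \<rho>"
 proof -
  have "integrable lborel (\<lambda>t. indicator {pi/6..5*pi/6} t*\<rho> t)"
   by (rule integrable_indicator_continuous[OF Cinf_continuous[OF rho(1)]])
  moreover have "(\<lambda>t. indicator {pi/6..5*pi/6} t*\<rho> t) = \<rho>"
   using rho(3) by (auto simp: fun_eq_iff not_le split: split_indicator)
  ultimately show ?thesis by simp
 qed
 have ib: "(LBINT x. b UNIV x) = 1"
  unfolding b_def using integral_lborel_prod_vec(2)[of "\<lambda>_. \<rho>", OF rint] by (simp add: int1)
 have b0: "b UNIV (\<chi> i. pi/2) \<noteq> 0" using rho(2) by (simp add: b_def)
 show ?thesis
 proof (rule that[OF K tb ib])
  fix e :: "real^'d => real" assume e: "tf icube e" and e0: "(LBINT x. e x) = 0"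
  from sol[OF e] obtain v eS where v: "\<And>i. tf icube (v i)" and eS: "tf icube eS"
   and dec: "\<And>x. e x = (\<Sum>i\<in>UNIV. pd (v i) i x) + eS x"
   and vb: "\<And>i l. nm (pd (v i) l) \<le> K * H1sum e"
   and inv: "\<And>x y. eS x * b UNIV y = eS y * b UNIV x"
   by blast
  \<comment> \<open>At the centre of the cube no factor of b vanishes, so the cross-multiplied
    identity can be divided there.\<close>
  define c where "c = eS (\<chi> i. pi/2)/b UNIV (\<chi> i. pi/2)"
  have eSc: "eS x = c * b UNIV x" for x
   using inv[of x "\<chi> i. pi/2"] b0 by (simp add: c_def field_simps)
  have ipd: "integrable lborel (pd (v i) i)" for i
   by (rule tf_integrable[OF tf_pd[OF v closed_icube] compact_icube])
  have ieS: "integrable lborel eS" by (rule tf_integrable[OF eS compact_icube])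
  have "0 = (LBINT x. (\<Sum>i\<in>UNIV. pd (v i) i x) + eS x)" using e0 by (simp add: dec)
  also have "\<dots> = (\<Sum>i\<in>UNIV. (LBINT x. pd (v i) i x)) + (LBINT x. eS x)"
   using ipd ieS by simp
  also have "\<dots> = c" using ib by (simp add: tf_icube_integral_pd[OF v] eSc)
  finally have "eS x = 0" for x by (simp add: eSc)
  thus "\<exists>v. (\<forall>i. tf icube (v i)) \<and> (\<forall>x. e x = (\<Sum>i\<in>UNIV. pd (v i) i x)) \<and>
    (\<forall>i l. nm (pd (v i) l) \<le> K * H1sum e)"
   using v vb dec by (intro exI[of _ v]) simp
 qed
qed

section \<open>The divergence equation for square integrable data on a cube\<close>

definition mid_cube :: "(real^'d) set" where
 "mid_cube = {x. \<forall>i. pi/3 \<le> x$i \<and> x$i \<le> 2 * pi/3}"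

lemma mid_cube_cbox: "mid_cube = cbox (\<chi> i. pi/3) (\<chi> i. 2 * pi/3)"
 by (auto simp: mid_cube_def mem_box_cart)

lemma cutoff_exists:
 obtains \<eta> :: "real^'d => real" where "tf icube \<eta>" "\<And>x. x \<in> mid_cube ==> \<eta> x = 1"
  "\<And>x. \<bar>\<eta> x\<bar> \<le> 1"
proof -
 obtain S S' :: "real => real" where S: "Cinf S" "Cinf S'" "\<And>x. (S has_real_derivative S' x) (at x)"
  "\<And>x. 0 \<le> S x" "\<And>x. S x \<le> 1" "\<And>x. x \<le> 0 ==> S x = 0" "\<And>x. x \<ge> 1 ==> S x = 1"
  "\<And>x. 0 \<le> S' x" "\<And>x. 0 < x ==> x < 1 ==> 0 < S' x" "\<And>x. x \<le> 0 \<or> x \<ge> 1 ==> S' x = 0"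
  by (rule smooth_step_exists, rule that)
 \<comment> \<open>The first factor rises on [pi/6, pi/3], the second falls on
   [2 pi/3, 5 pi/6].\<close>
 define h where "h t = S ((6/pi) \<bullet> t + - 1) * S ((- 6/pi) \<bullet> t + 5)" for t
 have Ch: "Cinf h" unfolding h_def[abs_def] by (intro Cinf_mult Cinf_compose_affine S)
 have h01: "0 \<le> h t" "h t \<le> 1" for t
  unfolding h_def using S(4,5) by (auto intro!: mult_le_one)
 have h1: "h t = 1" if "pi/3 \<le> t" "t \<le> 2 * pi/3" for t
 proof -
  have "6/pi * t - 1 \<ge> 1" "- 6/pi * t + 5 \<ge> 1" using that pi_gt_zero by (simp_all add: field_simps)
  thus ?thesis using S(7) by (simp add: h_def)
 qed
 have h0: "h t = 0" if "t < pi/6 \<or> 5 * pi/6 < t" for t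
 proof -
  have "6/pi * t - 1 \<le> 0 \<or> - 6/pi * t + 5 \<le> 0" using that pi_gt_zero by (auto simp: field_simps)
  thus ?thesis using S(6) by (auto simp: h_def)
 qed
 show ?thesis
 proof (rule that[of "\<lambda>x. \<Prod>i\<in>UNIV. h (x$i)"])
  show "tf icube (\<lambda>x::real^'d. \<Prod>i\<in>UNIV. h (x$i))"
   unfolding tf_def
  proof (intro conjI allI impI Cinf_prod Cinf_compose_nth Ch)
   fix x :: "real^'d" assume "x \<notin> icube"
   then obtain i where "x$i < pi/6 \<or> 5 * pi/6 < x$i" by (rule not_icubeE)
   hence "h (x$i) = 0" by (rule h0)
   thus "(\<Prod>i\<in>UNIV. h (x$i)) = 0" by (intro prod_zero bexI[of _ i]) auto
  qed
  show "(\<Prod>i\<in>UNIV. h (x$i)) = 1" if "x \<in> mid_cube" for x :: "real^'d"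
   using that h1 by (simp add: mid_cube_def)
  show "\<bar>\<Prod>i\<in>UNIV. h (x$i)\<bar> \<le> 1" for x :: "real^'d"
   using h01 by (simp add: abs_prod prod_le_1)
 qed
qed

lemma tf_family_bounded:
 fixes f :: "'i::finite => real^'d => real"
 assumes "\<And>i. tf K (f i)" "compact K"
 obtains B where "B > 0" "\<And>i x. \<bar>f i x\<bar> \<le> B"
proof -
 have "\<forall>i. \<exists>B. B > 0 \<and> (\<forall>x. \<bar>f i x\<bar> \<le> B)"
  using tf_bounded[OF assms(1) assms(2)] by metis
 then obtain B where B: "\<And>i. B i > 0" "\<And>i x. \<bar>f i x\<bar> \<le> B i" by metis
 have "\<bar>f i x\<bar> \<le> sum B UNIV" for i x
  using B(2)[of i x] member_le_sum[of i UNIV B] B(1) by (force simp: less_imp_le intro: order_trans)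
 moreover have "sum B UNIV > 0" using B(1) by (intro sum_pos) auto
 ultimately show ?thesis by (rule that[rotated])
qed

lemma cutoff_mult_bound:
 fixes h g :: "real^'d => real"
 assumes h: "tf icube h" "\<And>x. \<bar>h x\<bar> \<le> B" and g: "sqb (onQ g)"
 shows "sqb (\<lambda>x. h x * g x)" "nm (\<lambda>x. h x * g x) \<le> \<bar>B\<bar> * nm (onQ g)"
proof -
 have eq: "(\<lambda>x. h x * g x) = (\<lambda>x. h x * onQ g x)"
  using tf_eq_0[OF h(1)] subsetD[OF icube_subset] by (force simp: fun_eq_iff split: split_indicator)
 have "h \<in> borel_measurable lborel" using tf_borel[OF h(1)] by simp
 from nrm2_mult_bound[OF g this, of B] h(2)
 show "sqb (\<lambda>x. h x * g x)" "nm (\<lambda>x. h x * g x) \<le> \<bar>B\<bar> * nm (onQ g)"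
  unfolding eq by auto
qed

lemma mid_subset_inner: "mid_cube \<subseteq> icube"
proof
 fix x :: "real^'d" assume x: "x \<in> mid_cube"
 have "pi/6 \<le> x$i \<and> x$i \<le> 5 * pi/6" for i
 proof -
  have "pi/3 \<le> x$i" "x$i \<le> 2 * pi/3" using x by (auto simp: mid_cube_def)
  thus ?thesis using pi_gt_zero by linarith
 qed
 thus "x \<in> icube" by (simp add: icube_def)
qed

text \<open>Multiplication by a cutoff \<eta> gives the trigonometric solution compact support but
  adds grad \<eta> . wt to its divergence. This term contains no derivative of wt, so its H1 size is
  bounded by the data and the smooth solver removes it. The accuracy e of the cosine approximation
  stays free, and C does not depend on it.\<close>

lemma div_solve_local:
 obtains C where "C \<ge> 0"
  "\<And>(r :: real^'d => real) e. sqb r ==> \<forall>x. x \<notin> mid_cube \<longrightarrow> r x = 0 ==>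
   (LBINT x. r x) = 0 ==> e > 0 ==>
   \<exists>w. (\<forall>i. tf icube (w i)) \<and> nm (\<lambda>x. (\<Sum>i\<in>UNIV. pd (w i) i x) - r x) \<le> C * e \<and>
    (\<forall>i j. nm (pd (w i) j) \<le> C*(nm r + e))"
proof -
 obtain K and b :: "real^'d => real" where K: "K \<ge> 0" and b: "tf icube b" "(LBINT x. b x) = 1"
  and sol: "\<And>e :: real^'d => real. tf icube e ==> (LBINT x. e x) = 0 ==>
   \<exists>v. (\<forall>i. tf icube (v i)) \<and> (\<forall>x. e x = (\<Sum>i\<in>UNIV. pd (v i) i x)) \<and>
    (\<forall>i l. nm (pd (v i) l) \<le> K * H1sum e)"
  by (rule div_solve_smooth, rule that)
 obtain \<eta> :: "real^'d => real" where \<eta>: "tf icube \<eta>" "\<And>x. x \<in> mid_cube ==> \<eta> x = 1"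
  "\<And>x. \<bar>\<eta> x\<bar> \<le> 1"
  by (rule cutoff_exists, rule that)
 have p\<eta>: "tf icube (pd \<eta> i)" for i by (rule tf_pd[OF \<eta>(1) closed_icube])
 obtain B1 where B1: "B1 > 0" "\<And>i x. \<bar>pd \<eta> i x\<bar> \<le> B1"
  by (rule tf_family_bounded[of icube "\<lambda>i. pd \<eta> i", OF p\<eta> compact_icube]) blast
 obtain B2 where B2: "B2 > 0" "\<And>q x. \<bar>pd (pd \<eta> (fst q)) (snd q) x\<bar> \<le> B2"
  by (rule tf_family_bounded[of icube "\<lambda>q. pd (pd \<eta> (fst q)) (snd q)", OF tf_pd[OF p\<eta> closed_icube] compact_icube]) blast
 define B where "B = 1 + B1 + B2"
 have B: "B \<ge> 0" "\<And>x. \<bar>\<eta> x\<bar> \<le> B" "\<And>i x. \<bar>pd \<eta> i x\<bar> \<le> B" "\<And>i l x. \<bar>pd (pd \<eta> i) l x\<bar> \<le> B"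
 proof -
  show "B \<ge> 0" using B1(1) B2(1) by (simp add: B_def)
  show "\<bar>\<eta> x\<bar> \<le> B" for x using \<eta>(3)[of x] B1(1) B2(1) by (simp add: B_def)
  show "\<bar>pd \<eta> i x\<bar> \<le> B" for i x using B1(2)[where i = i and x = x] B2(1) by (simp add: B_def)
  show "\<bar>pd (pd \<eta> i) l x\<bar> \<le> B" for i l x using B2(2)[where q = "(i, l)" and x = x] B1(1) by (simp add: B_def)
 qed
 define V where "V = nm (onQ (\<lambda>x::real^'d. 1))"
 have V0: "V \<ge> 0" by (simp add: V_def)
 have s1: "sqb (onQ (\<lambda>x::real^'d. 1))" by (rule onQ_sqint) simp
 define d where "d = real CARD('d)"
 have d0: "d \<ge> 0" by (simp add: d_def)
 define c1 where "c1 = d * B + d*(d*(2 * B))"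
 define c2 where "c2 = (1 + d) * H1sum b"
 have c0: "c1 \<ge> 0" "c2 \<ge> 0" using d0 B(1) by (simp_all add: c1_def c2_def)
 define C where "C = (2 * B + K * c1 + K*(c2 * V)) + (1 + V * H1sum b)"
 show ?thesis
 proof (rule that[of C])
  show "C \<ge> 0" using B(1) K c0 V0 by (simp add: C_def)
  fix r :: "real^'d => real" and e :: real
  assume r: "sqb r" and r0': "\<forall>x. x \<notin> mid_cube \<longrightarrow> r x = 0"
   and rint: "(LBINT x. r x) = 0" and e: "e > 0"
  have r0: "r x = 0" if "x \<notin> mid_cube" for x using r0' that by blast
  have rQ: "onQ r x = r x" for x
   proof (cases "x \<in> cubepi")
    case False
    hence "x \<notin> mid_cube" using mid_subset_inner icube_subset by auto
    with False show ?thesis using r0[of x] by simp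
   qed simp
  have ri: "integrable lborel r"
   using sqint_mult_integrable[OF s1 r] by (simp only: mult_1_right rQ)
  obtain F c where F: "finite F" "(\<lambda>_. 0) \<notin> F"
   and approx: "nm (onQ (\<lambda>x. r x - (\<Sum>k\<in>F. c k * trig {} k x))) < e"
  proof -
   have "(LBINT x. onQ r x) = 0" by (simp only: rQ rint)
   from cos_poly_dense_mean_zero[OF r this e] show ?thesis using that .
  qed
  define T where "T x = (\<Sum>k\<in>F. c k * trig {} k x)" for x
  obtain wt :: "'d => real^'d => real" where wt: "\<And>i. Cinf (wt i)" "\<And>x. (\<Sum>i\<in>UNIV. pd (wt i) i x) = T x"
   "\<And>i. nm (onQ (wt i)) \<le> nm (onQ T)"
   "\<And>i j. nm (onQ (pd (wt i) j)) \<le> nm (onQ T)"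
  proof -
   from trig_div_solution[OF F, of c] show ?thesis using that unfolding T_def .
  qed
  have CT: "Cinf T" unfolding T_def[abs_def] by (intro Cinf_sum Cinf_mult Cinf_const Cinf_trig)
  have sT: "sqb (onQ T)" by (rule onQ_sqint[OF Cinf_continuous[OF CT]])
  have srT: "sqb (onQ (\<lambda>x. r x - T x))"
   using sqint_diff[OF r sT] by (simp only: right_diff_distrib rQ)
  define nT where "nT = nm (onQ T)"
  have nT0: "nT \<ge> 0" by (simp add: nT_def)
  have nT: "nT \<le> nm r + e"
  proof -
   have "onQ T x = r x - onQ (\<lambda>x. r x - T x) x" for x
    by (simp add: right_diff_distrib rQ)
   hence "nT \<le> nm r + nm (onQ (\<lambda>x. r x - T x))"
    unfolding nT_def using nrm2_triangle_diff[OF r srT] by simp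
   with approx show ?thesis by (simp add: T_def)
  qed
  \<comment> \<open>The data vanish wherever \<eta> differs from 1.\<close>
  have z_eq: "\<eta> x * T x - r x = \<eta> x*(T x - r x)" for x
   using \<eta>(2)[of x] r0[of x] by (cases "x \<in> mid_cube") (auto simp: algebra_simps)
  have sz0: "sqb (onQ (\<lambda>x. T x - r x))"
   using sqint_uminus[OF srT] by (simp add: algebra_simps)
  have nz0: "nm (onQ (\<lambda>x. T x - r x)) \<le> e"
   using nrm2_uminus[of lborel "onQ (\<lambda>x. r x - T x)"] approx by (simp add: algebra_simps T_def)
  have sz: "sqb (\<lambda>x. \<eta> x * T x - r x)" and nz: "nm (\<lambda>x. \<eta> x * T x - r x) \<le> e"
   unfolding z_eq using cutoff_mult_bound[OF \<eta>(1,3) sz0] nz0 by auto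
  \<comment> \<open>Cutting off destroys the zero mean; the defect m is of order e because r has
    mean zero.\<close>
  define m where "m = (LBINT x. \<eta> x * T x)"
  have i\<eta>T: "integrable lborel (\<lambda>x. \<eta> x * T x)"
   by (rule tf_integrable[OF tf_mult2[OF \<eta>(1) CT] compact_icube])
  have m: "\<bar>m\<bar> \<le> V * e"
  proof -
   have "m = (LBINT x. \<eta> x * T x - r x)" using i\<eta>T ri rint by (simp add: m_def)
   also have "\<dots> = (LBINT x. onQ (\<lambda>x. 1) x*(\<eta> x * T x - r x))"
   proof (rule int_cong)
    fix x :: "real^'d"
    show "\<eta> x * T x - r x = onQ (\<lambda>x. 1) x*(\<eta> x * T x - r x)"
     unfolding z_eq using tf_eq_0[OF \<eta>(1), of x] subsetD[OF icube_subset, of x]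
     by (cases "x \<in> icube") auto
   qed simp
   finally have "\<bar>m\<bar> \<le> V * nm (\<lambda>x. \<eta> x * T x - r x)"
    using L2_Cauchy_Schwarz[OF s1 sz] by (simp add: V_def)
   also have "\<dots> \<le> V * e" using nz V0 by (rule mult_left_mono)
   finally show ?thesis .
  qed
  \<comment> \<open>The divergence of \<eta> wt integrates to zero, so grad \<eta> . wt has integral
    -m; adding m b restores mean zero, as the smooth solver demands.\<close>
  define E where "E x = (\<Sum>i\<in>UNIV. pd \<eta> i x * wt i x) + m * b x" for x
  have tfpw: "tf icube (\<lambda>x. pd \<eta> i x * wt i x)" for i by (rule tf_mult2[OF p\<eta> wt(1)])
  have tfE: "tf icube E"
   unfolding E_def[abs_def] by (intro tf_add tf_sum tfpw tf_scale b)
  have tfcw: "tf icube (\<lambda>x. \<eta> x * wt i x)" for i by (rule tf_mult2[OF \<eta>(1) wt(1)])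
  have pdcw: "pd (\<lambda>x. \<eta> x * wt i x) j x = \<eta> x * pd (wt i) j x + pd \<eta> j x * wt i x" for i j x
   by (rule pd_mult[OF tf_Cinf[OF \<eta>(1)] wt(1)])
  have divcw: "(\<Sum>i\<in>UNIV. pd (\<lambda>x. \<eta> x * wt i x) i x) = \<eta> x * T x + (\<Sum>i\<in>UNIV. pd \<eta> i x * wt i x)" for x
   unfolding pdcw by (simp add: sum.distrib sum_distrib_left[symmetric] wt(2))
  have E0: "(LBINT x. E x) = 0"
  proof -
   have ipd: "integrable lborel (pd (\<lambda>x. \<eta> x * wt i x) i)" for i
    by (rule tf_integrable[OF tf_pd[OF tfcw closed_icube] compact_icube])
   have ib: "integrable lborel b" by (rule tf_integrable[OF b(1) compact_icube])
   have "E x = (\<Sum>i\<in>UNIV. pd (\<lambda>x. \<eta> x * wt i x) i x) - \<eta> x * T x + m * b x" for x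
    by (simp add: E_def divcw)
   hence "(LBINT x. E x) = (LBINT x. (\<Sum>i\<in>UNIV. pd (\<lambda>x. \<eta> x * wt i x) i x) - \<eta> x * T x + m * b x)"
    by simp
   also have "\<dots> = (\<Sum>i\<in>UNIV. (LBINT x. pd (\<lambda>x. \<eta> x * wt i x) i x)) - m + m"
    using ipd ib i\<eta>T b(2)
    by (subst int_add, simp, simp, subst int_diff)
     (simp_all add: m_def)
   also have "\<dots> = 0" using tf_icube_integral_pd[OF tfcw] by simp
   finally show ?thesis .
  qed
  from sol[OF tfE E0] obtain v where v: "\<And>i. tf icube (v i)" "\<And>x. E x = (\<Sum>i\<in>UNIV. pd (v i) i x)"
   "\<And>i l. nm (pd (v i) l) \<le> K * H1sum E" by blast
  have swt: "sqb (onQ (wt i))" for i by (rule onQ_sqint[OF Cinf_continuous[OF wt(1)]])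
  have spwt: "sqb (onQ (pd (wt i) l))" for i l by (rule onQ_sqint[OF Cinf_continuous[OF Cinf_pd[OF wt(1)]]])
  have sb: "sqb b" by (rule tf_sqint[OF b(1) compact_icube])
  have spb: "sqb (pd b l)" for l by (rule tf_sqint[OF tf_pd[OF b(1) closed_icube] compact_icube])
  have bd1: "nm (\<lambda>x. h x * wt i x) \<le> B * nT" "sqb (\<lambda>x. h x * wt i x)"
   if "tf icube h" "\<And>x. \<bar>h x\<bar> \<le> B" for h i
  proof -
   have "nm (\<lambda>x. h x * wt i x) \<le> \<bar>B\<bar> * nm (onQ (wt i))"
    by (rule cutoff_mult_bound(2)[OF that swt])
   also have "\<dots> \<le> B * nT" using wt(3)[of i] B(1) by (simp add: nT_def mult_left_mono)
   finally show "nm (\<lambda>x. h x * wt i x) \<le> B * nT" .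
   show "sqb (\<lambda>x. h x * wt i x)" by (rule cutoff_mult_bound(1)[OF that swt])
  qed
  have bd2: "nm (\<lambda>x. h x * pd (wt i) l x) \<le> B * nT" "sqb (\<lambda>x. h x * pd (wt i) l x)"
   if "tf icube h" "\<And>x. \<bar>h x\<bar> \<le> B" for h i l
  proof -
   have "nm (\<lambda>x. h x * pd (wt i) l x) \<le> \<bar>B\<bar> * nm (onQ (pd (wt i) l))"
    by (rule cutoff_mult_bound(2)[OF that spwt])
   also have "\<dots> \<le> B * nT" using wt(4)[of i l] B(1) by (simp add: nT_def mult_left_mono)
   finally show "nm (\<lambda>x. h x * pd (wt i) l x) \<le> B * nT" .
   show "sqb (\<lambda>x. h x * pd (wt i) l x)" by (rule cutoff_mult_bound(1)[OF that spwt])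
  qed
  have nE: "nm E \<le> d*(B * nT) + \<bar>m\<bar> * H1sum b"
  proof -
   have "nm E \<le> nm (\<lambda>x. \<Sum>i\<in>UNIV. pd \<eta> i x * wt i x) + nm (\<lambda>x. m * b x)"
    unfolding E_def[abs_def] by (intro nrm2_triangle sqint_sum bd1 p\<eta> B sqint_scale sb)
   also have "nm (\<lambda>x. \<Sum>i\<in>UNIV. pd \<eta> i x * wt i x) \<le> (\<Sum>i\<in>UNIV. nm (\<lambda>x. pd \<eta> i x * wt i x))"
    by (intro nrm2_sum bd1 p\<eta> B)
   also have "\<dots> \<le> (\<Sum>i\<in>(UNIV::'d set). B * nT)" by (intro sum_mono bd1 p\<eta> B)
   also have "nm (\<lambda>x. m * b x) \<le> \<bar>m\<bar> * H1sum b"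
    unfolding nrm2_scale by (intro mult_left_mono nrm2_le_H1sum) simp
   finally show ?thesis by (simp add: d_def)
  qed
  have npE: "nm (pd E l) \<le> d*(2 * B * nT) + \<bar>m\<bar> * H1sum b" for l
  proof -
   have "pd E l x = (\<Sum>i\<in>UNIV. pd (\<lambda>x. pd \<eta> i x * wt i x) l x) + pd (\<lambda>x. m * b x) l x" for x
    unfolding E_def[abs_def]
    by (subst pd_add) (auto intro!: Cinf_sum tf_Cinf[OF tfpw] tf_Cinf[OF tf_scale[OF b(1)]] simp: pd_sum tf_Cinf[OF tfpw])
   also have "\<dots> x = (\<Sum>i\<in>UNIV. pd \<eta> i x * pd (wt i) l x + pd (pd \<eta> i) l x * wt i x) + m * pd b l x" for x
    by (simp add: pd_mult[OF tf_Cinf[OF p\<eta>] wt(1)] pd_scale[OF tf_Cinf[OF b(1)]])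
   finally have eq: "pd E l x = (\<Sum>i\<in>UNIV. pd \<eta> i x * pd (wt i) l x + pd (pd \<eta> i) l x * wt i x) + m * pd b l x" for x .
   have pp: "tf icube (pd (pd \<eta> i) l)" for i by (rule tf_pd[OF p\<eta> closed_icube])
   have "nm (pd E l) \<le> nm (\<lambda>x. \<Sum>i\<in>UNIV. pd \<eta> i x * pd (wt i) l x + pd (pd \<eta> i) l x * wt i x)
     + nm (\<lambda>x. m * pd b l x)"
    unfolding eq by (intro nrm2_triangle sqint_sum sqint_add bd1 bd2 pp p\<eta> B sqint_scale spb)
   also have "nm (\<lambda>x. \<Sum>i\<in>UNIV. pd \<eta> i x * pd (wt i) l x + pd (pd \<eta> i) l x * wt i x)
    \<le> (\<Sum>i\<in>UNIV. nm (\<lambda>x. pd \<eta> i x * pd (wt i) l x + pd (pd \<eta> i) l x * wt i x))"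
    by (intro nrm2_sum sqint_add bd1 bd2 pp p\<eta> B)
   also have "\<dots> \<le> (\<Sum>i\<in>(UNIV::'d set). B * nT + B * nT)"
   proof (rule sum_mono)
    fix i
    have "nm (\<lambda>x. pd \<eta> i x * pd (wt i) l x + pd (pd \<eta> i) l x * wt i x)
     \<le> nm (\<lambda>x. pd \<eta> i x * pd (wt i) l x) + nm (\<lambda>x. pd (pd \<eta> i) l x * wt i x)"
     by (intro nrm2_triangle bd1 bd2 pp p\<eta> B)
    also have "\<dots> \<le> B * nT + B * nT" by (intro add_mono bd1 bd2 pp p\<eta> B)
    finally show "nm (\<lambda>x. pd \<eta> i x * pd (wt i) l x + pd (pd \<eta> i) l x * wt i x) \<le> B * nT + B * nT" .
   qed
   also have "nm (\<lambda>x. m * pd b l x) \<le> \<bar>m\<bar> * H1sum b"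
    unfolding nrm2_scale by (intro mult_left_mono nrm2_pd_le_H1sum) simp
   finally show ?thesis by (simp add: d_def)
  qed
  have HE: "H1sum E \<le> c1 * nT + c2*\<bar>m\<bar>"
  proof -
   have "(\<Sum>l\<in>UNIV. nm (pd E l)) \<le> d*(d*(2 * B * nT) + \<bar>m\<bar> * H1sum b)"
    using sum_bounded_above[of UNIV "\<lambda>l. nm (pd E l)" "d*(2 * B * nT) + \<bar>m\<bar> * H1sum b"] npE
    by (simp add: d_def)
   hence "H1sum E \<le> (d*(B * nT) + \<bar>m\<bar> * H1sum b) + d*(d*(2 * B * nT) + \<bar>m\<bar> * H1sum b)"
    using nE by (simp add: H1sum_def[of E])
   also have "\<dots> = c1 * nT + c2*\<bar>m\<bar>" by (simp add: c1_def c2_def algebra_simps)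
   finally show ?thesis .
  qed
  define w where "w i x = \<eta> x * wt i x - v i x" for i x
  have tfw: "tf icube (w i)" for i unfolding w_def[abs_def] by (rule tf_diff[OF tfcw v(1)])
  have pdw: "pd (w i) j x = \<eta> x * pd (wt i) j x + pd \<eta> j x * wt i x - pd (v i) j x" for i j x
   unfolding w_def[abs_def] using pd_diff[OF tf_Cinf[OF tfcw] tf_Cinf[OF v(1)]] pdcw by simp
  \<comment> \<open>Subtracting v leaves the divergence \<eta> T - m b, so the error consists of the
    approximation error and the mean defect.\<close>
  have "(\<Sum>i\<in>UNIV. pd (w i) i x) - r x = (\<eta> x * T x - r x) - m * b x" for x
  proof -
   have "(\<Sum>i\<in>UNIV. pd (w i) i x) = (\<eta> x * T x + (\<Sum>i\<in>UNIV. pd \<eta> i x * wt i x)) - E x"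
    unfolding v(2) divcw[symmetric] pdw pdcw by (simp add: sum_subtractf)
   thus ?thesis by (simp add: E_def)
  qed
  hence "nm (\<lambda>x. (\<Sum>i\<in>UNIV. pd (w i) i x) - r x)
    \<le> nm (\<lambda>x. \<eta> x * T x - r x) + nm (\<lambda>x. m * b x)"
   by (simp only: nrm2_triangle_diff[OF sz sqint_scale[OF sb]])
  also have "nm (\<lambda>x. m * b x) \<le> V * e * H1sum b"
   unfolding nrm2_scale using m V0 e by (intro mult_mono nrm2_le_H1sum) auto
  also have "nm (\<lambda>x. \<eta> x * T x - r x) + V * e * H1sum b \<le> C * e"
  proof -
   have "0 \<le> (2 * B + K * c1 + K*(c2 * V)) * e" using B(1) K c0 V0 e by simp
   thus ?thesis using nz by (simp add: C_def algebra_simps)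
  qed
  finally have goal1: "nm (\<lambda>x. (\<Sum>i\<in>UNIV. pd (w i) i x) - r x) \<le> C * e" by simp
  have goal2: "nm (pd (w i) j) \<le> C*(nm r + e)" for i j
  proof -
   have "nm (pd (w i) j) \<le> nm (\<lambda>x. \<eta> x * pd (wt i) j x + pd \<eta> j x * wt i x) + nm (pd (v i) j)"
    unfolding pdw
    by (intro nrm2_triangle_diff sqint_add bd1 bd2 \<eta> p\<eta> B tf_sqint[OF tf_pd[OF v(1) closed_icube] compact_icube])
   also have "nm (\<lambda>x. \<eta> x * pd (wt i) j x + pd \<eta> j x * wt i x)
    \<le> nm (\<lambda>x. \<eta> x * pd (wt i) j x) + nm (\<lambda>x. pd \<eta> j x * wt i x)"
    by (intro nrm2_triangle bd1 bd2 \<eta> p\<eta> B)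
   also have "nm (\<lambda>x. \<eta> x * pd (wt i) j x) \<le> B * nT" by (intro bd2 \<eta> B)
   also have "nm (\<lambda>x. pd \<eta> j x * wt i x) \<le> B * nT" by (intro bd1 p\<eta> B)
   also have "nm (pd (v i) j) \<le> K*(c1 * nT + c2*(V * e))"
   proof -
    have "H1sum E \<le> c1 * nT + c2*(V * e)" using HE mult_left_mono[OF m c0(2)] by linarith
    thus ?thesis using v(3)[of i j] mult_left_mono[OF _ K] order_trans by blast
   qed
   finally have "nm (pd (w i) j) \<le> (2 * B + K * c1) * nT + K*(c2 * V) * e"
    by (simp add: algebra_simps)
   also have "\<dots> \<le> (2 * B + K * c1)*(nm r + e) + K*(c2 * V)*(nm r + e)"
    using nT B(1) K c0 V0 by (intro add_mono mult_left_mono) auto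
   also have "\<dots> \<le> C*(nm r + e)"
   proof -
    have "0 \<le> (1 + V * H1sum b)*(nm r + e)" using V0 e by simp
    thus ?thesis by (simp add: C_def distrib_right)
   qed
   finally show ?thesis .
  qed
  show "\<exists>w. (\<forall>i. tf icube (w i)) \<and> nm (\<lambda>x. (\<Sum>i\<in>UNIV. pd (w i) i x) - r x) \<le> C * e \<and>
    (\<forall>i j. nm (pd (w i) j) \<le> C*(nm r + e))"
   using tfw goal1 goal2 by blast
 qed
qed

subsection \<open>The local estimate on cubes\<close>

text \<open>Fields are families of scalar components, to which the results on \<open>tf\<close>
  apply directly; \<open>test_field\<close> turns them into vector fields later.\<close>

definition vtf :: "(real^'d) set => ('d => real^'d => real) => bool" where
 "vtf K w \<longleftrightarrow> (\<forall>i. tf K (w i))"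

definition divf :: "('d => real^'d => real) => real^'d => real" where
 "divf w x = (\<Sum>i\<in>UNIV. pd (w i) i x)"

definition gnorm :: "('d => real^'d => real) => real" where
 "gnorm w = sqrt (\<Sum>i\<in>UNIV. \<Sum>j\<in>UNIV. (nm (pd (w i) j))^2)"

definition avg :: "(real^'d) set => (real^'d => real) => real" where
 "avg S p = (LBINT x. indicator S x * p x)/measure lborel S"

definition osc :: "(real^'d) set => (real^'d => real) => real" where
 "osc S p = nm (\<lambda>x. indicator S x*(p x - avg S p))"

lemma vtfD: "vtf K w ==> tf K (w i)" by (simp add: vtf_def)

lemma gnorm_nonneg [simp]: "0 \<le> gnorm w" by (simp add: gnorm_def sum_nonneg)

lemma gnorm_square: "(gnorm w)^2 = (\<Sum>i\<in>UNIV. \<Sum>j\<in>UNIV. (nm (pd (w i) j))^2)"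
 by (simp add: gnorm_def sum_nonneg)

lemma nrm2_pd_le_gnorm: "nm (pd (w i) j) \<le> gnorm w"
proof (rule power2_le_imp_le)
 have "(nm (pd (w i) j))^2 \<le> (\<Sum>j\<in>UNIV. (nm (pd (w i) j))^2)"
  by (rule member_le_sum) auto
 also have "\<dots> \<le> (gnorm w)^2"
  unfolding gnorm_square by (rule member_le_sum[of i UNIV "\<lambda>i. \<Sum>j\<in>UNIV. (nm (pd (w i) j))^2"]) (auto intro: sum_nonneg)
 finally show "(nm (pd (w i) j))^2 \<le> (gnorm w)^2" .
qed simp

lemma gnorm_le:
 fixes w :: "'d::finite => real^'d => real"
 assumes "\<And>i j. nm (pd (w i) j) \<le> B"
 shows "gnorm w \<le> real CARD('d) * B"
proof -
 have B: "0 \<le> B" by (rule order_trans[OF nrm2_nonneg assms[of undefined undefined]])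
 have "(gnorm w)^2 \<le> (\<Sum>i\<in>(UNIV::'d set). \<Sum>j\<in>(UNIV::'d set). B^2)"
  unfolding gnorm_square by (intro sum_mono power_mono assms nrm2_nonneg)
 also have "\<dots> = (real CARD('d) * B)^2" by (simp add: power2_eq_square)
 finally show ?thesis by (rule power2_le_imp_le) (simp add: B)
qed

lemma gnorm_scale:
 assumes "\<And>i. Cinf (w i)"
 shows "gnorm (\<lambda>i x. c * w i x) = \<bar>c\<bar> * gnorm w"
proof -
 have "nm (pd (\<lambda>x. c * w i x) j) = \<bar>c\<bar> * nm (pd (w i) j)" for i j
  by (simp add: pd_scale[OF assms] nrm2_scale)
 thus ?thesis
  by (simp add: gnorm_def power_mult_distrib sum_distrib_left[symmetric] real_sqrt_mult)
qed

lemma divf_scale: "(\<And>i. Cinf (w i)) ==> divf (\<lambda>i x. c * w i x) x = c * divf w x"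
 by (simp add: divf_def pd_scale sum_distrib_left)

lemma divf_sqint: "vtf K w ==> compact K ==> sqb (divf w)"
 unfolding divf_def[abs_def]
 by (intro sqint_sum tf_sqint[of K] tf_pd vtfD compact_imp_closed)

lemma avg_zero_integral:
 assumes S: "S \<in> sets lborel" "emeasure lborel S < \<infinity>" and p: "sqb p"
 shows "(LBINT x. indicator S x*(p x - avg S p)) = 0"
  "sqb (\<lambda>x. indicator S x*(p x - avg S p))"
  "(LBINT x. p x*(indicator S x*(p x - avg S p))) = (osc S p)^2"
proof -
 have i1: "integrable lborel (indicator S :: real^'a => real)"
  using S by (intro integrable_real_indicator) auto
 have s1: "sqb (indicator S :: real^'a => real)"
 proof -
  have "(\<lambda>x. (indicator S x :: real)^2) = indicator S" by (auto simp: fun_eq_iff split: split_indicator)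
  thus ?thesis using i1 S by (simp add: sqint_def)
 qed
 have ip: "integrable lborel (\<lambda>x. indicator S x * p x)" by (rule sqint_mult_integrable[OF s1 p])
 have "(LBINT x. indicator S x*(p x - avg S p)) = (LBINT x. indicator S x * p x) - avg S p * measure lborel S"
  using i1 ip S by (simp add: right_diff_distrib mult.commute[of _ "avg S p"])
 also have "\<dots> = 0"
 \<comment> \<open>For a null set the quotient in \<open>avg\<close> is a division by zero, but then
   the integral over S vanishes as well.\<close>
 proof (cases "measure lborel S = 0")
  case True
  hence "emeasure lborel S = 0" using S by (simp add: measure_eq_0_null_sets emeasure_eq_ennreal_measure)
  hence "S \<in> null_sets lborel" using S by (simp add: null_sets_def)
  hence "AE x in lborel. indicator S x * p x = 0"
   by (rule AE_I'[where N = S]) (auto split: split_indicator)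
  hence "(LBINT x. indicator S x * p x) = 0" by (rule integral_eq_zero_AE)
  with True show ?thesis by simp
 qed (simp add: avg_def)
 finally show *: "(LBINT x. indicator S x*(p x - avg S p)) = 0" .
 show sq: "sqb (\<lambda>x. indicator S x*(p x - avg S p))"
  using sqint_diff[OF sqint_indicator[OF p, of S] sqint_scale[OF s1, of "avg S p"]] S
  by (simp add: right_diff_distrib mult.commute[of _ "avg S p"])
 have i2: "integrable lborel (\<lambda>x. p x*(indicator S x*(p x - avg S p)))" by (rule sqint_mult_integrable[OF p sq])
 have i3: "integrable lborel (\<lambda>x. indicator S x*(p x - avg S p))"
  using sqint_mult_integrable[OF s1 sq] by (rule Bochner_Integration.integrable_cong[THEN iffD1, rotated 2]) (auto split: split_indicator)
 have "(osc S p)^2 = (LBINT x. p x*(indicator S x*(p x - avg S p)) - avg S p*(indicator S x*(p x - avg S p)))"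
  unfolding osc_def nrm2_square
  by (intro int_cong) (auto simp: power2_eq_square algebra_simps split: split_indicator)
 also have "\<dots> = (LBINT x. p x*(indicator S x*(p x - avg S p)))"
  using i2 i3 * by simp
 finally show "(LBINT x. p x*(indicator S x*(p x - avg S p))) = (osc S p)^2" ..
qed

text \<open>An approximate solution for p minus its average pairs with p to almost the squared
  oscillation, and a scalar factor makes this exact. Exact pairings are what allows the fields of
  many cubes to be added.\<close>

lemma unit_cube_test_field:
 obtains C where "C \<ge> 0"
  "\<And>p :: real^'d => real. sqb p ==>
   \<exists>w. vtf icube w \<and> (LBINT x. p x * divf w x) = (osc mid_cube p)^2 \<and> gnorm w \<le> C * osc mid_cube p"
proof -
 obtain C where C: "C \<ge> 0" and sol:
  "\<And>(r :: real^'d => real) e. sqb r ==> \<forall>x. x \<notin> mid_cube \<longrightarrow> r x = 0 ==>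
   (LBINT x. r x) = 0 ==> e > 0 ==>
   \<exists>w. (\<forall>i. tf icube (w i)) \<and> nm (\<lambda>x. (\<Sum>i\<in>UNIV. pd (w i) i x) - r x) \<le> C * e \<and>
    (\<forall>i j. nm (pd (w i) j) \<le> C*(nm r + e))"
  by (rule div_solve_local, rule that)
 define C' where "C' = 2*(real CARD('d)*(C*2))"
 show ?thesis
 proof (rule that[of C'])
  show "C' \<ge> 0" using C by (simp add: C'_def)
  fix p :: "real^'d => real" assume p: "sqb p"
  define A where "A = osc mid_cube p"
  define r where "r x = indicator mid_cube x*(p x - avg mid_cube p)" for x
  have mid: "mid_cube \<in> sets (lborel :: (real^'d) measure)" "emeasure lborel (mid_cube :: (real^'d) set) < \<infinity>"
   unfolding mid_cube_cbox by (simp, rule emeasure_bounded_finite[OF bounded_cbox])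
  note r = avg_zero_integral[OF mid p, folded r_def A_def]
  have Ar: "A = nm r" by (simp add: A_def osc_def r_def[abs_def])
  have A0: "A \<ge> 0" by (simp add: Ar)
  show "\<exists>w. vtf icube w \<and> (LBINT x. p x * divf w x) = (osc mid_cube p)^2 \<and> gnorm w \<le> C' * osc mid_cube p"
   unfolding A_def[symmetric]
  proof (cases "A = 0")
   case True
   have "gnorm (\<lambda>(i::'d) x. 0) = 0" by (simp add: gnorm_def)
   thus "\<exists>w. vtf icube w \<and> (LBINT x. p x * divf w x) = A^2 \<and> gnorm w \<le> C' * A"
    using True by (intro exI[of _ "\<lambda>i x. 0"]) (simp add: vtf_def divf_def)
  next
   case False
   with A0 have Apos: "A > 0" by simp
   define P where "P = C * nm p + 1"
   have P: "P > 0" using C by (simp add: P_def add_nonneg_pos)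
   \<comment> \<open>The bound e \<le> A keeps the gradient of order A. The other bound makes the
     pairing differ from A^2 by at most A^2/2, so the correcting factor is at most 2. The accuracy
     depends on p, the resulting constant does not.\<close>
   define e where "e = min A (A^2/(2 * P))"
   have e: "e > 0" using Apos P by (simp add: e_def)
   have r0: "\<forall>x. x \<notin> mid_cube \<longrightarrow> r x = 0" by (simp add: r_def)
   obtain w where w0: "(\<forall>i. tf icube (w i)) \<and> nm (\<lambda>x. (\<Sum>i\<in>UNIV. pd (w i) i x) - r x) \<le> C * e \<and>
    (\<forall>i j. nm (pd (w i) j) \<le> C*(nm r + e))"
    using sol[OF r(2) r0 r(1) e] ..
   have w: "tf icube (w i)" and w1: "nm (\<lambda>x. divf w x - r x) \<le> C * e"
    and w2: "nm (pd (w i) j) \<le> C*(A + e)" for i j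
    using w0 unfolding Ar divf_def by simp_all
   have vw: "vtf icube w" using w by (simp add: vtf_def)
   have sw: "sqb (divf w)" by (rule divf_sqint[OF vw compact_icube])
   define t where "t = (LBINT x. p x * divf w x)"
   have sd: "sqb (\<lambda>x. divf w x - r x)" by (rule sqint_diff[OF sw r(2)])
   have "t - A^2 = (LBINT x. p x*(divf w x - r x))"
    using sqint_mult_integrable[OF p sw] sqint_mult_integrable[OF p r(2)] r(3)
    by (simp add: t_def right_diff_distrib)
   hence "\<bar>t - A^2\<bar> \<le> nm p*(C * e)"
    using L2_Cauchy_Schwarz[OF p sd] mult_left_mono[OF w1 nrm2_nonneg[of lborel p]] by linarith
   also have "\<dots> \<le> P * e" using e by (simp add: P_def algebra_simps)
   also have "\<dots> \<le> P*(A^2/(2 * P))" using P by (intro mult_left_mono) (auto simp: e_def)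
   also have "\<dots> = A^2/2" using P by simp
   finally have t: "t \<ge> A^2/2" by linarith
   moreover have "A^2 > 0" using Apos by simp
   ultimately have tpos: "t > 0" by linarith
   define c where "c = A^2/t"
   have c: "0 \<le> c" "c \<le> 2" using tpos t by (simp_all add: c_def field_simps)
   have gw: "gnorm w \<le> real CARD('d)*(C*(A + e))" by (rule gnorm_le[OF w2])
   also have "\<dots> \<le> real CARD('d)*(C*(2 * A))"
    using C by (intro mult_left_mono) (auto simp: e_def)
   finally have gw: "gnorm w \<le> real CARD('d)*(C*2) * A" by simp
   show "\<exists>w. vtf icube w \<and> (LBINT x. p x * divf w x) = A^2 \<and> gnorm w \<le> C' * A"
   proof (intro exI[of _ "\<lambda>i x. c * w i x"] conjI)
    show "vtf icube (\<lambda>i x. c * w i x)" using tf_scale[OF w] by (simp add: vtf_def)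
    have "(LBINT x. p x * divf (\<lambda>i x. c * w i x) x) = c * t"
     by (simp add: divf_scale[OF tf_Cinf[OF w]] t_def mult.left_commute[of _ c])
    thus "(LBINT x. p x * divf (\<lambda>i x. c * w i x) x) = A^2" using tpos by (simp add: c_def)
    have "gnorm (\<lambda>i x. c * w i x) \<le> 2*(real CARD('d)*(C*2) * A)"
     unfolding gnorm_scale[OF tf_Cinf[OF w]] using c gw by (intro mult_mono) auto
    thus "gnorm (\<lambda>i x. c * w i x) \<le> C' * A" by (simp add: C'_def)
   qed
  qed
 qed
qed

section \<open>Rescaling to cubes of any size\<close>

lemma lborel_integral_scale:
 fixes f :: "'a::euclidean_space => real"
 assumes s: "s > 0" and f: "f \<in> borel_measurable borel"
 shows "(LBINT x. f x) = s^DIM('a)*(LBINT x. f (a + s*\<^sub>R x))"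
  and "integrable lborel (\<lambda>x. f (a + s*\<^sub>R x)) \<longleftrightarrow> integrable lborel f"
proof -
 let ?D = "density (distr lborel borel (\<lambda>x::'a. a + s*\<^sub>R x)) (\<lambda>_. ennreal (\<bar>s\<bar>^DIM('a)))"
 have L: "lborel = ?D" using lborel_affine[of s a] s by simp
 have f': "f \<in> borel_measurable (distr lborel borel (\<lambda>x::'a. a + s*\<^sub>R x))" using f by simp
 have "(LBINT x. f x) = (LINT x|?D. f x)" using L by simp
 also have "\<dots> = (LINT x|distr lborel borel (\<lambda>x::'a. a + s*\<^sub>R x). \<bar>s\<bar>^DIM('a)*\<^sub>R f x)"
  using f' s by (intro integral_density) auto
 also have "\<dots> = (LBINT x. \<bar>s\<bar>^DIM('a)*\<^sub>R f (a + s*\<^sub>R x))"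
  using f by (intro integral_distr) auto
 finally show "(LBINT x. f x) = s^DIM('a)*(LBINT x. f (a + s*\<^sub>R x))"
  using s by simp
 have "integrable lborel f \<longleftrightarrow> integrable ?D f" using L by simp
 also have "\<dots> \<longleftrightarrow> integrable (distr lborel borel (\<lambda>x::'a. a + s*\<^sub>R x)) (\<lambda>x. \<bar>s\<bar>^DIM('a)*\<^sub>R f x)"
  using f' s by (intro integrable_density) auto
 also have "\<dots> \<longleftrightarrow> integrable lborel (\<lambda>x. \<bar>s\<bar>^DIM('a)*\<^sub>R f (a + s*\<^sub>R x))"
  using f by (subst integrable_distr_eq) auto
 also have "\<dots> \<longleftrightarrow> integrable lborel (\<lambda>x. f (a + s*\<^sub>R x))"
  using s by simp
 finally show "integrable lborel (\<lambda>x. f (a + s*\<^sub>R x)) \<longleftrightarrow> integrable lborel f" ..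
qed

lemma nrm2_lborel_scale:
 fixes f :: "'a::euclidean_space => real"
 assumes s: "s > 0" and f: "f \<in> borel_measurable borel"
 shows "(nm f)^2 = s^DIM('a)*(nm (\<lambda>x. f (a + s*\<^sub>R x)))^2"
 unfolding nrm2_square using f by (intro lborel_integral_scale[OF s]) simp

lemma Cinf_compose_scale:
 fixes f :: "'a::euclidean_space => real"
 assumes "Cinf f" shows "Cinf (\<lambda>x. f (b + c*\<^sub>R x))"
proof -
 have "C_k k f ==> C_k k (\<lambda>x. f (b + c*\<^sub>R x))" for k
 proof (induction k arbitrary: f)
  case 0
  thus ?case by (auto intro!: continuous_on_compose2[of UNIV f] continuous_intros)
 next
  case (Suc k)
  have lin: "linear (frechet_derivative f (at x))" for x
   using C_k_SucD(1)[OF Suc.prems] has_derivative_linear by blast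
  show ?case
  proof (rule C_k_SucI[where D = "\<lambda>x v. c * frechet_derivative f (at (b + c*\<^sub>R x)) v"])
   show "((\<lambda>x. f (b + c*\<^sub>R x)) has_derivative (\<lambda>v. c * frechet_derivative f (at (b + c*\<^sub>R x)) v)) (at x)" for x
   proof -
    have "((\<lambda>x. f (b + c*\<^sub>R x)) has_derivative (\<lambda>v. frechet_derivative f (at (b + c*\<^sub>R x)) (c*\<^sub>R v))) (at x)"
     by (rule has_derivative_compose[OF _ C_k_SucD(1)[OF Suc.prems]]) (auto intro!: derivative_eq_intros)
    thus ?thesis by (simp add: linear_scale[OF lin])
   qed
   show "C_k k (\<lambda>x. c * frechet_derivative f (at (b + c*\<^sub>R x)) v)" if "v \<in> Basis" for v
    by (intro C_k_mult C_k_const Suc.IH C_k_SucD(2)[OF Suc.prems that])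
  qed
 qed
 with assms show ?thesis by (simp add: Cinf_def)
qed

lemma pd_compose_scale:
 fixes f :: "real^'d => real"
 assumes "Cinf f" shows "pd (\<lambda>x. f (b + c*\<^sub>R x)) j x = c * pd f j (b + c*\<^sub>R x)"
proof -
 have lin: "linear (frechet_derivative f (at x))" for x
  using Cinf_has_derivative[OF assms] has_derivative_linear by blast
 have "((\<lambda>x. f (b + c*\<^sub>R x)) has_derivative (\<lambda>v. frechet_derivative f (at (b + c*\<^sub>R x)) (c*\<^sub>R v))) (at x)"
  by (rule has_derivative_compose[OF _ Cinf_has_derivative[OF assms]]) (auto intro!: derivative_eq_intros)
 from pd_eqI[OF this, of j] show ?thesis by (simp add: linear_scale[OF lin])
qed

definition qcube :: "real^'d => real => (real^'d) set" where
 "qcube c l = {x. \<forall>i. c$i \<le> x$i \<and> x$i \<le> c$i + l}"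

text \<open>Concentric with \<open>qcube c l\<close> and twice as large, which is the room taken by
  the cutoff.\<close>

definition dcube :: "real^'d => real => (real^'d) set" where
 "dcube c l = {x. \<forall>i. c$i - l/2 \<le> x$i \<and> x$i \<le> c$i + 3 * l/2}"

lemma qcube_cbox: "qcube c l = cbox c (\<chi> i. c$i + l)"
 and dcube_cbox: "dcube c l = cbox (\<chi> i. c$i - l/2) (\<chi> i. c$i + 3 * l/2)"
 by (auto simp: qcube_def dcube_def mem_box_cart)

lemma compact_dcube: "compact (dcube c l)" and closed_dcube: "closed (dcube c l)"
 by (auto simp: dcube_cbox)

lemma sets_qcube: "qcube c l \<in> sets borel" and emeasure_qcube_finite: "emeasure lborel (qcube c l) < \<infinity>"
 unfolding qcube_cbox by (simp, rule emeasure_bounded_finite[OF bounded_cbox])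

text \<open>The similarity y -> a + s y takes \<open>mid_cube\<close> to \<open>qcube c l\<close>
  and \<open>icube\<close> to \<open>dcube c l\<close>.\<close>

context
 fixes c :: "real^'d" and l s :: real and a :: "real^'d"
 assumes l: "l > 0"
 defines "s \<equiv> 3 * l/pi" and "a \<equiv> c - (\<chi> i. l)"
begin

lemma scale_pos: "s > 0" using l by (simp add: s_def)

lemma scale_nth: "(a + s*\<^sub>R y)$i = c$i - l + 3 * l/pi * y$i"
 by (simp add: a_def s_def)

lemma scale_qcube: "a + s*\<^sub>R y \<in> qcube c l \<longleftrightarrow> y \<in> mid_cube"
proof -
 have "(c$i \<le> (a + s*\<^sub>R y)$i \<and> (a + s*\<^sub>R y)$i \<le> c$i + l) \<longleftrightarrow> (pi/3 \<le> y$i \<and> y$i \<le> 2 * pi/3)" for i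
  unfolding scale_nth using l by (simp add: field_simps)
 thus ?thesis by (simp add: qcube_def mid_cube_def)
qed

lemma scale_dcube: "a + s*\<^sub>R y \<in> dcube c l \<longleftrightarrow> y \<in> icube"
proof -
 have "(c$i - l/2 \<le> (a + s*\<^sub>R y)$i \<and> (a + s*\<^sub>R y)$i \<le> c$i + 3 * l/2) \<longleftrightarrow> (pi/6 \<le> y$i \<and> y$i \<le> 5 * pi/6)" for i
  unfolding scale_nth using l by (simp add: field_simps)
 thus ?thesis by (simp add: dcube_def icube_def)
qed

lemma scale_inverse: "a + s*\<^sub>R (- (1/s)*\<^sub>R a + (1/s)*\<^sub>R x) = x"
 using scale_pos by (simp add: scaleR_diff_right)

lemma tf_unscale:
 assumes "tf icube f"
 shows "tf (dcube c l) (\<lambda>x. f (- (1/s)*\<^sub>R a + (1/s)*\<^sub>R x))"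
 unfolding tf_def
proof (intro conjI allI impI Cinf_compose_scale tf_Cinf[OF assms])
 fix x assume "x \<notin> dcube c l"
 hence "- (1/s)*\<^sub>R a + (1/s)*\<^sub>R x \<notin> icube"
  using scale_dcube[of "- (1/s)*\<^sub>R a + (1/s)*\<^sub>R x"] unfolding scale_inverse by simp
 thus "f (- (1/s)*\<^sub>R a + (1/s)*\<^sub>R x) = 0" by (rule tf_eq_0[OF assms])
qed

lemma unscale_scale: "- (1/s)*\<^sub>R a + (1/s)*\<^sub>R (a + s*\<^sub>R y) = y"
 using scale_pos by (simp add: scaleR_add_right)

lemma sqint_compose_scale:
 assumes "sqb p" shows "sqb (\<lambda>y. p (a + s*\<^sub>R y))"
proof -
 have [measurable]: "p \<in> borel_measurable borel" using assms by (auto simp: sqint_def)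
 have "integrable lborel (\<lambda>x. (p x)^2)" using assms by (simp add: sqint_def)
 hence "integrable lborel (\<lambda>y. (p (a + s*\<^sub>R y))^2)"
  using lborel_integral_scale(2)[OF scale_pos, of "\<lambda>x. (p x)^2" a] by simp
 thus ?thesis by (simp add: sqint_def)
qed

lemma avg_scale:
 assumes p: "sqb p"
 shows "avg (qcube c l) p = avg mid_cube (\<lambda>y. p (a + s*\<^sub>R y))"
proof -
 let ?n = "s^DIM(real^'d)"
 have [measurable]: "p \<in> borel_measurable borel" using p by (auto simp: sqint_def)
 have [measurable]: "qcube c l \<in> sets borel" by (rule sets_qcube)
 have ind: "indicator (qcube c l) (a + s*\<^sub>R y) = (indicator mid_cube y :: real)" for y
  using scale_qcube[of y] by (simp split: split_indicator)
 have "(LBINT x. indicator (qcube c l) x * p x) = ?n*(LBINT y. indicator mid_cube y * p (a + s*\<^sub>R y))"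
  using lborel_integral_scale(1)[OF scale_pos, of "\<lambda>x. indicator (qcube c l) x * p x" a] by (simp add: ind)
 moreover have "measure lborel (qcube c l) = ?n * measure lborel (mid_cube :: (real^'d) set)"
  using lborel_integral_scale(1)[OF scale_pos, of "indicator (qcube c l)" a]
  by (simp add: ind)
 ultimately show ?thesis using scale_pos by (simp add: avg_def)
qed

lemma osc_scale:
 assumes p: "sqb p"
 shows "(osc (qcube c l) p)^2 = s^DIM(real^'d)*(osc mid_cube (\<lambda>y. p (a + s*\<^sub>R y)))^2"
proof -
 have [measurable]: "p \<in> borel_measurable borel" using p by (auto simp: sqint_def)
 have [measurable]: "qcube c l \<in> sets borel" by (rule sets_qcube)
 have ind: "indicator (qcube c l) (a + s*\<^sub>R y) = (indicator mid_cube y :: real)" for y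
  using scale_qcube[of y] by (simp split: split_indicator)
 show ?thesis
  unfolding osc_def avg_scale[OF p] by (subst nrm2_lborel_scale[OF scale_pos, of _ a]) (simp_all add: ind)
qed

end

lemma cube_test_field:
 obtains C where "C \<ge> 0"
  "\<And>(p :: real^'d => real) c l. sqb p ==> l > 0 ==>
   \<exists>w. vtf (dcube c l) w \<and> (LBINT x. p x * divf w x) = (osc (qcube c l) p)^2 \<and> gnorm w \<le> C * osc (qcube c l) p"
proof -
 obtain C where C: "C \<ge> 0" and unit: "\<And>p :: real^'d => real. sqb p ==>
   \<exists>w. vtf icube w \<and> (LBINT x. p x * divf w x) = (osc mid_cube p)^2 \<and> gnorm w \<le> C * osc mid_cube p"
  by (rule unit_cube_test_field, rule that)
 show ?thesis
 proof (rule that[OF C])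
  fix p :: "real^'d => real" and c :: "real^'d" and l assume p: "sqb p" and l: "l > (0::real)"
  define s where "s = 3 * l/pi"
  define a where "a = c - (\<chi> i. l)"
  note sc = scale_pos[OF l, folded s_def] scale_inverse[OF l, of c, folded s_def a_def]
   tf_unscale[OF l, of _ c, folded s_def a_def] unscale_scale[OF l, of c, folded s_def a_def]
   sqint_compose_scale[OF l, of p c, folded s_def a_def] osc_scale[OF l p, of c, folded s_def a_def]
  obtain w' where w'0: "vtf icube w' \<and>
   (LBINT y. p (a + s*\<^sub>R y) * divf w' y) = (osc mid_cube (\<lambda>y. p (a + s*\<^sub>R y)))^2 \<and>
   gnorm w' \<le> C * osc mid_cube (\<lambda>y. p (a + s*\<^sub>R y))"
   using unit[OF sc(5)[OF p]] ..
  note w' = conjunct1[OF w'0] conjunct1[OF conjunct2[OF w'0]] conjunct2[OF conjunct2[OF w'0]]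
  have s: "s > 0" by (rule sc(1))
  \<comment> \<open>The factor s offsets the chain rule, so gradients agree at corresponding points.
    Pairings, squared norms and squared oscillations then all acquire the factor s^d, and C is the
    same for every cube.\<close>
  define w where "w i x = s * w' i (- (1/s)*\<^sub>R a + (1/s)*\<^sub>R x)" for i x
  have Cw': "Cinf (w' i)" for i by (rule tf_Cinf[OF vtfD[OF w'(1)]])
  have tw: "tf (dcube c l) (w i)" for i
   unfolding w_def[abs_def] by (intro tf_scale sc(3) vtfD[OF w'(1)])
  have pdw: "pd (w i) j x = pd (w' i) j (- (1/s)*\<^sub>R a + (1/s)*\<^sub>R x)" for i j x
   unfolding w_def[abs_def] pd_scale[OF Cinf_compose_scale[OF Cw']] pd_compose_scale[OF Cw'] using s by simp
  have pdw': "pd (w i) j (a + s*\<^sub>R y) = pd (w' i) j y" for i j y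
   unfolding pdw sc(4) ..
  have vw: "vtf (dcube c l) w" using tw by (simp add: vtf_def)
  have bw: "pd (w i) j \<in> borel_measurable borel" for i j
   by (rule tf_borel[OF tf_pd[OF tw closed_dcube]])
  have [measurable]: "divf w \<in> borel_measurable borel" "p \<in> borel_measurable borel"
   using divf_sqint[OF vw compact_dcube] p by (auto simp: sqint_def)
  let ?n = "s^DIM(real^'d)"
  have n: "?n > 0" using s by simp
  have "(LBINT x. p x * divf w x) = ?n*(LBINT y. p (a + s*\<^sub>R y) * divf w' y)"
  proof -
   have m: "(\<lambda>x. p x * divf w x) \<in> borel_measurable borel" by measurable
   have "divf w (a + s*\<^sub>R y) = divf w' y" for y by (simp add: divf_def pdw')
   thus ?thesis using lborel_integral_scale(1)[OF s m, of a] by simp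
  qed
  hence 1: "(LBINT x. p x * divf w x) = (osc (qcube c l) p)^2"
   unfolding w'(2) sc(6) .
  have "(nm (pd (w i) j))^2 = ?n*(nm (pd (w' i) j))^2" for i j
   using nrm2_lborel_scale[OF s bw, of i j a] by (simp add: pdw')
  hence "(gnorm w)^2 = ?n*(gnorm w')^2"
   by (simp add: gnorm_square sum_distrib_left)
  also have "\<dots> \<le> ?n*(C * osc mid_cube (\<lambda>y. p (a + s*\<^sub>R y)))^2"
   using n w'(3) by (intro mult_left_mono power_mono) auto
  also have "\<dots> = (C * osc (qcube c l) p)^2"
   by (simp add: power_mult_distrib sc(6))
  finally have "gnorm w \<le> C * osc (qcube c l) p"
   by (rule power2_le_imp_le) (use C in \<open>simp add: osc_def\<close>)
  with vw 1 show "\<exists>w. vtf (dcube c l) w \<and> (LBINT x. p x * divf w x) = (osc (qcube c l) p)^2 \<and>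
    gnorm w \<le> C * osc (qcube c l) p" by (intro exI[of _ w] conjI)
 qed
qed

text \<open>A cosine approximation times the cutoff, transported by the similarity; it feeds the
  fundamental lemma of the calculus of variations.\<close>

lemma cube_test_function_dense:
 fixes r :: "real^'d => real"
 assumes r: "sqb r" and r0: "\<And>x. x \<notin> qcube c l ==> r x = 0" and l: "l > 0" and e: "e > 0"
 obtains \<phi> where "tf (dcube c l) \<phi>" "nm (\<lambda>x. \<phi> x - r x) \<le> e"
proof -
 define s where "s = 3 * l/pi"
 define a where "a = c - (\<chi> i. l)"
 note sc = scale_pos[OF l, folded s_def] scale_inverse[OF l, of c, folded s_def a_def]
  tf_unscale[OF l, of _ c, folded s_def a_def] unscale_scale[OF l, of c, folded s_def a_def]
  sqint_compose_scale[OF l, of r c, folded s_def a_def] scale_qcube[OF l, of c, folded s_def a_def]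
 have s: "s > 0" by (rule sc(1))
 define r' where "r' y = r (a + s*\<^sub>R y)" for y
 have sr': "sqb r'" unfolding r'_def[abs_def] by (rule sc(5)[OF r])
 have r'0: "r' y = 0" if "y \<notin> mid_cube" for y
  unfolding r'_def by (rule r0) (use that sc(6) in simp)
 let ?n = "sqrt (s^DIM(real^'d))"
 have n: "?n > 0" using s by simp
 obtain T where T: "T \<in> cos_poly" "nm (onQ (\<lambda>x. r' x - T x)) < e/?n"
  using cos_poly_dense[OF sr', of "e/?n"] e n by auto
 have CT: "Cinf T" by (rule cos_poly_Cinf[OF T(1)])
 obtain \<eta> :: "real^'d => real" where \<eta>: "tf icube \<eta>" "\<And>x. x \<in> mid_cube ==> \<eta> x = 1" "\<And>x. \<bar>\<eta> x\<bar> \<le> 1"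
  by (rule cutoff_exists, rule that)
 have z_eq: "\<eta> x * T x - r' x = \<eta> x*(T x - r' x)" for x
  using \<eta>(2)[of x] r'0[of x] by (cases "x \<in> mid_cube") (auto simp: algebra_simps)
 have sz: "sqb (onQ (\<lambda>x. T x - r' x))"
  using sqint_diff[OF onQ_sqint[OF Cinf_continuous[OF CT]] sqint_indicator[OF sr', of cubepi]]
  by (simp add: right_diff_distrib)
 have nz: "nm (\<lambda>x. \<eta> x * T x - r' x) \<le> e/?n"
  unfolding z_eq using cutoff_mult_bound(2)[OF \<eta>(1,3) sz] T(2) nrm2_uminus[of lborel "onQ (\<lambda>x. r' x - T x)"]
  by (simp add: algebra_simps)
 define \<phi> where "\<phi> x = \<eta> (- (1/s)*\<^sub>R a + (1/s)*\<^sub>R x) * T (- (1/s)*\<^sub>R a + (1/s)*\<^sub>R x)" for x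
 have t\<phi>: "tf (dcube c l) \<phi>"
  unfolding \<phi>_def[abs_def] using sc(3)[OF tf_mult2[OF \<eta>(1) CT]] .
 have \<phi>': "\<phi> (a + s*\<^sub>R y) = \<eta> y * T y" for y unfolding \<phi>_def sc(4) ..
 have [measurable]: "\<phi> \<in> borel_measurable borel" "r \<in> borel_measurable borel"
  using tf_borel[OF t\<phi>] r by (auto simp: sqint_def)
 have "(nm (\<lambda>x. \<phi> x - r x))^2 = s^DIM(real^'d)*(nm (\<lambda>y. \<eta> y * T y - r' y))^2"
  using nrm2_lborel_scale[OF s, of "\<lambda>x. \<phi> x - r x" a] by (simp add: \<phi>' r'_def)
 also have "\<dots> \<le> s^DIM(real^'d)*(e/?n)^2"
  using nz s by (intro mult_left_mono power_mono) auto
 also have "\<dots> = e^2" using s by (simp add: power_divide)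
 finally have "nm (\<lambda>x. \<phi> x - r x) \<le> e" by (rule power2_le_imp_le) (use e in simp)
 with t\<phi> show ?thesis by (rule that)
qed

subsection \<open>Negative norms and families of cubes\<close>

text \<open>\<open>bnd\<close> says that the gradient of \<open>p\<close> has norm at most \<open>M\<close> in the dual of \<open>H\<^sup>1\<^sub>0\<close>.\<close>

definition bnd :: "(real^'d) set => (real^'d => real) => real => bool" where
 "bnd Om p M \<longleftrightarrow> (\<forall>K w. compact K \<and> K \<subseteq> Om \<and> vtf K w \<longrightarrow> \<bar>LBINT x. p x * divf w x\<bar> \<le> M * gnorm w)"

lemma bndD: "bnd Om p M ==> compact K ==> K \<subseteq> Om ==> vtf K w ==> \<bar>LBINT x. p x * divf w x\<bar> \<le> M * gnorm w"
 unfolding bnd_def by blast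

text \<open>Cauchy-Schwarz over the indices that are active at a point, so that N enters in place of
  the size of F.\<close>

lemma overlap_square_sum:
 fixes f :: "'i => real"
 assumes "finite F" "\<And>i. i \<in> F ==> i \<notin> G ==> f i = 0" "G \<subseteq> F" "card G \<le> N"
 shows "(\<Sum>i\<in>F. f i)^2 \<le> real N*(\<Sum>i\<in>F. (f i)^2)"
proof -
 have "(\<Sum>i\<in>F. f i) = (\<Sum>i\<in>G. f i)"
  using assms by (intro sum.mono_neutral_right) auto
 hence "(\<Sum>i\<in>F. f i)^2 \<le> (\<Sum>i\<in>G. (f i)^2) * real (card G)"
  using sum_squared_le_sum_of_squares[of f G] by simp
 also have "\<dots> \<le> (\<Sum>i\<in>F. (f i)^2) * real N"
  using assms by (intro mult_mono sum_mono2) (auto intro: sum_nonneg)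
 finally show ?thesis by (simp add: mult.commute)
qed

text \<open>Let S be the sum of the squared oscillations. The sum of the test fields pairs with p to
  exactly S, and by bounded overlap its squared gradient norm is at most C^2 N S. Then S^2 \<le> M^2
  C^2 N S, and dividing by S gives a bound that does not see the number of cubes.\<close>

lemma family_osc_bound:
 obtains C where "C \<ge> 0"
  "\<And>(F :: 'i set) c l Om (p :: real^'d => real) M N. finite F ==> \<forall>f\<in>F. l f > 0 \<and> dcube (c f) (l f) \<subseteq> Om ==>
   \<forall>x. card {f \<in> F. x \<in> dcube (c f) (l f)} \<le> N ==> sqb p ==> bnd Om p M ==> 0 \<le> M ==>
   (\<Sum>f\<in>F. (osc (qcube (c f) (l f)) p)^2) \<le> C * real N * M^2"
proof -
 obtain C where C: "C \<ge> 0" and test: "\<And>(p :: real^'d => real) c l. sqb p ==> l > 0 ==>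
   \<exists>w. vtf (dcube c l) w \<and> (LBINT x. p x * divf w x) = (osc (qcube c l) p)^2 \<and> gnorm w \<le> C * osc (qcube c l) p"
  by (rule cube_test_field, rule that)
 show ?thesis
 proof (rule that[of "C^2"])
  fix F :: "'i set" and c :: "'i => real^'d" and l :: "'i => real" and Om and p :: "real^'d => real" and M N
  assume F: "finite F" "\<forall>f\<in>F. l f > 0 \<and> dcube (c f) (l f) \<subseteq> Om"
   "\<forall>x. card {f \<in> F. x \<in> dcube (c f) (l f)} \<le> N"
   and p: "sqb p" "bnd Om p M" and M: "0 \<le> M"
  let ?Q = "\<lambda>f. qcube (c f) (l f)" and ?D = "\<lambda>f. dcube (c f) (l f)"
  have "\<forall>f\<in>F. \<exists>w. vtf (?D f) w \<and> (LBINT x. p x * divf w x) = (osc (?Q f) p)^2 \<and> gnorm w \<le> C * osc (?Q f) p"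
   using test[OF p(1)] F(2) by simp
  then obtain w where w: "\<forall>f\<in>F. vtf (?D f) (w f) \<and> (LBINT x. p x * divf (w f) x) = (osc (?Q f) p)^2 \<and>
    gnorm (w f) \<le> C * osc (?Q f) p"
   by (rule bchoice[THEN exE])
  have tw: "tf (?D f) (w f i)" if "f \<in> F" for f i using w that by (simp add: vtf_def)
  define K where "K = (\<Union>f\<in>F. ?D f)"
  have K: "compact K" "K \<subseteq> Om" using F(1,2) by (auto simp: K_def intro!: compact_UN compact_dcube)
  define W where "W i x = (\<Sum>f\<in>F. w f i x)" for i x
  have CwF: "Cinf (w f i)" if "f \<in> F" for f i by (rule tf_Cinf[OF tw[OF that]])
  have vW: "vtf K W"
   unfolding vtf_def W_def[abs_def]
  proof (intro allI tf_sum)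
   show "tf K (w f i)" if "f \<in> F" for i f
    by (rule tf_mono[OF tw[OF that]]) (use that in \<open>auto simp: K_def\<close>)
  qed
  have pdW: "pd (W i) j x = (\<Sum>f\<in>F. pd (w f i) j x)" for i j x
   unfolding W_def[abs_def] by (rule pd_sum[OF CwF])
  have dW: "divf W x = (\<Sum>f\<in>F. divf (w f) x)" for x
   unfolding divf_def pdW by (rule sum.swap)
  define S where "S = (\<Sum>f\<in>F. (osc (?Q f) p)^2)"
  have S0: "S \<ge> 0" by (simp add: S_def sum_nonneg)
  have sdw: "sqb (divf (w f))" if "f \<in> F" for f
   using w that by (intro divf_sqint[OF _ compact_dcube]) auto
  have "(LBINT x. p x * divf W x) = (\<Sum>f\<in>F. (LBINT x. p x * divf (w f) x))"
   unfolding dW sum_distrib_left using sqint_mult_integrable[OF p(1) sdw]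
   by (intro int_sum) auto
  also have "\<dots> = S" unfolding S_def using w by (intro sum.cong) auto
  finally have SW: "S \<le> M * gnorm W"
   using bndD[OF p(2) K vW] by simp
  have sqw: "sqb (pd (w f i) j)" if "f \<in> F" for f i j
   by (rule tf_sqint[OF tf_pd[OF tw[OF that] closed_dcube] compact_dcube])
  have "(nm (pd (W i) j))^2 \<le> real N*(\<Sum>f\<in>F. (nm (pd (w f i) j))^2)" for i j
  proof -
   have sW: "sqb (pd (W i) j)" unfolding pdW by (intro sqint_sum sqw)
   have "(nm (pd (W i) j))^2 \<le> (LBINT x. real N*(\<Sum>f\<in>F. (pd (w f i) j x)^2))"
    unfolding nrm2_square
   proof (rule integral_mono[OF sqint_integrable_square[OF sW]])
    show "integrable lborel (\<lambda>x. real N*(\<Sum>f\<in>F. (pd (w f i) j x)^2))"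
     by (intro integrable_mult_right intble_sum sqint_integrable_square sqw)
    show "(pd (W i) j x)^2 \<le> real N*(\<Sum>f\<in>F. (pd (w f i) j x)^2)" for x
     unfolding pdW
    proof (rule overlap_square_sum[OF F(1), where G = "{f \<in> F. x \<in> ?D f}"])
     fix f assume f: "f \<in> F" "f \<notin> {f \<in> F. x \<in> ?D f}"
     thus "pd (w f i) j x = 0"
      using tf_eq_0[OF tf_pd[OF tw[OF f(1)] closed_dcube]] by auto
    qed (use F(3) in auto)
   qed
   also have "\<dots> = real N*(\<Sum>f\<in>F. (nm (pd (w f i) j))^2)"
    unfolding nrm2_square using sqint_integrable_square[OF sqw]
    by (subst integral_mult_right_zero, subst int_sum) auto
   finally show ?thesis .
  qed
  hence "(gnorm W)^2 \<le> (\<Sum>i\<in>UNIV. \<Sum>j\<in>UNIV. real N*(\<Sum>f\<in>F. (nm (pd (w f i) j))^2))"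
   unfolding gnorm_square by (intro sum_mono)
  also have "\<dots> = real N*(\<Sum>i\<in>UNIV. \<Sum>j\<in>UNIV. \<Sum>f\<in>F. (nm (pd (w f i) j))^2)"
   by (simp add: sum_distrib_left)
  also have "(\<Sum>i\<in>UNIV. \<Sum>j\<in>UNIV. \<Sum>f\<in>F. (nm (pd (w f i) j))^2) = (\<Sum>f\<in>F. (gnorm (w f))^2)"
   unfolding gnorm_square by (subst (2) sum.swap, subst sum.swap) (rule refl)
  also have "real N*(\<Sum>f\<in>F. (gnorm (w f))^2) \<le> real N*(\<Sum>f\<in>F. C^2*(osc (?Q f) p)^2)"
  proof (intro mult_left_mono sum_mono)
   fix f assume "f \<in> F"
   hence "gnorm (w f) \<le> C * osc (?Q f) p" using w by blast
   from power_mono[OF this, of 2] show "(gnorm (w f))^2 \<le> C^2*(osc (?Q f) p)^2"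
    by (simp add: power_mult_distrib)
  qed simp
  also have "\<dots> = C^2 * real N * S" by (simp add: S_def sum_distrib_left mult_ac)
  finally have gW: "(gnorm W)^2 \<le> C^2 * real N * S" .
  have "S * S \<le> (M * gnorm W)^2"
   using power_mono[OF SW S0, of 2] by (simp add: power2_eq_square)
  also have "\<dots> \<le> M^2*(C^2 * real N * S)"
   using gW by (simp add: power_mult_distrib mult_left_mono)
  finally have "S * S \<le> (C^2 * real N * M^2) * S" by (simp add: mult_ac)
  thus "S \<le> C^2 * real N * M^2"
   using S0 by (cases "S = 0") auto
 qed simp
qed

definition iint :: "(real^'d) set => (real^'d => real) => real" where
 "iint S f = (LBINT x. indicator S x * f x)"

lemma iint_integrable:
 fixes f :: "real^'d => real"
 assumes "integrable lborel f" "S \<in> sets borel"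
 shows "integrable lborel (\<lambda>x. indicator S x * f x)"
 using integrable_mult_indicator[of S lborel f] assms by simp

lemma iint_nonneg: "(\<And>x. 0 \<le> f x) ==> 0 \<le> iint S f"
 unfolding iint_def by (intro integral_nonneg_AE AE_I2) auto

lemma iint_mono_set:
 assumes "integrable lborel f" "S \<in> sets borel" "T \<in> sets borel" "S \<subseteq> T" "\<And>x. 0 \<le> f x"
 shows "iint S f \<le> iint T f"
 unfolding iint_def using assms by (intro integral_mono iint_integrable) (auto split: split_indicator)

lemma iint_mono:
 assumes "integrable lborel f" "integrable lborel g" "S \<in> sets borel" "\<And>x. x \<in> S ==> f x \<le> g x"
 shows "iint S f \<le> iint S g"
 unfolding iint_def using assms by (intro integral_mono iint_integrable) (auto split: split_indicator)

lemma iint_UN_le: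
 assumes "finite I" "integrable lborel f" "\<And>i. i \<in> I ==> T i \<in> sets borel" "S \<in> sets borel"
  "S \<subseteq> (\<Union>i\<in>I. T i)" "\<And>x. 0 \<le> f x"
 shows "iint S f \<le> (\<Sum>i\<in>I. iint (T i) f)"
proof -
 have "iint S f \<le> (LBINT x. (\<Sum>i\<in>I. indicator (T i) x * f x))"
  unfolding iint_def
 proof (rule integral_mono)
  show "integrable lborel (\<lambda>x. \<Sum>i\<in>I. indicator (T i) x * f x)"
   using assms by (intro intble_sum iint_integrable) auto
  fix x
  show "indicator S x * f x \<le> (\<Sum>i\<in>I. indicator (T i) x * f x)"
  proof (cases "x \<in> S")
   case True
   then obtain i where i: "i \<in> I" "x \<in> T i" using assms(5) by auto
   have "indicator (T i) x * f x \<le> (\<Sum>i\<in>I. indicator (T i) x * f x)"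
    using i(1) assms(1,6) by (intro member_le_sum[of i I "\<lambda>i. indicator (T i) x * f x"]) auto
   with True i(2) show ?thesis by simp
  qed (use assms(6) in \<open>auto intro!: sum_nonneg\<close>)
 qed (use assms in \<open>auto intro!: iint_integrable\<close>)
 also have "\<dots> = (\<Sum>i\<in>I. iint (T i) f)"
  unfolding iint_def using assms by (intro int_sum iint_integrable) auto
 finally show ?thesis .
qed

lemma osc_square_iint:
 "(osc S p)^2 = iint S (\<lambda>x. (p x - avg S p)^2)"
 unfolding osc_def nrm2_square iint_def
 by (intro int_cong) (auto split: split_indicator)

text \<open>Subtracting a constant destroys global integrability, so the constant is only subtracted
 on a bounded set.\<close>

lemma sqint_local_const:
 fixes p :: "real^'d => real"
 assumes "sqb p" "bounded B" "B \<in> sets borel"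
 shows "sqb (\<lambda>x. p x - m * indicator B x)"
proof -
 have i: "integrable lborel (indicator B :: real^'d => real)"
  using emeasure_bounded_finite[OF assms(2)] assms(3) by (intro integrable_real_indicator) auto
 have "(\<lambda>x. (indicator B x :: real)^2) = indicator B" by (auto simp: fun_eq_iff split: split_indicator)
 with i assms(3) have "sqb (indicator B :: real^'d => real)" by (simp add: sqint_def)
 from sqint_diff[OF assms(1) sqint_scale[OF this, of m]] show ?thesis .
qed

lemma iint_local_const:
 assumes "S \<subseteq> B"
 shows "iint S (\<lambda>x. (p x - m * indicator B x)^2) = iint S (\<lambda>x. (p x - m)^2)"
 unfolding iint_def using assms
 by (intro int_cong) (auto split: split_indicator)

lemma iint_integrable_const:
 fixes p :: "real^'d => real"
 assumes "sqb p" "bounded S" "S \<in> sets borel"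
 shows "integrable lborel (\<lambda>x. indicator S x*(p x - m)^2)"
proof -
 have "integrable lborel (\<lambda>x. indicator S x*(p x - m * indicator S x)^2)"
  by (rule iint_integrable[OF sqint_integrable_square[OF sqint_local_const[OF assms]] assms(3)])
 thus ?thesis
  by (rule Bochner_Integration.integrable_cong[THEN iffD1, rotated 2]) (auto split: split_indicator)
qed

lemma iint_square_triangle:
 fixes p :: "real^'d => real"
 assumes p: "sqb p" and S: "bounded S" "S \<in> sets borel"
 shows "iint S (\<lambda>x. (p x - m)^2) \<le> 2 * iint S (\<lambda>x. (p x - n)^2) + 2*(m - n)^2 * measure lborel S"
proof -
 have i: "integrable lborel (\<lambda>x. indicator S x*1 :: real)"
  unfolding mult_1_right
  using emeasure_bounded_finite[OF S(1)] S(2) by (intro integrable_real_indicator) auto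
 have "iint S (\<lambda>x. (p x - m)^2) \<le> (LBINT x. 2*(indicator S x*(p x - n)^2) + 2*(m - n)^2*(indicator S x*1))"
  unfolding iint_def
 proof (intro integral_mono iint_integrable_const[OF p S] intble_add integrable_mult_right i)
  fix x
  have "(a - m)^2 \<le> 2*(a - n)^2 + 2*(m - n)^2" for a
   using sum_squares_bound[of "a - n" "n - m"] by (simp add: power2_eq_square algebra_simps)
  thus "indicator S x*(p x - m)^2 \<le> 2*(indicator S x*(p x - n)^2) + 2*(m - n)^2*(indicator S x*1)"
   by (simp split: split_indicator)
 qed
 also have "\<dots> = 2 * iint S (\<lambda>x. (p x - n)^2) + 2*(m - n)^2 * measure lborel S"
  unfolding iint_def using iint_integrable_const[OF p S] i S
  by (subst int_add) auto
 finally show ?thesis .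
qed

subsection \<open>Interior estimates on connected sets\<close>

text \<open>Two constants that are both close to p on a set of positive measure are close to each
  other; this passes from one cube of a chain to the next.\<close>

lemma const_diff_bound:
 fixes p :: "real^'d => real"
 assumes p: "sqb p" and S: "bounded S" "S \<in> sets borel"
 shows "(m - n)^2 * measure lborel S \<le> 2 * iint S (\<lambda>x. (p x - m)^2) + 2 * iint S (\<lambda>x. (p x - n)^2)"
proof -
 have i: "integrable lborel (indicator S :: real^'d => real)"
  using emeasure_bounded_finite[OF S(1)] S(2) by (intro integrable_real_indicator) auto
 have "(m - n)^2 * measure lborel S = (LBINT x. (m - n)^2 * indicator S x)"
  using i S by simp
 also have "\<dots> \<le> (LBINT x. 2*(indicator S x*(p x - m)^2) + 2*(indicator S x*(p x - n)^2))"
 proof (intro integral_mono iint_integrable_const[OF p S] intble_add integrable_mult_right i)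
  fix x
  have "(m - n)^2 \<le> 2*(a - m)^2 + 2*(a - n)^2" for a
   using sum_squares_bound[of "m - a" "a - n"] by (simp add: power2_eq_square algebra_simps)
  thus "(m - n)^2 * indicator S x \<le> 2*(indicator S x*(p x - m)^2) + 2*(indicator S x*(p x - n)^2)"
   by (simp split: split_indicator)
 qed
 also have "\<dots> = 2 * iint S (\<lambda>x. (p x - m)^2) + 2 * iint S (\<lambda>x. (p x - n)^2)"
  unfolding iint_def using iint_integrable_const[OF p S]
  by (subst int_add) auto
 finally show ?thesis .
qed

lemma dcube_dist:
 fixes x y :: "real^'d"
 assumes "x \<in> dcube c l" "y \<in> dcube c l"
 shows "norm (y - x) \<le> real CARD('d)*(2 * l)"
proof -
 have "norm (y - x) \<le> (\<Sum>i\<in>UNIV. \<bar>(y - x)$i\<bar>)" by (rule norm_le_l1_cart)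
 also have "\<dots> \<le> (\<Sum>i\<in>(UNIV::'d set). 2 * l)"
 proof (rule sum_mono)
  fix i
  have "c$i - l/2 \<le> x$i" "x$i \<le> c$i + 3 * l/2" "c$i - l/2 \<le> y$i" "y$i \<le> c$i + 3 * l/2"
   using assms by (auto simp: dcube_def)
  thus "\<bar>(y - x)$i\<bar> \<le> 2 * l" by (simp add: abs_le_iff)
 qed
 finally show ?thesis by simp
qed

lemma qcube_subset_dcube: "0 \<le> l ==> qcube c l \<subseteq> dcube c l"
proof
 fix x assume l: "0 \<le> l" and x: "x \<in> qcube c l"
 have "c$i - l/2 \<le> x$i \<and> x$i \<le> c$i + 3 * l/2" for i
 proof -
  have "c$i \<le> x$i" "x$i \<le> c$i + l" using x by (auto simp: qcube_def)
  with l show ?thesis by simp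
 qed
 thus "x \<in> dcube c l" by (simp add: dcube_def)
qed

lemma cube_around:
 fixes a :: "real^'d"
 assumes "open Om" "a \<in> Om"
 obtains l where "l > 0" "dcube (a - (\<chi> i. l/2)) l \<subseteq> Om"
proof -
 obtain e where e: "e > 0" "ball a e \<subseteq> Om" using assms by (auto simp: open_contains_ball)
 define l where "l = e/(4 * real CARD('d))"
 have l: "l > 0" using e by (simp add: l_def)
 have "dcube (a - (\<chi> i. l/2)) l \<subseteq> ball a e"
 proof
  fix y assume y: "y \<in> dcube (a - (\<chi> i. l/2)) l"
  have "a \<in> dcube (a - (\<chi> i. l/2)) l" using l by (simp add: dcube_def)
  from dcube_dist[OF this y] have "norm (y - a) \<le> e/2" by (simp add: l_def)
  thus "y \<in> ball a e" using e by (simp add: dist_norm norm_minus_commute)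
 qed
 with e l that show ?thesis by blast
qed

lemma single_cube_osc:
 obtains C where "C \<ge> 0"
  "\<And>c l Om (p :: real^'d => real) M. l > 0 ==> dcube c l \<subseteq> Om ==> sqb p ==> bnd Om p M ==> 0 \<le> M ==>
   iint (qcube c l) (\<lambda>x. (p x - avg (qcube c l) p)^2) \<le> C * M^2"
proof -
 obtain C where C: "C \<ge> 0" and fam:
  "\<And>(F :: unit set) c l Om (p :: real^'d => real) M N. finite F ==> \<forall>f\<in>F. l f > 0 \<and> dcube (c f) (l f) \<subseteq> Om ==>
   \<forall>x. card {f \<in> F. x \<in> dcube (c f) (l f)} \<le> N ==> sqb p ==> bnd Om p M ==> 0 \<le> M ==>
   (\<Sum>f\<in>F. (osc (qcube (c f) (l f)) p)^2) \<le> C * real N * M^2"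
  by (rule family_osc_bound[where 'i = unit], rule that)
 show ?thesis
 proof (rule that[OF C])
  fix c :: "real^'d" and l and Om and p :: "real^'d => real" and M
  assume a: "l > 0" "dcube c l \<subseteq> Om" "sqb p" "bnd Om p M" "0 \<le> M"
  have "card {f :: unit. f \<in> UNIV \<and> x \<in> dcube c l} \<le> 1" for x
   using card_mono[of "UNIV :: unit set" "{f. f \<in> UNIV \<and> x \<in> dcube c l}"] by simp
  thus "iint (qcube c l) (\<lambda>x. (p x - avg (qcube c l) p)^2) \<le> C * M^2"
   using fam[of UNIV "\<lambda>_. l" "\<lambda>_. c" Om 1 p M] a by (simp add: osc_square_iint)
 qed
qed

lemma measure_ball_pos: "r > 0 ==> 0 < measure lborel (ball (x::'a::euclidean_space) r)"
 using content_ball_pos[of r x] by simp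

text \<open>The chain of cubes is hidden in an induction over the connected set. The mean over one
  base cube is the same constant at all points, while radii and factors vary from point to point
  until compactness of K leaves finitely many.\<close>

lemma interior_estimate:
 fixes Om :: "(real^'d) set"
 assumes Om: "open Om" "connected Om" and base: "l0 > 0" "dcube c0 l0 \<subseteq> Om" and K: "compact K" "K \<subseteq> Om"
 obtains A where "A \<ge> 0"
  "\<And>p M. sqb p ==> bnd Om p M ==> 0 \<le> M ==>
   iint K (\<lambda>x. (p x - avg (qcube c0 l0) p)^2) \<le> A * M^2"
proof -
 let ?m = "\<lambda>p. avg (qcube c0 l0) p"
 \<comment> \<open>Radius and constant are quantified before p and M: they may depend on the point,
   but not on the function.\<close>
 define P where "P x \<longleftrightarrow> (\<exists>r>0. \<exists>A\<ge>0. \<forall>p M. sqb p \<longrightarrow> bnd Om p M \<longrightarrow> 0 \<le> M \<longrightarrow>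
   iint (ball x r) (\<lambda>x. (p x - ?m p)^2) \<le> A * M^2)" for x
 obtain C where C: "C \<ge> 0" and cube: "\<And>c l Om (p :: real^'d => real) M. l > 0 ==> dcube c l \<subseteq> Om ==> sqb p ==>
   bnd Om p M ==> 0 \<le> M ==> iint (qcube c l) (\<lambda>x. (p x - avg (qcube c l) p)^2) \<le> C * M^2"
  by (rule single_cube_osc, rule that)
 have ballcube: "iint (ball x r) (\<lambda>x. (p x - avg (qcube c l) p)^2) \<le> C * M^2"
  if "ball x r \<subseteq> qcube c l" "l > 0" "dcube c l \<subseteq> Om" "sqb p" "bnd Om p M" "0 \<le> M" for x r c l p M
 proof -
  have "bounded (qcube c l)" by (simp add: qcube_cbox)
  have "iint (ball x r) (\<lambda>x. (p x - avg (qcube c l) p)^2) \<le> iint (qcube c l) (\<lambda>x. (p x - avg (qcube c l) p)^2)"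
   unfolding iint_def
   using iint_integrable_const[OF that(4), of "ball x r"] iint_integrable_const[OF that(4) \<open>bounded (qcube c l)\<close> sets_qcube] that(1)
   by (intro integral_mono) (auto split: split_indicator)
  with cube[OF that(2-6)] show ?thesis by linarith
 qed
 have opencube: "open (box c (\<chi> i. c$i + l))" "box c (\<chi> i. c$i + l) \<subseteq> qcube c l" for c :: "real^'d" and l
  by (auto simp: qcube_cbox box_subset_cbox)
 have P_all: "P x" if "x \<in> Om" for x
 proof (rule connected_induction_simple[OF Om(2)])
  let ?c0 = "c0 + (\<chi> i. l0/2)"
  have in0: "?c0 \<in> box c0 (\<chi> i. c0$i + l0)" using base(1) by (simp add: mem_box_cart)
  then obtain r where r: "r > 0" "ball ?c0 r \<subseteq> box c0 (\<chi> i. c0$i + l0)"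
   using opencube(1) open_contains_ball by blast
  have "P ?c0"
   unfolding P_def
   using r C ballcube[OF subset_trans[OF r(2) opencube(2)] base] by blast
  thus "P ?c0" .
  have "?c0 \<in> dcube c0 l0" using base(1) by (simp add: dcube_def)
  thus "?c0 \<in> Om" using base(2) by blast
  show "x \<in> Om" by fact
  fix a assume "a \<in> Om"
  then obtain l where l: "l > 0" "dcube (a - (\<chi> i. l/2)) l \<subseteq> Om" using cube_around[OF Om(1)] by blast
  define c where "c = a - (\<chi> i. l/2)"
  note l = l[folded c_def]
  let ?T = "box c (\<chi> i. c$i + l)"
  have qd: "qcube c l \<subseteq> dcube c l" using l(1) by (intro qcube_subset_dcube) simp
  show "\<exists>T. openin (top_of_set Om) T \<and> a \<in> T \<and> (\<forall>x\<in>T. \<forall>y\<in>T. P x \<longrightarrow> P y)"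
  proof (intro exI[of _ ?T] conjI ballI impI)
   show "openin (top_of_set Om) ?T"
    unfolding openin_open_eq[OF Om(1)] using opencube l(2) qd by blast
   show "a \<in> ?T" using l(1) by (simp add: c_def mem_box_cart)
   fix x y assume x: "x \<in> ?T" and y: "y \<in> ?T" and "P x"
   then obtain r A where r: "r > 0" "A \<ge> 0" and rA: "\<And>p M. sqb p ==> bnd Om p M ==> 0 \<le> M ==>
     iint (ball x r) (\<lambda>x. (p x - ?m p)^2) \<le> A * M^2" unfolding P_def by blast
   obtain r1 where r1: "r1 > 0" "ball x r1 \<subseteq> ?T" using x opencube(1) open_contains_ball by blast
   obtain r2 where r2: "r2 > 0" "ball y r2 \<subseteq> ?T" using y opencube(1) open_contains_ball by blast
   \<comment> \<open>This ball lies both in the ball where the claim is known and in the new cube,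
     so on it the base mean can be compared with the mean over the cube.\<close>
   define s where "s = min r r1"
   have s: "s > 0" "ball x s \<subseteq> ball x r" "ball x s \<subseteq> qcube c l"
   proof -
    show "s > 0" using r r1 by (simp add: s_def)
    show "ball x s \<subseteq> ball x r" by (simp add: s_def subset_ball)
    have "ball x s \<subseteq> ball x r1" by (simp add: s_def subset_ball)
    with r1(2) opencube(2) show "ball x s \<subseteq> qcube c l" by blast
   qed
   define \<mu> where "\<mu> = measure lborel (ball x s)"
   have \<mu>: "\<mu> > 0" using measure_ball_pos[OF s(1)] by (simp add: \<mu>_def)
   \<comment> \<open>The oscillation on the new cube plus the squared difference of the two means
     times the measure of the new ball.\<close>
   define B where "B = 2 * C + 2*((2 * C + 2 * A)/\<mu>) * measure lborel (ball y r2)"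
   have B: "B \<ge> 0" using C r(2) \<mu> by (simp add: B_def)
   have "iint (ball y r2) (\<lambda>x. (p x - ?m p)^2) \<le> B * M^2"
    if p: "sqb p" "bnd Om p M" "0 \<le> M" for p M
   proof -
    let ?q = "avg (qcube c l) p"
    have "(?m p - ?q)^2*\<mu> \<le> 2 * iint (ball x s) (\<lambda>x. (p x - ?m p)^2) + 2 * iint (ball x s) (\<lambda>x. (p x - ?q)^2)"
     unfolding \<mu>_def by (rule const_diff_bound[OF p(1)]) auto
    also have "iint (ball x s) (\<lambda>x. (p x - ?m p)^2) \<le> iint (ball x r) (\<lambda>x. (p x - ?m p)^2)"
     unfolding iint_def
     using iint_integrable_const[OF p(1), of "ball x r"] iint_integrable_const[OF p(1), of "ball x s"] s(2)
     by (intro integral_mono) (auto split: split_indicator)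
    also have "\<dots> \<le> A * M^2" by (rule rA[OF p])
    also have "iint (ball x s) (\<lambda>x. (p x - ?q)^2) \<le> C * M^2" by (rule ballcube[OF s(3) l p])
    finally have "(?m p - ?q)^2*\<mu> \<le> (2 * C + 2 * A) * M^2" by (simp add: algebra_simps)
    hence mq: "(?m p - ?q)^2 \<le> (2 * C + 2 * A)/\<mu> * M^2" using \<mu> by (simp add: field_simps)
    have "iint (ball y r2) (\<lambda>x. (p x - ?m p)^2) \<le>
      2 * iint (ball y r2) (\<lambda>x. (p x - ?q)^2) + 2*(?m p - ?q)^2 * measure lborel (ball y r2)"
     by (rule iint_square_triangle[OF p(1)]) auto
    also have "iint (ball y r2) (\<lambda>x. (p x - ?q)^2) \<le> C * M^2"
     by (rule ballcube[OF subset_trans[OF r2(2) opencube(2)] l p])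
    also have "2*(?m p - ?q)^2 * measure lborel (ball y r2) \<le> 2*((2 * C + 2 * A)/\<mu> * M^2) * measure lborel (ball y r2)"
     by (intro mult_right_mono mult_left_mono mq) auto
    finally show ?thesis by (simp add: B_def algebra_simps)
   qed
   thus "P y" unfolding P_def using r2(1) B by blast
  qed
 qed
 have "\<forall>x\<in>K. \<exists>r. r > 0 \<and> (\<exists>A\<ge>0. \<forall>p M. sqb p \<longrightarrow> bnd Om p M \<longrightarrow> 0 \<le> M \<longrightarrow>
   iint (ball x r) (\<lambda>x. (p x - ?m p)^2) \<le> A * M^2)"
  using P_all K(2) unfolding P_def by blast
 from bchoice[OF this] obtain r where r: "\<forall>x\<in>K. r x > 0 \<and> (\<exists>A\<ge>0. \<forall>p M. sqb p \<longrightarrow> bnd Om p M \<longrightarrow> 0 \<le> M \<longrightarrow>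
   iint (ball x (r x)) (\<lambda>x. (p x - ?m p)^2) \<le> A * M^2)" ..
 hence "\<forall>x\<in>K. \<exists>A. A \<ge> 0 \<and> (\<forall>p M. sqb p \<longrightarrow> bnd Om p M \<longrightarrow> 0 \<le> M \<longrightarrow>
   iint (ball x (r x)) (\<lambda>x. (p x - ?m p)^2) \<le> A * M^2)" by blast
 from bchoice[OF this] obtain A where A: "\<forall>x\<in>K. A x \<ge> 0 \<and> (\<forall>p M. sqb p \<longrightarrow> bnd Om p M \<longrightarrow> 0 \<le> M \<longrightarrow>
   iint (ball x (r x)) (\<lambda>x. (p x - ?m p)^2) \<le> A x * M^2)" ..
 have rA: "r x > 0" "A x \<ge> 0" "sqb p ==> bnd Om p M ==> 0 \<le> M ==>
   iint (ball x (r x)) (\<lambda>x. (p x - ?m p)^2) \<le> A x * M^2" if "x \<in> K" for x p M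
  using r A that by blast+
 have cover: "K \<subseteq> (\<Union>x\<in>K. ball x (r x))" using rA(1) by auto
 obtain J where J: "J \<subseteq> K" "finite J" "K \<subseteq> (\<Union>x\<in>J. ball x (r x))"
  by (rule compactE_image[OF K(1) open_ball cover], rule that)
 show ?thesis
 proof (rule that[of "sum A J"])
  show "sum A J \<ge> 0" using rA(2) J(1) by (intro sum_nonneg) auto
  fix p M assume p: "sqb p" "bnd Om p M" "0 \<le> M"
  define B where "B = K \<union> (\<Union>x\<in>J. ball x (r x))"
  have B: "bounded B" "B \<in> sets borel"
  proof -
   show "bounded B" using J(2) compact_imp_bounded[OF K(1)] by (auto simp: B_def)
   show "B \<in> sets borel"
    unfolding B_def by (intro sets.Un borel_closed compact_imp_closed[OF K(1)] borel_open open_UN ballI open_ball)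
  qed
  have i: "integrable lborel (\<lambda>x. (p x - ?m p * indicator B x)^2)"
   by (rule sqint_integrable_square[OF sqint_local_const[OF p(1) B]])
  have "iint K (\<lambda>x. (p x - ?m p)^2) = iint K (\<lambda>x. (p x - ?m p * indicator B x)^2)"
   by (rule iint_local_const[symmetric]) (simp add: B_def)
  also have "\<dots> \<le> (\<Sum>x\<in>J. iint (ball x (r x)) (\<lambda>x. (p x - ?m p * indicator B x)^2))"
   using J(2,3) i compact_imp_closed[OF K(1)] by (intro iint_UN_le) auto
  also have "\<dots> = (\<Sum>x\<in>J. iint (ball x (r x)) (\<lambda>x. (p x - ?m p)^2))"
   by (intro sum.cong refl iint_local_const) (auto simp: B_def)
  also have "\<dots> \<le> (\<Sum>x\<in>J. A x * M^2)" using J(1) rA(3) p by (intro sum_mono) auto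
  finally show "iint K (\<lambda>x. (p x - ?m p)^2) \<le> sum A J * M^2" by (simp add: sum_distrib_right)
 qed
qed

subsection \<open>Estimates near the boundary\<close>

lemma sqint_translate:
 fixes p :: "'a::euclidean_space => real"
 assumes "sqb p" shows "sqb (\<lambda>x. p (v + x))"
proof -
 have [measurable]: "p \<in> borel_measurable borel" using assms by (auto simp: sqint_def)
 have "integrable lborel (\<lambda>x. (p x)^2)" using assms by (simp add: sqint_def)
 hence "integrable lborel (\<lambda>x. (p (v + x))^2)"
  using lborel_integrable_translation[of "\<lambda>x. (p x)^2" v] by simp
 thus ?thesis by (simp add: sqint_def)
qed

lemma iint_translate:
 fixes f :: "real^'d => real"
 assumes f: "f \<in> borel_measurable borel" and S: "S \<in> sets borel" and T: "\<And>x. v + x \<in> T \<longleftrightarrow> x \<in> S" "T \<in> sets borel"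
 shows "iint S (\<lambda>x. f (v + x)) = iint T f"
proof -
 have ind: "indicator S x = (indicator T (v + x) :: real)" for x using T(1)[of x] by (simp split: split_indicator)
 have [measurable]: "f \<in> borel_measurable borel" "T \<in> sets borel" by fact+
 show ?thesis
  unfolding iint_def ind using lborel_integral_translation[of "\<lambda>x. indicator T x * f x" v] by simp
qed

lemma mult_divide_four: "(q::real) \<noteq> 0 ==> q*(a/(4 * q)) = a/4"
 by simp

context
 fixes Om :: "(real^'d) set" and x0 \<nu> :: "real^'d" and r L :: real and g :: "real^'d => real"
 assumes Om: "open Om" and x0: "x0 \<in> frontier Om" and r: "r > 0" and \<nu>: "norm \<nu> = 1"
  and lip: "L-lipschitz_on {y. y \<bullet> \<nu> = 0} g"
  and graph: "Om \<inter> ball x0 r = {x \<in> ball x0 r. g (x - (x \<bullet> \<nu>)*\<^sub>R \<nu>) < x \<bullet> \<nu>}"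
begin

definition prj :: "real^'d => real^'d" where "prj x = x - (x \<bullet> \<nu>)*\<^sub>R \<nu>"

text \<open>Height above the graph, measured along \<nu>. Near x0 the domain is where it is
  positive, and a translation along \<nu> changes it by exactly the length of the
  translation.\<close>

definition ht :: "real^'d => real" where "ht x = x \<bullet> \<nu> - g (prj x)"

lemma \<nu>\<nu>: "\<nu> \<bullet> \<nu> = 1" using \<nu> by (simp add: norm_eq_1)

lemma prj_hyper: "prj x \<bullet> \<nu> = 0"
 by (simp add: prj_def inner_diff_left \<nu>\<nu>)

lemma prj_shift: "prj (s*\<^sub>R \<nu> + x) = prj x" and ht_shift: "ht (s*\<^sub>R \<nu> + x) = ht x + s"
proof -
 show "prj (s*\<^sub>R \<nu> + x) = prj x" by (simp add: prj_def inner_add_left \<nu>\<nu> algebra_simps)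
 thus "ht (s*\<^sub>R \<nu> + x) = ht x + s" by (simp add: ht_def inner_add_left \<nu>\<nu>)
qed

lemma prj_diff: "prj x - prj y = prj (x - y)"
 by (simp add: prj_def inner_diff_left algebra_simps)

lemma norm_prj_le: "norm (prj x) \<le> norm x"
proof (rule power2_le_imp_le)
 have "(norm (prj x))^2 = (norm x)^2 - (x \<bullet> \<nu>)^2"
  unfolding power2_norm_eq_inner
  by (simp add: prj_def inner_diff_left inner_diff_right \<nu>\<nu> inner_commute power2_eq_square)
 thus "(norm (prj x))^2 \<le> (norm x)^2" by simp
qed simp

lemma L_nonneg: "0 \<le> L" by (rule lipschitz_on_nonneg[OF lip])

lemma g_prj_lip: "\<bar>g (prj x) - g (prj y)\<bar> \<le> L * norm (prj x - prj y)"
 using lipschitz_onD[OF lip, of "prj x" "prj y"] by (simp add: prj_hyper dist_norm)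

lemma inner_\<nu>_le: "\<bar>x \<bullet> \<nu>\<bar> \<le> norm x"
 using Cauchy_Schwarz_ineq2[of x \<nu>] \<nu> by simp

lemma ht_lip: "\<bar>ht x - ht y\<bar> \<le> (1 + L) * norm (x - y)"
proof -
 have "\<bar>ht x - ht y\<bar> \<le> \<bar>(x - y) \<bullet> \<nu>\<bar> + \<bar>g (prj x) - g (prj y)\<bar>"
  by (simp add: ht_def inner_diff_left)
 also have "\<dots> \<le> norm (x - y) + L * norm (x - y)"
  using inner_\<nu>_le[of "x - y"] g_prj_lip[of x y] mult_left_mono[OF norm_prj_le[of "x - y"] L_nonneg]
  unfolding prj_diff by linarith
 finally show ?thesis by (simp add: distrib_right)
qed

lemma continuous_ht: "continuous_on S ht"
proof -
 have "(1 + L)-lipschitz_on S ht"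
  using ht_lip L_nonneg by (intro lipschitz_onI) (auto simp: dist_norm)
 thus ?thesis by (rule lipschitz_on_continuous_on)
qed

lemma continuous_prj: "continuous_on S prj"
 unfolding prj_def[abs_def] by (intro continuous_intros)

lemma in_Om_iff: "norm (x - x0) < r ==> x \<in> Om \<longleftrightarrow> 0 < ht x"
proof -
 assume "norm (x - x0) < r"
 hence "x \<in> ball x0 r" by (simp add: dist_norm norm_minus_commute)
 hence "x \<in> Om \<longleftrightarrow> g (x - (x \<bullet> \<nu>)*\<^sub>R \<nu>) < x \<bullet> \<nu>" using graph by blast
 thus ?thesis by (simp add: ht_def prj_def)
qed

text \<open>An open set does not contain its frontier points, so the height is at most 0; a negative
  height would persist near x0 and contradict the points of the domain that accumulate
  there.\<close>

lemma ht_x0: "ht x0 = 0"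
proof -
 have "x0 \<notin> Om" using x0 Om by (simp add: frontier_def interior_open)
 hence "ht x0 \<le> 0" using in_Om_iff[of x0] r by simp
 moreover have "\<not> ht x0 < 0"
 proof
  assume neg: "ht x0 < 0"
  define e where "e = min r (- ht x0/(1 + L))"
  have "- ht x0/(1 + L) > 0" using neg L_nonneg by (intro divide_pos_pos) auto
  hence e: "e > 0" using r by (simp add: e_def)
  have "x0 \<in> closure Om" using x0 by (simp add: frontier_def)
  then obtain y where y: "y \<in> Om" "dist y x0 < e" using e by (auto simp: closure_approachable)
  hence n: "norm (y - x0) < e" by (simp add: dist_norm)
  hence "0 < ht y" using in_Om_iff[of y] y(1) by (simp add: e_def)
  moreover have "(1 + L) * norm (y - x0) < (1 + L)*(- ht x0/(1 + L))"
   using n L_nonneg by (intro mult_strict_left_mono) (auto simp: e_def)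
  hence "(1 + L) * norm (y - x0) < - ht x0" using L_nonneg by simp
  ultimately show False using ht_lip[of y x0] by linarith
 qed
 ultimately show ?thesis by linarith
qed

text \<open>Chosen so that (1 + L) rad + 2 hh = r/4 + r/4: the cylinder of radius rad and heights up
  to 2 hh in absolute value stays within distance r/2 of x0, inside the chart.\<close>

definition "rad = r/(4*(1 + L))"
definition "hh = r/8"

lemma rad_pos: "rad > 0" and hh_pos: "hh > 0"
 using r L_nonneg by (simp_all add: rad_def hh_def)

lemma rad_eq: "(1 + L) * rad = r/4"
 unfolding rad_def using L_nonneg by (intro mult_divide_four) simp

section \<open>Layers parallel to the boundary and their cells\<close>

definition strip :: "real => real => (real^'d) set" where
 "strip a b = {x. norm (prj x - prj x0) < rad \<and> a < ht x \<and> ht x \<le> b}"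

lemma near_x0: "norm (prj x - prj x0) \<le> rad ==> \<bar>ht x\<bar> \<le> 2 * hh ==> norm (x - x0) \<le> r/2"
proof -
 assume a: "norm (prj x - prj x0) \<le> rad" "\<bar>ht x\<bar> \<le> 2 * hh"
 have "x - x0 = (prj x - prj x0) + ((x - x0) \<bullet> \<nu>)*\<^sub>R \<nu>"
  by (simp add: prj_def inner_diff_left algebra_simps)
 hence "norm (x - x0) \<le> norm (prj x - prj x0) + \<bar>(x - x0) \<bullet> \<nu>\<bar>"
  using norm_triangle_ineq[of "prj x - prj x0" "((x - x0) \<bullet> \<nu>)*\<^sub>R \<nu>"] \<nu> by simp
 also have "(x - x0) \<bullet> \<nu> = ht x + (g (prj x) - g (prj x0))"
  using ht_x0 by (simp add: ht_def inner_diff_left)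
 also have "\<bar>ht x + (g (prj x) - g (prj x0))\<bar> \<le> \<bar>ht x\<bar> + \<bar>g (prj x) - g (prj x0)\<bar>"
  by (rule abs_triangle_ineq)
 also have "\<bar>g (prj x) - g (prj x0)\<bar> \<le> L * rad"
  using g_prj_lip[of x x0] mult_left_mono[OF a(1) L_nonneg] by linarith
 finally have "norm (x - x0) \<le> (1 + L) * rad + \<bar>ht x\<bar>" using a(1) by (simp add: distrib_right)
 thus ?thesis using a(2) by (simp add: rad_eq hh_def)
qed

text \<open>The height is Lipschitz with constant 1 + L, so over this radius it changes by at most
  \<tau>/4. The window obtained for it later limits how many levels of cubes can meet at a
  point.\<close>

lemma ball_in_Om:
 assumes x: "norm (prj x - prj x0) \<le> rad" "\<tau>/2 \<le> ht x" "ht x \<le> 2*\<tau>" and \<tau>: "0 < \<tau>" "\<tau> \<le> hh"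
  and y: "norm (y - x) \<le> \<tau>/(4*(1 + L))"
 shows "y \<in> Om" "\<tau>/4 \<le> ht y" "ht y \<le> 9*\<tau>/4"
proof -
 have L1: "1 + L \<ge> 1" using L_nonneg by simp
 have "(1 + L) * norm (y - x) \<le> (1 + L)*(\<tau>/(4*(1 + L)))"
  using y L1 by (intro mult_left_mono) auto
 also have "\<dots> = \<tau>/4" using L1 by (intro mult_divide_four) simp
 finally have d: "\<bar>ht y - ht x\<bar> \<le> \<tau>/4" using ht_lip[of y x] by linarith
 thus 1: "\<tau>/4 \<le> ht y" "ht y \<le> 9*\<tau>/4" using x by linarith+
 have "norm (x - x0) \<le> r/2" using x \<tau> by (intro near_x0) auto
 moreover have "norm (y - x) \<le> \<tau>/4"
 proof -
  have "\<tau>/(4*(1 + L)) \<le> \<tau>/(4*1)" using L1 \<tau>(1) by (intro divide_left_mono) auto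
  from order_trans[OF y this] show ?thesis by simp
 qed
 moreover have "norm (y - x0) \<le> norm (y - x) + norm (x - x0)"
  using norm_triangle_ineq[of "y - x" "x - x0"] by simp
 ultimately have "norm (y - x0) < r" using \<tau>(2) r by (simp add: hh_def)
 thus "y \<in> Om" using in_Om_iff 1(1) \<tau>(1) by auto
qed

lemma sets_strip: "strip a b \<in> sets borel"
proof -
 have [measurable]: "ht \<in> borel_measurable borel" "prj \<in> borel_measurable borel"
  by (intro borel_measurable_continuous_onI continuous_ht continuous_prj)+
 show ?thesis unfolding strip_def by measurable
qed

lemma strip_shift: "s*\<^sub>R \<nu> + x \<in> strip (a + s) (b + s) \<longleftrightarrow> x \<in> strip a b"
 by (simp add: strip_def prj_shift ht_shift)

lemma strip_bounded: "b \<le> 2 * hh ==> - 2 * hh \<le> a ==> strip a b \<subseteq> cball x0 (r/2)"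
proof
 fix x assume a: "b \<le> 2 * hh" "- 2 * hh \<le> a" and x: "x \<in> strip a b"
 hence "norm (prj x - prj x0) \<le> rad" "\<bar>ht x\<bar> \<le> 2 * hh" by (auto simp: strip_def)
 from near_x0[OF this] show "x \<in> cball x0 (r/2)" by (simp add: dist_norm norm_minus_commute)
qed

text \<open>So many translations by \<open>sig k\<close> climb half of \<open>tau k\<close>. The
  bound 12 d (1 + L) makes the enlarged cube of edge 6 \<open>sig k\<close> around a cell so small
  that \<open>ball_in_Om\<close> applies to it.\<close>

definition "steps = nat \<lceil>12 * real CARD('d)*(1 + L)\<rceil> + 1"

definition tau :: "nat => real" where "tau k = hh/2^k"

definition sig :: "nat => real" where "sig k = tau k/(2 * real steps)"

lemma tau_pos: "tau k > 0" and tau_Suc: "tau k = 2 * tau (Suc k)"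
 using hh_pos by (simp_all add: tau_def)

lemma tau_le: "tau k \<le> hh"
proof -
 have "hh/2^k \<le> hh/1" using hh_pos by (intro divide_left_mono) auto
 thus ?thesis by (simp add: tau_def)
qed

lemma sig_pos: "sig k > 0"
 unfolding sig_def steps_def by (intro divide_pos_pos tau_pos) simp

lemma tau_sig: "tau k = 2 * real steps * sig k"
 by (simp add: sig_def steps_def)

lemma steps_ge: "12 * real CARD('d)*(1 + L) \<le> real steps"
 unfolding steps_def by linarith

definition cell :: "nat => ('d => int) => (real^'d) set" where
 "cell k z = qcube (\<chi> i. sig k * of_int (z i)) (sig k)"

text \<open>Lower corner of the block of three cells in each direction around a cell. As \<nu> has
  unit length, the block also contains the translate of the cell by \<open>sig k\<close> along
  \<nu>.\<close>

definition corner :: "nat => ('d => int) => real^'d" where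
 "corner k z = (\<chi> i. sig k*(of_int (z i) - 1))"

definition idx :: "nat => real^'d => 'd => int" where
 "idx k x = (\<lambda>i. \<lfloor>x$i/sig k\<rfloor>)"

lemma in_cell: "x \<in> cell k (idx k x)"
proof -
 have "sig k * of_int \<lfloor>x$i/sig k\<rfloor> \<le> x$i \<and> x$i \<le> sig k * of_int \<lfloor>x$i/sig k\<rfloor> + sig k" for i
 proof -
  have "of_int \<lfloor>x$i/sig k\<rfloor> \<le> x$i/sig k" "x$i/sig k \<le> of_int \<lfloor>x$i/sig k\<rfloor> + 1"
   by linarith+
  from this[THEN mult_left_mono[OF _ less_imp_le[OF sig_pos[of k]]]]
  have "sig k * of_int \<lfloor>x$i/sig k\<rfloor> \<le> sig k*(x$i/sig k)"
   "sig k*(x$i/sig k) \<le> sig k*(of_int \<lfloor>x$i/sig k\<rfloor> + 1)" by blast+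
  thus ?thesis using sig_pos[of k] by (simp add: distrib_left)
 qed
 thus ?thesis by (simp add: cell_def qcube_def idx_def)
qed

lemma corner_nth: "corner k z$i = sig k * of_int (z i) - sig k"
 by (simp add: corner_def right_diff_distrib)

lemma cell_subset: "cell k z \<subseteq> qcube (corner k z) (3 * sig k)"
 and cell_shift: "x \<in> cell k z ==> sig k*\<^sub>R \<nu> + x \<in> qcube (corner k z) (3 * sig k)"
proof -
 have n: "\<bar>\<nu>$i\<bar> \<le> 1" for i using component_le_norm_cart[of \<nu> i] \<nu> by simp
 have b: "- sig k \<le> sig k*\<nu>$i \<and> sig k*\<nu>$i \<le> sig k" for i
 proof -
  have "\<bar>sig k*\<nu>$i\<bar> \<le> sig k*1"
   using n[of i] sig_pos[of k] by (simp add: abs_mult)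
  thus ?thesis by linarith
 qed
 show "cell k z \<subseteq> qcube (corner k z) (3 * sig k)"
 proof
  fix x assume "x \<in> cell k z"
  hence "sig k * of_int (z i) \<le> x$i \<and> x$i \<le> sig k * of_int (z i) + sig k" for i by (simp add: cell_def qcube_def)
  hence "corner k z$i \<le> x$i \<and> x$i \<le> corner k z$i + 3 * sig k" for i
  proof -
   have "sig k * of_int (z i) \<le> x$i \<and> x$i \<le> sig k * of_int (z i) + sig k"
    using \<open>x \<in> cell k z\<close> by (simp add: cell_def qcube_def)
   thus ?thesis unfolding corner_nth using sig_pos[of k] by linarith
  qed
  thus "x \<in> qcube (corner k z) (3 * sig k)" by (simp add: qcube_def)
 qed
 assume "x \<in> cell k z"
 hence c: "sig k * of_int (z i) \<le> x$i \<and> x$i \<le> sig k * of_int (z i) + sig k" for i by (simp add: cell_def qcube_def)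
 have "corner k z$i \<le> (sig k*\<^sub>R \<nu> + x)$i \<and> (sig k*\<^sub>R \<nu> + x)$i \<le> corner k z$i + 3 * sig k" for i
 proof -
  have "(sig k*\<^sub>R \<nu> + x)$i = sig k*\<nu>$i + x$i" by simp
  thus ?thesis unfolding corner_nth using b[of i] c[of i] by linarith
 qed
 thus "sig k*\<^sub>R \<nu> + x \<in> qcube (corner k z) (3 * sig k)" by (simp add: qcube_def)
qed

lemma dcube_strip:
 assumes x: "x \<in> strip (tau k/2) (2 * tau k)" "x \<in> cell k z" and y: "y \<in> dcube (corner k z) (3 * sig k)"
 shows "y \<in> Om" "tau k/4 \<le> ht y" "ht y \<le> 9 * tau k/4"
proof -
 have "x \<in> dcube (corner k z) (3 * sig k)"
  using x(2) cell_subset[of k z] qcube_subset_dcube[of "3 * sig k" "corner k z"] sig_pos[of k] by auto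
 from dcube_dist[OF this y] have "norm (y - x) \<le> real CARD('d)*(6 * sig k)" by simp
 also have "\<dots> \<le> tau k/(4*(1 + L))"
 proof -
  have "12 * real CARD('d)*(1 + L)*(2 * sig k) \<le> real steps*(2 * sig k)"
   using steps_ge sig_pos[of k] by (intro mult_right_mono) auto
  thus ?thesis using L_nonneg by (simp add: tau_sig field_simps)
 qed
 finally have n: "norm (y - x) \<le> tau k/(4*(1 + L))" .
 have s: "norm (prj x - prj x0) \<le> rad" "tau k/2 \<le> ht x" "ht x \<le> 2 * tau k"
  using x(1) by (auto simp: strip_def)
 show "y \<in> Om" "tau k/4 \<le> ht y" "ht y \<le> 9 * tau k/4"
  by (rule ball_in_Om[OF s tau_pos tau_le n])+
qed

definition cells :: "nat => ('d => int) set" where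
 "cells k = idx k ` strip (tau k/2) (2 * tau k)"

lemma finite_cells: "finite (cells k)"
proof -
 have "strip (tau k/2) (2 * tau k) \<subseteq> cball x0 (r/2)"
  using tau_le[of k] tau_pos[of k] hh_pos by (intro strip_bounded) auto
 hence "bounded (strip (tau k/2) (2 * tau k))" using bounded_cball bounded_subset by blast
 then obtain B where B: "\<forall>x\<in>strip (tau k/2) (2 * tau k). norm x \<le> B" by (auto simp: bounded_iff)
 have "cells k \<subseteq> (\<Pi>\<^sub>E i\<in>UNIV. {\<lfloor>- B/sig k\<rfloor> .. \<lfloor>B/sig k\<rfloor>})"
 proof
  fix z assume "z \<in> cells k"
  then obtain x where x: "x \<in> strip (tau k/2) (2 * tau k)" "z = idx k x" by (auto simp: cells_def)
  have "\<lfloor>- B/sig k\<rfloor> \<le> \<lfloor>x$i/sig k\<rfloor> \<and> \<lfloor>x$i/sig k\<rfloor> \<le> \<lfloor>B/sig k\<rfloor>" for i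
  proof -
   have "\<bar>x$i\<bar> \<le> B" using component_le_norm_cart[of x i] B x(1) by fastforce
   hence "- B \<le> x$i" "x$i \<le> B" by linarith+
   thus ?thesis using sig_pos[of k] by (intro conjI floor_mono divide_right_mono) auto
  qed
  thus "z \<in> (\<Pi>\<^sub>E i\<in>UNIV. {\<lfloor>- B/sig k\<rfloor> .. \<lfloor>B/sig k\<rfloor>})" by (simp add: x(2) idx_def PiE_def Pi_def extensional_def)
 qed
 thus ?thesis by (rule finite_subset) (intro finite_PiE; simp)
qed

lemma cells_dcube:
 assumes "z \<in> cells k" "y \<in> dcube (corner k z) (3 * sig k)"
 shows "y \<in> Om" "tau k/4 \<le> ht y" "ht y \<le> 9 * tau k/4"
proof -
 obtain x where x: "x \<in> strip (tau k/2) (2 * tau k)" "x \<in> cell k z"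
  using assms(1) in_cell by (auto simp: cells_def)
 show "y \<in> Om" "tau k/4 \<le> ht y" "ht y \<le> 9 * tau k/4"
  using dcube_strip[OF x assms(2)] by auto
qed

lemma dcube_idx:
 assumes "y \<in> dcube (corner k z) (3 * sig k)"
 shows "z \<in> (\<Pi>\<^sub>E i\<in>UNIV. {\<lfloor>y$i/sig k\<rfloor> - 4 .. \<lfloor>y$i/sig k\<rfloor> + 4})"
proof -
 have "\<lfloor>y$i/sig k\<rfloor> - 4 \<le> z i \<and> z i \<le> \<lfloor>y$i/sig k\<rfloor> + 4" for i
 proof -
  define q where "q = y$i/sig k"
  have yq: "y$i = q * sig k" using sig_pos[of k] by (simp add: q_def)
  have "sig k*(of_int (z i) - 1) - 3 * sig k/2 \<le> y$i" "y$i \<le> sig k*(of_int (z i) - 1) + 3*(3 * sig k)/2"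
   using assms by (auto simp: dcube_def corner_def)
  hence "(of_int (z i) - 1 - 3/2) * sig k \<le> q * sig k" "q * sig k \<le> (of_int (z i) - 1 + 9/2) * sig k"
   unfolding yq by (simp_all add: algebra_simps)
  hence "of_int (z i) - 1 - 3/2 \<le> q" "q \<le> of_int (z i) - 1 + 9/2"
   using sig_pos[of k] by simp_all
  thus ?thesis unfolding q_def[symmetric] by linarith
 qed
 thus ?thesis by (simp add: PiE_def Pi_def extensional_def)
qed

lemma finite_Collect_mem_conj: "finite A ==> finite {x \<in> A. P x}"
 by simp

text \<open>At a level k that reaches y, the height of y lies between tau k/4 and 9 tau k/4. Four
  levels further down tau has shrunk by 16 > 9, so at most four levels occur. On each level every
  coordinate of the cell index lies in a window of nine integers.\<close>

lemma overlap:
 fixes n :: nat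
 shows "card {f \<in> Sigma {1..n} cells. y \<in> dcube (corner (fst f) (snd f)) (3 * sig (fst f))} \<le> 4*9^CARD('d)"
proof -
 define S where "S = {f \<in> Sigma {1..n} cells. y \<in> dcube (corner (fst f) (snd f)) (3 * sig (fst f))}"
 have S: "snd f \<in> cells (fst f)" "y \<in> dcube (corner (fst f) (snd f)) (3 * sig (fst f))" if "f \<in> S" for f
 proof -
  have "f \<in> Sigma {1..n} cells \<and> y \<in> dcube (corner (fst f) (snd f)) (3 * sig (fst f))"
   using that unfolding S_def by (rule CollectD)
  thus "snd f \<in> cells (fst f)" "y \<in> dcube (corner (fst f) (snd f)) (3 * sig (fst f))"
   by (cases f, simp)+
 qed
 have fin: "finite (Sigma {1..n} cells)" by (rule finite_SigmaI) (simp_all add: finite_cells)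
 have fS: "finite S" unfolding S_def using fin by (rule finite_Collect_mem_conj)
 show ?thesis
 proof (cases "S = {}")
  case True
  show ?thesis unfolding S_def[symmetric] True by (simp only: card.empty)
 next
  case False
  define k0 where "k0 = Min (fst ` S)"
  have Ks: "fst ` S \<noteq> {}" "finite (fst ` S)" using False fS by simp_all
  have k0: "k0 \<in> fst ` S" unfolding k0_def by (rule Min_in[OF Ks(2,1)])
  have k0_le: "k0 \<le> k" if "k \<in> fst ` S" for k unfolding k0_def by (rule Min_le[OF Ks(2) that])
  have range: "tau k/4 \<le> ht y \<and> ht y \<le> 9 * tau k/4" if kS: "k \<in> fst ` S" for k
  proof -
   obtain f where f: "k = fst f" "f \<in> S" using kS by (rule imageE)
   show ?thesis unfolding f(1) using cells_dcube(2,3)[OF S[OF f(2)]] by (rule conjI)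
  qed
  have K4: "k \<le> k0 + 3" if k: "k \<in> fst ` S" for k
  proof (rule ccontr)
   assume "\<not> k \<le> k0 + 3"
   hence "(2::real)^(k0 + 4) \<le> 2^k" by (intro power_increasing) auto
   hence k16: "16*2^k0 \<le> (2::real)^k" by (simp add: power_add)
   have "hh/2^k \<le> hh/(16*2^k0)" using hh_pos k16 by (intro divide_left_mono) auto
   hence "tau k \<le> tau k0/16" unfolding tau_def by simp
   with range[OF k] range[OF k0] tau_pos[of k0] show False by linarith
  qed
  let ?Z = "\<lambda>k. \<Pi>\<^sub>E i\<in>(UNIV::'d set). {\<lfloor>y$i/sig k\<rfloor> - 4 .. \<lfloor>y$i/sig k\<rfloor> + 4}"
  have "S \<subseteq> Sigma {k0..k0 + 3} ?Z"
  proof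
   fix f assume f: "f \<in> S"
   have "k0 \<le> fst f" "fst f \<le> k0 + 3" using k0_le[OF imageI[OF f]] K4[OF imageI[OF f]] by simp_all
   hence "fst f \<in> {k0..k0 + 3}" by simp
   with dcube_idx[OF S(2)[OF f]] show "f \<in> Sigma {k0..k0 + 3} ?Z"
    by (cases f, simp only: mem_Sigma_iff fst_conv snd_conv)
  qed
  moreover have fZ: "finite (?Z k)" for k by (rule finite_PiE) simp_all
  hence "finite (Sigma {k0..k0 + 3} ?Z)" by (rule finite_SigmaI[rotated]) simp
  ultimately have "card S \<le> card (Sigma {k0..k0 + 3} ?Z)" by (intro card_mono)
  also have "\<dots> = (\<Sum>k\<in>{k0..k0 + 3}. card (?Z k))" using fZ by (intro card_SigmaI) simp_all
  also have "\<dots> = 4*9^CARD('d)" by (simp add: card_PiE)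
  finally show ?thesis unfolding S_def .
 qed
qed

definition gap :: "(real^'d => real) => nat => real^'d => real" where
 "gap p k x = (p x - p (sig k*\<^sub>R \<nu> + x))^2"

lemma gap_integrable: "sqb p ==> integrable lborel (gap p k)"
 unfolding gap_def[abs_def] by (intro sqint_integrable_square sqint_diff sqint_translate)

text \<open>Both the cell and its translate lie in the block, so p and the translated p are each
  compared with the mean over the block; 4 = 2 + 2.\<close>

lemma cell_gap:
 assumes p: "sqb p"
 shows "iint (cell k z) (gap p k) \<le> 4*(osc (qcube (corner k z) (3 * sig k)) p)^2"
proof -
 let ?Q = "qcube (corner k z) (3 * sig k)"
 define m where "m = avg ?Q p"
 have bQ: "bounded ?Q" "?Q \<in> sets borel" by (auto simp: qcube_cbox)
 have bc: "bounded (cell k z)" "cell k z \<in> sets borel" by (auto simp: cell_def qcube_cbox)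
 have [measurable]: "p \<in> borel_measurable borel" using p by (auto simp: sqint_def)
 define T where "T = (\<lambda>x. sig k*\<^sub>R \<nu> + x) ` cell k z"
 have T: "sig k*\<^sub>R \<nu> + x \<in> T \<longleftrightarrow> x \<in> cell k z" for x by (auto simp: T_def)
 have Tc: "compact T" unfolding T_def cell_def qcube_cbox by (intro compact_continuous_image continuous_intros) auto
 have Ts: "T \<in> sets borel" using compact_imp_closed[OF Tc] by auto
 have TQ: "T \<subseteq> ?Q" using cell_shift by (auto simp: T_def)
 have i1: "integrable lborel (\<lambda>x. indicator (cell k z) x*(p x - m)^2)"
  by (rule iint_integrable_const[OF p bc])
 have i2: "integrable lborel (\<lambda>x. indicator (cell k z) x*(p (sig k*\<^sub>R \<nu> + x) - m)^2)"
  by (rule iint_integrable_const[OF sqint_translate[OF p] bc])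
 have iQ: "integrable lborel (\<lambda>x. indicator ?Q x*(p x - m)^2)" by (rule iint_integrable_const[OF p bQ])
 have iT: "integrable lborel (\<lambda>x. indicator T x*(p x - m)^2)" by (rule iint_integrable_const[OF p compact_imp_bounded[OF Tc] Ts])
 have j1: "integrable lborel (\<lambda>x. 2*(indicator (cell k z) x*(p x - m)^2))"
  by (rule integrable_mult_right, rule i1)
 have j2: "integrable lborel (\<lambda>x. 2*(indicator (cell k z) x*(p (sig k*\<^sub>R \<nu> + x) - m)^2))"
  by (rule integrable_mult_right, rule i2)
 have "iint (cell k z) (gap p k) \<le> (LBINT x. 2*(indicator (cell k z) x*(p x - m)^2) +
   2*(indicator (cell k z) x*(p (sig k*\<^sub>R \<nu> + x) - m)^2))"
  unfolding iint_def
 proof (rule integral_mono[OF iint_integrable[OF gap_integrable[OF p] bc(2)] intble_add[OF j1 j2]])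
  fix x
  have "(a - b)^2 \<le> 2*(a - m)^2 + 2*(b - m)^2" for a b
   using sum_squares_bound[of "a - m" "m - b"] by (simp add: power2_eq_square algebra_simps)
  thus "indicator (cell k z) x * gap p k x \<le> 2*(indicator (cell k z) x*(p x - m)^2) +
   2*(indicator (cell k z) x*(p (sig k*\<^sub>R \<nu> + x) - m)^2)"
   by (simp add: gap_def split: split_indicator)
 qed
 also have "\<dots> = 2 * iint (cell k z) (\<lambda>x. (p x - m)^2) + 2 * iint (cell k z) (\<lambda>x. (p (sig k*\<^sub>R \<nu> + x) - m)^2)"
  unfolding iint_def int_add[OF j1 j2] by (simp only: integral_mult_right_zero)
 also have "iint (cell k z) (\<lambda>x. (p (sig k*\<^sub>R \<nu> + x) - m)^2) = iint T (\<lambda>x. (p x - m)^2)"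
  by (rule iint_translate[OF _ bc(2) T Ts]) simp
 also have "\<dots> \<le> iint ?Q (\<lambda>x. (p x - m)^2)"
  unfolding iint_def using TQ by (intro integral_mono iT iQ) (auto split: split_indicator)
 also have "iint (cell k z) (\<lambda>x. (p x - m)^2) \<le> iint ?Q (\<lambda>x. (p x - m)^2)"
  unfolding iint_def using cell_subset[of k z] by (intro integral_mono i1 iQ) (auto split: split_indicator)
 finally show ?thesis by (simp add: osc_square_iint m_def)
qed

text \<open>The cubes of all levels form a single family with overlap at most 4 * 9^d, so the whole
  sum over the levels, not merely each summand, is bounded by M^2, uniformly in n.\<close>

lemma gap_sum_bound:
 obtains C where "C \<ge> 0" "\<And>p M n. sqb p ==> bnd Om p M ==> 0 \<le> M ==>
  (\<Sum>k\<in>{1..n}. iint (strip (tau k/2) (2 * tau k)) (gap p k)) \<le> C * M^2"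
proof -
 obtain C where C: "C \<ge> 0" and fam: "\<And>(F :: (nat \<times> ('d => int)) set) c l Om (p :: real^'d => real) M N.
   finite F ==> \<forall>f\<in>F. l f > 0 \<and> dcube (c f) (l f) \<subseteq> Om ==>
   \<forall>x. card {f \<in> F. x \<in> dcube (c f) (l f)} \<le> N ==> sqb p ==> bnd Om p M ==> 0 \<le> M ==>
   (\<Sum>f\<in>F. (osc (qcube (c f) (l f)) p)^2) \<le> C * real N * M^2"
  by (rule family_osc_bound, rule that)
 show ?thesis
 proof (rule that[of "4*(C * real (4*9^CARD('d)))"])
  show "0 \<le> 4*(C * real (4*9^CARD('d)))" using C by simp
  fix p M and n :: nat assume p: "sqb p" "bnd Om p M" "0 \<le> M"
  let ?F = "Sigma {1..n} cells"
  let ?Q = "\<lambda>k z. qcube (corner k z) (3 * sig k)"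
  have fin: "finite ?F" by (rule finite_SigmaI) (simp_all add: finite_cells)
  have 1: "\<forall>f\<in>?F. 3 * sig (fst f) > 0 \<and> dcube (corner (fst f) (snd f)) (3 * sig (fst f)) \<subseteq> Om"
  proof
   fix f assume "f \<in> ?F"
   hence "snd f \<in> cells (fst f)" by (cases f) simp
   from cells_dcube(1)[OF this] sig_pos[of "fst f"]
   show "3 * sig (fst f) > 0 \<and> dcube (corner (fst f) (snd f)) (3 * sig (fst f)) \<subseteq> Om" by auto
  qed
  have osc: "(\<Sum>f\<in>?F. (osc (?Q (fst f) (snd f)) p)^2) \<le> C * real (4*9^CARD('d)) * M^2"
   using fam[OF fin 1 _ p] overlap by blast
  have "iint (strip (tau k/2) (2 * tau k)) (gap p k) \<le> (\<Sum>z\<in>cells k. 4*(osc (?Q k z) p)^2)" for k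
  proof -
   have "iint (strip (tau k/2) (2 * tau k)) (gap p k) \<le> (\<Sum>z\<in>cells k. iint (cell k z) (gap p k))"
   proof (rule iint_UN_le[OF finite_cells gap_integrable[OF p(1)] _ sets_strip])
    show "cell k z \<in> sets borel" for z by (simp add: cell_def qcube_cbox)
    show "strip (tau k/2) (2 * tau k) \<subseteq> (\<Union>z\<in>cells k. cell k z)"
     using in_cell by (fastforce simp: cells_def)
    show "0 \<le> gap p k x" for x by (simp add: gap_def)
   qed
   also have "\<dots> \<le> (\<Sum>z\<in>cells k. 4*(osc (?Q k z) p)^2)" by (intro sum_mono cell_gap p)
   finally show ?thesis .
  qed
  hence "(\<Sum>k\<in>{1..n}. iint (strip (tau k/2) (2 * tau k)) (gap p k))
    \<le> (\<Sum>k\<in>{1..n}. \<Sum>z\<in>cells k. 4*(osc (?Q k z) p)^2)" by (intro sum_mono)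
  also have "\<dots> = (\<Sum>f\<in>?F. 4*(osc (?Q (fst f) (snd f)) p)^2)"
   by (subst sum.Sigma) (simp_all add: finite_cells split_def)
  also have "\<dots> = 4*(\<Sum>f\<in>?F. (osc (?Q (fst f) (snd f)) p)^2)" by (rule sum_distrib_left[symmetric])
  finally show "(\<Sum>k\<in>{1..n}. iint (strip (tau k/2) (2 * tau k)) (gap p k)) \<le> 4*(C * real (4*9^CARD('d))) * M^2"
   using osc by linarith
 qed
qed

text \<open>The difference of p and its m-th translate telescopes into m gaps, all located in the
  strip because m \<open>sig k\<close> \<le> \<open>tau k\<close>; Cauchy-Schwarz then costs a
  factor m.\<close>

lemma shift_step:
 assumes p: "sqb p" and m: "m \<le> 2 * steps"
 shows "iint (strip (tau k/2) (tau k)) (\<lambda>x. (p x)^2)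
  \<le> 3*(2 * real steps)^2 * iint (strip (tau k/2) (2 * tau k)) (gap p k)
   + 3/2 * iint (strip (tau k/2 + real m * sig k) (tau k + real m * sig k)) (\<lambda>x. (p x)^2)"
proof -
 let ?D = "strip (tau k/2) (tau k)" and ?G = "iint (strip (tau k/2) (2 * tau k)) (gap p k)"
 let ?t = "\<lambda>j. (real j * sig k)*\<^sub>R \<nu>"
 have [measurable]: "p \<in> borel_measurable borel" using p by (auto simp: sqint_def)
 have gm: "gap p k \<in> borel_measurable borel" unfolding gap_def[abs_def] by measurable
 have gi: "integrable lborel (\<lambda>x. gap p k (?t j + x))" for j
  by (rule lborel_integrable_translation[OF gm, THEN iffD2, OF gap_integrable[OF p]])
 have tele: "p x - p (?t m + x) = (\<Sum>j<m. p (?t j + x) - p (sig k*\<^sub>R \<nu> + (?t j + x)))" for x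
 proof -
  have "sig k*\<^sub>R \<nu> + (?t j + x) = ?t (Suc j) + x" for j by (simp add: algebra_simps)
  hence "(\<Sum>j<m. p (?t j + x) - p (sig k*\<^sub>R \<nu> + (?t j + x))) = (\<Sum>j<m. p (?t j + x) - p (?t (Suc j) + x))"
   by (simp only:)
  also have "\<dots> = p (?t 0 + x) - p (?t m + x)" by (rule sum_lessThan_telescope')
  finally show ?thesis by simp
 qed
 have pw: "(p x)^2 \<le> 3*(real m*(\<Sum>j<m. gap p k (?t j + x))) + 3/2*(p (?t m + x))^2" for x
 proof -
  have "(p x - p (?t m + x))^2 \<le> (\<Sum>j<m. gap p k (?t j + x)) * real m"
   using sum_squared_le_sum_of_squares[of "\<lambda>j. p (?t j + x) - p (sig k*\<^sub>R \<nu> + (?t j + x))" "{..<m}"]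
   unfolding tele gap_def by simp
  \<comment> \<open>Any factor below 2 in front of b^2 would lead to a contraction after averaging
    over two translates; 3/2 is a convenient choice.\<close>
  moreover have "a^2 \<le> 3*(a - b)^2 + 3/2 * b^2" for a b :: real
  proof -
   have "3*(a - b)^2 + 3/2 * b^2 - a^2 = (2 * a - 3 * b)^2/2" by (simp add: power2_eq_square algebra_simps)
   thus ?thesis using zero_le_power2[of "2 * a - 3 * b"] by linarith
  qed
  from this[of "p x" "p (?t m + x)"] calculation show ?thesis by (simp add: mult.commute)
 qed
 have pi: "integrable lborel (\<lambda>x. (p (?t j + x))^2)" for j
  by (rule sqint_integrable_square[OF sqint_translate[OF p]])
 have "iint ?D (\<lambda>x. (p x)^2) \<le> iint ?D (\<lambda>x. 3*(real m*(\<Sum>j<m. gap p k (?t j + x))) + 3/2*(p (?t m + x))^2)"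
 proof (rule iint_mono[OF sqint_integrable_square[OF p] _ sets_strip pw])
  show "integrable lborel (\<lambda>x. 3*(real m*(\<Sum>j<m. gap p k (?t j + x))) + 3/2*(p (?t m + x))^2)"
   by (rule intble_add; rule integrable_mult_right, (rule pi | (rule integrable_mult_right, rule intble_sum, rule gi)))
 qed
 also have "\<dots> = 3*(real m*(\<Sum>j<m. iint ?D (\<lambda>x. gap p k (?t j + x)))) + 3/2 * iint ?D (\<lambda>x. (p (?t m + x))^2)"
 proof -
  have i1: "integrable lborel (\<lambda>x. indicator ?D x * gap p k (?t j + x))" for j
   by (rule iint_integrable[OF gi sets_strip])
  have i2: "integrable lborel (\<lambda>x. indicator ?D x*(p (?t m + x))^2)"
   by (rule iint_integrable[OF pi sets_strip])
  have j1: "integrable lborel (\<lambda>x. 3*(real m*(\<Sum>j<m. indicator ?D x * gap p k (?t j + x))))"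
   by (rule integrable_mult_right, rule integrable_mult_right, rule intble_sum, rule i1)
  have j2: "integrable lborel (\<lambda>x. 3/2*(indicator ?D x*(p (?t m + x))^2))"
   by (rule integrable_mult_right, rule i2)
  have "indicator ?D x*(3*(real m*(\<Sum>j<m. gap p k (?t j + x))) + 3/2*(p (?t m + x))^2) =
   3*(real m*(\<Sum>j<m. indicator ?D x * gap p k (?t j + x))) + 3/2*(indicator ?D x*(p (?t m + x))^2)" for x
   unfolding sum_distrib_left[symmetric] by (simp add: algebra_simps)
  thus ?thesis
   unfolding iint_def by (simp only: int_add[OF j1 j2] integral_mult_right_zero
    int_sum[OF i1])
 qed
 also have "iint ?D (\<lambda>x. (p (?t m + x))^2) = iint (strip (tau k/2 + real m * sig k) (tau k + real m * sig k)) (\<lambda>x. (p x)^2)"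
  by (rule iint_translate[OF _ sets_strip strip_shift sets_strip]) measurable
 also have "3*(real m*(\<Sum>j<m. iint ?D (\<lambda>x. gap p k (?t j + x)))) \<le> 3*(real m*(\<Sum>j<m. ?G))"
 proof (intro mult_left_mono sum_mono)
  fix j assume j: "j \<in> {..<m}"
  have "iint ?D (\<lambda>x. gap p k (?t j + x)) = iint (strip (tau k/2 + real j * sig k) (tau k + real j * sig k)) (gap p k)"
   by (rule iint_translate[OF gm sets_strip strip_shift sets_strip])
  also have "\<dots> \<le> ?G"
  proof (rule iint_mono_set[OF gap_integrable[OF p] sets_strip sets_strip])
   have "real j * sig k \<le> real (2 * steps) * sig k" using j m sig_pos[of k] by (intro mult_right_mono) auto
   hence "real j * sig k \<le> tau k" "0 \<le> real j * sig k" using sig_pos[of k] by (simp_all add: tau_sig)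
   thus "strip (tau k/2 + real j * sig k) (tau k + real j * sig k) \<subseteq> strip (tau k/2) (2 * tau k)"
    by (auto simp: strip_def)
   show "0 \<le> gap p k x" for x by (simp add: gap_def)
  qed
  finally show "iint ?D (\<lambda>x. gap p k (?t j + x)) \<le> ?G" .
 qed simp_all
 also have "3*(real m*(\<Sum>j<m. ?G)) \<le> 3*(2 * real steps)^2 * ?G"
 proof -
  have "real m * real m \<le> (2 * real steps)*(2 * real steps)" using m by (intro mult_mono) auto
  moreover have "0 \<le> ?G" by (rule iint_nonneg) (simp add: gap_def)
  ultimately have "(real m * real m) * ?G \<le> (2 * real steps)^2 * ?G" unfolding power2_eq_square by (rule mult_right_mono)
  thus ?thesis by (simp add: mult.assoc)
 qed
 finally show ?thesis by simp
qed

text \<open>The translates of the layer \<open>(t/2, t]\<close> by \<open>t/2\<close> and by \<open>t\<close> together fill \<open>(t, 2t]\<close>.\<close>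

lemma layer_step:
 assumes p: "sqb p"
 shows "iint (strip (tau (Suc (Suc k))) (tau (Suc k))) (\<lambda>x. (p x)^2)
  \<le> 12*(real steps)^2 * iint (strip (tau (Suc k)/2) (2 * tau (Suc k))) (gap p (Suc k))
   + 3/4 * iint (strip (tau (Suc k)) (tau k)) (\<lambda>x. (p x)^2)"
proof -
 define t where "t = tau (Suc k)"
 have t: "tau (Suc (Suc k)) = t/2" "tau k = 2 * t" "t > 0"
  unfolding t_def using tau_Suc[of k] tau_Suc[of "Suc k"] tau_pos by simp_all
 have s: "real steps * sig (Suc k) = t/2" "real (2 * steps) * sig (Suc k) = t"
  using tau_sig[of "Suc k"] by (simp_all add: t_def)
 have ip: "integrable lborel (\<lambda>x. (p x)^2)" by (rule sqint_integrable_square[OF p])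
 let ?I = "\<lambda>a b. iint (strip a b) (\<lambda>x. (p x)^2)"
 \<comment> \<open>Strips are open below and closed above, so the two translated layers are disjoint
   and leave no gap.\<close>
 have "?I (t/2 + t/2) (t + t/2) + ?I (t/2 + t) (t + t) = ?I t (2 * t)"
 proof -
  have "?I (t/2 + t/2) (t + t/2) + ?I (t/2 + t) (t + t) =
   (LBINT x. indicator (strip (t/2 + t/2) (t + t/2)) x*(p x)^2 + indicator (strip (t/2 + t) (t + t)) x*(p x)^2)"
   unfolding iint_def
   by (rule int_add[OF iint_integrable[OF ip sets_strip] iint_integrable[OF ip sets_strip], symmetric])
  also have "\<dots> = ?I t (2 * t)"
   unfolding iint_def using t(3) by (intro int_cong) (auto simp: strip_def split: split_indicator)
  finally show ?thesis .
 qed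
 moreover have "?I (t/2) t \<le> 3*(2 * real steps)^2 * iint (strip (t/2) (2 * t)) (gap p (Suc k)) + 3/2 * ?I (t/2 + t/2) (t + t/2)"
  by (rule shift_step[OF p, of steps "Suc k", unfolded s t_def[symmetric]]) simp
 moreover have "?I (t/2) t \<le> 3*(2 * real steps)^2 * iint (strip (t/2) (2 * t)) (gap p (Suc k)) + 3/2 * ?I (t/2 + t) (t + t)"
  by (rule shift_step[OF p, of "2 * steps" "Suc k", unfolded s t_def[symmetric]]) simp
 moreover have "3*(2 * real steps)^2 = 12*(real steps)^2" by (simp add: power_mult_distrib)
 ultimately have "?I (t/2) t \<le> 12*(real steps)^2 * iint (strip (t/2) (2 * t)) (gap p (Suc k)) + 3/4 * ?I t (2 * t)" by simp
 thus ?thesis unfolding t(1,2) t_def[symmetric] .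
qed

lemma layers_sum:
 assumes p: "sqb p"
 shows "iint (strip (tau (Suc n)) hh) (\<lambda>x. (p x)^2) \<le> 4 * iint (strip (hh/2) hh) (\<lambda>x. (p x)^2)
  + 48*(real steps)^2*(\<Sum>k\<in>{1..n}. iint (strip (tau k/2) (2 * tau k)) (gap p k))"
proof -
 define J where "J k = iint (strip (tau (Suc k)) (tau k)) (\<lambda>x. (p x)^2)" for k
 define G where "G k = iint (strip (tau k/2) (2 * tau k)) (gap p k)" for k
 have ip: "integrable lborel (\<lambda>x. (p x)^2)" by (rule sqint_integrable_square[OF p])
 have J: "J (Suc k) \<le> 12*(real steps)^2 * G (Suc k) + 3/4 * J k" for k
  unfolding J_def G_def by (rule layer_step[OF p])
 have J0: "J k \<ge> 0" for k unfolding J_def by (rule iint_nonneg) simp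
 \<comment> \<open>The extra term 3 J n makes the induction close: one step adds 4 J (n+1) - 3 J n,
   which the layer estimate bounds by 48 steps^2 G (n+1).\<close>
 have "(\<Sum>k\<le>n. J k) + 3 * J n \<le> 4 * J 0 + 48*(real steps)^2*(\<Sum>k\<in>{1..n}. G k)"
 proof (induction n)
  case (Suc n)
  from Suc J[of n] show ?case by (simp add: distrib_left)
 qed simp
 with J0[of n] have "(\<Sum>k\<le>n. J k) \<le> 4 * J 0 + 48*(real steps)^2*(\<Sum>k\<in>{1..n}. G k)" by linarith
 moreover have "iint (strip (tau (Suc n)) hh) (\<lambda>x. (p x)^2) \<le> (\<Sum>k\<le>n. J k)"
  unfolding J_def
 proof (rule iint_UN_le[OF _ ip sets_strip sets_strip])
  have "x \<in> (\<Union>k\<le>n. strip (tau (Suc k)) (tau k))" if "x \<in> strip (tau (Suc n)) (tau 0)" for x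
   using that
  proof (induction n)
   case (Suc n)
   show ?case
   proof (cases "x \<in> strip (tau (Suc n)) (tau 0)")
    case True
    from Suc.IH[OF this] obtain k where "k \<le> n" "x \<in> strip (tau (Suc k)) (tau k)" by auto
    thus ?thesis by (intro UN_I[of k]) auto
   next
    case False
    with Suc.prems have "x \<in> strip (tau (Suc (Suc n))) (tau (Suc n))" by (auto simp: strip_def)
    thus ?thesis by (intro UN_I[of "Suc n"]) auto
   qed
  qed auto
  thus "strip (tau (Suc n)) hh \<subseteq> (\<Union>k\<in>{..n}. strip (tau (Suc k)) (tau k))" by (auto simp: tau_def)
 qed auto
 moreover have "J 0 = iint (strip (hh/2) hh) (\<lambda>x. (p x)^2)" by (simp add: J_def tau_def)
 ultimately show ?thesis unfolding G_def by linarith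
qed

text \<open>Finitely many layers never reach the boundary; since the bound on them is uniform in n,
  it passes to the limit.\<close>

lemma full_strip:
 assumes p: "sqb p"
 shows "(\<lambda>n. iint (strip (tau (Suc n)) hh) (\<lambda>x. (p x)^2)) \<longlonglongrightarrow> iint (strip 0 hh) (\<lambda>x. (p x)^2)"
 unfolding iint_def
proof (rule integral_dominated_convergence[where w = "\<lambda>x. (p x)^2"])
 have [measurable]: "p \<in> borel_measurable borel" "\<And>a b. strip a b \<in> sets borel" using p sets_strip by (auto simp: sqint_def)
 show "(\<lambda>x. indicator (strip 0 hh) x*(p x)^2) \<in> borel_measurable lborel" by measurable
 show "(\<lambda>x. indicator (strip (tau (Suc n)) hh) x*(p x)^2) \<in> borel_measurable lborel" for n by measurable
 show "integrable lborel (\<lambda>x. (p x)^2)" by (rule sqint_integrable_square[OF p])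
 have tau0: "(\<lambda>n. tau (Suc n)) \<longlonglongrightarrow> 0"
  unfolding tau_def by (rule LIMSEQ_Suc) (rule LIMSEQ_divide_realpow_zero, simp)
 show "AE x in lborel. (\<lambda>n. indicator (strip (tau (Suc n)) hh) x*(p x)^2) \<longlonglongrightarrow> indicator (strip 0 hh) x*(p x)^2"
 proof (rule AE_I2)
  fix x
  have "\<forall>\<^sub>F n in sequentially. indicator (strip (tau (Suc n)) hh) x*(p x)^2 = indicator (strip 0 hh) x*(p x)^2"
  proof (cases "0 < ht x")
   case True
   from order_tendstoD(2)[OF tau0 True] show ?thesis
    by eventually_elim (use True in \<open>auto simp: strip_def split: split_indicator\<close>)
  next
   case False
   hence "\<not> tau n < ht x" for n using tau_pos[of n] by linarith
   with False show ?thesis by (auto simp: strip_def)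
  qed
  thus "(\<lambda>n. indicator (strip (tau (Suc n)) hh) x*(p x)^2) \<longlonglongrightarrow> indicator (strip 0 hh) x*(p x)^2"
   by (rule tendsto_eventually)
 qed
 show "AE x in lborel. norm (indicator (strip (tau (Suc n)) hh) x*(p x)^2) \<le> (p x)^2" for n
  by (auto split: split_indicator)
qed

text \<open>The compact set is the closed top layer, at a positive distance from the boundary. No
  mean is subtracted from p, so the estimate can be used after any constant has been removed from
  the function on the whole domain.\<close>

lemma boundary_estimate:
 obtains U K A where "open U" "x0 \<in> U" "compact K" "K \<subseteq> Om" "0 \<le> A"
  "\<And>p M. sqb p ==> bnd Om p M ==> 0 \<le> M ==>
   iint (U \<inter> Om) (\<lambda>x. (p x)^2) \<le> A*(M^2 + iint K (\<lambda>x. (p x)^2))"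
proof -
 obtain C where C: "C \<ge> 0" and gap: "\<And>p M n. sqb p ==> bnd Om p M ==> 0 \<le> M ==>
  (\<Sum>k\<in>{1..n}. iint (strip (tau k/2) (2 * tau k)) (gap p k)) \<le> C * M^2"
  by (rule gap_sum_bound, rule that)
 define U where "U = {x. norm (prj x - prj x0) < rad \<and> - hh < ht x \<and> ht x < hh}"
 define K where "K = {x. norm (prj x - prj x0) \<le> rad \<and> hh/2 \<le> ht x \<and> ht x \<le> hh}"
 define A where "A = 4 + 48*(real steps)^2 * C"
 have A: "4 \<le> A" "48*(real steps)^2 * C \<le> A" using C by (simp_all add: A_def)
 show ?thesis
 proof (rule that[of U K A])
  show "open U" unfolding U_def
   by (intro open_Collect_conj open_Collect_less continuous_intros continuous_ht continuous_prj)
  show "x0 \<in> U" using rad_pos hh_pos by (simp add: U_def ht_x0)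
  have nr: "norm (x - x0) \<le> r/2" if "x \<in> K" for x using that hh_pos by (intro near_x0) (auto simp: K_def)
  have "closed K" unfolding K_def
   by (intro closed_Collect_conj closed_Collect_le continuous_intros continuous_ht continuous_prj)
  moreover have "K \<subseteq> cball x0 (r/2)" using nr by (auto simp: dist_norm norm_minus_commute)
  ultimately show Kc: "compact K" using bounded_subset[OF bounded_cball] compact_eq_bounded_closed by blast
  show "K \<subseteq> Om"
  proof
   fix x assume x: "x \<in> K"
   hence "0 < ht x" using hh_pos by (simp add: K_def)
   thus "x \<in> Om" using in_Om_iff[of x] nr[OF x] r by simp
  qed
  show "0 \<le> A" using A by simp
  fix p M assume p: "sqb p" "bnd Om p M" "0 \<le> M"
  have ip: "integrable lborel (\<lambda>x. (p x)^2)" by (rule sqint_integrable_square[OF p(1)])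
  have Kb: "K \<in> sets borel" using Kc by (simp add: compact_imp_closed)
  have UO: "U \<inter> Om \<subseteq> strip 0 hh"
  proof
   fix x assume x: "x \<in> U \<inter> Om"
   hence "norm (x - x0) \<le> r/2" using hh_pos by (intro near_x0) (auto simp: U_def)
   hence "0 < ht x" using in_Om_iff[of x] x r by simp
   with x show "x \<in> strip 0 hh" by (auto simp: U_def strip_def)
  qed
  have "iint (U \<inter> Om) (\<lambda>x. (p x)^2) \<le> iint (strip 0 hh) (\<lambda>x. (p x)^2)"
   using \<open>open U\<close> Om by (intro iint_mono_set[OF ip _ sets_strip UO]) (auto intro: borel_open)
  also have "\<dots> \<le> 4 * iint (strip (hh/2) hh) (\<lambda>x. (p x)^2) + 48*(real steps)^2*(C * M^2)"
  proof (rule LIMSEQ_le_const2[OF full_strip[OF p(1)]], rule exI, rule allI, rule impI)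
   fix n :: nat
   have "48*(real steps)^2*(\<Sum>k\<in>{1..n}. iint (strip (tau k/2) (2 * tau k)) (gap p k)) \<le> 48*(real steps)^2*(C * M^2)"
    by (intro mult_left_mono gap p) simp
   with layers_sum[OF p(1), of n]
   show "iint (strip (tau (Suc n)) hh) (\<lambda>x. (p x)^2) \<le> 4 * iint (strip (hh/2) hh) (\<lambda>x. (p x)^2) + 48*(real steps)^2*(C * M^2)"
    by linarith
  qed
  also have "iint (strip (hh/2) hh) (\<lambda>x. (p x)^2) \<le> iint K (\<lambda>x. (p x)^2)"
   by (rule iint_mono_set[OF ip sets_strip Kb]) (auto simp: strip_def K_def)
  also have "4 * iint K (\<lambda>x. (p x)^2) \<le> A * iint K (\<lambda>x. (p x)^2)"
   by (intro mult_right_mono A iint_nonneg) simp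
  also have "48*(real steps)^2*(C * M^2) \<le> A * M^2"
   unfolding mult.assoc[symmetric] by (intro mult_right_mono A) simp
  finally show "iint (U \<inter> Om) (\<lambda>x. (p x)^2) \<le> A*(M^2 + iint K (\<lambda>x. (p x)^2))" by (simp add: distrib_left)
 qed
qed

end

section \<open>From local estimates to the whole domain\<close>

lemma divf_integral_zero: "vtf K w ==> compact K ==> (LBINT x. divf w x) = 0"
proof -
 assume w: "vtf K w" "compact K"
 have "integrable lborel (pd (w i) i)" for i
  by (rule tf_integrable[OF tf_pd[OF vtfD[OF w(1)] compact_imp_closed[OF w(2)]] w(2)])
 hence "(LBINT x. divf w x) = (\<Sum>i\<in>UNIV. (LBINT x. pd (w i) i x))"
  unfolding divf_def by (intro int_sum)
 also have "\<dots> = 0" by (intro sum.neutral ballI integral_pd_eq_0[OF vtfD[OF w(1)] w(2)])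
 finally show ?thesis .
qed

lemma divf_outside: "vtf K w ==> compact K ==> x \<notin> K ==> divf w x = 0"
 unfolding divf_def by (intro sum.neutral ballI tf_eq_0[OF tf_pd[OF vtfD compact_imp_closed]])

text \<open>The divergence of a field with compact support integrates to zero, so constants are
  invisible to the gradient norm.\<close>

lemma bnd_minus_const:
 assumes p: "sqb p" and Om: "bounded Om" "Om \<in> sets borel" and b: "bnd Om p M"
 shows "bnd Om (\<lambda>x. p x - m * indicator Om x) M"
 unfolding bnd_def
proof (intro allI impI)
 fix K w assume a: "compact K \<and> K \<subseteq> Om \<and> vtf K w"
 have s: "sqb (divf w)" using a by (intro divf_sqint) auto
 have i1: "integrable lborel (\<lambda>x. p x * divf w x)" by (rule sqint_mult_integrable[OF p s])
 have i2: "integrable lborel (\<lambda>x. m * divf w x)"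
  unfolding divf_def[abs_def] using a
  by (intro integrable_mult_right intble_sum tf_integrable[of K] tf_pd vtfD compact_imp_closed) auto
 have "(p x - m * indicator Om x) * divf w x = p x * divf w x - m * divf w x" for x
  using divf_outside[of K w x] a by (cases "x \<in> Om") (auto simp: left_diff_distrib)
 hence "(LBINT x. (p x - m * indicator Om x) * divf w x) = (LBINT x. p x * divf w x)"
  by (simp only: int_diff[OF i1 i2]) (use divf_integral_zero[of K w] a in simp)
 thus "\<bar>LBINT x. (p x - m * indicator Om x) * divf w x\<bar> \<le> M * gnorm w"
  using bndD[OF b, of K w] a by (simp only:)
qed

text \<open>The mean is the best approximating constant in L^2. Here the mean over the domain is
  zero, whereas m will be the mean over a small cube.\<close>

lemma square_minus_mean:
 assumes p: "sqb p" "\<forall>x. x \<notin> Om \<longrightarrow> p x = 0" "(LBINT x. p x) = 0" and Om: "bounded Om" "Om \<in> sets borel"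
 shows "(LBINT x. (p x)^2) \<le> (LBINT x. (p x - m * indicator Om x)^2)"
proof -
 have s1: "sqb (\<lambda>x. m * indicator Om x)"
 proof -
  have "integrable lborel (\<lambda>x. m^2 * indicator Om x)"
   using emeasure_bounded_finite[OF Om(1)] Om(2) by (intro integrable_mult_right integrable_real_indicator) auto
  moreover have "(m * indicator Om x)^2 = m^2 * indicator Om x" for x by (simp add: power_mult_distrib split: split_indicator)
  ultimately show ?thesis using Om(2) by (simp add: sqint_def)
 qed
 have e: "p x*(m * indicator Om x) = m * p x" for x
  using p(2)[rule_format, of x] by (simp split: split_indicator)
 have i1: "integrable lborel (\<lambda>x. m * p x)"
  using sqint_mult_integrable[OF p(1) s1] by (simp only: e)
 have "(LBINT x. (p x)^2) - (LBINT x. 2*(m * p x)) = (LBINT x. (p x)^2 - 2*(m * p x))"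
  by (rule int_diff[symmetric, OF sqint_integrable_square[OF p(1)] integrable_mult_right[OF i1]])
 also have "\<dots> \<le> (LBINT x. (p x - m * indicator Om x)^2)"
 proof (rule integral_mono)
  show "integrable lborel (\<lambda>x. (p x)^2 - 2*(m * p x))"
   by (rule intble_diff[OF sqint_integrable_square[OF p(1)] integrable_mult_right[OF i1]])
  show "integrable lborel (\<lambda>x. (p x - m * indicator Om x)^2)"
   by (rule sqint_integrable_square[OF sqint_diff[OF p(1) s1]])
  fix x show "(p x)^2 - 2*(m * p x) \<le> (p x - m * indicator Om x)^2"
   unfolding power2_diff using e[of x] zero_le_power2[of "m * indicator Om x"] by linarith
 qed
 finally show ?thesis by (simp add: p(3))
qed

lemma negative_norm:
 fixes Om :: "(real^'d) set"
 assumes "bounded_lipschitz_domain Om"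
 obtains A where "A \<ge> 0"
  "\<And>p M. sqb p ==> \<forall>x. x \<notin> Om \<longrightarrow> p x = 0 ==> (LBINT x. p x) = 0 ==> bnd Om p M ==> 0 \<le> M ==>
   nm p \<le> A * M"
proof -
 have Om: "Om \<noteq> {}" "open Om" "connected Om" "bounded Om" and lb: "lipschitz_boundary Om"
  using assms by (auto simp: bounded_lipschitz_domain_def)
 have Oms: "Om \<in> sets borel" using Om(2) by (rule borel_open)
 \<comment> \<open>Neighbourhood, compact set and constant are packed into one triple, so that a
   single choice over the frontier supplies them together.\<close>
 define good where "good x U K A \<longleftrightarrow> open U \<and> x \<in> U \<and> compact K \<and> K \<subseteq> Om \<and> 0 \<le> A \<and>
  (\<forall>p M. sqb p \<longrightarrow> bnd Om p M \<longrightarrow> 0 \<le> M \<longrightarrow>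
   iint (U \<inter> Om) (\<lambda>x. (p x)^2) \<le> A*(M^2 + iint K (\<lambda>x. (p x)^2)))" for x and U K :: "(real^'d) set" and A
 have "\<exists>s. good x0 (fst s) (fst (snd s)) (snd (snd s))" if xf: "x0 \<in> frontier Om" for x0
  using bspec[OF lb[unfolded lipschitz_boundary_def] xf]
 proof (elim exE conjE)
  fix r \<nu> L g assume g: "0 < r" "norm \<nu> = 1" "L-lipschitz_on {y. y \<bullet> \<nu> = 0} g"
   "Om \<inter> ball x0 r = {x \<in> ball x0 r. g (x - (x \<bullet> \<nu>)*\<^sub>R \<nu>) < x \<bullet> \<nu>}"
  obtain U K A where "open U" "x0 \<in> U" "compact K" "K \<subseteq> Om" "0 \<le> A"
   "\<And>p M. sqb p ==> bnd Om p M ==> 0 \<le> M ==>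
    iint (U \<inter> Om) (\<lambda>x. (p x)^2) \<le> A*(M^2 + iint K (\<lambda>x. (p x)^2))"
   by (rule boundary_estimate[OF Om(2) xf g], rule that)
  hence "good x0 U K A" by (simp add: good_def)
  thus ?thesis by (intro exI[of _ "(U, K, A)"]) simp
 qed
 hence "\<forall>x\<in>frontier Om. \<exists>s. good x (fst s) (fst (snd s)) (snd (snd s))" ..
 then obtain s where s: "\<forall>x\<in>frontier Om. good x (fst (s x)) (fst (snd (s x))) (snd (snd (s x)))"
  by (rule bchoice[THEN exE])
 define U K B where "U x = fst (s x)" and "K x = fst (snd (s x))" and "B x = snd (snd (s x))" for x
 have G: "open (U x)" "x \<in> U x" "compact (K x)" "K x \<subseteq> Om" "0 \<le> B x"
  "\<And>p M. sqb p ==> bnd Om p M ==> 0 \<le> M ==>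
   iint (U x \<inter> Om) (\<lambda>x. (p x)^2) \<le> B x*(M^2 + iint (K x) (\<lambda>x. (p x)^2))" if "x \<in> frontier Om" for x
  using bspec[OF s that] unfolding good_def U_def K_def B_def by simp_all
 have "compact (frontier Om)" using Om(4) by (rule compact_frontier_bounded)
 from this _ _ obtain T where T: "T \<subseteq> frontier Om" "finite T" "frontier Om \<subseteq> (\<Union>x\<in>T. U x)"
 proof (rule compactE_image)
  show "open (U x)" if "x \<in> frontier Om" for x by (rule G(1)[OF that])
  show "frontier Om \<subseteq> (\<Union>x\<in>frontier Om. U x)" by (rule subsetI, rule UN_I, assumption, rule G(2))
 qed (rule that)
 \<comment> \<open>What the boundary neighbourhoods leave of the closure is compact and inside the
   domain. \<open>Ka\<close> adds the compact sets on which the boundary estimates rest, so one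
   interior estimate serves all of them.\<close>
 define K0 where "K0 = closure Om - (\<Union>x\<in>T. U x)"
 define Ka where "Ka = K0 \<union> (\<Union>x\<in>T. K x)"
 have "compact (closure Om)" using Om(4) by simp
 moreover have "open (\<Union>x\<in>T. U x)" using T(1) G(1) by blast
 ultimately have K0c: "compact K0" unfolding K0_def by (rule compact_diff)
 have K0: "K0 \<subseteq> Om" using T(3) Om(2) by (auto simp: K0_def frontier_def interior_open)
 have Kac: "compact Ka" "Ka \<subseteq> Om"
 proof -
  have K: "compact (K x)" "K x \<subseteq> Om" if "x \<in> T" for x by (rule G(3,4)[OF subsetD[OF T(1) that]])+
  show "compact Ka" unfolding Ka_def by (intro compact_Un K0c compact_UN T(2) ballI K(1))
  show "Ka \<subseteq> Om" unfolding Ka_def by (intro Un_least K0 UN_least K(2))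
 qed
 obtain a where a: "a \<in> Om" using Om(1) by blast
 obtain l where l: "l > 0" "dcube (a - (\<chi> i. l/2)) l \<subseteq> Om" by (rule cube_around[OF Om(2) a])
 obtain A0 where A0: "A0 \<ge> 0" and int: "\<And>p M. sqb p ==> bnd Om p M ==> 0 \<le> M ==>
   iint Ka (\<lambda>x. (p x - avg (qcube (a - (\<chi> i. l/2)) l) p)^2) \<le> A0 * M^2"
  by (rule interior_estimate[OF Om(2,3) l Kac], rule that)
 define A where "A = A0 + (\<Sum>x\<in>T. B x*(1 + A0))"
 have A: "0 \<le> A" unfolding A_def using A0 T(1) G(5) by (auto intro!: add_nonneg_nonneg sum_nonneg mult_nonneg_nonneg)
 show ?thesis
 proof (rule that[of "sqrt A"])
  show "0 \<le> sqrt A" using A by simp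
  fix p M assume p: "sqb p" "\<forall>x. x \<notin> Om \<longrightarrow> p x = 0" "(LBINT x. p x) = 0" and b: "bnd Om p M" and M: "0 \<le> M"
  \<comment> \<open>The constant of the interior estimate. The boundary estimates are applied to q
    instead of p, so that the terms over compact sets are those already bounded.\<close>
  define m where "m = avg (qcube (a - (\<chi> i. l/2)) l) p"
  define q where "q x = p x - m * indicator Om x" for x
  have q: "sqb q" unfolding q_def[abs_def] by (rule sqint_local_const[OF p(1) Om(4) Oms])
  have bq: "bnd Om q M" unfolding q_def[abs_def] by (rule bnd_minus_const[OF p(1) Om(4) Oms b])
  have iq: "integrable lborel (\<lambda>x. (q x)^2)" by (rule sqint_integrable_square[OF q])
  have cs: "compact S ==> S \<in> sets borel" for S :: "(real^'d) set" by (simp add: compact_imp_closed)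
  have Ka: "iint Ka (\<lambda>x. (q x)^2) \<le> A0 * M^2"
   unfolding q_def iint_local_const[OF Kac(2)] m_def by (rule int[OF p(1) b M])
  have K: "iint S (\<lambda>x. (q x)^2) \<le> A0 * M^2" if "compact S" "S \<subseteq> Ka" for S
   using iint_mono_set[OF iq cs[OF that(1)] cs[OF Kac(1)] that(2)] Ka by simp
  have Ub: "iint (U x \<inter> Om) (\<lambda>x. (q x)^2) \<le> B x*(1 + A0) * M^2" if x: "x \<in> T" for x
  proof -
   have f: "x \<in> frontier Om" using T(1) x by blast
   have "iint (U x \<inter> Om) (\<lambda>x. (q x)^2) \<le> B x*(M^2 + iint (K x) (\<lambda>x. (q x)^2))" by (rule G(6)[OF f q bq M])
   also have "\<dots> \<le> B x*(M^2 + A0 * M^2)"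
    using x by (intro mult_left_mono add_left_mono K G(3)[OF f] G(5)[OF f]) (auto simp: Ka_def)
   finally show ?thesis by (simp add: algebra_simps)
  qed
  have "(LBINT x. (q x)^2) = iint Om (\<lambda>x. (q x)^2)"
   unfolding iint_def using p(2) by (intro int_cong) (auto simp: q_def split: split_indicator)
  \<comment> \<open>\<open>None\<close> indexes the interior part and \<open>Some x\<close> the
    neighbourhood of a frontier point.\<close>
  also have "\<dots> \<le> (\<Sum>e\<in>insert None (Some ` T). iint (case e of None => K0 | Some x => U x \<inter> Om) (\<lambda>x. (q x)^2))"
  proof (rule iint_UN_le[OF _ iq _ Oms])
   show "Om \<subseteq> (\<Union>e\<in>insert None (Some ` T). case e of None => K0 | Some x => U x \<inter> Om)"
    using closure_subset[of Om] by (auto simp: K0_def)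
   show "(case e of None => K0 | Some x => U x \<inter> Om) \<in> sets borel" if "e \<in> insert None (Some ` T)" for e
   proof (cases e)
    case (Some x)
    hence "x \<in> T" using that by auto
    from G(1)[OF subsetD[OF T(1) this]] show ?thesis unfolding Some using Om(2) by (simp add: borel_open open_Int)
   qed (simp add: cs[OF K0c])
  qed (use T(2) in auto)
  also have "\<dots> = iint K0 (\<lambda>x. (q x)^2) + (\<Sum>x\<in>T. iint (U x \<inter> Om) (\<lambda>x. (q x)^2))"
   using T(2) by (subst sum.insert) (auto simp: sum.reindex)
  also have "\<dots> \<le> A0 * M^2 + (\<Sum>x\<in>T. B x*(1 + A0) * M^2)"
   by (intro add_mono sum_mono Ub K K0c) (auto simp: Ka_def)
  also have "\<dots> = A * M^2" by (simp add: A_def distrib_right sum_distrib_right)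
  finally have "(nm p)^2 \<le> A * M^2"
   unfolding nrm2_square using square_minus_mean[OF p Om(4) Oms, of m] unfolding q_def by simp
  hence "sqrt ((nm p)^2) \<le> sqrt (A * M^2)" by (rule real_sqrt_le_mono)
  thus "nm p \<le> sqrt A * M" using M by (simp add: real_sqrt_mult)
 qed
qed

subsection \<open>Representatives and the fundamental lemma\<close>

abbreviation "leb \<equiv> lebesgue_on"
abbreviation "ip \<equiv> L2_inner"
abbreviation "wg \<equiv> weak_grad"
abbreviation "wd \<equiv> weak_div"
abbreviation "TF \<equiv> test_functions"

lemma lebesgue_on_integral_borel:
 fixes f :: "'a::euclidean_space => real"
 assumes S: "S \<in> sets borel" and f: "f \<in> borel_measurable borel" and f0: "\<And>x. x \<notin> S ==> f x = 0"
 shows "(LINT x|lebesgue_on S. f x) = (LBINT x. f x)"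
  and "integrable (lebesgue_on S) f \<longleftrightarrow> integrable lborel f"
proof -
 have e: "(\<lambda>x. indicator S x*\<^sub>R f x) = f" using f0 by (auto simp: fun_eq_iff split: split_indicator)
 have S': "S \<inter> space lebesgue \<in> sets lebesgue" using S by simp
 show "(LINT x|lebesgue_on S. f x) = (LBINT x. f x)"
  unfolding integral_restrict_space[OF S'] e using f by (simp add: integral_completion)
 show "integrable (lebesgue_on S) f \<longleftrightarrow> integrable lborel f"
  unfolding integrable_restrict_space[OF S'] e using f by (simp add: integrable_completion)
qed

lemma borel_imp_lebesgue_on:
 fixes f :: "'a::euclidean_space => 'b::second_countable_topology"
 assumes "f \<in> borel_measurable borel" shows "f \<in> borel_measurable (lebesgue_on S)"
 using assms by (intro measurable_restrict_space1 measurable_completion) simp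

lemma sqint_lebesgue_on:
 fixes f :: "'a::euclidean_space => real"
 assumes S: "S \<in> sets borel" and f: "sqb f"
 shows "sqint (lebesgue_on S) f"
 unfolding sqint_def
proof
 have m: "f \<in> borel_measurable borel" using f by (auto simp: sqint_def)
 thus "f \<in> borel_measurable (lebesgue_on S)" by (rule borel_imp_lebesgue_on)
 have S': "S \<inter> space lebesgue \<in> sets lebesgue" using S by simp
 have "integrable lebesgue (\<lambda>x. (f x)^2)"
  using m sqint_integrable_square[OF f] by (subst integrable_completion) auto
 from integrable_mult_indicator[OF _ this, of S]
 show "integrable (lebesgue_on S) (\<lambda>x. (f x)^2)"
  unfolding integrable_restrict_space[OF S'] using S by simp
qed

text \<open>The spaces refer to the completed measure on the domain, the calculus above to Borel
  functions on the whole space. A Borel representative that vanishes outside S keeps the norm and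
  all pairings with Borel functions.\<close>

lemma sqint_borel_representative:
 fixes f :: "'a::euclidean_space => real"
 assumes S: "S \<in> sets borel" and f: "sqint (lebesgue_on S) f"
 obtains f' where "sqb f'" "\<forall>x. x \<notin> S \<longrightarrow> f' x = 0" "AE x in lebesgue_on S. f x = f' x"
  "\<forall>h\<in>borel_measurable borel. (LINT x|lebesgue_on S. f x * h x) = (LBINT x. f' x * h x)"
  "nrm2 (lebesgue_on S) f = nm f'"
proof -
 have S': "S \<inter> space lebesgue \<in> sets lebesgue" using S by simp
 have fm: "f \<in> borel_measurable (lebesgue_on S)" using f by (auto simp: sqint_def)
 hence "(\<lambda>x. indicator S x*\<^sub>R f x) \<in> borel_measurable (completion lborel)"
  unfolding borel_measurable_restrict_space_iff[OF S'] by simp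
 hence "(\<lambda>x. indicator S x * f x) \<in> borel_measurable (completion lborel)" by simp
 from completion_ex_borel_measurable_real[OF this]
 obtain g where g: "g \<in> borel_measurable lborel" "AE x in lborel. indicator S x * f x = g x" by (rule bexE)
 have [measurable]: "g \<in> borel_measurable borel" "S \<in> sets borel" using g(1) S by simp_all
 define f' where "f' x = indicator S x * g x" for x
 have m': "f' \<in> borel_measurable borel" unfolding f'_def[abs_def] by measurable
 have ae: "AE x in lebesgue_on S. f x = f' x"
  unfolding AE_restrict_space_iff[OF S'] AE_completion_iff
  using g(2) by eventually_elim (rule impI, simp add: f'_def)
 have f'0: "f' x = 0" if "x \<notin> S" for x using that by (simp add: f'_def)
 have fm': "f' \<in> borel_measurable (lebesgue_on S)" using m' by (rule borel_imp_lebesgue_on)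
 have "integrable (lebesgue_on S) (\<lambda>x. (f' x)^2)"
  by (rule Bochner_Integration.integrable_cong_AE_imp[OF sqint_integrable_square[OF f]]) (use fm' ae in auto)
 hence "integrable lborel (\<lambda>x. (f' x)^2)"
  by (subst (asm) lebesgue_on_integral_borel(2)[OF S]) (use m' f'0 in auto)
 hence s: "sqb f'" using m' by (simp add: sqint_def)
 have "(LINT x|lebesgue_on S. f x * h x) = (LBINT x. f' x * h x)" if h: "h \<in> borel_measurable borel" for h
 proof -
  have "(LINT x|lebesgue_on S. f x * h x) = (LINT x|lebesgue_on S. f' x * h x)"
  proof (rule integral_cong_AE)
   show "(\<lambda>x. f x * h x) \<in> borel_measurable (lebesgue_on S)" "(\<lambda>x. f' x * h x) \<in> borel_measurable (lebesgue_on S)"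
    by (intro borel_measurable_times fm fm' borel_imp_lebesgue_on[OF h])+
   show "AE x in lebesgue_on S. f x * h x = f' x * h x" using ae by eventually_elim simp
  qed
  also have "\<dots> = (LBINT x. f' x * h x)"
   using m' h f'0 by (intro lebesgue_on_integral_borel(1)[OF S]) auto
  finally show ?thesis .
 qed
 moreover have "nrm2 (lebesgue_on S) f = nm f'"
 proof -
  have "nrm2 (lebesgue_on S) f = nrm2 (lebesgue_on S) f'" by (rule nrm2_cong_AE[OF fm fm' ae])
  also have "\<dots> = nm f'"
   unfolding nrm2_def using m' f'0 by (intro arg_cong[of _ _ sqrt] lebesgue_on_integral_borel(1)[OF S]) auto
  finally show ?thesis .
 qed
 ultimately show ?thesis using f'0 by (intro that[OF s _ ae]) auto
qed

lemma test_functions_iff: "\<phi> \<in> TF Om \<longleftrightarrow> (\<exists>K. compact K \<and> K \<subseteq> Om \<and> tf K \<phi>)"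
proof
 assume "\<phi> \<in> TF Om"
 thus "\<exists>K. compact K \<and> K \<subseteq> Om \<and> tf K \<phi>"
  using closure_subset[of "{x. \<phi> x \<noteq> 0}"]
  by (intro exI[of _ "closure {x. \<phi> x \<noteq> 0}"]) (auto simp: test_functions_def tf_def Cinf_def)
next
 assume "\<exists>K. compact K \<and> K \<subseteq> Om \<and> tf K \<phi>"
 then obtain K where "compact K \<and> K \<subseteq> Om \<and> tf K \<phi>" ..
 hence K: "compact K" "K \<subseteq> Om" "tf K \<phi>" by simp_all
 have "closure {x. \<phi> x \<noteq> 0} \<subseteq> K"
  using K(1,3) by (intro closure_minimal compact_imp_closed) (auto simp: tf_def)
 moreover from this have "compact (closure {x. \<phi> x \<noteq> 0})"
  using compact_Int_closed[OF K(1) closed_closure[of "{x. \<phi> x \<noteq> 0}"]] by (simp add: Int_absorb1)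
 ultimately show "\<phi> \<in> TF Om" using K by (auto simp: test_functions_def tf_def Cinf_def)
qed

text \<open>The restriction of f to a cube is approximated within e by a test function supported in
  the doubled cube. Testing bounds the squared norm of the restriction by e times the norm of f, for
  every e.\<close>

lemma fundamental_lemma:
 fixes Om :: "(real^'d) set"
 assumes Om: "open Om" and h: "sqint (leb Om) h"
  and z: "\<And>\<phi>. \<phi> \<in> TF Om ==> (LINT x|leb Om. h x*\<phi> x) = 0"
 shows "AE x in leb Om. h x = 0"
proof -
 have Oms: "Om \<in> sets borel" using Om by (rule borel_open)
 obtain f where f: "sqb f" "\<forall>x. x \<notin> Om \<longrightarrow> f x = 0" "AE x in leb Om. h x = f x"
  "\<forall>g\<in>borel_measurable borel. (LINT x|leb Om. h x * g x) = (LBINT x. f x * g x)"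
  by (rule sqint_borel_representative[OF Oms h])
 have z': "(LBINT x. f x*\<phi> x) = 0" if "compact K" "K \<subseteq> Om" "tf K \<phi>" for K \<phi>
 proof -
  have "\<phi> \<in> TF Om" using that test_functions_iff by blast
  from z[OF this] show ?thesis using bspec[OF f(4) tf_borel[OF that(3)]] by simp
 qed
 have cube: "AE x in lborel. x \<in> qcube c l \<longrightarrow> f x = 0" if l: "l > 0" "dcube c l \<subseteq> Om" for c l
 proof -
  let ?r = "\<lambda>x. indicator (qcube c l) x * f x"
  have r: "sqb ?r" by (rule sqint_indicator[OF f(1)]) (simp add: qcube_cbox)
  have "(nm ?r)^2 \<le> e * nm f" if e: "e > 0" for e
  proof -
   obtain \<phi> where p: "tf (dcube c l) \<phi>" "nm (\<lambda>x. \<phi> x - ?r x) \<le> e"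
    by (rule cube_test_function_dense[OF r _ l(1) e]) (auto intro: that)
   have sp: "sqb \<phi>" by (rule tf_sqint[OF p(1) compact_dcube])
   have sd: "sqb (\<lambda>x. \<phi> x - ?r x)" by (rule sqint_diff[OF sp r])
   have "(nm ?r)^2 = (LBINT x. f x * ?r x)"
    unfolding nrm2_square by (intro int_cong) (auto simp: power2_eq_square split: split_indicator)
   also have "\<dots> = (LBINT x. f x*\<phi> x) - (LBINT x. f x*(\<phi> x - ?r x))"
    unfolding int_diff[OF sqint_mult_integrable[OF f(1) sp] sqint_mult_integrable[OF f(1) sd], symmetric]
    by (intro int_cong) (auto simp: algebra_simps)
   also have "\<dots> \<le> \<bar>LBINT x. f x*(\<phi> x - ?r x)\<bar>"
    unfolding z'[OF compact_dcube l(2) p(1)] by linarith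
   also have "\<dots> \<le> nm f * nm (\<lambda>x. \<phi> x - ?r x)" by (rule L2_Cauchy_Schwarz[OF f(1) sd])
   also have "\<dots> \<le> nm f * e" by (rule mult_left_mono[OF p(2)]) simp
   finally show ?thesis by (simp add: mult.commute)
  qed
  note lim = this
  have "(nm ?r)^2 \<le> 0"
  proof (rule field_le_epsilon)
   fix e :: real assume e: "e > 0"
   have "0 < nm f + 1" by (simp add: add_nonneg_pos)
   with e have "0 < e/(nm f + 1)" by simp
   from lim[OF this] have "(nm ?r)^2 \<le> e*(nm f/(nm f + 1))" by simp
   also have "\<dots> \<le> e*1" using e by (intro mult_left_mono) (auto simp: divide_le_eq_1 add_nonneg_pos)
   finally show "(nm ?r)^2 \<le> 0 + e" by simp
  qed
  hence "nm ?r = 0" by simp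
  hence "AE x in lborel. ?r x = 0" using nrm2_eq_0_iff[OF r] by simp
  thus ?thesis by eventually_elim (auto split: split_indicator_asm)
 qed
 have "\<forall>a\<in>Om. \<exists>U. open U \<and> a \<in> U \<and> (AE x in lborel. x \<in> U \<longrightarrow> f x = 0)"
 proof
  fix a assume a: "a \<in> Om"
  obtain l where l: "l > 0" "dcube (a - (\<chi> i. l/2)) l \<subseteq> Om" by (rule cube_around[OF Om a])
  have "a \<in> interior (qcube (a - (\<chi> i. l/2)) l)"
   unfolding qcube_cbox interior_cbox using l(1) by (simp add: mem_box_cart)
  moreover have "AE x in lborel. x \<in> interior (qcube (a - (\<chi> i. l/2)) l) \<longrightarrow> f x = 0"
   using cube[OF l] by eventually_elim (use interior_subset in blast)
  ultimately show "\<exists>U. open U \<and> a \<in> U \<and> (AE x in lborel. x \<in> U \<longrightarrow> f x = 0)" by blast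
 qed
 then obtain U where U: "\<forall>a\<in>Om. open (U a) \<and> a \<in> U a \<and> (AE x in lborel. x \<in> U a \<longrightarrow> f x = 0)"
  by (rule bchoice[THEN exE])
 \<comment> \<open>Null sets survive only countable unions, hence the passage to a countable
   subcover.\<close>
 obtain F where F: "F \<subseteq> U ` Om" "countable F" "\<Union>F = \<Union>(U ` Om)"
  by (rule Lindelof[of "U ` Om"]) (use U in auto)
 have "AE x in lborel. \<forall>V\<in>F. x \<in> V \<longrightarrow> f x = 0"
  unfolding AE_ball_countable[OF F(2)] using F(1) U by blast
 hence "AE x in lborel. x \<in> Om \<longrightarrow> f x = 0"
 proof eventually_elim
  case (elim x)
  show ?case
  proof
   assume "x \<in> Om"
   hence "x \<in> \<Union>F" unfolding F(3) using U by blast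
   thus "f x = 0" using elim by blast
  qed
 qed
 hence "AE x in leb Om. f x = 0"
  by (subst AE_restrict_space_iff) (use Oms in \<open>auto simp: AE_completion_iff\<close>)
 with f(3) show ?thesis by eventually_elim simp
qed

subsection \<open>The space of square integrable fields\<close>

definition L2n :: "('a::euclidean_space) set => ('a => 'b::euclidean_space) => real" where
 "L2n Om f = sqrt (ip Om f f)"

lemma L2_measurable: "f \<in> L2 Om ==> f \<in> borel_measurable (leb Om)"
 by (simp add: L2_def)

lemma L2_real_iff: "f \<in> L2 Om \<longleftrightarrow> sqint (leb Om) f"
 by (simp add: L2_def sqint_def)

lemma L2_norm_sqint: "f \<in> L2 Om ==> sqint (leb Om) (\<lambda>x. norm (f x))"
 by (auto simp: L2_def sqint_def intro: borel_measurable_norm)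

lemma L2_boundI:
 assumes "f \<in> borel_measurable (leb Om)" "sqint (leb Om) g" "\<And>x. norm (f x) \<le> g x"
 shows "f \<in> L2 Om"
proof -
 have "sqint (leb Om) (\<lambda>x. norm (f x))"
  using assms(1) by (intro sqint_bound[OF _ assms(2)]) (auto intro: order_trans[OF assms(3) abs_ge_self])
 thus ?thesis using assms(1) by (simp add: L2_def sqint_def)
qed

lemma L2_zero: "(\<lambda>x. 0) \<in> L2 Om" by (simp add: L2_def)

lemma L2_add_scale:
 assumes "f \<in> L2 Om" "g \<in> L2 Om"
 shows "(\<lambda>x. f x + c*\<^sub>R g x) \<in> L2 Om"
proof (rule L2_boundI)
 have [measurable]: "f \<in> borel_measurable (leb Om)" "g \<in> borel_measurable (leb Om)"
  using assms by (auto intro: L2_measurable)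
 show "(\<lambda>x. f x + c*\<^sub>R g x) \<in> borel_measurable (leb Om)" by measurable
 show "sqint (leb Om) (\<lambda>x. norm (f x) + \<bar>c\<bar> * norm (g x))"
  by (intro sqint_add sqint_scale L2_norm_sqint assms)
 show "norm (f x + c*\<^sub>R g x) \<le> norm (f x) + \<bar>c\<bar> * norm (g x)" for x
  using norm_triangle_ineq[of "f x" "c*\<^sub>R g x"] by simp
qed

lemma L2_scale: "f \<in> L2 Om ==> (\<lambda>x. c*\<^sub>R f x) \<in> L2 Om"
 using L2_add_scale[OF L2_zero, of f Om c] by simp

lemma L2_sum: "(\<And>i. i \<in> I ==> f i \<in> L2 Om) ==> (\<lambda>x. \<Sum>i\<in>I. f i x) \<in> L2 Om"
proof (induction I rule: infinite_finite_induct)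
 case (insert i I)
 thus ?case using L2_add_scale[of "f i" Om "\<lambda>x. \<Sum>i\<in>I. f i x" 1] by simp
qed (simp_all add: L2_zero)

lemma L2_inner_integrable:
 assumes "f \<in> L2 Om" "g \<in> L2 Om"
 shows "integrable (leb Om) (\<lambda>x. f x \<bullet> g x)"
proof (rule intble_bound[OF sqint_mult_integrable[OF L2_norm_sqint[OF assms(1)] L2_norm_sqint[OF assms(2)]]])
 have [measurable]: "f \<in> borel_measurable (leb Om)" "g \<in> borel_measurable (leb Om)"
  using assms by (auto intro: L2_measurable)
 show "(\<lambda>x. f x \<bullet> g x) \<in> borel_measurable (leb Om)" by measurable
 show "AE x in leb Om. norm (f x \<bullet> g x) \<le> norm (norm (f x) * norm (g x))"
  by (auto intro: Cauchy_Schwarz_ineq2)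
qed

lemma L2_inner_commute: "ip Om f g = ip Om g f"
 by (simp add: L2_inner_def inner_commute)

lemma L2_inner_add_scale_left:
 assumes "f \<in> L2 Om" "g \<in> L2 Om" "h \<in> L2 Om"
 shows "ip Om (\<lambda>x. f x + c*\<^sub>R g x) h = ip Om f h + c * ip Om g h"
proof -
 have "ip Om (\<lambda>x. f x + c*\<^sub>R g x) h = (LINT x|leb Om. f x \<bullet> h x + c*(g x \<bullet> h x))"
  by (simp add: L2_inner_def inner_add_left)
 also have "\<dots> = ip Om f h + (LINT x|leb Om. c*(g x \<bullet> h x))"
  unfolding L2_inner_def
  by (rule int_add[OF L2_inner_integrable[OF assms(1,3)] integrable_mult_right[OF L2_inner_integrable[OF assms(2,3)]]])
 finally show ?thesis by (simp add: L2_inner_def)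
qed

lemma L2_inner_add_scale_right:
 assumes "f \<in> L2 Om" "g \<in> L2 Om" "h \<in> L2 Om"
 shows "ip Om h (\<lambda>x. f x + c*\<^sub>R g x) = ip Om h f + c * ip Om h g"
 using L2_inner_add_scale_left[OF assms] by (simp add: L2_inner_commute[of _ h])

lemma L2_inner_zero [simp]: "ip Om (\<lambda>x. 0) f = 0" "ip Om f (\<lambda>x. 0) = 0"
 by (simp_all add: L2_inner_def)

lemma L2_inner_scale:
 "ip Om (\<lambda>x. c*\<^sub>R f x) g = c * ip Om f g"
 "ip Om g (\<lambda>x. c*\<^sub>R f x) = c * ip Om g f"
 by (simp_all add: L2_inner_def)

lemma L2_inner_sum_left:
 assumes "\<And>i. i \<in> I ==> f i \<in> L2 Om" "g \<in> L2 Om"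
 shows "ip Om (\<lambda>x. \<Sum>i\<in>I. f i x) g = (\<Sum>i\<in>I. ip Om (f i) g)"
 unfolding L2_inner_def inner_sum_left
 by (intro int_sum L2_inner_integrable assms)

lemma L2_inner_self: "ip Om f f = (nrm2 (leb Om) (\<lambda>x. norm (f x)))^2"
 unfolding nrm2_square L2_inner_def by (simp add: power2_norm_eq_inner)

lemma L2_inner_self_nonneg [simp]: "0 \<le> ip Om f f"
 by (simp add: L2_inner_self)

lemma L2n_eq: "L2n Om f = nrm2 (leb Om) (\<lambda>x. norm (f x))"
 by (simp add: L2n_def L2_inner_self)

lemma L2n_nonneg [simp]: "0 \<le> L2n Om f" and L2n_square: "(L2n Om f)^2 = ip Om f f"
 by (simp_all add: L2n_def)

lemma L2n_real: "L2n Om (f :: 'a::euclidean_space => real) = nrm2 (leb Om) f"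
 by (simp add: L2n_eq)

lemma L2n_Cauchy_Schwarz:
 assumes "f \<in> L2 Om" "g \<in> L2 Om" shows "\<bar>ip Om f g\<bar> \<le> L2n Om f * L2n Om g"
proof -
 have "\<bar>ip Om f g\<bar> \<le> (LINT x|leb Om. norm (f x) * norm (g x))"
  unfolding L2_inner_def
  using Bochner_Integration.integral_norm_bound_integral[OF L2_inner_integrable[OF assms]
   sqint_mult_integrable[OF assms[THEN L2_norm_sqint]] Cauchy_Schwarz_ineq2[of "f _" "g _", folded real_norm_def]] by simp
 also have "\<dots> \<le> \<bar>LINT x|leb Om. norm (f x) * norm (g x)\<bar>" by simp
 also have "\<dots> \<le> L2n Om f * L2n Om g"
  unfolding L2n_eq by (rule L2_Cauchy_Schwarz[OF assms[THEN L2_norm_sqint]])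
 finally show ?thesis .
qed

lemma L2_inner_cong_AE:
 assumes "f \<in> L2 Om" "f' \<in> L2 Om" "g \<in> L2 Om" "AE x in leb Om. f x = f' x"
 shows "ip Om f g = ip Om f' g" "ip Om g f = ip Om g f'"
proof -
 show "ip Om f g = ip Om f' g"
  unfolding L2_inner_def
 proof (rule integral_cong_AE)
  show "(\<lambda>x. f x \<bullet> g x) \<in> borel_measurable (leb Om)" "(\<lambda>x. f' x \<bullet> g x) \<in> borel_measurable (leb Om)"
   by (intro borel_measurable_inner L2_measurable assms)+
  show "AE x in leb Om. f x \<bullet> g x = f' x \<bullet> g x" using assms(4) by eventually_elim simp
 qed
 thus "ip Om g f = ip Om g f'" by (simp add: L2_inner_commute[of _ g])
qed

lemma L2n_eq_0: "f \<in> L2 Om ==> L2n Om f = 0 \<longleftrightarrow> zero_ae Om f"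
 unfolding L2n_eq using nrm2_eq_0_iff[OF L2_norm_sqint[of f Om]] by (simp add: zero_ae_def)

lemma L2n_triangle:
 assumes "f \<in> L2 Om" "g \<in> L2 Om"
 shows "L2n Om (\<lambda>x. f x + c*\<^sub>R g x) \<le> L2n Om f + \<bar>c\<bar> * L2n Om g"
proof -
 have m: "(\<lambda>x. norm (f x + c*\<^sub>R g x)) \<in> borel_measurable (leb Om)"
  by (rule measurable_compose[OF L2_measurable[OF L2_add_scale[OF assms]] borel_measurable_norm])
 have "L2n Om (\<lambda>x. f x + c*\<^sub>R g x) \<le> nrm2 (leb Om) (\<lambda>x. norm (f x) + \<bar>c\<bar> * norm (g x))"
  unfolding L2n_eq
 proof (rule nrm2_mono[OF _ m])
  show "sqint (leb Om) (\<lambda>x. norm (f x) + \<bar>c\<bar> * norm (g x))" by (intro sqint_add sqint_scale L2_norm_sqint assms)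
  fix x show "\<bar>norm (f x + c*\<^sub>R g x)\<bar> \<le> \<bar>norm (f x) + \<bar>c\<bar> * norm (g x)\<bar>"
   using norm_triangle_ineq[of "f x" "c*\<^sub>R g x"] by simp
 qed
 also have "\<dots> \<le> nrm2 (leb Om) (\<lambda>x. norm (f x)) + nrm2 (leb Om) (\<lambda>x. \<bar>c\<bar> * norm (g x))"
  by (intro nrm2_triangle sqint_scale L2_norm_sqint assms)
 finally show ?thesis by (simp add: nrm2_scale L2n_eq)
qed

lemma L2_nth: "f \<in> L2 Om ==> (\<lambda>x. (f x :: 'b::euclidean_space^'n)$i) \<in> L2 Om"
 by (rule L2_boundI[OF _ L2_norm_sqint])
  (auto intro: L2_measurable borel_measurable_continuous_on[OF continuous_on_component[OF continuous_on_id]] Finite_Cartesian_Product.norm_nth_le)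

lemma L2_vecI:
 fixes f :: "'a::euclidean_space => ('b::euclidean_space)^'n"
 assumes "\<And>i. (\<lambda>x. f x$i) \<in> L2 Om"
 shows "f \<in> L2 Om"
proof (rule L2_boundI)
 show "f \<in> borel_measurable (leb Om)"
  unfolding borel_measurable_euclidean_space[of f]
 proof
  fix b :: "'b^'n" assume "b \<in> Basis"
  have "f x \<bullet> b = (\<Sum>i\<in>UNIV. f x$i \<bullet> b$i)" for x by (simp add: inner_vec_def)
  thus "(\<lambda>x. f x \<bullet> b) \<in> borel_measurable (leb Om)"
   using assms[THEN L2_measurable] by simp
 qed
 show "sqint (leb Om) (\<lambda>x. \<Sum>i\<in>UNIV. norm (f x$i))"
  by (intro sqint_sum L2_norm_sqint assms)
 show "norm (f x) \<le> (\<Sum>i\<in>UNIV. norm (f x$i))" for x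
  unfolding norm_vec_def by (rule L2_set_le_sum) simp
qed

lemma L2_inner_vec:
 fixes f g :: "'a::euclidean_space => ('b::euclidean_space)^'n"
 assumes "f \<in> L2 Om" "g \<in> L2 Om"
 shows "ip Om f g = (\<Sum>i\<in>UNIV. ip Om (\<lambda>x. f x$i) (\<lambda>x. g x$i))"
 unfolding L2_inner_def inner_vec_def
 by (intro int_sum L2_inner_integrable L2_nth assms)

subsection \<open>Weak derivatives\<close>

context
 fixes Om :: "(real^'d) set"
 assumes Om: "open Om"
begin

lemma Om_borel: "Om \<in> sets borel" using Om by (rule borel_open)

lemma grad_nth: "grad \<phi> x$j = pd \<phi> j x"
 by (simp add: grad_def)

lemma tf_L2: "tf K \<phi> ==> compact K ==> \<phi> \<in> L2 Om"
 unfolding L2_real_iff by (intro sqint_lebesgue_on[OF Om_borel] tf_sqint)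

lemma test_E:
 assumes "\<phi> \<in> TF Om"
 obtains K where "compact K" "K \<subseteq> Om" "tf K \<phi>"
 using assms unfolding test_functions_iff by (elim exE conjE)

lemma test_I: "compact K ==> K \<subseteq> Om ==> tf K \<phi> ==> \<phi> \<in> TF Om"
 unfolding test_functions_iff by (intro exI conjI)

lemma test_pd: "\<phi> \<in> TF Om ==> pd \<phi> j \<in> TF Om"
 by (erule test_E, rule test_I, assumption+, rule tf_pd) (auto intro: compact_imp_closed)

lemma test_Cinf: "\<phi> \<in> TF Om ==> Cinf \<phi>"
 by (erule test_E, rule tf_Cinf)

lemma test_L2: "\<phi> \<in> TF Om ==> \<phi> \<in> L2 Om"
 by (erule test_E, rule tf_L2)

lemma test_grad_L2: "\<phi> \<in> TF Om ==> grad \<phi> \<in> L2 Om"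
 by (rule L2_vecI) (simp add: grad_nth[abs_def] test_L2 test_pd)

lemma test_zero: "(\<lambda>x. 0) \<in> TF Om"
 by (rule test_I[of "{}"]) (simp_all add: tf_zero)

lemma test_add_scale:
 assumes "\<phi> \<in> TF Om" "\<psi> \<in> TF Om"
 shows "(\<lambda>x. \<phi> x + c*\<^sub>R \<psi> x) \<in> TF Om"
proof -
 obtain K where K: "compact K" "K \<subseteq> Om" "tf K \<phi>" by (rule test_E[OF assms(1)])
 obtain L where L: "compact L" "L \<subseteq> Om" "tf L \<psi>" by (rule test_E[OF assms(2)])
 have "tf (K \<union> L) (\<lambda>x. \<phi> x + c*\<psi> x)"
  by (intro tf_add tf_scale tf_mono[OF K(3)] tf_mono[OF L(3)]) auto
 thus ?thesis using K L by (intro test_I[of "K \<union> L"]) (auto intro: compact_Un)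
qed

lemma test_parts:
 assumes "\<phi> \<in> TF Om" "\<psi> \<in> TF Om"
 shows "ip Om \<phi> (pd \<psi> j) = - ip Om \<psi> (pd \<phi> j)"
proof -
 obtain K where K: "compact K" "K \<subseteq> Om" "tf K \<phi>" by (rule test_E[OF assms(1)])
 obtain L where L: "compact L" "L \<subseteq> Om" "tf L \<psi>" by (rule test_E[OF assms(2)])
 have C: "Cinf \<phi>" "Cinf \<psi>" using assms by (simp_all add: test_Cinf)
 have s: "sqb \<phi>" "sqb (pd \<phi> j)" "sqb \<psi>" "sqb (pd \<psi> j)"
  using tf_sqint[OF K(3,1)] tf_sqint[OF tf_pd[OF K(3) compact_imp_closed[OF K(1)]] K(1)]
   tf_sqint[OF L(3,1)] tf_sqint[OF tf_pd[OF L(3) compact_imp_closed[OF L(1)]] L(1)] by blast+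
 have b: "f \<in> borel_measurable borel" if "sqb f" for f :: "real^'d => real" using that by (auto simp: sqint_def)
 have "0 = (LBINT x. pd (\<lambda>x. \<phi> x*\<psi> x) j x)"
  by (rule integral_pd_eq_0[OF tf_mult2[OF K(3) C(2)] K(1), symmetric])
 also have "\<dots> = (LBINT x. \<phi> x * pd \<psi> j x + \<psi> x * pd \<phi> j x)"
  by (simp add: pd_mult C mult.commute)
 also have "\<dots> = (LBINT x. \<phi> x * pd \<psi> j x) + (LBINT x. \<psi> x * pd \<phi> j x)"
  by (rule int_add[OF sqint_mult_integrable[OF s(1,4)] sqint_mult_integrable[OF s(3,2)]])
 finally have "(LBINT x. \<phi> x * pd \<psi> j x) = - (LBINT x. \<psi> x * pd \<phi> j x)" by simp
 moreover have "(LBINT x. \<phi> x * pd \<psi> j x) = ip Om \<phi> (pd \<psi> j)"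
  unfolding L2_inner_def inner_real_def using K(2,3) b[OF s(1)] b[OF s(4)]
  by (intro lebesgue_on_integral_borel(1)[OF Om_borel, symmetric]) (auto simp: tf_def)
 moreover have "(LBINT x. \<psi> x * pd \<phi> j x) = ip Om \<psi> (pd \<phi> j)"
  unfolding L2_inner_def inner_real_def using L(2,3) b[OF s(3)] b[OF s(2)]
  by (intro lebesgue_on_integral_borel(1)[OF Om_borel, symmetric]) (auto simp: tf_def)
 ultimately show ?thesis by simp
qed

lemma L2_fundamental:
 fixes h :: "real^'d => real"
 assumes "h \<in> L2 Om" "\<And>\<phi>. \<phi> \<in> TF Om ==> ip Om \<phi> h = 0"
 shows "AE x in leb Om. h x = 0"
proof (rule fundamental_lemma[OF Om])
 show "sqint (leb Om) h" using assms(1) by (simp add: L2_real_iff)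
 show "(LINT x|leb Om. h x*\<phi> x) = 0" if "\<phi> \<in> TF Om" for \<phi>
  using assms(2)[OF that] by (simp add: L2_inner_def mult.commute)
qed

lemma is_weak_grad_iff:
 assumes f: "f \<in> L2 Om" and G: "G \<in> L2 Om"
 shows "is_weak_grad Om f G \<longleftrightarrow> (\<forall>\<phi>\<in>TF Om. \<forall>j. ip Om f (pd \<phi> j) = - ip Om \<phi> (\<lambda>x. G x$j))"
 unfolding is_weak_grad_def
proof (rule ball_cong[OF refl])
 fix \<phi> assume p: "\<phi> \<in> TF Om"
 have i1: "integrable (leb Om) (\<lambda>x. f x * pd \<phi> j x)" for j
  using L2_inner_integrable[OF f test_L2[OF test_pd[OF p]]] by simp
 have i2: "integrable (leb Om) (\<lambda>x. \<phi> x*(G x$j))" for j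
  using L2_inner_integrable[OF test_L2[OF p] L2_nth[OF G]] by simp
 \<comment> \<open>The component map commutes with the integral of an integrable field, so
   integrability of F is rebuilt from that of its components; otherwise the integral would be 0 by
   convention.\<close>
 have vec: "(LINT x|leb Om. F x)$j = (LINT x|leb Om. F x$j)"
  if i: "\<And>j. integrable (leb Om) (\<lambda>x. F x$j)" for F :: "real^'d => real^'d" and j
 proof -
  have "integrable (leb Om) (\<lambda>x. \<Sum>j\<in>UNIV. F x$j*\<^sub>R axis j (1::real))"
   by (intro intble_sum integrable_scaleR_left i)
  moreover have "(\<lambda>x. \<Sum>j\<in>UNIV. F x$j*\<^sub>R axis j (1::real)) = F"
   by (simp add: fun_eq_iff basis_expansion scalar_mult_eq_scaleR[symmetric])
  ultimately have "integrable (leb Om) F" by simp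
  from integral_bounded_linear[OF bounded_linear_vec_nth this, of j] show ?thesis by simp
 qed
 have "(LINT x|leb Om. f x*\<^sub>R grad \<phi> x)$j = ip Om f (pd \<phi> j)" for j
  by (subst vec) (simp_all add: grad_nth i1 L2_inner_def)
 moreover have "(LINT x|leb Om. \<phi> x*\<^sub>R G x)$j = ip Om \<phi> (\<lambda>x. G x$j)" for j
  by (subst vec) (simp_all add: i2 L2_inner_def)
 ultimately show "((LINT x|leb Om. f x*\<^sub>R grad \<phi> x) = - (LINT x|leb Om. \<phi> x*\<^sub>R G x)) \<longleftrightarrow>
  (\<forall>j. ip Om f (pd \<phi> j) = - ip Om \<phi> (\<lambda>x. G x$j))"
  by (simp add: cart_eq_iff)
qed

lemma is_weak_div_iff:
 "is_weak_div Om v D \<longleftrightarrow> (\<forall>\<phi>\<in>TF Om. ip Om v (grad \<phi>) = - ip Om \<phi> D)"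
 by (simp add: is_weak_div_def L2_inner_def)

text \<open>\<open>weak_grad\<close> is a choice among representatives, so linearity and agreement
  with the classical gradient hold almost everywhere, and uniqueness is what yields them.\<close>

lemma weak_grad_unique:
 assumes f: "f \<in> L2 Om" and G: "G \<in> L2 Om" "is_weak_grad Om f G" and H: "H \<in> L2 Om" "is_weak_grad Om f H"
 shows "AE x in leb Om. G x = H x"
proof -
 have "AE x in leb Om. G x$j + (- 1)*\<^sub>R (H x$j) = 0" for j
 proof (rule L2_fundamental)
  show "(\<lambda>x. G x$j + (- 1)*\<^sub>R (H x$j)) \<in> L2 Om" by (intro L2_add_scale L2_nth G H)
  fix \<phi> assume p: "\<phi> \<in> TF Om"
  show "ip Om \<phi> (\<lambda>x. G x$j + (- 1)*\<^sub>R (H x$j)) = 0"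
   unfolding L2_inner_add_scale_right[OF L2_nth[OF G(1)] L2_nth[OF H(1)] test_L2[OF p]]
   using G(2)[unfolded is_weak_grad_iff[OF f G(1)]] H(2)[unfolded is_weak_grad_iff[OF f H(1)]] p by simp
 qed
 hence "AE x in leb Om. \<forall>j. G x$j + (- 1)*\<^sub>R (H x$j) = 0"
  by (simp add: AE_all_countable)
 thus ?thesis by eventually_elim (simp add: cart_eq_iff)
qed

lemma weak_div_unique:
 assumes D: "D \<in> L2 Om" "is_weak_div Om v D" and E: "E \<in> L2 Om" "is_weak_div Om v E"
 shows "AE x in leb Om. D x = E x"
proof -
 have "AE x in leb Om. D x + (- 1)*\<^sub>R E x = 0"
 proof (rule L2_fundamental[OF L2_add_scale[OF D(1) E(1)]])
  fix \<phi> assume p: "\<phi> \<in> TF Om"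
  show "ip Om \<phi> (\<lambda>x. D x + (- 1)*\<^sub>R E x) = 0"
   unfolding L2_inner_add_scale_right[OF D(1) E(1) test_L2[OF p]]
   using D(2) E(2) p by (simp add: is_weak_div_iff)
 qed
 thus ?thesis by eventually_elim simp
qed

lemma H1D: "f \<in> H1 Om ==> f \<in> L2 Om" "f \<in> H1 Om ==> wg Om f \<in> L2 Om"
 "f \<in> H1 Om ==> is_weak_grad Om f (wg Om f)"
proof -
 show "f \<in> H1 Om ==> f \<in> L2 Om" by (simp add: H1_def)
 assume "f \<in> H1 Om"
 hence "\<exists>G. G \<in> L2 Om \<and> is_weak_grad Om f G" by (auto simp: H1_def)
 from someI_ex[OF this] show "wg Om f \<in> L2 Om" "is_weak_grad Om f (wg Om f)"
  by (simp_all add: weak_grad_def)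
qed

lemma HdivD: "v \<in> Hdiv Om ==> v \<in> L2 Om" "v \<in> Hdiv Om ==> wd Om v \<in> L2 Om"
 "v \<in> Hdiv Om ==> is_weak_div Om v (wd Om v)"
proof -
 show "v \<in> Hdiv Om ==> v \<in> L2 Om" by (simp add: Hdiv_def)
 assume "v \<in> Hdiv Om"
 hence "\<exists>D. D \<in> L2 Om \<and> is_weak_div Om v D" by (auto simp: Hdiv_def)
 from someI_ex[OF this] show "wd Om v \<in> L2 Om" "is_weak_div Om v (wd Om v)"
  by (simp_all add: weak_div_def)
qed

lemma weak_grad_eq:
 assumes "f \<in> L2 Om" "G \<in> L2 Om" "is_weak_grad Om f G"
 shows "f \<in> H1 Om" "AE x in leb Om. wg Om f x = G x"
proof -
 show f: "f \<in> H1 Om" using assms by (auto simp: H1_def)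
 show "AE x in leb Om. wg Om f x = G x"
  by (rule weak_grad_unique[OF assms(1) H1D(2,3)[OF f] assms(2,3)])
qed

lemma weak_div_eq:
 assumes "v \<in> L2 Om" "D \<in> L2 Om" "is_weak_div Om v D"
 shows "v \<in> Hdiv Om" "AE x in leb Om. wd Om v x = D x"
proof -
 show v: "v \<in> Hdiv Om" using assms by (auto simp: Hdiv_def)
 show "AE x in leb Om. wd Om v x = D x"
  by (rule weak_div_unique[OF HdivD(2,3)[OF v] assms(2,3)])
qed

lemma H1_add_scale:
 assumes f: "f \<in> H1 Om" and g: "g \<in> H1 Om"
 shows "(\<lambda>x. f x + c*\<^sub>R g x) \<in> H1 Om"
  "AE x in leb Om. wg Om (\<lambda>x. f x + c*\<^sub>R g x) x = wg Om f x + c*\<^sub>R wg Om g x"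
proof -
 have G: "(\<lambda>x. wg Om f x + c*\<^sub>R wg Om g x) \<in> L2 Om" by (intro L2_add_scale H1D f g)
 have fg: "(\<lambda>x. f x + c*\<^sub>R g x) \<in> L2 Om" by (intro L2_add_scale H1D f g)
 have "is_weak_grad Om (\<lambda>x. f x + c*\<^sub>R g x) (\<lambda>x. wg Om f x + c*\<^sub>R wg Om g x)"
  unfolding is_weak_grad_iff[OF fg G]
 proof (intro ballI allI)
  fix \<phi> j assume p: "\<phi> \<in> TF Om"
  note F = H1D(3)[OF f, unfolded is_weak_grad_iff[OF H1D(1,2)[OF f]], rule_format, OF p, of j]
   H1D(3)[OF g, unfolded is_weak_grad_iff[OF H1D(1,2)[OF g]], rule_format, OF p, of j]
  show "ip Om (\<lambda>x. f x + c*\<^sub>R g x) (pd \<phi> j) = - ip Om \<phi> (\<lambda>x. (wg Om f x + c*\<^sub>R wg Om g x)$j)"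
   unfolding L2_inner_add_scale_left[OF H1D(1)[OF f] H1D(1)[OF g] test_L2[OF test_pd[OF p]]] vector_add_component vector_scaleR_component
    L2_inner_add_scale_right[OF L2_nth[OF H1D(2)[OF f]] L2_nth[OF H1D(2)[OF g]] test_L2[OF p]] F by simp
 qed
 from weak_grad_eq[OF fg G this] show "(\<lambda>x. f x + c*\<^sub>R g x) \<in> H1 Om"
  "AE x in leb Om. wg Om (\<lambda>x. f x + c*\<^sub>R g x) x = wg Om f x + c*\<^sub>R wg Om g x" .
qed

lemma Hdiv_add_scale:
 assumes f: "f \<in> Hdiv Om" and g: "g \<in> Hdiv Om"
 shows "(\<lambda>x. f x + c*\<^sub>R g x) \<in> Hdiv Om"
  "AE x in leb Om. wd Om (\<lambda>x. f x + c*\<^sub>R g x) x = wd Om f x + c*\<^sub>R wd Om g x"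
proof -
 have G: "(\<lambda>x. wd Om f x + c*\<^sub>R wd Om g x) \<in> L2 Om" by (intro L2_add_scale HdivD f g)
 have fg: "(\<lambda>x. f x + c*\<^sub>R g x) \<in> L2 Om" by (intro L2_add_scale HdivD f g)
 have "is_weak_div Om (\<lambda>x. f x + c*\<^sub>R g x) (\<lambda>x. wd Om f x + c*\<^sub>R wd Om g x)"
  unfolding is_weak_div_iff
 proof
  fix \<phi> assume p: "\<phi> \<in> TF Om"
  note F = HdivD(3)[OF f, unfolded is_weak_div_iff, rule_format, OF p]
   HdivD(3)[OF g, unfolded is_weak_div_iff, rule_format, OF p]
  show "ip Om (\<lambda>x. f x + c*\<^sub>R g x) (grad \<phi>) = - ip Om \<phi> (\<lambda>x. wd Om f x + c*\<^sub>R wd Om g x)"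
   unfolding L2_inner_add_scale_left[OF HdivD(1)[OF f] HdivD(1)[OF g] test_grad_L2[OF p]]
    L2_inner_add_scale_right[OF HdivD(2)[OF f] HdivD(2)[OF g] test_L2[OF p]] F by simp
 qed
 from weak_div_eq[OF fg G this] show "(\<lambda>x. f x + c*\<^sub>R g x) \<in> Hdiv Om"
  "AE x in leb Om. wd Om (\<lambda>x. f x + c*\<^sub>R g x) x = wd Om f x + c*\<^sub>R wd Om g x" .
qed

lemma test_weak_grad:
 assumes p: "\<phi> \<in> TF Om"
 shows "\<phi> \<in> H1 Om" "AE x in leb Om. wg Om \<phi> x = grad \<phi> x"
proof -
 have "is_weak_grad Om \<phi> (grad \<phi>)"
  unfolding is_weak_grad_iff[OF test_L2[OF p] test_grad_L2[OF p]] grad_nth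
  by (intro ballI allI test_parts p)
 from weak_grad_eq[OF test_L2[OF p] test_grad_L2[OF p] this]
 show "\<phi> \<in> H1 Om" "AE x in leb Om. wg Om \<phi> x = grad \<phi> x" .
qed

end

lemma norm_transpose: "norm (transpose A) = norm (A :: real^'n^'m)"
proof -
 have "(norm (transpose A))^2 = (norm A)^2"
  unfolding power2_norm_eq_inner inner_vec_def transpose_def by (simp, rule sum.swap)
 thus ?thesis by simp
qed

lemma trace_square_le: "(\<Sum>i\<in>UNIV. A$i$i)^2 \<le> real CARD('n)*(norm (A :: real^'n^'n))^2"
proof -
 have "(\<Sum>i\<in>UNIV. A$i$i)^2 \<le> (\<Sum>i\<in>UNIV. (A$i$i)^2) * real CARD('n)"
  using sum_squared_le_sum_of_squares[of "\<lambda>i. A$i$i" UNIV] by simp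
 also have "\<dots> \<le> (norm A)^2 * real CARD('n)"
 proof (rule mult_right_mono)
  have "(A$i$i)^2 \<le> A$i \<bullet> A$i" for i
   unfolding inner_vec_def using member_le_sum[of i UNIV "\<lambda>j. A$i$j \<bullet> A$i$j"] by (simp add: power2_eq_square)
  thus "(\<Sum>i\<in>UNIV. (A$i$i)^2) \<le> (norm A)^2"
   unfolding power2_norm_eq_inner inner_vec_def[of A] by (rule sum_mono)
 qed simp
 finally show ?thesis by (simp add: mult.commute)
qed

lemma L2n_cong_AE:
 assumes "f \<in> L2 Om" "g \<in> L2 Om" "AE x in leb Om. f x = g x"
 shows "L2n Om f = L2n Om g"
 unfolding L2n_def using L2_inner_cong_AE(1)[OF assms(1,2,1,3)] L2_inner_cong_AE(2)[OF assms(1,2,2,3)] by simp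

lemma L2n_mono:
 assumes "f \<in> L2 Om" "g \<in> L2 Om" "\<And>x. norm (f x) \<le> norm (g x)"
 shows "L2n Om f \<le> L2n Om g"
 unfolding L2n_eq using assms(3)
 by (intro nrm2_mono[OF L2_norm_sqint[OF assms(2)]] sqint_measurable[OF L2_norm_sqint[OF assms(1)]]) simp

lemma L2n_scale: "L2n Om (\<lambda>x. c*\<^sub>R f x) = \<bar>c\<bar> * L2n Om f"
 unfolding L2n_eq norm_scaleR nrm2_scale by simp

lemma zero_ae_L2: "f \<in> L2 Om ==> zero_ae Om f ==> g \<in> L2 Om ==> ip Om f g = 0"
 using L2n_Cauchy_Schwarz[of f Om g] L2n_eq_0[of f Om] by simp

context
 fixes Om :: "(real^'d) set"
 assumes Om: "open Om"
begin

abbreviation "H1f \<equiv> {u. \<forall>i. (\<lambda>x. u x$i) \<in> H1 Om}"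

lemma field_div:
 assumes u: "u \<in> H1f"
 shows "u \<in> Hdiv Om" "AE x in leb Om. wd Om u x = (\<Sum>i\<in>UNIV. wg Om (\<lambda>x. u x$i) x$i)"
proof -
 let ?G = "\<lambda>i x. wg Om (\<lambda>x. u x$i) x$i"
 have ui: "(\<lambda>x. u x$i) \<in> H1 Om" for i using u by simp
 have uL: "u \<in> L2 Om" by (rule L2_vecI[OF H1D(1)[OF Om ui]])
 have GL: "?G i \<in> L2 Om" for i by (rule L2_nth[OF H1D(2)[OF Om ui]])
 have DL: "(\<lambda>x. \<Sum>i\<in>UNIV. ?G i x) \<in> L2 Om" by (rule L2_sum[OF GL])
 have "is_weak_div Om u (\<lambda>x. \<Sum>i\<in>UNIV. ?G i x)"
  unfolding is_weak_div_iff[OF Om]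
 proof
  fix \<phi> assume p: "\<phi> \<in> TF Om"
  have "ip Om u (grad \<phi>) = (\<Sum>i\<in>UNIV. ip Om (\<lambda>x. u x$i) (pd \<phi> i))"
   unfolding L2_inner_vec[OF uL test_grad_L2[OF Om p]] grad_nth[OF Om] ..
  also have "\<dots> = (\<Sum>i\<in>UNIV. - ip Om \<phi> (?G i))"
   using H1D(3)[OF Om ui, unfolded is_weak_grad_iff[OF Om H1D(1,2)[OF Om ui]]] p by (intro sum.cong) auto
  also have "\<dots> = - ip Om \<phi> (\<lambda>x. \<Sum>i\<in>UNIV. ?G i x)"
   by (simp only: sum_negf L2_inner_commute[of Om \<phi>] L2_inner_sum_left[OF GL test_L2[OF Om p]])
  finally show "ip Om u (grad \<phi>) = - ip Om \<phi> (\<lambda>x. \<Sum>i\<in>UNIV. ?G i x)" .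
 qed
 from weak_div_eq[OF Om uL DL this] show "u \<in> Hdiv Om" "AE x in leb Om. wd Om u x = (\<Sum>i\<in>UNIV. ?G i x)" .
qed

lemma strain_nth: "strain Om u x$i$j = (wg Om (\<lambda>y. u y$i) x$j + wg Om (\<lambda>y. u y$j) x$i)/2"
 by (simp add: strain_def Let_def transpose_def)

lemma strain_L2:
 assumes u: "u \<in> H1f" shows "strain Om u \<in> L2 Om"
proof (intro L2_vecI)
 fix i j
 have ui: "(\<lambda>x. u x$i) \<in> H1 Om" for i using u by simp
 have "(\<lambda>x. (1/2)*\<^sub>R (wg Om (\<lambda>y. u y$i) x$j + 1*\<^sub>R (wg Om (\<lambda>y. u y$j) x$i))) \<in> L2 Om"
  by (intro L2_scale L2_add_scale L2_nth H1D(2)[OF Om ui])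
 thus "(\<lambda>x. strain Om u x$i$j) \<in> L2 Om" by (simp add: strain_nth)
qed

lemma field_add_scale:
 assumes u: "u \<in> H1f" and w: "w \<in> H1f"
 shows "(\<lambda>x. u x + c*\<^sub>R w x) \<in> H1f"
  "AE x in leb Om. strain Om (\<lambda>x. u x + c*\<^sub>R w x) x = strain Om u x + c*\<^sub>R strain Om w x"
proof -
 have ui: "(\<lambda>x. u x$i) \<in> H1 Om" "(\<lambda>x. w x$i) \<in> H1 Om" for i using u w by simp_all
 note L = H1_add_scale[OF Om ui]
 show "(\<lambda>x. u x + c*\<^sub>R w x) \<in> H1f" using L(1) by simp
 have "AE x in leb Om. \<forall>i. wg Om (\<lambda>x. u x$i + c*\<^sub>R (w x$i)) x =
   wg Om (\<lambda>x. u x$i) x + c*\<^sub>R wg Om (\<lambda>x. w x$i) x"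
  unfolding AE_all_countable using L(2) by blast
 thus "AE x in leb Om. strain Om (\<lambda>x. u x + c*\<^sub>R w x) x = strain Om u x + c*\<^sub>R strain Om w x"
  by eventually_elim (simp add: cart_eq_iff strain_nth algebra_simps add_divide_distrib)
qed

text \<open>The divergence is the trace of the strain, and a squared trace is at most d times the
  squared Frobenius norm. This controls the divergence when \<lambda> is small.\<close>

lemma div_le_strain:
 assumes u: "u \<in> H1f"
 shows "(L2n Om (wd Om u))^2 \<le> real CARD('d)*(L2n Om (strain Om u))^2"
proof -
 let ?t = "\<lambda>x. \<Sum>i\<in>UNIV. strain Om u x$i$i"
 have tL: "?t \<in> L2 Om" by (intro L2_sum L2_nth strain_L2 u)
 have "L2n Om (wd Om u) = L2n Om ?t"
  using field_div(2)[OF u] by (intro L2n_cong_AE[OF HdivD(2)[OF Om field_div(1)[OF u]] tL]) (simp add: strain_nth)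
 also have "\<dots> \<le> L2n Om (\<lambda>x. sqrt (real CARD('d))*\<^sub>R strain Om u x)"
 proof (rule L2n_mono[OF tL L2_scale[OF strain_L2[OF u]]])
  fix x
  have "sqrt ((?t x)^2) \<le> sqrt (real CARD('d)*(norm (strain Om u x))^2)"
   by (rule real_sqrt_le_mono[OF trace_square_le])
  thus "norm (?t x) \<le> norm (sqrt (real CARD('d))*\<^sub>R strain Om u x)" by (simp add: real_sqrt_mult)
 qed
 finally have "L2n Om (wd Om u) \<le> sqrt (real CARD('d)) * L2n Om (strain Om u)" by (simp add: L2n_scale)
 hence "(L2n Om (wd Om u))^2 \<le> (sqrt (real CARD('d)) * L2n Om (strain Om u))^2" by (intro power_mono) simp_all
 thus ?thesis by (simp add: power_mult_distrib)
qed

lemma diagonal_le_strain: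
 assumes u: "u \<in> H1f"
 shows "L2n Om (\<lambda>x. wg Om (\<lambda>x. u x$i) x$i) \<le> L2n Om (strain Om u)"
proof (rule L2n_mono)
 show "(\<lambda>x. wg Om (\<lambda>x. u x$i) x$i) \<in> L2 Om" using u by (intro L2_nth H1D(2)[OF Om]) simp
 show "strain Om u \<in> L2 Om" by (rule strain_L2[OF u])
 fix x
 have "norm (strain Om u x$i$i) \<le> norm (strain Om u x)"
  by (rule order_trans[OF Finite_Cartesian_Product.norm_nth_le Finite_Cartesian_Product.norm_nth_le])
 thus "norm (wg Om (\<lambda>x. u x$i) x$i) \<le> norm (strain Om u x)" by (simp add: strain_nth)
qed

lemma zero_weak_grad:
 assumes f: "f \<in> H1 Om" "zero_ae Om f" shows "zero_ae Om (wg Om f)"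
proof -
 have "is_weak_grad Om f (\<lambda>x. 0)"
  unfolding is_weak_grad_iff[OF Om H1D(1)[OF Om f(1)] L2_zero]
  using zero_ae_L2[OF H1D(1)[OF Om f(1)] f(2)] by (simp add: test_L2[OF Om] test_pd[OF Om])
 from weak_grad_eq(2)[OF Om H1D(1)[OF Om f(1)] L2_zero this] show ?thesis by (simp add: zero_ae_def)
qed

lemma zero_weak_div:
 assumes v: "v \<in> Hdiv Om" "zero_ae Om v" shows "zero_ae Om (wd Om v)"
proof -
 have "is_weak_div Om v (\<lambda>x. 0)"
  unfolding is_weak_div_iff[OF Om]
  using zero_ae_L2[OF HdivD(1)[OF Om v(1)] v(2)] by (simp add: test_grad_L2[OF Om])
 from weak_div_eq(2)[OF Om HdivD(1)[OF Om v(1)] L2_zero this] show ?thesis by (simp add: zero_ae_def)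
qed

lemma zero_strain:
 assumes u: "u \<in> H1f" "zero_ae Om u" shows "zero_ae Om (strain Om u)"
proof -
 have "zero_ae Om (wg Om (\<lambda>x. u x$i))" for i
 proof (rule zero_weak_grad)
  show "(\<lambda>x. u x$i) \<in> H1 Om" using u(1) by simp
  show "zero_ae Om (\<lambda>x. u x$i)" using u(2) unfolding zero_ae_def by eventually_elim simp
 qed
 hence "AE x in leb Om. \<forall>i. wg Om (\<lambda>x. u x$i) x = 0"
  unfolding AE_all_countable zero_ae_def by blast
 thus ?thesis
  unfolding zero_ae_def by eventually_elim (simp add: cart_eq_iff strain_nth)
qed

lemma H1_norm_bounds:
 assumes f: "f \<in> H1 Om"
 shows "L2n Om f \<le> H1_norm Om f" "L2n Om (wg Om f) \<le> H1_norm Om f"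
  "H1_norm Om f \<le> L2n Om f + L2n Om (wg Om f)"
 unfolding H1_norm_def L2n_def using sqrt_add_le_add_sqrt[of "ip Om f f" "ip Om (wg Om f) (wg Om f)"]
 by (auto intro: real_sqrt_le_mono)

lemma H10_H1: "f \<in> H10 Om ==> f \<in> H1 Om" by (simp add: H10_def)

lemma H10_E:
 assumes "f \<in> H10 Om"
 obtains \<phi> where "\<forall>k::nat. \<phi> k \<in> TF Om" "(\<lambda>k. H1_norm Om (\<lambda>x. f x - \<phi> k x)) \<longlonglongrightarrow> 0"
 using assms unfolding H10_def mem_Collect_eq by (elim conjE exE)

lemma U_H1f: "u \<in> U_space Om ==> u \<in> H1f" by (simp add: U_space_def H10_H1)

lemma H1_diff_test:
 assumes f: "f \<in> H1 Om" and p: "\<phi> \<in> TF Om"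
 shows "(\<lambda>x. f x - \<phi> x) \<in> H1 Om" "AE x in leb Om. wg Om (\<lambda>x. f x - \<phi> x) x = wg Om f x - grad \<phi> x"
proof -
 note L = H1_add_scale[OF Om f test_weak_grad(1)[OF Om p], of "- 1"]
 show "(\<lambda>x. f x - \<phi> x) \<in> H1 Om" using L(1) by simp
 show "AE x in leb Om. wg Om (\<lambda>x. f x - \<phi> x) x = wg Om f x - grad \<phi> x"
  using L(2) test_weak_grad(2)[OF Om p] by eventually_elim simp
qed

lemma test_H10:
 assumes p: "\<phi> \<in> TF Om" shows "\<phi> \<in> H10 Om"
proof -
 note z = test_zero[OF Om]
 have g0: "grad (\<lambda>x::real^'d. 0::real) x = 0" for x
  by (simp add: cart_eq_iff grad_nth[OF Om] pd_const)
 have "zero_ae Om (wg Om (\<lambda>x. 0))"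
  using test_weak_grad(2)[OF Om z] by (simp add: g0 zero_ae_def)
 from zero_ae_L2[OF H1D(2)[OF Om test_weak_grad(1)[OF Om z]] this H1D(2)[OF Om test_weak_grad(1)[OF Om z]]]
 have "H1_norm Om (\<lambda>x. 0) = 0" by (simp add: H1_norm_def)
 thus ?thesis
  using test_weak_grad(1)[OF Om p] p unfolding H10_def by (auto intro!: exI[of _ "\<lambda>k. \<phi>"])
qed

lemma H10_add_scale:
 assumes f: "f \<in> H10 Om" and g: "g \<in> H10 Om"
 shows "(\<lambda>x. f x + c*\<^sub>R g x) \<in> H10 Om"
proof -
 obtain \<phi> where p: "\<And>k::nat. \<phi> k \<in> TF Om" "(\<lambda>k. H1_norm Om (\<lambda>x. f x - \<phi> k x)) \<longlonglongrightarrow> 0"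
  by (rule H10_E[OF f], rule that, erule spec, assumption)
 obtain \<psi> where q: "\<And>k::nat. \<psi> k \<in> TF Om" "(\<lambda>k. H1_norm Om (\<lambda>x. g x - \<psi> k x)) \<longlonglongrightarrow> 0"
  by (rule H10_E[OF g], rule that, erule spec, assumption)
 define a b where "a k = (\<lambda>x. f x - \<phi> k x)" and "b k = (\<lambda>x. g x - \<psi> k x)" for k
 have a: "a k \<in> H1 Om" and b: "b k \<in> H1 Om" for k
  unfolding a_def b_def by (rule H1_diff_test(1)[OF H10_H1[OF f] p(1)], rule H1_diff_test(1)[OF H10_H1[OF g] q(1)])
 have le: "H1_norm Om (\<lambda>x. a k x + c*\<^sub>R b k x) \<le> 2 * H1_norm Om (a k) + 2*\<bar>c\<bar> * H1_norm Om (b k)" for k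
 proof -
  note L = H1_add_scale[OF Om a[of k] b[of k], of c]
  have "L2n Om (wg Om (\<lambda>x. a k x + c*\<^sub>R b k x)) = L2n Om (\<lambda>x. wg Om (a k) x + c*\<^sub>R wg Om (b k) x)"
   by (rule L2n_cong_AE[OF H1D(2)[OF Om L(1)] L2_add_scale[OF H1D(2)[OF Om a] H1D(2)[OF Om b]] L(2)])
  also have "\<dots> \<le> L2n Om (wg Om (a k)) + \<bar>c\<bar> * L2n Om (wg Om (b k))"
   by (rule L2n_triangle[OF H1D(2)[OF Om a] H1D(2)[OF Om b]])
  finally have "H1_norm Om (\<lambda>x. a k x + c*\<^sub>R b k x) \<le>
   (L2n Om (a k) + \<bar>c\<bar> * L2n Om (b k)) + (L2n Om (wg Om (a k)) + \<bar>c\<bar> * L2n Om (wg Om (b k)))"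
   using H1_norm_bounds(3)[OF L(1)] L2n_triangle[OF H1D(1)[OF Om a[of k]] H1D(1)[OF Om b[of k]], of c] by linarith
  moreover have "\<bar>c\<bar> * L2n Om (b k) \<le> \<bar>c\<bar> * H1_norm Om (b k)" "\<bar>c\<bar> * L2n Om (wg Om (b k)) \<le> \<bar>c\<bar> * H1_norm Om (b k)"
   by (intro mult_left_mono H1_norm_bounds b abs_ge_zero)+
  ultimately show ?thesis using H1_norm_bounds(1,2)[OF a[of k]] by linarith
 qed
 have "(\<lambda>k. 2 * H1_norm Om (a k) + 2*\<bar>c\<bar> * H1_norm Om (b k)) \<longlonglongrightarrow> 2*0 + 2*\<bar>c\<bar>*0"
  unfolding a_def b_def by (intro tendsto_intros p q)
 hence "(\<lambda>k. H1_norm Om (\<lambda>x. a k x + c*\<^sub>R b k x)) \<longlonglongrightarrow> 0"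
  unfolding mult_zero_right add_0
  by (rule tendsto_sandwich[OF always_eventually always_eventually tendsto_const, rotated 2])
   (intro allI order_trans[OF L2n_nonneg H1_norm_bounds(1)[OF H1_add_scale(1)[OF Om a b]]], intro allI le)
 moreover have "(\<lambda>x. a k x + c*\<^sub>R b k x) = (\<lambda>x. (f x + c*\<^sub>R g x) - (\<phi> k x + c*\<^sub>R \<psi> k x))" for k
  by (simp add: a_def b_def algebra_simps)
 ultimately have "(\<lambda>k. H1_norm Om (\<lambda>x. (f x + c*\<^sub>R g x) - (\<phi> k x + c*\<^sub>R \<psi> k x))) \<longlonglongrightarrow> 0" by simp
 thus ?thesis
  unfolding H10_def using H1_add_scale(1)[OF Om H10_H1[OF f] H10_H1[OF g], of c] test_add_scale[OF Om p(1) q(1), of _ c]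
  by (intro CollectI conjI exI[of _ "\<lambda>k x. \<phi> k x + c*\<^sub>R \<psi> k x"]) simp_all
qed

lemma test_Poincare:
 assumes p: "\<phi> \<in> TF Om" and R: "\<And>x. x \<in> Om ==> \<bar>x$j\<bar> \<le> R"
 shows "L2n Om \<phi> \<le> 2*\<bar>R\<bar> * L2n Om (pd \<phi> j)"
proof -
 obtain K where K: "compact K" "K \<subseteq> Om" "tf K \<phi>" by (rule test_E[OF Om p])
 have e: "L2n Om f = nm f" if "tf K f" for f
  unfolding L2n_real nrm2_def using tf_borel[OF that] that K(2)
  by (intro arg_cong[of _ _ sqrt] lebesgue_on_integral_borel(1)[OF Om_borel[OF Om]]) (auto simp: tf_def)
 show ?thesis
  unfolding e[OF K(3)] e[OF tf_pd[OF K(3) compact_imp_closed[OF K(1)]]]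
  by (rule tf_Poincare[OF K(3,1) R]) (use K(2) in auto)
qed

text \<open>The inequality for test functions passes to the limit. Keeping just the j-th derivative
  on the right matters: the strain controls the i-th derivative of the i-th component
  pointwise.\<close>

lemma H10_Poincare:
 assumes f: "f \<in> H10 Om" and R: "\<And>x. x \<in> Om ==> \<bar>x$j\<bar> \<le> R"
 shows "L2n Om f \<le> 2*\<bar>R\<bar> * L2n Om (\<lambda>x. wg Om f x$j)"
proof -
 obtain \<phi> where p: "\<And>k::nat. \<phi> k \<in> TF Om" "(\<lambda>k. H1_norm Om (\<lambda>x. f x - \<phi> k x)) \<longlonglongrightarrow> 0"
  by (rule H10_E[OF f], rule that, erule spec, assumption)
 note f1 = H10_H1[OF f] and pL = test_L2[OF Om p(1)]
 let ?g = "\<lambda>x. wg Om f x$j"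
 have gL: "?g \<in> L2 Om" by (rule L2_nth[OF H1D(2)[OF Om f1]])
 have pdL: "pd (\<phi> k) j \<in> L2 Om" for k by (rule test_L2[OF Om test_pd[OF Om p(1)]])
 have "L2n Om f \<le> (1 + 2*\<bar>R\<bar>) * H1_norm Om (\<lambda>x. f x - \<phi> k x) + 2*\<bar>R\<bar> * L2n Om ?g" for k
 proof -
  let ?h = "\<lambda>x. f x - \<phi> k x"
  note L = H1_diff_test[OF f1 p(1)[of k]]
  have "L2n Om f \<le> L2n Om ?h + L2n Om (\<phi> k)"
   using L2n_triangle[OF H1D(1)[OF Om L(1)] pL[of k], of 1] by simp
  also have "L2n Om (\<phi> k) \<le> 2*\<bar>R\<bar> * L2n Om (pd (\<phi> k) j)" by (rule test_Poincare[OF p(1) R])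
  also have "L2n Om ?h \<le> H1_norm Om ?h" by (rule H1_norm_bounds(1)[OF L(1)])
  finally have 1: "L2n Om f \<le> H1_norm Om ?h + 2*\<bar>R\<bar> * L2n Om (pd (\<phi> k) j)" by simp
  have "L2n Om (pd (\<phi> k) j) \<le> L2n Om ?g + L2n Om (\<lambda>x. wg Om ?h x$j)"
  proof -
   have wL: "(\<lambda>x. wg Om ?h x$j) \<in> L2 Om" by (rule L2_nth[OF H1D(2)[OF Om L(1)]])
   have "L2n Om (pd (\<phi> k) j) = L2n Om (\<lambda>x. ?g x + (- 1)*\<^sub>R (wg Om ?h x$j))"
   proof (rule L2n_cong_AE[OF pdL L2_add_scale[OF gL wL]])
    show "AE x in leb Om. pd (\<phi> k) j x = ?g x + (- 1)*\<^sub>R (wg Om ?h x$j)"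
     using L(2) by eventually_elim (simp add: grad_nth[OF Om])
   qed
   also have "\<dots> \<le> L2n Om ?g + \<bar>- 1\<bar> * L2n Om (\<lambda>x. wg Om ?h x$j)" by (rule L2n_triangle[OF gL wL])
   finally show ?thesis by simp
  qed
  also have "L2n Om (\<lambda>x. wg Om ?h x$j) \<le> H1_norm Om ?h"
   by (rule order_trans[OF L2n_mono[OF L2_nth[OF H1D(2)[OF Om L(1)]] H1D(2)[OF Om L(1)] Finite_Cartesian_Product.norm_nth_le] H1_norm_bounds(2)[OF L(1)]])
  finally have "2*\<bar>R\<bar> * L2n Om (pd (\<phi> k) j) \<le> 2*\<bar>R\<bar>*(L2n Om ?g + H1_norm Om ?h)" by (intro mult_left_mono) auto
  with 1 show ?thesis by (simp add: algebra_simps)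
 qed
 note bd = this
 have "(\<lambda>k. (1 + 2*\<bar>R\<bar>) * H1_norm Om (\<lambda>x. f x - \<phi> k x) + 2*\<bar>R\<bar> * L2n Om ?g) \<longlonglongrightarrow> (1 + 2*\<bar>R\<bar>)*0 + 2*\<bar>R\<bar> * L2n Om ?g"
  by (intro tendsto_intros p)
 from LIMSEQ_le_const[OF this] bd show ?thesis by auto
qed

end

lemma one_L2:
 fixes Om :: "(real^'d) set"
 assumes "open Om" "bounded Om" shows "(\<lambda>x. 1 :: real) \<in> L2 Om"
proof -
 have "emeasure lebesgue Om < \<infinity>"
  using emeasure_bounded_finite[OF assms(2)] Om_borel[OF assms(1)] by simp
 hence "emeasure (leb Om) (space (leb Om)) < \<infinity>"
  using Om_borel[OF assms(1)] by (simp add: emeasure_restrict_space)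
 then interpret finite_measure "leb Om" by (intro finite_measureI) simp
 show ?thesis by (simp add: L2_def)
qed

lemma L2_integrable:
 fixes f :: "real^'d => real"
 assumes "open Om" "bounded Om" "f \<in> L2 Om" shows "integrable (leb Om) f"
 using L2_inner_integrable[OF assms(3) one_L2[OF assms(1,2)]] by simp

subsection \<open>The inf-sup condition\<close>

context
 fixes Om :: "(real^'d) set"
 assumes Om: "open Om"
begin

lemma U_add_scale: "u \<in> U_space Om ==> w \<in> U_space Om ==> (\<lambda>x. u x + c*\<^sub>R w x) \<in> U_space Om"
 using H10_add_scale[OF Om] by (simp add: U_space_def)

lemma H0div_Hdiv: "v \<in> H0div Om ==> v \<in> Hdiv Om" by (simp add: H0div_def)

lemma H0div_add_scale:
 assumes v: "v \<in> H0div Om" and w: "w \<in> H0div Om"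
 shows "(\<lambda>x. v x + c*\<^sub>R w x) \<in> H0div Om"
proof -
 note vw = H0div_Hdiv[OF v] H0div_Hdiv[OF w]
 note L = Hdiv_add_scale[OF Om vw, of c] and DL = HdivD(2)[OF Om vw(1)] HdivD(2)[OF Om vw(2)]
 have "normal_trace Om (\<lambda>x. v x + c*\<^sub>R w x) \<phi> = 0" if p: "\<phi> \<in> H1 Om" for \<phi>
 proof -
  note pL = H1D(1,2)[OF Om p]
  have "normal_trace Om (\<lambda>x. v x + c*\<^sub>R w x) \<phi> = normal_trace Om v \<phi> + c * normal_trace Om w \<phi>"
   unfolding normal_trace_def L2_inner_cong_AE(1)[OF HdivD(2)[OF Om L(1)] L2_add_scale[OF DL] pL(1) L(2)]
    L2_inner_add_scale_left[OF DL pL(1)] L2_inner_add_scale_left[OF HdivD(1)[OF Om vw(1)] HdivD(1)[OF Om vw(2)] pL(2)]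
   by (simp add: algebra_simps)
  thus ?thesis using v w p by (simp add: H0div_def)
 qed
 thus ?thesis using L(1) by (simp add: H0div_def)
qed

text \<open>The constant 1 has weak gradient zero, so the vanishing normal trace tested with 1 gives
  mean zero. Consequently the tuple y built from Div v is an admissible pressure.\<close>

lemma H0div_weak_div_L20:
 assumes v: "v \<in> H0div Om" and b: "bounded Om"
 shows "wd Om v \<in> L20 Om"
proof -
 let ?o = "\<lambda>x::real^'d. 1 :: real"
 have oL: "?o \<in> L2 Om" by (rule one_L2[OF Om b])
 have "ip Om ?o (pd \<phi> j) = 0" if p: "\<phi> \<in> TF Om" for \<phi> j
 proof -
  obtain K where K: "compact K" "K \<subseteq> Om" "tf K \<phi>" by (rule test_E[OF Om p])
  note t = tf_pd[OF K(3) compact_imp_closed[OF K(1)]]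
  have "ip Om ?o (pd \<phi> j) = (LINT x|leb Om. pd \<phi> j x)" by (simp add: L2_inner_def)
  also have "\<dots> = (LBINT x. pd \<phi> j x)"
   using tf_borel[OF t] t K(2) by (intro lebesgue_on_integral_borel(1)[OF Om_borel[OF Om]]) (auto simp: tf_def)
  also have "\<dots> = 0" by (rule integral_pd_eq_0[OF K(3,1)])
  finally show ?thesis .
 qed
 hence "is_weak_grad Om ?o (\<lambda>x. 0)" unfolding is_weak_grad_iff[OF Om oL L2_zero] by simp
 note G = weak_grad_eq[OF Om oL L2_zero this]
 have z: "zero_ae Om (wg Om ?o)" using G(2) by (simp add: zero_ae_def)
 have "normal_trace Om v ?o = 0" using v G(1) by (simp add: H0div_def)
 hence "ip Om (wd Om v) ?o = 0"
  unfolding normal_trace_def using zero_ae_L2[OF H1D(2)[OF Om G(1)] z HdivD(1)[OF Om H0div_Hdiv[OF v]]]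
  by (simp add: L2_inner_commute)
 thus ?thesis using HdivD(2)[OF Om H0div_Hdiv[OF v]] by (simp add: L20_def L2_inner_def)
qed

text \<open>For a test field Green's formula is the definition of the weak gradient of the other
  factor, whence the zero normal trace. Taking the symmetric part of the gradient does not increase
  its norm.\<close>

lemma test_field:
 assumes K: "compact K" "K \<subseteq> Om" and w: "vtf K w"
 defines "W \<equiv> \<lambda>x. \<chi> i. w i x"
 shows "W \<in> U_space Om" "W \<in> H0div Om" "AE x in leb Om. wd Om W x = divf w x"
  "L2n Om (strain Om W) \<le> gnorm w" "L2n Om W \<le> (\<Sum>i\<in>UNIV. L2n Om (w i))"
proof -
 have wt: "w i \<in> TF Om" for i by (rule test_I[OF Om K vtfD[OF w]])
 note wL = test_L2[OF Om wt] and gL = test_grad_L2[OF Om wt]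
 have Wi: "(\<lambda>x. W x$i) = w i" for i by (simp add: W_def)
 show U: "W \<in> U_space Om" by (simp add: U_space_def Wi test_H10[OF Om wt])
 have h: "W \<in> {u. \<forall>i. (\<lambda>x. u x$i) \<in> H1 Om}" by (rule U_H1f[OF Om U])
 have ae: "AE x in leb Om. \<forall>i. wg Om (w i) x = grad (w i) x"
  unfolding AE_all_countable using test_weak_grad(2)[OF Om wt] by blast
 note fd = field_div[OF Om h, unfolded Wi]
 show dv: "AE x in leb Om. wd Om W x = divf w x"
  using fd(2) ae by eventually_elim (simp add: divf_def grad_nth[OF Om])
 have dL: "divf w \<in> L2 Om" unfolding divf_def[abs_def] by (intro L2_sum test_L2[OF Om] test_pd[OF Om] wt)
 have WL: "W \<in> L2 Om" by (rule HdivD(1)[OF Om fd(1)])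
 have "normal_trace Om W \<phi> = 0" if p: "\<phi> \<in> H1 Om" for \<phi>
 proof -
  note pL = H1D(1,2)[OF Om p]
  have "ip Om W (wg Om \<phi>) = (\<Sum>i\<in>UNIV. ip Om (w i) (\<lambda>x. wg Om \<phi> x$i))"
   unfolding L2_inner_vec[OF WL pL(2)] Wi ..
  also have "\<dots> = (\<Sum>i\<in>UNIV. - ip Om \<phi> (pd (w i) i))"
   using H1D(3)[OF Om p, unfolded is_weak_grad_iff[OF Om pL]] wt by simp
  also have "\<dots> = - ip Om (divf w) \<phi>"
   unfolding divf_def[abs_def] sum_negf L2_inner_sum_left[OF test_L2[OF Om test_pd[OF Om wt]] pL(1)]
   by (simp only: L2_inner_commute[of Om \<phi>])
  finally show ?thesis
   unfolding normal_trace_def L2_inner_cong_AE(1)[OF HdivD(2)[OF Om fd(1)] dL pL(1) dv] by simp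
 qed
 thus "W \<in> H0div Om" using fd(1) by (simp add: H0div_def)
 let ?J = "\<lambda>x. \<chi> i. grad (w i) x"
 have JL: "?J \<in> L2 Om" by (rule L2_vecI) (simp add: gL)
 let ?S = "\<lambda>x. (1/2)*\<^sub>R (?J x + transpose (?J x))"
 have SL: "?S \<in> L2 Om"
 proof (intro L2_vecI)
  fix i j
  have "(\<lambda>x. (1/2)*\<^sub>R (pd (w i) j x + 1*\<^sub>R pd (w j) i x)) \<in> L2 Om"
   by (intro L2_scale L2_add_scale test_L2[OF Om] test_pd[OF Om] wt)
  thus "(\<lambda>x. ?S x$i$j) \<in> L2 Om" by (simp add: transpose_def grad_nth[OF Om])
 qed
 have "L2n Om (strain Om W) = L2n Om ?S"
 proof (rule L2n_cong_AE[OF strain_L2[OF Om h] SL])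
  show "AE x in leb Om. strain Om W x = ?S x"
   using ae by eventually_elim (simp add: strain_def Let_def Wi)
 qed
 also have "\<dots> \<le> L2n Om ?J"
 proof (rule L2n_mono[OF SL JL])
  fix x
  have "norm (?J x + transpose (?J x)) \<le> norm (?J x) + norm (?J x)"
   using norm_triangle_ineq[of "?J x" "transpose (?J x)"] norm_transpose[of "?J x"] by simp
  thus "norm (?S x) \<le> norm (?J x)" by simp
 qed
 also have "L2n Om ?J = gnorm w"
 proof -
  have e: "ip Om (pd (w i) j) (pd (w i) j) = (nm (pd (w i) j))^2" for i j
  proof -
   note t = tf_pd[OF vtfD[OF w, of i] compact_imp_closed[OF K(1)], of j]
   show ?thesis
    unfolding nrm2_square unfolding L2_inner_def inner_real_def power2_eq_square using tf_borel[OF t] t K(2)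
    by (intro lebesgue_on_integral_borel(1)[OF Om_borel[OF Om]]) (auto simp: tf_def)
  qed
  have "ip Om ?J ?J = (\<Sum>i\<in>UNIV. \<Sum>j\<in>UNIV. ip Om (pd (w i) j) (pd (w i) j))"
   unfolding L2_inner_vec[OF JL JL] vec_lambda_beta L2_inner_vec[OF gL gL] grad_nth[OF Om] ..
  thus ?thesis by (simp add: L2n_def gnorm_def e)
 qed
 finally show "L2n Om (strain Om W) \<le> gnorm w" .
 have "L2n Om W = nrm2 (leb Om) (\<lambda>x. norm (W x))" by (rule L2n_eq)
 also have "\<dots> \<le> nrm2 (leb Om) (\<lambda>x. \<Sum>i\<in>UNIV. \<bar>w i x\<bar>)"
 proof (rule nrm2_mono[OF _ sqint_measurable[OF L2_norm_sqint[OF WL]]])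
  show "sqint (leb Om) (\<lambda>x. \<Sum>i\<in>UNIV. \<bar>w i x\<bar>)"
   using L2_norm_sqint[OF wL] by (intro sqint_sum) simp
  fix x
  have "norm (W x) \<le> (\<Sum>i\<in>UNIV. \<bar>W x$i\<bar>)" by (rule norm_le_l1_cart)
  thus "\<bar>norm (W x)\<bar> \<le> \<bar>\<Sum>i\<in>UNIV. \<bar>w i x\<bar>\<bar>" by (simp add: W_def)
 qed
 also have "\<dots> \<le> (\<Sum>i\<in>UNIV. nrm2 (leb Om) (\<lambda>x. \<bar>w i x\<bar>))"
  using L2_norm_sqint[OF wL] by (intro nrm2_sum) simp
 also have "\<dots> = (\<Sum>i\<in>UNIV. L2n Om (w i))" by (simp add: L2n_eq)
 finally show "L2n Om W \<le> (\<Sum>i\<in>UNIV. L2n Om (w i))" .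
qed

end

text \<open>The same field will act as a displacement and as a flux, hence the bounds on both its
  strain and its L^2 norm; the latter comes from Poincare's inequality on the bounded
  domain.\<close>

lemma inf_sup_condition:
 fixes Om :: "(real^'d) set"
 assumes dom: "bounded_lipschitz_domain Om"
 obtains B where "B \<ge> 0" "\<And>s. s \<in> L20 Om ==> \<exists>W. W \<in> U_space Om \<and> W \<in> H0div Om \<and>
  ip Om s (wd Om W) = (L2n Om s)^2 \<and> L2n Om (strain Om W) \<le> B * L2n Om s \<and> L2n Om W \<le> B * L2n Om s"
proof -
 have Om: "open Om" "bounded Om" using dom by (auto simp: bounded_lipschitz_domain_def)
 note Omb = Om_borel[OF Om(1)]
 obtain R where R: "\<forall>x\<in>Om. norm x \<le> R" using Om(2) by (auto simp: bounded_iff)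
 have Rj: "\<bar>x$j\<bar> \<le> \<bar>R\<bar>" if "x \<in> Om" for x j
  using component_le_norm_cart[of x j] bspec[OF R that] by linarith
 obtain A where A: "A \<ge> 0" and neg: "\<And>p M. sqb p ==> \<forall>x. x \<notin> Om \<longrightarrow> p x = 0 ==> (LBINT x. p x) = 0 ==>
   bnd Om p M ==> 0 \<le> M ==> nm p \<le> A * M"
  by (rule negative_norm[OF dom], rule that)
 define B where "B = (A + 1)*(1 + real CARD('d)*(2*\<bar>R\<bar>))"
 have B: "0 \<le> B" "A + 1 \<le> B" using A by (auto simp: B_def distrib_left)
 show ?thesis
 proof (rule that[OF B(1)])
  fix s assume s: "s \<in> L20 Om"
  hence sL: "s \<in> L2 Om" by (simp add: L20_def)
  obtain f where f: "sqb f" "\<forall>x. x \<notin> Om \<longrightarrow> f x = 0"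
   "\<forall>h\<in>borel_measurable borel. (LINT x|leb Om. s x * h x) = (LBINT x. f x * h x)"
   "nrm2 (leb Om) s = nm f"
   by (rule sqint_borel_representative[OF Omb sL[unfolded L2_real_iff]], rule that)
  have n: "L2n Om s = nm f" by (simp add: L2n_real f(4))
  show "\<exists>W. W \<in> U_space Om \<and> W \<in> H0div Om \<and> ip Om s (wd Om W) = (L2n Om s)^2 \<and>
   L2n Om (strain Om W) \<le> B * L2n Om s \<and> L2n Om W \<le> B * L2n Om s"
  proof -
   have "\<exists>K w. compact K \<and> K \<subseteq> Om \<and> vtf K w \<and> (LBINT x. f x * divf w x) = (L2n Om s)^2 \<and> gnorm w \<le> (A + 1) * L2n Om s"
   proof (cases "L2n Om s = 0")
    case True
    have "vtf ({} :: (real^'d) set) (\<lambda>i x. 0)" by (simp add: vtf_def tf_zero)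
    moreover have "gnorm (\<lambda>(i::'d) (x::real^'d). 0) = 0" by (simp add: gnorm_def pd_const)
    moreover have "divf (\<lambda>(i::'d) x. 0) x = 0" for x :: "real^'d" by (simp add: divf_def pd_const)
    ultimately show ?thesis using True by (intro exI[of _ "{}"] exI[of _ "\<lambda>i x. 0"]) simp
   next
    case False
    hence pos: "L2n Om s > 0" using L2n_nonneg[of Om s] by linarith
    \<comment> \<open>Because of the added 1, A M is strictly below the norm of s, so
      \<open>negative_norm\<close> refutes \<open>bnd Om f M\<close> and some test field exceeds the
      bound.\<close>
    define M where "M = L2n Om s/(A + 1)"
    have M: "0 < M" "A * M < L2n Om s" using pos A by (simp_all add: M_def field_simps)
    have "(LBINT x. f x) = (LINT x|leb Om. s x)" using bspec[OF f(3), of "\<lambda>x. 1"] by simp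
    hence f0: "(LBINT x. f x) = 0" using s by (simp add: L20_def)
    have "\<not> bnd Om f M"
    proof
     assume "bnd Om f M"
     from neg[OF f(1) f(2) f0 this] M show False unfolding n by simp
    qed
    then obtain K w where w: "compact K" "K \<subseteq> Om" "vtf K w" "M * gnorm w < \<bar>LBINT x. f x * divf w x\<bar>"
     unfolding bnd_def by (auto simp: not_le)
    define I where "I = (LBINT x. f x * divf w x)"
    have "0 \<le> M * gnorm w" using M(1) by simp
    with w(4) have I: "I \<noteq> 0" unfolding I_def[symmetric] by linarith
    \<comment> \<open>Scaling by t normalises the pairing and also fixes its sign.\<close>
    define t where "t = (L2n Om s)^2/I"
    have Cw: "Cinf (w i)" for i by (rule tf_Cinf[OF vtfD[OF w(3)]])
    have "vtf K (\<lambda>i x. t * w i x)" using w(3) by (auto simp: vtf_def intro: tf_scale)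
    moreover have "(LBINT x. f x * divf (\<lambda>i x. t * w i x) x) = (L2n Om s)^2"
    proof -
     have "f x * divf (\<lambda>i x. t * w i x) x = t*(f x * divf w x)" for x
      by (simp add: divf_def pd_scale[OF Cw] sum_distrib_left[symmetric])
     thus ?thesis using I by (simp add: I_def[symmetric] t_def)
    qed
    moreover have "gnorm (\<lambda>i x. t * w i x) \<le> (A + 1) * L2n Om s"
    proof -
     have "gnorm (\<lambda>i x. t * w i x) = \<bar>t\<bar> * gnorm w"
      by (simp add: gnorm_def pd_scale[OF Cw] nrm2_scale power_mult_distrib sum_distrib_left[symmetric] real_sqrt_mult)
     also have "\<dots> \<le> \<bar>t\<bar>*(\<bar>I\<bar>/M)"
      using w(4) M(1) by (intro mult_left_mono) (simp_all add: I_def[symmetric] field_simps)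
     also have "\<dots> = (A + 1) * L2n Om s"
      using I pos A by (simp add: t_def M_def abs_mult field_simps power2_eq_square)
     finally show ?thesis .
    qed
    ultimately show ?thesis using w(1,2) by blast
   qed
   then obtain K w where w: "compact K" "K \<subseteq> Om" "vtf K w"
    "(LBINT x. f x * divf w x) = (L2n Om s)^2" "gnorm w \<le> (A + 1) * L2n Om s" by (elim exE conjE)
   define W :: "real^'d => real^'d" where "W = (\<lambda>x. \<chi> i. w i x)"
   note T = test_field[OF Om(1) w(1,2,3), folded W_def]
   have wt: "w i \<in> TF Om" for i by (rule test_I[OF Om(1) w(1,2) vtfD[OF w(3)]])
   have dL: "divf w \<in> L2 Om" unfolding divf_def[abs_def] by (intro L2_sum test_L2[OF Om(1)] test_pd[OF Om(1)] wt)
   have db: "divf w \<in> borel_measurable borel" using divf_sqint[OF w(3,1)] by (auto simp: sqint_def)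
   have "ip Om s (wd Om W) = ip Om s (divf w)"
    by (rule L2_inner_cong_AE(2)[OF HdivD(2)[OF Om(1) H0div_Hdiv[OF Om(1) T(2)]] dL sL T(3)])
   also have "\<dots> = (L2n Om s)^2" using bspec[OF f(3) db] w(4) by (simp add: L2_inner_def)
   finally have 1: "ip Om s (wd Om W) = (L2n Om s)^2" .
   have 2: "L2n Om (strain Om W) \<le> B * L2n Om s"
    using T(4) w(5) mult_right_mono[OF B(2) L2n_nonneg[of Om s]] by linarith
   have "L2n Om (w i) \<le> 2*\<bar>R\<bar> * gnorm w" for i
   proof -
    have "L2n Om (w i) \<le> 2*\<bar>\<bar>R\<bar>\<bar> * L2n Om (pd (w i) i)" by (rule test_Poincare[OF Om(1) wt Rj])
    also have "L2n Om (pd (w i) i) = nm (pd (w i) i)"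
    proof -
     note t = tf_pd[OF vtfD[OF w(3), of i] compact_imp_closed[OF w(1)], of i]
     show ?thesis
      unfolding L2n_real nrm2_def using tf_borel[OF t] t w(2)
      by (intro arg_cong[of _ _ sqrt] lebesgue_on_integral_borel(1)[OF Omb]) (auto simp: tf_def)
    qed
    also have "2*\<bar>\<bar>R\<bar>\<bar> * nm (pd (w i) i) \<le> 2*\<bar>R\<bar> * gnorm w"
     using nrm2_pd_le_gnorm[of w i i] by (simp add: mult_left_mono)
    finally show ?thesis .
   qed
   hence "(\<Sum>i\<in>UNIV. L2n Om (w i)) \<le> (\<Sum>i\<in>(UNIV::'d set). 2*\<bar>R\<bar> * gnorm w)" by (intro sum_mono)
   also have "\<dots> = real CARD('d)*(2*\<bar>R\<bar>) * gnorm w" by simp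
   also have "\<dots> \<le> real CARD('d)*(2*\<bar>R\<bar>)*((A + 1) * L2n Om s)" by (intro mult_left_mono w) simp
   also have "\<dots> \<le> B * L2n Om s" using A by (simp add: B_def algebra_simps)
   finally have 3: "L2n Om W \<le> B * L2n Om s" using T(5) by linarith
   show ?thesis using T(1,2) 1 2 3 by blast
  qed
 qed
qed

subsection \<open>The parameter matrices\<close>

text \<open>If the matrix were not invertible, Gauss-Jordan elimination would end in an echelon form
  other than the identity, and that form exhibits a nonzero kernel vector.\<close>

lemma mat_inverse_trivial_kernel:
 fixes A :: "real mat"
 assumes A: "A \<in> carrier_mat n n"
  and ker: "\<And>v. v \<in> carrier_vec n ==> A *\<^sub>v v = 0\<^sub>v n ==> v = 0\<^sub>v n"
 shows "the (mat_inverse A) \<in> carrier_mat n n" "A * the (mat_inverse A) = 1\<^sub>m n"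
proof -
 have U: "A \<in> Units (ring_mat TYPE(real) n ())"
 proof (rule ccontr)
  assume nU: "A \<notin> Units (ring_mat TYPE(real) n ())"
  obtain C D where g: "gauss_jordan A (1\<^sub>m n) = (C, D)" by (cases "gauss_jordan A (1\<^sub>m n)")
  have C1: "C \<noteq> 1\<^sub>m n"
  proof
   assume "C = 1\<^sub>m n"
   with gauss_jordan_inverse_one_direction(1)[OF A one_carrier_mat, of D "()"] g nU show False by simp
  qed
  note J = gauss_jordan[OF A one_carrier_mat g]
  note v = find_base_vector_not_1[OF gauss_jordan_row_echelon[OF A g] J(3) C1]
  have "A *\<^sub>v find_base_vector C = 0\<^sub>v n" using J(1)[OF v(1)] v(3) by simp
  with ker[OF v(1)] v(2) show False by simp
 qed
 then obtain B where B: "mat_inverse A = Some B"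
  using mat_inverse(1)[OF A, of "()"] by (cases "mat_inverse A") simp_all
 from mat_inverse(2)[OF A B] show "the (mat_inverse A) \<in> carrier_mat n n" "A * the (mat_inverse A) = 1\<^sub>m n"
  by (simp_all add: B)
qed

definition qf :: "nat => real mat => (nat => real) => real" where
 "qf n M x = (\<Sum>i<n. \<Sum>j<n. M $$ (i, j)*(x j * x i))"

lemma Lam_carrier: "Lam1 n am \<in> carrier_mat n n" "Lam2 n ap \<in> carrier_mat n n"
 "Lam1 n am + Lam2 n ap \<in> carrier_mat n n" "Lam n lam Rinv ap am \<in> carrier_mat n n"
 by (simp_all add: Lam_def Lam1_def Lam2_def Lam3_def Lam4_def)

lemma Lam_nth:
 assumes "i < n" "j < n"
 shows "Lam n lam Rinv ap am $$ (i, j) = (Lam1 n am + Lam2 n ap) $$ (i, j) +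
  (if i = j then inverse (Max (Rinv ` {..<n})) else 0) + 1/max 1 lam"
 using assms by (simp add: Lam_def Lam1_def Lam2_def Lam3_def Lam4_def)

lemma Lam_sym:
 assumes "admissible n lam Rinv ap am" "i < n" "j < n"
 shows "(Lam1 n am + Lam2 n ap) $$ (i, j) = (Lam1 n am + Lam2 n ap) $$ (j, i)"
  "Lam n lam Rinv ap am $$ (i, j) = Lam n lam Rinv ap am $$ (j, i)"
proof -
 obtain \<tau> \<alpha> \<beta> where "\<forall>i<n. \<forall>j<n. i \<noteq> j \<longrightarrow> \<beta> i j = \<beta> j i \<and> (0::real) \<le> \<beta> i j"
  "\<forall>i<n. \<forall>j<n. am i j = \<tau>*\<beta> i j/(\<alpha> i*\<alpha> j)"
  using assms(1) unfolding admissible_def by (elim conjE exE)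
 hence "i \<noteq> j ==> am i j = am j i" using assms(2,3) by (simp add: mult.commute)
 thus *: "(Lam1 n am + Lam2 n ap) $$ (i, j) = (Lam1 n am + Lam2 n ap) $$ (j, i)"
  using assms(2,3) by (auto simp: Lam1_def Lam2_def)
 show "Lam n lam Rinv ap am $$ (i, j) = Lam n lam Rinv ap am $$ (j, i)"
  unfolding Lam_nth[OF assms(2,3)] Lam_nth[OF assms(3,2)] * by auto
qed

text \<open>Exchanging the roles of i and j and adding gives the sum of the nonnegative terms b_ij
  (y_i - y_j)^2.\<close>

lemma graph_Laplacian_nonneg:
 fixes b :: "nat => nat => real"
 assumes "\<And>i j. i < n ==> j < n ==> b i j = b j i" "\<And>i j. i < n ==> j < n ==> 0 \<le> b i j"
 shows "0 \<le> (\<Sum>i<n. \<Sum>j<n. b i j*((y i)^2 - y i * y j))"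
proof -
 let ?S = "\<Sum>i<n. \<Sum>j<n. b i j*((y i)^2 - y i * y j)"
 have "?S = (\<Sum>i<n. \<Sum>j<n. b j i*((y j)^2 - y j * y i))" by (rule sum.swap)
 also have "\<dots> = (\<Sum>i<n. \<Sum>j<n. b i j*((y j)^2 - y j * y i))" using assms(1) by (intro sum.cong) auto
 finally have "2 * ?S = ?S + (\<Sum>i<n. \<Sum>j<n. b i j*((y j)^2 - y j * y i))" by simp
 also have "\<dots> = (\<Sum>i<n. \<Sum>j<n. b i j*(y i - y j)^2)"
  unfolding sum.distrib[symmetric] by (intro sum.cong refl) (simp add: power2_eq_square algebra_simps)
 also have "\<dots> \<ge> 0" using assms(2) by (intro sum_nonneg mult_nonneg_nonneg) auto
 finally show ?thesis by simp
qed

text \<open>The substitution y_i = x_i/\<alpha>_i turns \<Lambda>1 into the Laplacian of a graph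
  with weights \<tau> \<beta>_ij; the condition on \<beta>_ii says precisely that the diagonal
  consists of the row sums.\<close>

lemma Lam12_nonneg:
 assumes adm: "admissible n lam Rinv ap am"
 shows "0 \<le> qf n (Lam1 n am + Lam2 n ap) x"
proof -
 obtain \<tau> \<alpha> \<beta> where a: "\<forall>i<n. 0 \<le> ap i" "0 < \<tau>" "\<forall>i<n. (0::real) < \<alpha> i"
  "\<forall>i<n. \<forall>j<n. i \<noteq> j \<longrightarrow> \<beta> i j = \<beta> j i \<and> (0::real) \<le> \<beta> i j"
  "\<forall>i<n. \<beta> i i = (\<Sum>j\<in>{..<n} - {i}. \<beta> i j)"
  "\<forall>i<n. \<forall>j<n. am i j = \<tau>*\<beta> i j/(\<alpha> i*\<alpha> j)"
  using adm unfolding admissible_def by (elim conjE exE)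
 define y where "y i = x i/\<alpha> i" for i
 \<comment> \<open>Diagonal terms contribute (y i)^2 - (y i)^2 = 0, so their weight may be set to
   zero; off the diagonal symmetry and sign are given.\<close>
 define b where "b i j = (if i = j then 0 else \<tau>*\<beta> i j)" for i j
 have ym: "am i j*(x j * x i) = \<tau>*\<beta> i j*(y i * y j)" if "i < n" "j < n" for i j
  using a(6) that by (simp add: y_def)
 have row: "(\<Sum>j<n. Lam1 n am $$ (i, j)*(x j * x i)) = (\<Sum>j<n. b i j*((y i)^2 - y i * y j))" if i: "i < n" for i
 proof -
  have "(\<Sum>j<n. Lam1 n am $$ (i, j)*(x j * x i)) =
    am i i*(x i * x i) + (\<Sum>j\<in>{..<n} - {i}. - (am i j*(x j * x i)))"
   using i by (subst sum.remove[of _ i]) (auto simp: Lam1_def intro!: sum.cong)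
  also have "\<dots> = \<tau>*\<beta> i i*(y i)^2 + (\<Sum>j\<in>{..<n} - {i}. - (\<tau>*\<beta> i j*(y i * y j)))"
   using i ym[OF i] ym[OF i i] by (intro arg_cong2[of _ _ _ _ "(+)"] sum.cong) (auto simp: power2_eq_square)
  also have "\<tau>*\<beta> i i*(y i)^2 = (\<Sum>j\<in>{..<n} - {i}. \<tau>*\<beta> i j*(y i)^2)"
   using a(5) i by (simp add: sum_distrib_left sum_distrib_right)
  also have "(\<Sum>j\<in>{..<n} - {i}. \<tau>*\<beta> i j*(y i)^2) + (\<Sum>j\<in>{..<n} - {i}. - (\<tau>*\<beta> i j*(y i * y j)))
    = (\<Sum>j\<in>{..<n} - {i}. b i j*((y i)^2 - y i * y j))"
   unfolding sum.distrib[symmetric] by (intro sum.cong refl) (auto simp: b_def algebra_simps)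
  also have "\<dots> = (\<Sum>j<n. b i j*((y i)^2 - y i * y j))"
   using i by (subst (2) sum.remove[of _ i]) (auto simp: b_def)
  finally show ?thesis .
 qed
 have "qf n (Lam1 n am + Lam2 n ap) x = (\<Sum>i<n. (\<Sum>j<n. Lam1 n am $$ (i, j)*(x j * x i)) + ap i*(x i)^2)"
  unfolding qf_def
 proof (intro sum.cong refl)
  fix i assume i: "i \<in> {..<n}"
  have "(\<Sum>j<n. (Lam1 n am + Lam2 n ap) $$ (i, j)*(x j * x i)) =
    (\<Sum>j<n. Lam1 n am $$ (i, j)*(x j * x i) + (if i = j then ap i*(x j * x i) else 0))"
   using i by (intro sum.cong refl) (auto simp: Lam1_def Lam2_def algebra_simps)
  also have "\<dots> = (\<Sum>j<n. Lam1 n am $$ (i, j)*(x j * x i)) + ap i*(x i)^2"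
   using i by (simp add: sum.distrib power2_eq_square)
  finally show "(\<Sum>j<n. (Lam1 n am + Lam2 n ap) $$ (i, j)*(x j * x i)) =
    (\<Sum>j<n. Lam1 n am $$ (i, j)*(x j * x i)) + ap i*(x i)^2" .
 qed
 also have "\<dots> = (\<Sum>i<n. \<Sum>j<n. b i j*((y i)^2 - y i * y j)) + (\<Sum>i<n. ap i*(x i)^2)"
  by (simp add: row sum.distrib)
 also have "\<dots> \<ge> 0"
  using a by (intro add_nonneg_nonneg graph_Laplacian_nonneg sum_nonneg mult_nonneg_nonneg) (auto simp: b_def)
 finally show ?thesis .
qed

lemma sum_square_double: "(\<Sum>i<n. \<Sum>j<n. x j * x i) = (\<Sum>i<n. x i)^2" for x :: "nat => real"
 by (simp add: power2_eq_square sum_product mult.commute)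

lemma qf_Lam:
 "qf n (Lam n lam Rinv ap am) x = qf n (Lam1 n am + Lam2 n ap) x +
  inverse (Max (Rinv ` {..<n}))*(\<Sum>i<n. (x i)^2) + (1/max 1 lam)*(\<Sum>i<n. x i)^2"
proof -
 let ?r = "inverse (Max (Rinv ` {..<n}))"
 have "qf n (Lam n lam Rinv ap am) x = (\<Sum>i<n. \<Sum>j<n. (Lam1 n am + Lam2 n ap) $$ (i, j)*(x j * x i)
   + (if i = j then ?r*(x j * x i) else 0) + (1/max 1 lam)*(x j * x i))"
  unfolding qf_def by (intro sum.cong refl) (simp add: Lam_nth distrib_right)
 also have "\<dots> = qf n (Lam1 n am + Lam2 n ap) x + ?r*(\<Sum>i<n. (x i)^2) + (1/max 1 lam)*(\<Sum>i<n. x i)^2"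
  unfolding sum.distrib sum_distrib_left[symmetric] sum_square_double
  by (simp add: qf_def sum_distrib_left power2_eq_square)
 finally show ?thesis .
qed

lemma Rinv_Max:
 assumes adm: "admissible n lam Rinv ap am" and n: "n \<ge> 1"
 shows "0 < inverse (Max (Rinv ` {..<n}))" "\<And>i. i < n ==> inverse (Max (Rinv ` {..<n})) * Rinv i \<le> 1"
proof -
 have ne: "Rinv ` {..<n} \<noteq> {}" "finite (Rinv ` {..<n})" using n by (auto simp: lessThan_empty_iff)
 have le: "Rinv i \<le> Max (Rinv ` {..<n})" if "i < n" for i using ne that by (intro Max_ge) auto
 have "0 < Rinv 0" using adm n by (simp add: admissible_def)
 hence pos: "0 < Max (Rinv ` {..<n})" by (rule less_le_trans) (rule le, use n in simp)
 thus "0 < inverse (Max (Rinv ` {..<n}))" by simp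
 show "inverse (Max (Rinv ` {..<n})) * Rinv i \<le> 1" if "i < n" for i
  using le[OF that] pos by (simp add: field_simps)
qed

text \<open>\<Lambda>3 is a positive multiple of the identity, since the maximum runs over a
  nonempty set of positive numbers, and the other summands are nonnegative. A kernel vector thus has
  sum of squares zero.\<close>

lemma Lam_inverse:
 assumes adm: "admissible n lam Rinv ap am" and n: "n \<ge> 1"
 defines "B \<equiv> the (mat_inverse (Lam n lam Rinv ap am))"
 shows "B \<in> carrier_mat n n" "\<And>i k. i < n ==> k < n ==> (\<Sum>j<n. Lam n lam Rinv ap am $$ (i, j) * B $$ (j, k)) = (if i = k then 1 else 0)"
proof -
 let ?L = "Lam n lam Rinv ap am"
 have ker: "v = 0\<^sub>v n" if v: "v \<in> carrier_vec n" "?L *\<^sub>v v = 0\<^sub>v n" for v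
 proof -
  let ?x = "\<lambda>i. vec_index v i"
  have row: "(\<Sum>j<n. ?L $$ (i, j) * ?x j) = 0" if i: "i < n" for i
  proof -
   have "vec_index (?L *\<^sub>v v) i = (\<Sum>j<n. ?L $$ (i, j) * ?x j)"
    using v(1) i Lam_carrier(4)[of n lam Rinv ap am] by (simp add: scalar_prod_def atLeast0LessThan)
   thus ?thesis using v(2) i by simp
  qed
  have "qf n ?L ?x = (\<Sum>i<n. (\<Sum>j<n. ?L $$ (i, j) * ?x j) * ?x i)"
   unfolding qf_def by (simp add: sum_distrib_right mult.assoc)
  also have "\<dots> = 0" by (intro sum.neutral) (simp add: row)
  finally have q0: "qf n ?L ?x = 0" .
  have "0 \<le> (1/max 1 lam)*(\<Sum>i<n. ?x i)^2" by simp
  with q0 Lam12_nonneg[OF adm, of ?x] have "inverse (Max (Rinv ` {..<n}))*(\<Sum>i<n. (?x i)^2) \<le> 0"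
   unfolding qf_Lam by linarith
  hence "\<not> 0 < (\<Sum>i<n. (?x i)^2)" using mult_pos_pos[OF Rinv_Max(1)[OF adm n], of "\<Sum>i<n. (?x i)^2"] by linarith
  hence "(\<Sum>i<n. (?x i)^2) \<le> 0" by simp
  hence "(\<Sum>i<n. (?x i)^2) = 0" by (intro antisym sum_nonneg) auto
  hence "\<forall>i\<in>{..<n}. (?x i)^2 = 0" by (subst (asm) sum_nonneg_eq_0_iff) auto
  thus ?thesis using v(1) by (intro eq_vecI) auto
 qed
 show B: "B \<in> carrier_mat n n" unfolding B_def by (rule mat_inverse_trivial_kernel(1)[OF Lam_carrier(4)], rule ker)
 have LB: "?L * B = 1\<^sub>m n" unfolding B_def by (rule mat_inverse_trivial_kernel(2)[OF Lam_carrier(4)], rule ker)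
 show "(\<Sum>j<n. ?L $$ (i, j) * B $$ (j, k)) = (if i = k then 1 else 0)" if "i < n" "k < n" for i k
 proof -
  have "(?L * B) $$ (i, k) = (\<Sum>j<n. ?L $$ (i, j) * B $$ (j, k))"
   using that B Lam_carrier(4)[of n lam Rinv ap am] by (simp add: scalar_prod_def atLeast0LessThan)
  thus ?thesis using LB that by simp
 qed
qed

subsection \<open>Quadratic forms on tuples\<close>

lemma L2_inner_mult: "ip Om (\<lambda>x. c * f x) g = c * ip Om f g" for f :: "'a::euclidean_space => real"
 by (simp add: L2_inner_def mult.assoc)

definition Qf :: "(real^'d) set => nat => real mat => (nat => real^'d => real) => (nat => real^'d => real) => real" where
 "Qf Om n M p q = (\<Sum>i<n. \<Sum>j<n. M $$ (i, j) * ip Om (p j) (q i))"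

definition L2t :: "(real^'d) set => nat => (nat => real^'d => real) set" where
 "L2t Om n = {p. \<forall>i<n. p i \<in> L2 Om}"

lemma mat_app_L2:
 assumes "M \<in> carrier_mat n n" "p \<in> L2t Om n"
 shows "mat_app M p i \<in> L2 Om"
proof -
 have "(\<lambda>x. \<Sum>j<n. (M $$ (i, j))*\<^sub>R p j x) \<in> L2 Om"
  using assms(2) by (intro L2_sum L2_scale) (simp add: L2t_def)
 thus ?thesis using assms(1) by (simp add: mat_app_def)
qed

lemma mat_app_inner:
 assumes "M \<in> carrier_mat n n" "p \<in> L2t Om n" "f \<in> L2 Om"
 shows "ip Om (mat_app M p i) f = (\<Sum>j<n. M $$ (i, j) * ip Om (p j) f)"
proof -
 have "mat_app M p i = (\<lambda>x. \<Sum>j<n. (M $$ (i, j))*\<^sub>R p j x)" using assms(1) by (simp add: mat_app_def)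
 moreover have "ip Om (\<lambda>x. \<Sum>j<n. (M $$ (i, j))*\<^sub>R p j x) f = (\<Sum>j<n. M $$ (i, j) * ip Om (p j) f)"
  using assms(2) by (subst L2_inner_sum_left[OF L2_scale assms(3)]) (simp_all add: L2t_def L2_inner_mult)
 ultimately show ?thesis by simp
qed

lemma Qf_eq:
 assumes "M \<in> carrier_mat n n" "p \<in> L2t Om n" "q \<in> L2t Om n"
 shows "L2_inner_tuple Om n (mat_app M p) q = Qf Om n M p q"
 unfolding L2_inner_tuple_def Qf_def using assms(3)
 by (intro sum.cong refl mat_app_inner[OF assms(1,2)]) (simp add: L2t_def)

lemma Qf_sym:
 assumes "\<And>i j. i < n ==> j < n ==> M $$ (i, j) = M $$ (j, i)"
 shows "Qf Om n M p q = Qf Om n M q p"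
proof -
 have "Qf Om n M p q = (\<Sum>i<n. \<Sum>j<n. M $$ (j, i) * ip Om (p i) (q j))"
  unfolding Qf_def by (rule sum.swap)
 also have "\<dots> = Qf Om n M q p"
  unfolding Qf_def by (intro sum.cong refl) (simp add: assms L2_inner_commute[of Om "p _"])
 finally show ?thesis .
qed

lemma Qf_add_scale:
 assumes "p \<in> L2t Om n" "q \<in> L2t Om n" "r \<in> L2t Om n"
 shows "Qf Om n M r (\<lambda>i x. p i x + c*\<^sub>R q i x) = Qf Om n M r p + c * Qf Om n M r q"
  "Qf Om n M (\<lambda>i x. p i x + c*\<^sub>R q i x) r = Qf Om n M p r + c * Qf Om n M q r"
proof -
 have L: "p i \<in> L2 Om" "q i \<in> L2 Om" "r i \<in> L2 Om" if "i < n" for i using assms that by (simp_all add: L2t_def)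
 have "Qf Om n M r (\<lambda>i x. p i x + c*\<^sub>R q i x) = (\<Sum>i<n. \<Sum>j<n. M $$ (i, j) * ip Om (r j) (p i) + c*(M $$ (i, j) * ip Om (r j) (q i)))"
  unfolding Qf_def by (intro sum.cong refl) (subst L2_inner_add_scale_right[OF L(1,2,3)], auto simp: algebra_simps)
 thus "Qf Om n M r (\<lambda>i x. p i x + c*\<^sub>R q i x) = Qf Om n M r p + c * Qf Om n M r q"
  by (simp add: Qf_def sum.distrib sum_distrib_left)
 have "Qf Om n M (\<lambda>i x. p i x + c*\<^sub>R q i x) r = (\<Sum>i<n. \<Sum>j<n. M $$ (i, j) * ip Om (p j) (r i) + c*(M $$ (i, j) * ip Om (q j) (r i)))"
  unfolding Qf_def by (intro sum.cong refl) (subst L2_inner_add_scale_left[OF L(1,2,3)], auto simp: algebra_simps)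
 thus "Qf Om n M (\<lambda>i x. p i x + c*\<^sub>R q i x) r = Qf Om n M p r + c * Qf Om n M q r"
  by (simp add: Qf_def sum.distrib sum_distrib_left)
qed

lemma L2t_add_scale: "p \<in> L2t Om n ==> q \<in> L2t Om n ==> (\<lambda>i x. p i x + c*\<^sub>R q i x) \<in> L2t Om n"
 unfolding L2t_def using L2_add_scale[of "p _" Om "q _" c] by auto

text \<open>The form is the integral of the pointwise quadratic form of the matrix.\<close>

lemma Qf_nonneg:
 assumes M: "\<And>x. 0 \<le> qf n M x" and p: "p \<in> L2t Om n"
 shows "0 \<le> Qf Om n M p p"
proof -
 have i: "integrable (leb Om) (\<lambda>x. M $$ (i, j)*(p j x * p i x))" if "i < n" "j < n" for i j
  using L2_inner_integrable[of "p j" Om "p i"] p that by (intro integrable_mult_right) (simp add: L2t_def)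
 have "Qf Om n M p p = (\<Sum>i<n. \<Sum>j<n. (LINT x|leb Om. M $$ (i, j)*(p j x * p i x)))"
  unfolding Qf_def by (simp add: L2_inner_def)
 also have "\<dots> = (\<Sum>i<n. (LINT x|leb Om. (\<Sum>j<n. M $$ (i, j)*(p j x * p i x))))"
  using i by (intro sum.cong refl int_sum[symmetric]) auto
 also have "\<dots> = (LINT x|leb Om. qf n M (\<lambda>i. p i x))"
  unfolding qf_def using i
  by (intro int_sum[symmetric] intble_sum) auto
 also have "\<dots> \<ge> 0" by (intro integral_nonneg_AE AE_I2 M)
 finally show ?thesis .
qed

lemma Qf_Cauchy_Schwarz:
 assumes M: "\<And>x. 0 \<le> qf n M x" and sym: "\<And>i j. i < n ==> j < n ==> M $$ (i, j) = M $$ (j, i)"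
  and p: "p \<in> L2t Om n" and q: "q \<in> L2t Om n"
 shows "(Qf Om n M p q)^2 \<le> Qf Om n M p p * Qf Om n M q q"
proof (rule quadratic_nonneg_imp)
 have sy: "Qf Om n M q p = Qf Om n M p q" by (rule Qf_sym) (rule sym)
 show "0 \<le> Qf Om n M q q" by (rule Qf_nonneg[OF M q])
 fix t :: real
 have "0 \<le> Qf Om n M (\<lambda>i x. p i x + t*\<^sub>R q i x) (\<lambda>i x. p i x + t*\<^sub>R q i x)"
  by (rule Qf_nonneg[OF M L2t_add_scale[OF p q]])
 also have "\<dots> = Qf Om n M p p + 2 * t * Qf Om n M p q + t^2 * Qf Om n M q q"
  unfolding Qf_add_scale(1)[OF p q L2t_add_scale[OF p q]] Qf_add_scale(2)[OF p q p] Qf_add_scale(2)[OF p q q]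
   sy by (simp add: power2_eq_square algebra_simps)
 finally show "0 \<le> Qf Om n M p p + 2 * t * Qf Om n M p q + t^2 * Qf Om n M q q" .
qed

lemma Qf_add_le:
 assumes M: "\<And>x. 0 \<le> qf n M x" and sym: "\<And>i j. i < n ==> j < n ==> M $$ (i, j) = M $$ (j, i)"
  and p: "p \<in> L2t Om n" and q: "q \<in> L2t Om n"
 shows "Qf Om n M (\<lambda>i x. p i x + c*\<^sub>R q i x) (\<lambda>i x. p i x + c*\<^sub>R q i x) \<le> 2 * Qf Om n M p p + 2 * c^2 * Qf Om n M q q"
proof -
 have sy: "Qf Om n M q p = Qf Om n M p q" by (rule Qf_sym) (rule sym)
 have "0 \<le> Qf Om n M (\<lambda>i x. p i x + (- c)*\<^sub>R q i x) (\<lambda>i x. p i x + (- c)*\<^sub>R q i x)"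
  by (rule Qf_nonneg[OF M L2t_add_scale[OF p q]])
 thus ?thesis
  unfolding Qf_add_scale(1)[OF p q L2t_add_scale[OF p q]] Qf_add_scale(2)[OF p q p] Qf_add_scale(2)[OF p q q]
   sy by (simp add: power2_eq_square algebra_simps)
qed

lemma Qf_Lam:
 assumes p: "p \<in> L2t Om n" and q: "q \<in> L2t Om n"
 shows "Qf Om n (Lam n lam Rinv ap am) p q = Qf Om n (Lam1 n am + Lam2 n ap) p q +
  inverse (Max (Rinv ` {..<n}))*(\<Sum>i<n. ip Om (p i) (q i)) +
  (1/max 1 lam) * ip Om (\<lambda>x. \<Sum>i<n. p i x) (\<lambda>x. \<Sum>i<n. q i x)"
proof -
 let ?r = "inverse (Max (Rinv ` {..<n}))"
 have L: "p i \<in> L2 Om" "q i \<in> L2 Om" if "i \<in> {..<n}" for i using p q that by (simp_all add: L2t_def)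
 have S: "ip Om (\<lambda>x. \<Sum>i<n. p i x) (\<lambda>x. \<Sum>i<n. q i x) = (\<Sum>i<n. \<Sum>j<n. ip Om (p j) (q i))"
 proof -
  have "ip Om (\<lambda>x. \<Sum>i<n. p i x) (\<lambda>x. \<Sum>i<n. q i x) = (\<Sum>i<n. ip Om (q i) (\<lambda>x. \<Sum>i<n. p i x))"
   by (subst L2_inner_commute) (rule L2_inner_sum_left[OF L(2) L2_sum[OF L(1)]])
  also have "\<dots> = (\<Sum>i<n. \<Sum>j<n. ip Om (p j) (q i))"
   using L by (intro sum.cong refl) (subst L2_inner_commute, rule L2_inner_sum_left)
  finally show ?thesis .
 qed
 have "Qf Om n (Lam n lam Rinv ap am) p q = (\<Sum>i<n. \<Sum>j<n. (Lam1 n am + Lam2 n ap) $$ (i, j) * ip Om (p j) (q i)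
   + (if i = j then ?r * ip Om (p j) (q i) else 0) + (1/max 1 lam) * ip Om (p j) (q i))"
  unfolding Qf_def by (intro sum.cong refl) (simp add: Lam_nth distrib_right)
 also have "\<dots> = Qf Om n (Lam1 n am + Lam2 n ap) p q + ?r*(\<Sum>i<n. ip Om (p i) (q i)) +
   (1/max 1 lam) * ip Om (\<lambda>x. \<Sum>i<n. p i x) (\<lambda>x. \<Sum>i<n. q i x)"
  unfolding sum.distrib sum_distrib_left[symmetric] S
  by (simp add: Qf_def sum_distrib_left)
 finally show ?thesis .
qed

lemma L2_inner_self_add_le:
 assumes f: "f \<in> L2 Om" and g: "g \<in> L2 Om"
 shows "ip Om (\<lambda>x. f x + c*\<^sub>R g x) (\<lambda>x. f x + c*\<^sub>R g x) \<le> 2 * ip Om f f + 2 * c^2 * ip Om g g"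
proof -
 have "0 \<le> ip Om (\<lambda>x. f x + (- c)*\<^sub>R g x) (\<lambda>x. f x + (- c)*\<^sub>R g x)" by (rule L2_inner_self_nonneg)
 thus ?thesis
  unfolding L2_inner_add_scale_right[OF f g L2_add_scale[OF f g]] L2_inner_add_scale_left[OF f g f]
   L2_inner_add_scale_left[OF f g g] L2_inner_commute[of Om g f] by (simp add: power2_eq_square algebra_simps)
qed

text \<open>Young's inequality, by completing the square with t = 2 c/\<mu>; the weight \<mu>
  decides how much of the squared norm of f is spent.\<close>

lemma L2_inner_lower:
 assumes f: "f \<in> L2 Om" and g: "g \<in> L2 Om" and \<mu>: "\<mu> > 0"
 shows "- (\<mu>/4 * ip Om f f + c^2/\<mu> * ip Om g g) \<le> c * ip Om f g"
proof -
 define t where "t = 2 * c/\<mu>"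
 have "0 \<le> \<mu>/4 * ip Om (\<lambda>x. f x + t*\<^sub>R g x) (\<lambda>x. f x + t*\<^sub>R g x)" using \<mu> by simp
 also have "\<dots> = \<mu>/4 * ip Om f f + (\<mu> * t/2) * ip Om f g + (\<mu> * t^2/4) * ip Om g g"
  unfolding L2_inner_add_scale_right[OF f g L2_add_scale[OF f g]] L2_inner_add_scale_left[OF f g f]
   L2_inner_add_scale_left[OF f g g] L2_inner_commute[of Om g f] by (simp add: power2_eq_square algebra_simps)
 also have "\<mu> * t/2 = c" using \<mu> by (simp add: t_def)
 also have "\<mu> * t^2/4 = c^2/\<mu>" using \<mu> by (simp add: t_def power2_eq_square field_simps)
 finally show ?thesis by simp
qed

lemma Qf_lower:
 assumes M: "\<And>x. 0 \<le> qf n M x" and sym: "\<And>i j. i < n ==> j < n ==> M $$ (i, j) = M $$ (j, i)"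
  and p: "p \<in> L2t Om n" and q: "q \<in> L2t Om n"
 shows "- (Qf Om n M p p/2 + c^2/2 * Qf Om n M q q) \<le> c * Qf Om n M p q"
proof -
 have sy: "Qf Om n M q p = Qf Om n M p q" by (rule Qf_sym) (rule sym)
 have "0 \<le> Qf Om n M (\<lambda>i x. p i x + c*\<^sub>R q i x) (\<lambda>i x. p i x + c*\<^sub>R q i x)"
  by (rule Qf_nonneg[OF M L2t_add_scale[OF p q]])
 also have "\<dots> = Qf Om n M p p + 2*(c * Qf Om n M p q) + c^2 * Qf Om n M q q"
  unfolding Qf_add_scale(1)[OF p q L2t_add_scale[OF p q]] Qf_add_scale(2)[OF p q p] Qf_add_scale(2)[OF p q q]
   sy by (simp add: power2_eq_square algebra_simps)
 finally show ?thesis by simp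
qed

text \<open>The arithmetic of the lower bound in \<open>main_estimate\<close>: F, G, K, H are the
  cross terms, the prefix m stands for multiplication by min \<kappa> \<delta>, and kZ, dS, dR are
  the terms gained by the three corrections.\<close>

lemma coercive_arith:
 fixes X V Z T mX mV mZ mT mS mR kZ dS dR t1 t2 t3 t4 F G K H :: real
 assumes "t1 \<le> dS/2" "t2 \<le> dR" "t3 + t4 = kZ/2" "mX \<le> X" "mV \<le> V" "mT \<le> T" "mZ \<le> kZ" "mS \<le> dS" "mR \<le> dR"
  "- (X/4 + t1) \<le> F" "- (V/2 + t2/2) \<le> G" "- (X/4 + t3) \<le> K" "- (T/2 + t4) \<le> H"
 shows "(mX + mV + mZ + mT + mR + mS)/2 \<le> X + V + kZ + T + dS + dR + F + G + K + H"
proof -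
 have "- (X/4 + t1) + (- (V/2 + t2/2)) + (- (X/4 + t3)) + (- (T/2 + t4)) \<le> F + G + K + H"
  by (intro add_mono assms)
 moreover have "t1 + t2/2 \<le> dS/2 + dR/2" using assms(1,2) by linarith
 moreover have "mX + mV + mZ + mT + mR + mS \<le> X + V + kZ + T + dR + dS" by (intro add_mono assms)
 ultimately show ?thesis using assms(3) by (simp add: field_simps)
qed

text \<open>The arithmetic of the upper bound: X, V + Z and T + R + S are the squared norms of u, v
  and p, and the prefix k stands for multiplication by (1 + D) B^2.\<close>

lemma upper_arith:
 fixes X V Z T R S kX kV kZ kT kR kS u1 u2 u3 :: real
 assumes "u1 \<le> 2 * X + 2 * kS" "u2 \<le> 2*(V + Z) + 2 * kR" "u3 \<le> 2*(T + R + S) + 2 * Z"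
  "0 \<le> X" "0 \<le> V" "0 \<le> Z" "0 \<le> T" "0 \<le> R" "0 \<le> S" "0 \<le> kX" "0 \<le> kV" "0 \<le> kZ" "0 \<le> kT" "0 \<le> kR" "0 \<le> kS"
 shows "u1 + u2 + u3 \<le> 4*(X + (V + Z) + (T + R + S)) + 4*(kX + kV + kZ + kT + kR + kS)"
proof -
 have "u1 + u2 + u3 \<le> (2 * X + 2 * kS) + (2*(V + Z) + 2 * kR) + (2*(T + R + S) + 2 * Z)" by (intro add_mono assms)
 thus ?thesis using assms(4-) by simp
qed

lemma V_space_mem: "v \<in> V_space Om n ==> i < n ==> v i \<in> H0div Om"
 using PiE_mem[of v "{..<n}" "\<lambda>i. H0div Om" i] by (simp add: V_space_def)

lemma P_space_mem: "p \<in> P_space Om n ==> i < n ==> p i \<in> L20 Om"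
 using PiE_mem[of p "{..<n}" "\<lambda>i. L20 Om" i] by (simp add: P_space_def)

context
 fixes Om :: "(real^'d) set" and n :: nat and lam :: real and Rinv ap :: "nat => real" and am :: "nat => nat => real"
 assumes Om: "open Om" and bd: "bounded Om" and adm: "admissible n lam Rinv ap am" and n: "n \<ge> 1"
begin

abbreviation "LM \<equiv> Lam n lam Rinv ap am"
abbreviation "BM \<equiv> the (mat_inverse LM)"
abbreviation "M12 \<equiv> Lam1 n am + Lam2 n ap"
abbreviation "\<rho> \<equiv> inverse (Max (Rinv ` {..<n}))"
abbreviation "l0 \<equiv> max 1 lam"

lemma lam_pos: "lam > 0" and Rinv_pos: "i < n ==> Rinv i > 0"
 using adm by (auto simp: admissible_def)

lemma \<rho>_pos: "\<rho> > 0" and \<rho>_Rinv: "i < n ==> \<rho> * Rinv i \<le> 1"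
 using Rinv_Max[OF adm n] by auto

lemma BM_carrier: "BM \<in> carrier_mat n n" by (rule Lam_inverse(1)[OF adm n])

lemma M12_nonneg: "0 \<le> qf n M12 x" by (rule Lam12_nonneg[OF adm])

lemma LM_nonneg: "0 \<le> qf n LM x"
 unfolding qf_Lam using M12_nonneg \<rho>_pos by (intro add_nonneg_nonneg mult_nonneg_nonneg sum_nonneg) auto

lemma LM_sym: "i < n ==> j < n ==> LM $$ (i, j) = LM $$ (j, i)"
 and M12_sym: "i < n ==> j < n ==> M12 $$ (i, j) = M12 $$ (j, i)"
 using Lam_sym[OF adm] by blast+

lemma BM_L2t: "g \<in> L2t Om n ==> mat_app BM g \<in> L2t Om n"
 unfolding L2t_def[of Om n] using mat_app_L2[OF BM_carrier, of g Om] by (simp add: L2t_def)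

lemma LM_BM:
 assumes g: "g \<in> L2t Om n" and q: "q \<in> L2t Om n"
 shows "Qf Om n LM (mat_app BM g) q = (\<Sum>i<n. ip Om (g i) (q i))"
 unfolding Qf_def
proof (intro sum.cong refl)
 fix i assume i: "i \<in> {..<n}"
 hence qi: "q i \<in> L2 Om" using q by (simp add: L2t_def)
 have "(\<Sum>j<n. LM $$ (i, j) * ip Om (mat_app BM g j) (q i)) =
   (\<Sum>j<n. \<Sum>k<n. (LM $$ (i, j) * BM $$ (j, k)) * ip Om (g k) (q i))"
  unfolding mat_app_inner[OF BM_carrier g qi] by (simp add: sum_distrib_left mult.assoc)
 also have "\<dots> = (\<Sum>k<n. (\<Sum>j<n. LM $$ (i, j) * BM $$ (j, k)) * ip Om (g k) (q i))"
  by (subst sum.swap) (simp add: sum_distrib_right)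
 also have "\<dots> = (\<Sum>k<n. (if i = k then 1 else 0) * ip Om (g k) (q i))"
  using i by (intro sum.cong refl) (subst Lam_inverse(2)[OF adm n], auto)
 also have "\<dots> = ip Om (g i) (q i)"
  using i by (simp add: if_distrib[of "\<lambda>t. t * _"] sum.delta cong: if_cong)
 finally show "(\<Sum>j<n. LM $$ (i, j) * ip Om (mat_app BM g j) (q i)) = ip Om (g i) (q i)" .
qed

text \<open>The squared \<Lambda>-inverse norm of g, written as the \<Lambda>-form of
  \<Lambda>-inverse g; in this way symmetry and positivity are those of \<Lambda>.\<close>

definition "Dq g = Qf Om n LM (mat_app BM g) (mat_app BM g)"

lemma Dq_eq:
 assumes g: "g \<in> L2t Om n"
 shows "L2_inner_tuple Om n (mat_app BM g) g = Dq g" "Dq g = (\<Sum>i<n. ip Om (g i) (mat_app BM g i))"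
 unfolding Dq_def LM_BM[OF g BM_L2t[OF g]] L2_inner_tuple_def by (simp_all only: L2_inner_commute[of Om "mat_app _ _ _"])

lemma Dq_nonneg: "g \<in> L2t Om n ==> 0 \<le> Dq g"
 unfolding Dq_def by (rule Qf_nonneg[OF LM_nonneg BM_L2t])

lemma Qf_LM_bounds:
 assumes p: "p \<in> L2t Om n"
 shows "Qf Om n M12 p p \<le> Qf Om n LM p p" "\<rho>*(\<Sum>i<n. ip Om (p i) (p i)) \<le> Qf Om n LM p p"
  "ip Om (\<lambda>x. \<Sum>i<n. p i x) (\<lambda>x. \<Sum>i<n. p i x) \<le> l0 * Qf Om n LM p p"
proof -
 have a: "0 \<le> Qf Om n M12 p p" by (rule Qf_nonneg[OF M12_nonneg p])
 have b: "0 \<le> \<rho>*(\<Sum>i<n. ip Om (p i) (p i))" using \<rho>_pos by (intro mult_nonneg_nonneg sum_nonneg) auto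
 let ?s = "ip Om (\<lambda>x. \<Sum>i<n. p i x) (\<lambda>x. \<Sum>i<n. p i x)"
 have c: "0 \<le> (1/l0) * ?s" by simp
 show "Qf Om n M12 p p \<le> Qf Om n LM p p" "\<rho>*(\<Sum>i<n. ip Om (p i) (p i)) \<le> Qf Om n LM p p"
  unfolding Qf_Lam[OF p p] using a b c by linarith+
 have "(1/l0) * ?s \<le> Qf Om n LM p p" unfolding Qf_Lam[OF p p] using a b by linarith
 hence "l0*((1/l0) * ?s) \<le> l0 * Qf Om n LM p p" by (rule mult_left_mono) simp
 thus "?s \<le> l0 * Qf Om n LM p p" by simp
qed

text \<open>With y = \<Lambda>-inverse g, Young's inequality bounds (g, y) by |g|^2/(2\<rho>) +
  \<rho> |y|^2/2. As \<Lambda> \<ge> \<rho> I, the last term is at most half of the left side and is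
  absorbed.\<close>

lemma Dq_le:
 assumes g: "g \<in> L2t Om n"
 shows "Dq g \<le> (\<Sum>i<n. ip Om (g i) (g i))/\<rho>"
proof -
 let ?y = "mat_app BM g"
 have y: "?y \<in> L2t Om n" by (rule BM_L2t[OF g])
 have "ip Om (g i) (?y i) \<le> (1/(2*\<rho>)) * ip Om (g i) (g i) + (\<rho>/2) * ip Om (?y i) (?y i)" if "i < n" for i
  using L2_inner_lower[of "g i" Om "?y i" "2/\<rho>" "- 1"] g y that \<rho>_pos by (simp add: L2t_def)
 hence "Dq g \<le> (\<Sum>i<n. (1/(2*\<rho>)) * ip Om (g i) (g i) + (\<rho>/2) * ip Om (?y i) (?y i))"
  unfolding Dq_eq(2)[OF g] by (intro sum_mono) simp
 also have "\<dots> = (\<Sum>i<n. ip Om (g i) (g i))/\<rho>/2 + (\<rho>*(\<Sum>i<n. ip Om (?y i) (?y i)))/2"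
  by (simp add: sum.distrib sum_distrib_left sum_divide_distrib mult.commute)
 finally have "Dq g \<le> (\<Sum>i<n. ip Om (g i) (g i))/\<rho>/2 + (\<rho>*(\<Sum>i<n. ip Om (?y i) (?y i)))/2" .
 moreover have "\<rho>*(\<Sum>i<n. ip Om (?y i) (?y i)) \<le> Dq g" unfolding Dq_def by (rule Qf_LM_bounds(2)[OF y])
 moreover have "d \<le> t/2 + s/2 ==> s \<le> d ==> d \<le> t" for d t s :: real by linarith
 ultimately show ?thesis by blast
qed

lemma Dq_add_le:
 assumes g: "g \<in> L2t Om n" and h: "h \<in> L2t Om n"
 shows "Dq (\<lambda>i x. g i x + c*\<^sub>R h i x) \<le> 2 * Dq g + 2 * c^2 * Dq h"
proof -
 have "mat_app BM (\<lambda>i x. g i x + c*\<^sub>R h i x) = (\<lambda>i x. mat_app BM g i x + c*\<^sub>R mat_app BM h i x)"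
  by (simp add: mat_app_def fun_eq_iff sum.distrib sum_distrib_left algebra_simps)
 thus ?thesis
  unfolding Dq_def using Qf_add_le[OF LM_nonneg LM_sym BM_L2t[OF g] BM_L2t[OF h], of c] by simp
qed

text \<open>Needed because the weak divergence of a combination equals the combination of weak
  divergences almost everywhere only.\<close>

lemma Dq_cong:
 assumes g: "g \<in> L2t Om n" and h: "h \<in> L2t Om n" and ae: "\<And>i. i < n ==> AE x in leb Om. g i x = h i x"
 shows "Dq g = Dq h"
proof -
 have "Dq g = Qf Om n BM g g" using Dq_eq(1)[OF g] Qf_eq[OF BM_carrier g g] by simp
 also have "\<dots> = Qf Om n BM h h"
  unfolding Qf_def
 proof (intro sum.cong refl arg_cong2[of _ _ _ _ "(*)"])
  fix i j assume "i \<in> {..<n}" "j \<in> {..<n}"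
  hence L: "g i \<in> L2 Om" "g j \<in> L2 Om" "h i \<in> L2 Om" "h j \<in> L2 Om" and "i < n" "j < n"
   using g h by (simp_all add: L2t_def)
  thus "ip Om (g j) (g i) = ip Om (h j) (h i)"
   using L2_inner_cong_AE(1)[OF L(2,4,1) ae] L2_inner_cong_AE(2)[OF L(1,3,4) ae] by simp
 qed
 also have "\<dots> = Dq h" using Dq_eq(1)[OF h] Qf_eq[OF BM_carrier h h] by simp
 finally show ?thesis .
qed

lemma Div_L2t: "(\<And>i. i < n ==> v i \<in> H0div Om) ==> Div Om v \<in> L2t Om n"
 by (simp add: L2t_def Div_def HdivD(2)[OF Om] H0div_Hdiv[OF Om])

lemma V_inner_eq:
 assumes "\<And>i. i < n ==> v i \<in> H0div Om"
 shows "V_inner Om n lam Rinv ap am v v = (\<Sum>i<n. Rinv i * ip Om (v i) (v i)) + Dq (Div Om v)"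
 unfolding V_inner_def using Dq_eq(1)[OF Div_L2t[OF assms]] by simp

lemma P_inner_eq: "p \<in> L2t Om n ==> P_inner Om n lam Rinv ap am p p = Qf Om n LM p p"
 unfolding P_inner_def by (rule Qf_eq[OF Lam_carrier(4)])

lemma U_inner_nonneg: "0 \<le> U_inner Om lam u u"
 unfolding U_inner_def
 by (intro add_nonneg_nonneg mult_nonneg_nonneg L2_inner_self_nonneg less_imp_le[OF lam_pos])

lemma V_inner_nonneg: "v \<in> V_space Om n ==> 0 \<le> V_inner Om n lam Rinv ap am v v"
proof -
 assume vV: "v \<in> V_space Om n"
 have v: "v i \<in> H0div Om" if "i < n" for i by (rule V_space_mem[OF vV that])
 have "0 \<le> (\<Sum>i<n. Rinv i * ip Om (v i) (v i))"
  by (intro sum_nonneg mult_nonneg_nonneg L2_inner_self_nonneg less_imp_le[OF Rinv_pos]) simp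
 thus ?thesis by (subst V_inner_eq) (auto intro!: add_nonneg_nonneg Dq_nonneg Div_L2t v)
qed

lemma P_space_L2t: "p \<in> P_space Om n ==> p \<in> L2t Om n"
 using P_space_mem[of p Om n] by (simp add: L2t_def L20_def)

lemma P_inner_nonneg: "p \<in> P_space Om n ==> 0 \<le> P_inner Om n lam Rinv ap am p p"
 using P_inner_eq[OF P_space_L2t] Qf_nonneg[OF LM_nonneg P_space_L2t] by simp

lemma U_part:
 fixes c :: real
 assumes u: "u \<in> U_space Om" and W: "W \<in> U_space Om"
 defines "w \<equiv> \<lambda>x. u x + c*\<^sub>R W x"
 shows "ip Om (strain Om u) (strain Om w) = ip Om (strain Om u) (strain Om u) + c * ip Om (strain Om u) (strain Om W)"
  "s \<in> L2 Om ==> ip Om s (wd Om w) = ip Om s (wd Om u) + c * ip Om s (wd Om W)"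
  "U_inner Om lam w w \<le> 2 * U_inner Om lam u u + 2 * c^2 * U_inner Om lam W W"
proof -
 note uH = U_H1f[OF Om u] and WH = U_H1f[OF Om W]
 note F = field_add_scale[OF Om uH WH, of c, folded w_def]
 note du = field_div(1)[OF Om uH] and dW = field_div(1)[OF Om WH] and dw = field_div(1)[OF Om F(1)]
 note D = Hdiv_add_scale(2)[OF Om du dW, of c, folded w_def]
 note sL = strain_L2[OF Om uH] strain_L2[OF Om WH] strain_L2[OF Om F(1)]
 note dL = HdivD(2)[OF Om du] HdivD(2)[OF Om dW] HdivD(2)[OF Om dw]
 note S = L2_inner_cong_AE[OF sL(3) L2_add_scale[OF sL(1,2)] _ F(2)]
 note T = L2_inner_cong_AE[OF dL(3) L2_add_scale[OF dL(1,2)] _ D]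
 show "ip Om (strain Om u) (strain Om w) = ip Om (strain Om u) (strain Om u) + c * ip Om (strain Om u) (strain Om W)"
  unfolding S(2)[OF sL(1)] by (rule L2_inner_add_scale_right[OF sL(1,2,1)])
 show "ip Om s (wd Om w) = ip Om s (wd Om u) + c * ip Om s (wd Om W)" if "s \<in> L2 Om"
  unfolding T(2)[OF that] by (rule L2_inner_add_scale_right[OF dL(1,2) that])
 have "ip Om (strain Om w) (strain Om w) \<le> 2 * ip Om (strain Om u) (strain Om u) + 2 * c^2 * ip Om (strain Om W) (strain Om W)"
  unfolding S(1)[OF sL(3)] S(2)[OF L2_add_scale[OF sL(1,2)]] by (rule L2_inner_self_add_le[OF sL(1,2)])
 moreover have "ip Om (wd Om w) (wd Om w) \<le> 2 * ip Om (wd Om u) (wd Om u) + 2 * c^2 * ip Om (wd Om W) (wd Om W)"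
  unfolding T(1)[OF dL(3)] T(2)[OF L2_add_scale[OF dL(1,2)]] by (rule L2_inner_self_add_le[OF dL(1,2)])
 hence "lam * ip Om (wd Om w) (wd Om w) \<le> lam*(2 * ip Om (wd Om u) (wd Om u) + 2 * c^2 * ip Om (wd Om W) (wd Om W))"
  using lam_pos by (intro mult_left_mono) auto
 ultimately show "U_inner Om lam w w \<le> 2 * U_inner Om lam u u + 2 * c^2 * U_inner Om lam W W"
  unfolding U_inner_def by (simp add: algebra_simps)
qed

text \<open>\<open>restrict\<close> makes the perturbed tuple extensional, as membership in
  \<open>V_space\<close> demands. The remaining parts record how each term of the form and the norm
  respond to the perturbation.\<close>

lemma V_part:
 fixes c :: real
 assumes vO: "\<forall>i<n. v i \<in> H0div Om" and WO: "\<forall>i<n. W i \<in> H0div Om"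
 defines "z \<equiv> restrict (\<lambda>i x. v i x + c*\<^sub>R W i x) {..<n}"
 shows "z \<in> V_space Om n"
  "p \<in> L2t Om n ==> L2_inner_tuple Om n p (Div Om z) = L2_inner_tuple Om n p (Div Om v) + c * L2_inner_tuple Om n p (Div Om W)"
  "(\<Sum>i<n. Rinv i * ip Om (v i) (z i)) = (\<Sum>i<n. Rinv i * ip Om (v i) (v i)) + c*(\<Sum>i<n. Rinv i * ip Om (v i) (W i))"
  "V_inner Om n lam Rinv ap am z z \<le> 2 * V_inner Om n lam Rinv ap am v v + 2 * c^2 * V_inner Om n lam Rinv ap am W W"
proof -
 have v: "v i \<in> H0div Om" and W: "W i \<in> H0div Om" if "i < n" for i using vO WO that by simp_all
 have zi: "z i = (\<lambda>x. v i x + c*\<^sub>R W i x)" if "i < n" for i using that by (simp add: z_def)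
 have zH: "z i \<in> H0div Om" if "i < n" for i unfolding zi[OF that] by (rule H0div_add_scale[OF Om v[OF that] W[OF that]])
 show "z \<in> V_space Om n" unfolding V_space_def
 proof (rule PiE_I)
  show "z i \<in> H0div Om" if "i \<in> {..<n}" for i using zH that by simp
  show "z i = undefined" if "i \<notin> {..<n}" for i using that by (simp add: z_def)
 qed
 have L: "v i \<in> L2 Om" "W i \<in> L2 Om" if "i < n" for i
  using HdivD(1)[OF Om H0div_Hdiv[OF Om v[OF that]]] HdivD(1)[OF Om H0div_Hdiv[OF Om W[OF that]]] by blast+
 have DL: "Div Om v \<in> L2t Om n" "Div Om W \<in> L2t Om n" "Div Om z \<in> L2t Om n"
  by (rule Div_L2t[OF v], assumption, rule Div_L2t[OF W], assumption, rule Div_L2t[OF zH])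
 have ae: "AE x in leb Om. Div Om z i x = Div Om v i x + c*\<^sub>R Div Om W i x" if "i < n" for i
  using Hdiv_add_scale(2)[OF Om H0div_Hdiv[OF Om v[OF that]] H0div_Hdiv[OF Om W[OF that]], of c]
  unfolding Div_def zi[OF that] .
 show "L2_inner_tuple Om n p (Div Om z) = L2_inner_tuple Om n p (Div Om v) + c * L2_inner_tuple Om n p (Div Om W)"
  if p: "p \<in> L2t Om n"
 proof -
  have "L2_inner_tuple Om n p (Div Om z) = (\<Sum>i<n. ip Om (p i) (Div Om v i) + c * ip Om (p i) (Div Om W i))"
   unfolding L2_inner_tuple_def
  proof (intro sum.cong refl)
   fix i assume "i \<in> {..<n}"
   hence i: "i < n" by simp
   have M: "p i \<in> L2 Om" "Div Om v i \<in> L2 Om" "Div Om W i \<in> L2 Om" "Div Om z i \<in> L2 Om"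
    using i p DL by (simp_all add: L2t_def)
   show "ip Om (p i) (Div Om z i) = ip Om (p i) (Div Om v i) + c * ip Om (p i) (Div Om W i)"
    unfolding L2_inner_cong_AE(2)[OF M(4) L2_add_scale[OF M(2,3)] M(1) ae[OF i]]
    by (rule L2_inner_add_scale_right[OF M(2,3,1)])
  qed
  thus ?thesis by (simp add: L2_inner_tuple_def sum.distrib sum_distrib_left)
 qed
 have "(\<Sum>i<n. Rinv i * ip Om (v i) (z i)) = (\<Sum>i<n. Rinv i * ip Om (v i) (v i) + c*(Rinv i * ip Om (v i) (W i)))"
  by (intro sum.cong refl) (simp only: lessThan_iff zi L2_inner_add_scale_right[OF L(1,2,1)], simp add: algebra_simps)
 thus "(\<Sum>i<n. Rinv i * ip Om (v i) (z i)) = (\<Sum>i<n. Rinv i * ip Om (v i) (v i)) + c*(\<Sum>i<n. Rinv i * ip Om (v i) (W i))"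
  by (simp add: sum.distrib sum_distrib_left)
 have "(\<Sum>i<n. Rinv i * ip Om (z i) (z i)) \<le> (\<Sum>i<n. Rinv i*(2 * ip Om (v i) (v i) + 2 * c^2 * ip Om (W i) (W i)))"
 proof (rule sum_mono)
  fix i assume "i \<in> {..<n}"
  hence i: "i < n" by simp
  show "Rinv i * ip Om (z i) (z i) \<le> Rinv i*(2 * ip Om (v i) (v i) + 2 * c^2 * ip Om (W i) (W i))"
   unfolding zi[OF i] by (rule mult_left_mono[OF L2_inner_self_add_le[OF L[OF i]] less_imp_le[OF Rinv_pos[OF i]]])
 qed
 also have "\<dots> = 2*(\<Sum>i<n. Rinv i * ip Om (v i) (v i)) + 2 * c^2*(\<Sum>i<n. Rinv i * ip Om (W i) (W i))"
  unfolding sum_distrib_left sum.distrib[symmetric] by (intro sum.cong refl) (simp add: algebra_simps)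
 finally have 1: "(\<Sum>i<n. Rinv i * ip Om (z i) (z i)) \<le>
  2*(\<Sum>i<n. Rinv i * ip Om (v i) (v i)) + 2 * c^2*(\<Sum>i<n. Rinv i * ip Om (W i) (W i))" .
 have "Dq (Div Om z) = Dq (\<lambda>i x. Div Om v i x + c*\<^sub>R Div Om W i x)"
  by (rule Dq_cong[OF DL(3) L2t_add_scale[OF DL(1,2)] ae])
 also have "\<dots> \<le> 2 * Dq (Div Om v) + 2 * c^2 * Dq (Div Om W)"
  by (rule Dq_add_le[OF DL(1,2)])
 finally have 2: "Dq (Div Om z) \<le> 2 * Dq (Div Om v) + 2 * c^2 * Dq (Div Om W)" .
 have "V_inner Om n lam Rinv ap am v v = (\<Sum>i<n. Rinv i * ip Om (v i) (v i)) + Dq (Div Om v)"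
  "V_inner Om n lam Rinv ap am W W = (\<Sum>i<n. Rinv i * ip Om (W i) (W i)) + Dq (Div Om W)"
  "V_inner Om n lam Rinv ap am z z = (\<Sum>i<n. Rinv i * ip Om (z i) (z i)) + Dq (Div Om z)"
  by (rule V_inner_eq, rule v, assumption, rule V_inner_eq, rule W, assumption, rule V_inner_eq, rule zH, assumption)
 with 1 2 show "V_inner Om n lam Rinv ap am z z \<le> 2 * V_inner Om n lam Rinv ap am v v + 2 * c^2 * V_inner Om n lam Rinv ap am W W"
  by (simp only: distrib_left)
qed

text \<open>The overall minus sign belongs to the test function, since the pressure block of the
  form is negative. Mean zero of p and y is what makes q an admissible pressure.\<close>

lemma P_part:
 fixes c :: real
 assumes p: "p \<in> P_space Om n" and yO: "\<forall>i<n. y i \<in> L20 Om"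
 defines "q \<equiv> restrict (\<lambda>i x. - (p i x + c * y i x)) {..<n}"
 shows "q \<in> P_space Om n"
  "f \<in> L2 Om ==> ip Om f (\<lambda>x. \<Sum>i<n. q i x) = - ip Om f (\<lambda>x. \<Sum>i<n. p i x) - c * ip Om f (\<lambda>x. \<Sum>i<n. y i x)"
  "g \<in> L2t Om n ==> L2_inner_tuple Om n g q = - L2_inner_tuple Om n g p - c * L2_inner_tuple Om n g y"
  "P_inner Om n lam Rinv ap am q q \<le> 2 * Qf Om n LM p p + 2 * c^2 * Qf Om n LM y y"
proof -
 have y: "y i \<in> L20 Om" if "i < n" for i using yO that by simp
 have pt: "p \<in> L2t Om n" by (rule P_space_L2t[OF p])
 have yt: "y \<in> L2t Om n" using y by (simp add: L2t_def L20_def)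
 have L: "p i \<in> L2 Om" "y i \<in> L2 Om" if "i < n" for i using pt yt that by (simp_all add: L2t_def)
 define r where "r = (\<lambda>i x. p i x + c*\<^sub>R y i x)"
 have rt: "r \<in> L2t Om n" unfolding r_def by (rule L2t_add_scale[OF pt yt])
 have qi: "q i = (\<lambda>x. (- 1)*\<^sub>R r i x)" if "i < n" for i using that by (simp add: q_def r_def)
 have qt: "q \<in> L2t Om n" unfolding L2t_def
 proof (intro CollectI allI impI)
  fix i assume i: "i < n"
  show "q i \<in> L2 Om" unfolding qi[OF i] using rt i by (intro L2_scale) (simp add: L2t_def)
 qed
 show "q \<in> P_space Om n" unfolding P_space_def
 proof (rule PiE_I)
  show "q i = undefined" if "i \<notin> {..<n}" for i using that by (simp add: q_def)
  fix i assume "i \<in> {..<n}"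
  hence i: "i < n" by simp
  have "(LINT x|leb Om. q i x) = 0"
  proof -
   have I: "integrable (leb Om) (p i)" "integrable (leb Om) (y i)"
    by (rule L2_integrable[OF Om bd L(1)[OF i]], rule L2_integrable[OF Om bd L(2)[OF i]])
   have "(LINT x|leb Om. p i x) = 0" "(LINT x|leb Om. y i x) = 0"
    using P_space_mem[OF p i] y[OF i] by (simp_all add: L20_def)
   hence "(LINT x|leb Om. p i x + c * y i x) = 0"
    using int_add[OF I(1) integrable_mult_right[OF I(2)], of c] by simp
   thus ?thesis unfolding qi[OF i] r_def by (simp del: minus_add_distrib)
  qed
  thus "q i \<in> L20 Om" using qt i by (simp add: L20_def L2t_def)
 qed
 have S: "(\<lambda>x. \<Sum>i<n. p i x) \<in> L2 Om" "(\<lambda>x. \<Sum>i<n. y i x) \<in> L2 Om" using L by (intro L2_sum; simp)+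
 have Sq: "(\<lambda>x. \<Sum>i<n. q i x) = (\<lambda>x. (- 1)*\<^sub>R ((\<Sum>i<n. p i x) + c*\<^sub>R (\<Sum>i<n. y i x)))"
  by (simp add: fun_eq_iff qi r_def sum_negf sum.distrib sum_distrib_left del: minus_add_distrib)
 show "ip Om f (\<lambda>x. \<Sum>i<n. q i x) = - ip Om f (\<lambda>x. \<Sum>i<n. p i x) - c * ip Om f (\<lambda>x. \<Sum>i<n. y i x)"
  if "f \<in> L2 Om"
  unfolding Sq L2_inner_scale(2) L2_inner_add_scale_right[OF S that] by simp
 show "L2_inner_tuple Om n g q = - L2_inner_tuple Om n g p - c * L2_inner_tuple Om n g y" if g: "g \<in> L2t Om n"
 proof -
  have "L2_inner_tuple Om n g q = (\<Sum>i<n. - (ip Om (g i) (p i)) - c * ip Om (g i) (y i))"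
   unfolding L2_inner_tuple_def
  proof (intro sum.cong refl)
   fix i assume "i \<in> {..<n}"
   hence i: "i < n" by simp
   have gi: "g i \<in> L2 Om" using g i by (simp add: L2t_def)
   show "ip Om (g i) (q i) = - (ip Om (g i) (p i)) - c * ip Om (g i) (y i)"
    unfolding qi[OF i] r_def L2_inner_scale(2) L2_inner_add_scale_right[OF L[OF i] gi] by simp
  qed
  thus ?thesis by (simp add: L2_inner_tuple_def sum_subtractf sum_negf sum_distrib_left)
 qed
 have "P_inner Om n lam Rinv ap am q q = Qf Om n LM q q" by (rule P_inner_eq[OF qt])
 also have "\<dots> = Qf Om n LM r r"
  unfolding Qf_def
 proof (intro sum.cong refl arg_cong2[of _ _ _ _ "(*)"])
  fix i j assume "i \<in> {..<n}" "j \<in> {..<n}"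
  hence ij: "i < n" "j < n" by simp_all
  show "ip Om (q j) (q i) = ip Om (r j) (r i)"
   unfolding qi[OF ij(1)] qi[OF ij(2)] L2_inner_scale by simp
 qed
 also have "\<dots> \<le> 2 * Qf Om n LM p p + 2 * c^2 * Qf Om n LM y y"
  unfolding r_def by (rule Qf_add_le[OF LM_nonneg LM_sym pt yt])
 finally show "P_inner Om n lam Rinv ap am q q \<le> 2 * Qf Om n LM p p + 2 * c^2 * Qf Om n LM y y" .
qed

lemma L20_sum_scale:
 assumes "\<And>j. j < n ==> g j \<in> L20 Om"
 shows "(\<lambda>x. \<Sum>j<n. a j * g j x) \<in> L20 Om"
proof -
 have L: "g j \<in> L2 Om" "(LINT x|leb Om. g j x) = 0" if "j \<in> {..<n}" for j
  using assms that by (simp_all add: L20_def)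
 have "(\<lambda>x. \<Sum>j<n. a j*\<^sub>R g j x) \<in> L2 Om" by (intro L2_sum L2_scale L)
 moreover have "(LINT x|leb Om. (\<Sum>j<n. a j * g j x)) = (\<Sum>j<n. (LINT x|leb Om. a j * g j x))"
  by (intro int_sum integrable_mult_right L2_integrable[OF Om bd] L)
 ultimately show ?thesis using L(2) by (simp add: L20_def)
qed

lemma U_cross:
 assumes u: "u \<in> U_space Om" and W: "W \<in> U_space Om"
 shows "- (U_inner Om lam u u/4 + c^2 * U_inner Om lam W W) \<le>
  c * ip Om (strain Om u) (strain Om W) + lam*(c * ip Om (wd Om u) (wd Om W))"
proof -
 note uH = U_H1f[OF Om u] and WH = U_H1f[OF Om W]
 have o: "0 < (1::real)" by simp
 note i1 = L2_inner_lower[OF strain_L2[OF Om uH] strain_L2[OF Om WH] o, of c]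
 note i2 = mult_left_mono[OF L2_inner_lower[OF HdivD(2)[OF Om field_div(1)[OF Om uH]] HdivD(2)[OF Om field_div(1)[OF Om WH]] o, of c]
  less_imp_le[OF lam_pos]]
 show ?thesis unfolding U_inner_def using i1 i2 by (simp add: algebra_simps add_divide_distrib)
qed

lemma V_cross:
 assumes vO: "\<forall>i<n. v i \<in> H0div Om" and WO: "\<forall>i<n. W i \<in> H0div Om"
 shows "- ((\<Sum>i<n. Rinv i * ip Om (v i) (v i))/2 + c^2/2*(\<Sum>i<n. Rinv i * ip Om (W i) (W i))) \<le>
  c*(\<Sum>i<n. Rinv i * ip Om (v i) (W i))"
proof -
 have v: "v i \<in> H0div Om" and W: "W i \<in> H0div Om" if "i < n" for i using vO WO that by simp_all
 have "(\<Sum>i<n. - (Rinv i * ip Om (v i) (v i)/2 + c^2/2*(Rinv i * ip Om (W i) (W i)))) \<le>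
  (\<Sum>i<n. c*(Rinv i * ip Om (v i) (W i)))"
 proof (rule sum_mono)
  fix i assume "i \<in> {..<n}"
  hence i: "i < n" by simp
  have L: "v i \<in> L2 Om" "W i \<in> L2 Om"
   using HdivD(1)[OF Om H0div_Hdiv[OF Om v[OF i]]] HdivD(1)[OF Om H0div_Hdiv[OF Om W[OF i]]] by blast+
  have "- (2/4 * ip Om (v i) (v i) + c^2/2 * ip Om (W i) (W i)) \<le> c * ip Om (v i) (W i)"
   by (rule L2_inner_lower[OF L]) simp
  from mult_left_mono[OF this less_imp_le[OF Rinv_pos[OF i]]]
  show "- (Rinv i * ip Om (v i) (v i)/2 + c^2/2*(Rinv i * ip Om (W i) (W i))) \<le> c*(Rinv i * ip Om (v i) (W i))"
   by (simp add: algebra_simps)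
 qed
 thus ?thesis unfolding sum_negf sum.distrib sum_distrib_left sum_divide_distrib .
qed

text \<open>For \<lambda> \<le> 1 the weight is 1 and the strain controls the divergence; for larger
  \<lambda> the term \<lambda> |div u|^2 is itself part of the norm.\<close>

lemma div_weighted:
 assumes u: "u \<in> U_space Om"
 shows "l0/real CARD('d) * ip Om (wd Om u) (wd Om u) \<le> U_inner Om lam u u"
proof -
 define D where "D = real CARD('d)"
 define e where "e = ip Om (strain Om u) (strain Om u)"
 define f where "f = ip Om (wd Om u) (wd Om u)"
 have D: "1 \<le> D" by (simp add: D_def Suc_le_eq)
 have ef: "0 \<le> e" "0 \<le> f" by (simp_all add: e_def f_def)
 have fe: "f \<le> D * e" using div_le_strain[OF Om U_H1f[OF Om u]] by (simp add: L2n_square e_def f_def D_def)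
 have "l0 * f \<le> D*(e + lam * f)"
 proof (cases "lam \<le> 1")
  case True
  hence "l0 * f = f" by simp
  also have "\<dots> \<le> D*(e + lam * f)" using fe ef D lam_pos by (simp add: distrib_left add_increasing2)
  finally show ?thesis .
 next
  case False
  hence "l0 * f = 1*(lam * f)" by simp
  also have "\<dots> \<le> D*(lam * f)" using D ef lam_pos by (intro mult_right_mono) auto
  also have "\<dots> \<le> D*(e + lam * f)" using D ef by (intro mult_left_mono) auto
  finally show ?thesis .
 qed
 hence "l0/D * f \<le> e + lam * f" using D by (simp add: field_simps)
 thus ?thesis by (simp add: U_inner_def D_def e_def f_def)
qed

text \<open>Both \<lambda> and 1 are at most \<lambda>0, so the parameters enter the cost of the
  field through the factor \<lambda>0 alone.\<close>

lemma U_inner_test: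
 assumes W: "W \<in> U_space Om" and b: "L2n Om (strain Om W) \<le> B * L2n Om s" and B: "0 \<le> B"
 shows "U_inner Om lam W W \<le> l0*((1 + real CARD('d)) * B^2 * ip Om s s)"
  "ip Om (wd Om W) (wd Om W) \<le> real CARD('d) * B^2 * ip Om s s"
proof -
 define D where "D = real CARD('d)"
 define e where "e = ip Om (strain Om W) (strain Om W)"
 define f where "f = ip Om (wd Om W) (wd Om W)"
 define t where "t = B^2 * ip Om s s"
 have D: "0 \<le> D" by (simp add: D_def)
 have fe: "f \<le> D * e" using div_le_strain[OF Om U_H1f[OF Om W]] by (simp add: L2n_square e_def f_def D_def)
 have "(L2n Om (strain Om W))^2 \<le> (B * L2n Om s)^2" using b by (intro power_mono) simp_all
 hence et: "e \<le> t" by (simp add: e_def t_def power_mult_distrib L2n_square)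
 have t0: "0 \<le> t" by (simp add: t_def)
 have ft: "f \<le> D * t" using fe mult_left_mono[OF et D] by linarith
 thus "ip Om (wd Om W) (wd Om W) \<le> real CARD('d) * B^2 * ip Om s s"
  by (simp add: f_def t_def D_def mult.assoc)
 have "lam * f \<le> l0*(D * t)"
  using ft t0 D lam_pos by (intro mult_mono) (auto simp: f_def)
 moreover have "e \<le> l0 * t" using et mult_right_mono[of 1 l0 t] t0 by simp
 ultimately have "e + lam * f \<le> l0*((1 + D) * t)" by (simp add: algebra_simps)
 thus "U_inner Om lam W W \<le> l0*((1 + real CARD('d)) * B^2 * ip Om s s)"
  by (simp add: U_inner_def e_def f_def t_def D_def mult.assoc)
qed

lemma main_estimate:
 fixes B :: real
 defines "D \<equiv> real CARD('d)"
 defines "\<kappa> \<equiv> 1/(2 * D + 1)" and "\<delta> \<equiv> 1/(B^2*(2 * D + 3) + 1)"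
 assumes B: "0 \<le> B"
  and infsup: "\<forall>s\<in>L20 Om. \<exists>W. W \<in> U_space Om \<and> W \<in> H0div Om \<and>
   ip Om s (wd Om W) = (L2n Om s)^2 \<and> L2n Om (strain Om W) \<le> B * L2n Om s \<and> L2n Om W \<le> B * L2n Om s"
  and u: "u \<in> U_space Om" and v: "v \<in> V_space Om n" and p: "p \<in> P_space Om n"
 defines "E \<equiv> U_inner Om lam u u + V_inner Om n lam Rinv ap am v v + P_inner Om n lam Rinv ap am p p"
 shows "\<exists>w z q. w \<in> U_space Om \<and> z \<in> V_space Om n \<and> q \<in> P_space Om n \<and>
  min \<kappa> \<delta>/2 * E \<le> A_form Om n lam Rinv ap am u v p w z q \<and>
  U_inner Om lam w w + V_inner Om n lam Rinv ap am z z + P_inner Om n lam Rinv ap am q q \<le> (4 + 4*(1 + D) * B^2) * E"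
proof -
 have D: "1 \<le> D" by (simp add: D_def Suc_le_eq)
 have \<kappa>: "0 < \<kappa>" "\<kappa> \<le> 1" using D by (simp_all add: \<kappa>_def)
 \<comment> \<open>Origin of \<kappa>: the two cross terms with y cost \<kappa>^2 D Z and \<kappa>^2
   Z/2, which together must be half of the gain \<kappa> Z.\<close>
 have "\<kappa>*(2 * D + 1) = 1" using D by (simp add: \<kappa>_def)
 hence "\<kappa>*(\<kappa>*(2 * D + 1)) = \<kappa>" by simp
 hence \<kappa>2: "\<kappa>^2*(D + 1/2) = \<kappa>/2" by (simp add: power2_eq_square algebra_simps)
 \<comment> \<open>Origin of \<delta>: the displacement correction costs \<delta>^2 (1 + D) B^2,
   which must be at most \<delta>/2, and the flux correction \<delta>^2 B^2, at most \<delta>; the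
   coefficients add up to 2 (1 + D) + 1 = 2 D + 3. The summand 1 covers B = 0 and gives \<delta>
   \<le> 1.\<close>
 have dpos: "0 < B^2*(2 * D + 3) + 1" using D by (intro add_nonneg_pos mult_nonneg_nonneg) auto
 have \<delta>: "0 < \<delta>" "\<delta> \<le> 1" "\<delta>*(B^2*(2 * D + 3)) \<le> 1"
  using dpos D by (auto simp: \<delta>_def divide_le_eq_1)
 have B2: "0 \<le> B^2" by simp
 have pt: "p \<in> L2t Om n" by (rule P_space_L2t[OF p])
 have v': "v i \<in> H0div Om" if "i < n" for i by (rule V_space_mem[OF v that])
 define s where "s = (\<lambda>x. \<Sum>i<n. p i x)"
 have s: "s \<in> L20 Om" using L20_sum_scale[of p "\<lambda>j. 1"] P_space_mem[OF p] by (simp add: s_def)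
 hence sL: "s \<in> L2 Om" by (simp add: L20_def)
 obtain W where W: "W \<in> U_space Om" "ip Om s (wd Om W) = ip Om s s" "L2n Om (strain Om W) \<le> B * L2n Om s"
  using bspec[OF infsup s] unfolding L2n_square by (elim exE conjE)
 have "\<forall>i\<in>{..<n}. \<exists>W. W \<in> U_space Om \<and> W \<in> H0div Om \<and>
   ip Om (p i) (wd Om W) = (L2n Om (p i))^2 \<and> L2n Om (strain Om W) \<le> B * L2n Om (p i) \<and> L2n Om W \<le> B * L2n Om (p i)"
  using infsup P_space_mem[OF p] by simp
 then obtain Y where Y: "\<forall>i\<in>{..<n}. Y i \<in> U_space Om \<and> Y i \<in> H0div Om \<and>
   ip Om (p i) (wd Om (Y i)) = (L2n Om (p i))^2 \<and> L2n Om (strain Om (Y i)) \<le> B * L2n Om (p i) \<and> L2n Om (Y i) \<le> B * L2n Om (p i)"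
  by (rule bchoice[THEN exE])
 have Yi: "Y i \<in> U_space Om" "Y i \<in> H0div Om" "ip Om (p i) (wd Om (Y i)) = ip Om (p i) (p i)"
  "L2n Om (strain Om (Y i)) \<le> B * L2n Om (p i)" "L2n Om (Y i) \<le> B * L2n Om (p i)" if "i < n" for i
  using bspec[OF Y, of i] that by (simp_all add: L2n_square)
 define g where "g = Div Om v"
 have g: "g \<in> L2t Om n" unfolding g_def by (rule Div_L2t) (rule v')
 define y where "y = mat_app BM g"
 have yt: "y \<in> L2t Om n" unfolding y_def by (rule BM_L2t[OF g])
 have y: "y i \<in> L20 Om" for i
 proof -
  have "(\<lambda>x. \<Sum>j<n. BM $$ (i, j) * g j x) \<in> L20 Om"
   by (rule L20_sum_scale) (simp add: g_def Div_def H0div_weak_div_L20[OF Om v' bd])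
  thus ?thesis using BM_carrier by (simp add: y_def mat_app_def)
 qed
 \<comment> \<open>The pairings of pressure with divergence enter the form with a minus sign, so
   negative multiples of the fields produce positive squares of s and p.\<close>
 define c where "c = - \<delta>/l0"
 define e where "e = - \<delta>*\<rho>"
 define w where "w = (\<lambda>x. u x + c*\<^sub>R W x)"
 define z where "z = restrict (\<lambda>i x. v i x + e*\<^sub>R Y i x) {..<n}"
 define q where "q = restrict (\<lambda>i x. - (p i x + \<kappa> * y i x)) {..<n}"
 have vO: "\<forall>i<n. v i \<in> H0div Om" and YO: "\<forall>i<n. Y i \<in> H0div Om" and yO: "\<forall>i<n. y i \<in> L20 Om"
  using v' Yi(2) y by simp_all
 note Up = U_part[where c = c, OF u W(1), folded w_def]
 note Vp = V_part[where c = e, OF vO YO, folded z_def]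
 note Pp = P_part[where c = \<kappa>, OF p yO, folded q_def]
 let ?ip = "ip Om"
 define X where "X = U_inner Om lam u u"
 define VV where "VV = (\<Sum>i<n. Rinv i * ?ip (v i) (v i))"
 define Z where "Z = Dq g"
 define T where "T = Qf Om n M12 p p"
 define s2 where "s2 = ?ip s s"
 define p2 where "p2 = (\<Sum>i<n. ?ip (p i) (p i))"
 have l0: "1 \<le> l0" by simp
 have nn: "0 \<le> X" "0 \<le> VV" "0 \<le> Z" "0 \<le> T" "0 \<le> s2/l0" "0 \<le> \<rho> * p2"
  using U_inner_nonneg Dq_nonneg[OF g] Qf_nonneg[OF M12_nonneg pt] Rinv_pos \<rho>_pos
  by (auto simp: X_def VV_def Z_def T_def s2_def p2_def intro!: sum_nonneg mult_nonneg_nonneg less_imp_le[OF Rinv_pos])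
 have PP: "P_inner Om n lam Rinv ap am p p = T + \<rho> * p2 + s2/l0"
  unfolding P_inner_eq[OF pt] Qf_Lam[OF pt pt] T_def p2_def s2_def s_def by simp
 have VVeq: "V_inner Om n lam Rinv ap am v v = VV + Z"
  unfolding VV_def Z_def g_def by (rule V_inner_eq) (rule v')
 have E: "E = X + (VV + Z) + (T + \<rho> * p2 + s2/l0)" by (simp only: E_def X_def VVeq PP)
 \<comment> \<open>Since q contains -p, the terms (s, div u) and (p, Div v) occur twice with
   opposite signs and cancel. The part -\<kappa> y of q turns -(Div v, q) into the gain \<kappa>
   Z.\<close>
 have A: "A_form Om n lam Rinv ap am u v p w z q = X + VV + \<kappa> * Z + T + \<delta>*(s2/l0) + \<delta>*(\<rho> * p2)
   + (c * ?ip (strain Om u) (strain Om W) + lam*(c * ?ip (wd Om u) (wd Om W)))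
   + e*(\<Sum>i<n. Rinv i * ?ip (v i) (Y i))
   + \<kappa> * ?ip (wd Om u) (\<lambda>x. \<Sum>i<n. y i x) + \<kappa> * Qf Om n M12 p y"
 proof -
  note duL = HdivD(2)[OF Om field_div(1)[OF Om U_H1f[OF Om u]]]
  have mt: "mat_app M12 p \<in> L2t Om n" using mat_app_L2[OF Lam_carrier(3) pt] by (simp add: L2t_def)
  have 1: "?ip (wd Om u) (wd Om w) = ?ip (wd Om u) (wd Om u) + c * ?ip (wd Om u) (wd Om W)"
   by (rule Up(2)[OF duL])
  have 2: "?ip s (wd Om w) = ?ip s (wd Om u) + c * s2"
   unfolding Up(2)[OF sL] W(2) s2_def ..
  have 3: "L2_inner_tuple Om n p (Div Om z) = L2_inner_tuple Om n p g + e * p2"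
  proof -
   have "L2_inner_tuple Om n p (Div Om Y) = p2"
    unfolding L2_inner_tuple_def p2_def Div_def using Yi(3) by (intro sum.cong) auto
   thus ?thesis unfolding Vp(2)[OF pt] g_def by simp
  qed
  have 4: "L2_inner_tuple Om n (Div Om v) q = - L2_inner_tuple Om n p g - \<kappa> * Z"
   unfolding g_def[symmetric] Pp(3)[OF g] Z_def Dq_eq(2)[OF g] y_def[symmetric]
   by (simp add: L2_inner_tuple_def L2_inner_commute[of Om "g _" "p _"])
  have 5: "L2_inner_tuple Om n (mat_app M12 p) q = - T - \<kappa> * Qf Om n M12 p y"
   unfolding Pp(3)[OF mt] Qf_eq[OF Lam_carrier(3) pt pt] Qf_eq[OF Lam_carrier(3) pt yt] T_def ..
  have 6: "?ip (wd Om u) (\<lambda>x. \<Sum>i<n. q i x) = - ?ip s (wd Om u) - \<kappa> * ?ip (wd Om u) (\<lambda>x. \<Sum>i<n. y i x)"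
   unfolding Pp(2)[OF duL] s_def[symmetric] L2_inner_commute[of Om "wd Om u" s] ..
  have 7: "c * s2 = - (\<delta>*(s2/l0))" "e * p2 = - (\<delta>*(\<rho> * p2))" by (simp_all add: c_def e_def)
  show ?thesis
   unfolding A_form_def s_def[symmetric] Up(1) 1 2 3 4 5 6 7 Vp(3) VV_def[symmetric] X_def U_inner_def
   by (simp add: algebra_simps)
 qed
 \<comment> \<open>Two factors 1/l0 in c^2 meet one factor l0 in the norm of W, which leaves the
   weight of \<Lambda>4.\<close>
 have b1: "c^2 * U_inner Om lam W W \<le> \<delta>^2*((1 + D) * B^2)*(s2/l0)"
 proof -
  have "c^2 * U_inner Om lam W W \<le> c^2*(l0*((1 + D) * B^2 * s2))"
   unfolding D_def s2_def by (rule mult_left_mono[OF U_inner_test(1)[OF W(1,3) B]]) simp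
  also have "\<dots> = \<delta>^2*((1 + D) * B^2)*(s2/l0)"
   using l0 by (simp add: c_def power2_eq_square)
  finally show ?thesis .
 qed
 have YL: "ip Om (Y i) (Y i) \<le> B^2 * ?ip (p i) (p i)" if "i < n" for i
 proof -
  have "(L2n Om (Y i))^2 \<le> (B * L2n Om (p i))^2" using Yi(5)[OF that] by (intro power_mono) simp_all
  thus ?thesis by (simp add: power_mult_distrib L2n_square)
 qed
 \<comment> \<open>Of the two factors \<rho> in e^2, one is used up by \<rho> Rinv_i \<le> 1 and the
   other is the weight of \<Lambda>3.\<close>
 have b2: "e^2*(\<Sum>i<n. Rinv i * ?ip (Y i) (Y i)) \<le> \<delta>^2 * B^2*(\<rho> * p2)"
 proof -
  have "\<rho>*(\<Sum>i<n. Rinv i * ?ip (Y i) (Y i)) \<le> B^2 * p2"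
   unfolding p2_def sum_distrib_left
  proof (rule sum_mono)
   fix i assume "i \<in> {..<n}"
   hence i: "i < n" by simp
   have "(\<rho> * Rinv i) * ?ip (Y i) (Y i) \<le> 1 * ?ip (Y i) (Y i)" using \<rho>_Rinv[OF i] by (rule mult_right_mono) simp
   with YL[OF i] show "\<rho>*(Rinv i * ?ip (Y i) (Y i)) \<le> B^2 * ?ip (p i) (p i)" by (simp add: mult.assoc)
  qed
  hence "(\<delta>^2*\<rho>)*(\<rho>*(\<Sum>i<n. Rinv i * ?ip (Y i) (Y i))) \<le> (\<delta>^2*\<rho>)*(B^2 * p2)"
   using \<rho>_pos by (intro mult_left_mono) simp_all
  moreover have "e^2 = \<delta>^2*(\<rho>*\<rho>)" by (simp add: e_def power2_eq_square)
  ultimately show ?thesis by (simp only: mult_ac)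
 qed
 \<comment> \<open>Here one factor \<rho> cancels the 1/\<rho> in the bound for the
   \<Lambda>-inverse norm.\<close>
 have b3: "e^2 * Dq (Div Om Y) \<le> \<delta>^2*(D * B^2)*(\<rho> * p2)"
 proof -
  have "Dq (Div Om Y) \<le> (\<Sum>i<n. ?ip (Div Om Y i) (Div Om Y i))/\<rho>"
   by (rule Dq_le, rule Div_L2t, rule Yi(2))
  also have "\<dots> \<le> (\<Sum>i<n. D * B^2 * ?ip (p i) (p i))/\<rho>"
   unfolding D_def Div_def using \<rho>_pos U_inner_test(2)[OF Yi(1,4) B] by (intro divide_right_mono sum_mono) auto
  also have "\<dots> = D * B^2 * p2/\<rho>" by (simp add: p2_def sum_distrib_left)
  finally have "e^2 * Dq (Div Om Y) \<le> e^2*(D * B^2 * p2/\<rho>)" by (rule mult_left_mono) simp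
  also have "\<dots> = \<delta>^2*(D * B^2)*(\<rho> * p2)" using \<rho>_pos by (simp add: e_def power2_eq_square)
  finally show ?thesis .
 qed
 have b4: "Qf Om n M12 y y \<le> Z" "?ip (\<lambda>x. \<Sum>i<n. y i x) (\<lambda>x. \<Sum>i<n. y i x) \<le> l0 * Z"
  unfolding Z_def Dq_def y_def[symmetric] by (rule Qf_LM_bounds(1)[OF yt], rule Qf_LM_bounds(3)[OF yt])
 \<comment> \<open>The cross terms may consume half of each square: X gives a quarter here and a
   quarter in \<open>k3\<close>, VV a half in \<open>k2\<close> and T a half in
   \<open>k4\<close>.\<close>
 have k1: "- (X/4 + \<delta>^2*((1 + D) * B^2)*(s2/l0)) \<le>
   c * ?ip (strain Om u) (strain Om W) + lam*(c * ?ip (wd Om u) (wd Om W))"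
  using U_cross[OF u W(1), of c] b1 unfolding X_def by linarith
 have k2: "- (VV/2 + \<delta>^2 * B^2*(\<rho> * p2)/2) \<le> e*(\<Sum>i<n. Rinv i * ?ip (v i) (Y i))"
  using V_cross[where c = e, OF vO YO] b2 unfolding VV_def by simp
 \<comment> \<open>Young's inequality with weight l0/D: on one side \<open>div_weighted\<close>
   applies, on the other l0 cancels against the bound l0 Z for the squared norm of the sum of the
   y_i.\<close>
 have k3: "- (X/4 + \<kappa>^2 * D * Z) \<le> \<kappa> * ?ip (wd Om u) (\<lambda>x. \<Sum>i<n. y i x)"
 proof -
  note duL = HdivD(2)[OF Om field_div(1)[OF Om U_H1f[OF Om u]]]
  have yL: "(\<lambda>x. \<Sum>i<n. y i x) \<in> L2 Om" using y by (intro L2_sum) (simp add: L20_def)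
  have "\<kappa>^2/(l0/D) * ?ip (\<lambda>x. \<Sum>i<n. y i x) (\<lambda>x. \<Sum>i<n. y i x) \<le> \<kappa>^2/(l0/D)*(l0 * Z)"
   using D by (intro mult_left_mono b4) auto
  also have "\<dots> = \<kappa>^2 * D * Z" using l0 by simp
  finally show ?thesis
   using L2_inner_lower[OF duL yL, of "l0/D" \<kappa>] div_weighted[OF u] D unfolding X_def D_def by simp
 qed
 have k4: "- (T/2 + \<kappa>^2/2 * Z) \<le> \<kappa> * Qf Om n M12 p y"
  using Qf_lower[OF M12_nonneg M12_sym pt yt, of \<kappa>] mult_left_mono[OF b4(1), of "\<kappa>^2/2"] unfolding T_def by simp
 have c1: "\<delta>^2*((1 + D) * B^2) \<le> \<delta>/2" "\<delta>^2 * B^2 \<le> \<delta>"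
 proof -
  have "\<delta>*(B^2*(2 * D + 3)) = 2*(\<delta>*((1 + D) * B^2)) + \<delta> * B^2" by (simp add: algebra_simps)
  moreover have "0 \<le> \<delta> * B^2" "0 \<le> \<delta>*((1 + D) * B^2)" using \<delta> D by simp_all
  ultimately have "\<delta>*((1 + D) * B^2) \<le> 1/2" "\<delta> * B^2 \<le> 1" using \<delta>(3) by linarith+
  from this[THEN mult_left_mono, of \<delta>] \<delta>(1) show "\<delta>^2*((1 + D) * B^2) \<le> \<delta>/2" "\<delta>^2 * B^2 \<le> \<delta>"
   by (simp_all add: power2_eq_square mult.assoc)
 qed
 define m where "m = min \<kappa> \<delta>"
 have m: "m \<le> \<kappa>" "m \<le> \<delta>" "m \<le> 1" "0 \<le> m" using \<kappa> \<delta> by (simp_all add: m_def)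
 have lower: "m/2 * E \<le> A_form Om n lam Rinv ap am u v p w z q"
 proof -
  have a1: "\<delta>^2*((1 + D) * B^2)*(s2/l0) \<le> \<delta>*(s2/l0)/2"
   using mult_right_mono[OF c1(1) nn(5)] by simp
  have a2: "\<delta>^2 * B^2*(\<rho> * p2) \<le> \<delta>*(\<rho> * p2)" by (rule mult_right_mono[OF c1(2) nn(6)])
  have "\<kappa>^2 * D * Z + \<kappa>^2/2 * Z = (\<kappa>^2*(D + 1/2)) * Z" by (simp add: algebra_simps)
  hence a3: "\<kappa>^2 * D * Z + \<kappa>^2/2 * Z = \<kappa> * Z/2" by (simp add: \<kappa>2)
  have m1: "m * t \<le> t" if "0 \<le> t" for t using mult_right_mono[OF m(3) that] by simp
  have mE: "m/2 * E = (m * X + m * VV + m * Z + m * T + m*(\<rho> * p2) + m*(s2/l0))/2"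
   unfolding E by (simp add: algebra_simps)
  note coercive_arith[OF a1 a2 a3 m1[OF nn(1)] m1[OF nn(2)] m1[OF nn(4)] mult_right_mono[OF m(1) nn(3)]
    mult_right_mono[OF m(2) nn(5)] mult_right_mono[OF m(2) nn(6)] k1 k2 k3 k4]
  thus ?thesis unfolding A mE by (simp only: add.assoc)
 qed
 have \<delta>1: "\<delta>^2 * t \<le> t" if "0 \<le> t" for t
  using mult_right_mono[of "\<delta>^2" 1 t] \<delta> that by (simp add: power_le_one)
 have upper: "U_inner Om lam w w + V_inner Om n lam Rinv ap am z z + P_inner Om n lam Rinv ap am q q \<le> (4 + 4*(1 + D) * B^2) * E"
 proof -
  let ?S = "s2/l0" and ?R = "\<rho> * p2"
  have "0 \<le> (1 + D) * B^2 * ?S" "0 \<le> B^2 * ?R" "0 \<le> D * B^2 * ?R"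
   using D by (intro mult_nonneg_nonneg nn B2; simp)+
  note \<delta>2 = this[THEN \<delta>1]
  have r: "\<delta>^2 * B^2 * ?R = \<delta>^2*(B^2 * ?R)" "\<delta>^2*(D * B^2) * ?R = \<delta>^2*(D * B^2 * ?R)"
   by (simp_all only: mult.assoc)
  have "c^2 * U_inner Om lam W W \<le> (1 + D) * B^2 * ?S"
   by (rule order_trans[OF b1[unfolded mult.assoc] \<delta>2(1)[unfolded mult.assoc], folded mult.assoc])
  hence u1: "U_inner Om lam w w \<le> 2 * X + 2*((1 + D) * B^2 * ?S)" using Up(3) unfolding X_def by linarith
  have "e^2*(\<Sum>i<n. Rinv i * ?ip (Y i) (Y i)) \<le> B^2 * ?R" 
   by (rule order_trans[OF b2[unfolded r] \<delta>2(2)])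
  moreover have "e^2 * Dq (Div Om Y) \<le> D * B^2 * ?R" 
   by (rule order_trans[OF b3[unfolded r] \<delta>2(3)])
  moreover have "V_inner Om n lam Rinv ap am Y Y = (\<Sum>i<n. Rinv i * ?ip (Y i) (Y i)) + Dq (Div Om Y)"
   by (rule V_inner_eq, rule Yi(2))
  ultimately have u2: "V_inner Om n lam Rinv ap am z z \<le> 2*(VV + Z) + 2*((1 + D) * B^2 * ?R)"
   using Vp(4) unfolding VVeq by (simp add: algebra_simps)
  have PPq: "Qf Om n LM p p = T + ?R + ?S" using PP P_inner_eq[OF pt] by simp
  have yZ: "Qf Om n LM y y = Z" by (simp add: Z_def Dq_def y_def)
  have "\<kappa>^2 * Z \<le> 1 * Z" using \<kappa> nn(3) by (intro mult_right_mono) (simp_all add: power_le_one)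
  hence u3: "P_inner Om n lam Rinv ap am q q \<le> 2*(T + ?R + ?S) + 2 * Z"
   using Pp(4) unfolding PPq yZ by linarith
  define k where "k = (1 + D) * B^2"
  have k: "0 \<le> k" using D by (simp add: k_def)
  have kn: "0 \<le> k * X" "0 \<le> k * VV" "0 \<le> k * Z" "0 \<le> k * T" "0 \<le> k * ?R" "0 \<le> k * ?S"
   using k nn by (simp_all only: mult_nonneg_nonneg)
  have "(4 + 4*(1 + D) * B^2) * E = 4*(X + (VV + Z) + (T + ?R + ?S)) + 4*(k * X + k * VV + k * Z + k * T + k * ?R + k * ?S)"
   unfolding E k_def by (simp add: algebra_simps)
  thus ?thesis
   using upper_arith[OF u1[folded k_def] u2[folded k_def] u3 nn(1,2,3,4,6,5) kn] by (simp only:)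
 qed
 show ?thesis
  using Up Vp(1) Pp(1) lower[unfolded m_def] upper U_add_scale[OF Om u W(1), of c, folded w_def] by blast
qed

end

context
 fixes Om :: "(real^'d) set" and n :: nat and lam :: real and Rinv ap :: "nat => real" and am :: "nat => nat => real"
 assumes Om: "open Om" and bd: "bounded Om" and adm: "admissible n lam Rinv ap am" and n: "n \<ge> 1"
begin

lemma A_form_zero:
 assumes w: "w \<in> U_space Om" "zero_ae Om w" and z: "z \<in> V_space Om n" "\<forall>i<n. zero_ae Om (z i)"
  and q: "q \<in> P_space Om n" "\<forall>i<n. zero_ae Om (q i)"
  and u: "u \<in> U_space Om" and v: "v \<in> V_space Om n" and p: "p \<in> P_space Om n"
 shows "A_form Om n lam Rinv ap am u v p w z q = 0"
proof -
 have zz: "ip Om g f = 0" if "f \<in> L2 Om" "zero_ae Om f" "g \<in> L2 Om" for f g :: "real^'d => 'x::euclidean_space"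
  using zero_ae_L2[OF that] by (simp add: L2_inner_commute)
 note uH = U_H1f[OF Om u] and wH = U_H1f[OF Om w(1)]
 note dL = HdivD(2)[OF Om field_div(1)[OF Om uH]] HdivD(2)[OF Om field_div(1)[OF Om wH]]
 have dz: "zero_ae Om (wd Om w)" by (rule zero_weak_div[OF Om field_div(1)[OF Om wH] w(2)])
 have pL: "p i \<in> L2 Om" "q i \<in> L2 Om" if "i < n" for i
  using P_space_mem[OF p that] P_space_mem[OF q(1) that] by (simp_all add: L20_def)
 have vD: "v i \<in> Hdiv Om" "z i \<in> Hdiv Om" if "i < n" for i
  using H0div_Hdiv[OF Om V_space_mem[OF v that]] H0div_Hdiv[OF Om V_space_mem[OF z(1) that]] by blast+
 have S: "(\<lambda>x. \<Sum>i<n. p i x) \<in> L2 Om" "(\<lambda>x. \<Sum>i<n. q i x) \<in> L2 Om" using pL by (intro L2_sum; simp)+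
 have "AE x in leb Om. \<forall>i\<in>{..<n}. q i x = 0"
  using q(2) by (subst AE_ball_countable) (auto simp: zero_ae_def)
 hence qz: "zero_ae Om (\<lambda>x. \<Sum>i<n. q i x)" unfolding zero_ae_def by eventually_elim simp
 have mL: "mat_app (Lam1 n am + Lam2 n ap) p i \<in> L2 Om" for i
  by (rule mat_app_L2[OF Lam_carrier(3)]) (use pL in \<open>simp add: L2t_def\<close>)
 have 1: "(\<Sum>i<n. Rinv i * ip Om (v i) (z i)) = 0"
  using zz[OF HdivD(1)[OF Om vD(2)] _ HdivD(1)[OF Om vD(1)]] z(2) by simp
 have 2: "L2_inner_tuple Om n p (Div Om z) = 0"
  unfolding L2_inner_tuple_def Div_def
  using zz[OF HdivD(2)[OF Om vD(2)] zero_weak_div[OF Om vD(2)] pL(1)] z(2) by simp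
 have 3: "L2_inner_tuple Om n (Div Om v) q = 0"
  unfolding L2_inner_tuple_def Div_def using zz[OF pL(2) _ HdivD(2)[OF Om vD(1)]] q(2) by simp
 have 4: "L2_inner_tuple Om n (mat_app (Lam1 n am + Lam2 n ap) p) q = 0"
  unfolding L2_inner_tuple_def using zz[OF pL(2) _ mL] q(2) by simp
 show ?thesis
  unfolding A_form_def 1 2 3 4 zz[OF strain_L2[OF Om wH] zero_strain[OF Om wH w(2)] strain_L2[OF Om uH]]
   zz[OF dL(2) dz dL(1)] zz[OF dL(2) dz S(1)] zz[OF S(2) qz dL(1)] by simp
qed

text \<open>Makes the denominators positive on nonzero triples; a zero denominator would turn the
  quotient into 0. For u, zero strain kills the i-th derivative of the i-th component, and
  Poincare's inequality in that direction does the rest.\<close>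

lemma definite:
 assumes u: "u \<in> U_space Om" and v: "v \<in> V_space Om n" and p: "p \<in> P_space Om n"
  and z: "U_inner Om lam u u + V_inner Om n lam Rinv ap am v v + P_inner Om n lam Rinv ap am p p = 0"
 shows "zero_ae Om u \<and> (\<forall>i<n. zero_ae Om (v i)) \<and> (\<forall>i<n. zero_ae Om (p i))"
proof -
 note nn = U_inner_nonneg[OF Om bd adm n, of u] V_inner_nonneg[OF Om bd adm n v] P_inner_nonneg[OF Om bd adm n p]
 have 0: "U_inner Om lam u u = 0" "V_inner Om n lam Rinv ap am v v = 0" "P_inner Om n lam Rinv ap am p p = 0"
  using nn z by linarith+
 note uH = U_H1f[OF Om u]
 obtain R where R: "\<forall>x\<in>Om. norm x \<le> R" using bd by (auto simp: bounded_iff)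
 have Rj: "\<bar>x$j\<bar> \<le> R" if "x \<in> Om" for x j
  using component_le_norm_cart[of x j] bspec[OF R that] by linarith
 have "0 \<le> lam * ip Om (wd Om u) (wd Om u)"
  using lam_pos[OF Om bd adm n] by (intro mult_nonneg_nonneg) simp_all
 hence "ip Om (strain Om u) (strain Om u) = 0"
  using 0(1) L2_inner_self_nonneg[of Om "strain Om u"] unfolding U_inner_def by linarith
 hence e: "L2n Om (strain Om u) = 0" by (simp add: L2n_def)
 have "zero_ae Om (\<lambda>x. u x$i)" for i
 proof -
  have ui: "(\<lambda>x. u x$i) \<in> H10 Om" using u by (simp add: U_space_def)
  have "L2n Om (\<lambda>x. wg Om (\<lambda>x. u x$i) x$i) = 0"
   using diagonal_le_strain[OF Om uH, of i] e by (intro antisym) simp_all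
  hence "L2n Om (\<lambda>x. u x$i) \<le> 0" using H10_Poincare[OF Om ui Rj, of i] by simp
  hence "L2n Om (\<lambda>x. u x$i) = 0" by (intro antisym) simp_all
  thus ?thesis using L2n_eq_0[OF H1D(1)[OF Om H10_H1[OF Om ui]]] by simp
 qed
 hence "AE x in leb Om. \<forall>i. u x$i = 0" unfolding AE_all_countable zero_ae_def by blast
 hence "zero_ae Om u" unfolding zero_ae_def by eventually_elim (simp add: cart_eq_iff)
 moreover have "zero_ae Om (v i)" if i: "i < n" for i
 proof -
  have vH: "\<forall>i<n. v i \<in> H0div Om" using V_space_mem[OF v] by blast
  have "V_inner Om n lam Rinv ap am v v = (\<Sum>i<n. Rinv i * ip Om (v i) (v i)) + Dq Om n lam Rinv ap am (Div Om v)"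
   by (rule V_inner_eq[OF Om bd adm n]) (use vH in blast)
  moreover have "0 \<le> Dq Om n lam Rinv ap am (Div Om v)"
   by (rule Dq_nonneg[OF Om bd adm n], rule Div_L2t[OF Om bd adm n]) (use vH in blast)
  moreover have t: "0 \<le> Rinv i * ip Om (v i) (v i)" if "i \<in> {..<n}" for i
   using Rinv_pos[OF Om bd adm n, of i] that by (intro mult_nonneg_nonneg) simp_all
  moreover have "0 \<le> (\<Sum>i<n. Rinv i * ip Om (v i) (v i))" by (rule sum_nonneg[OF t])
  ultimately have "(\<Sum>i<n. Rinv i * ip Om (v i) (v i)) = 0" using 0(2) by linarith
  hence "\<forall>i\<in>{..<n}. Rinv i * ip Om (v i) (v i) = 0"
   using sum_nonneg_eq_0_iff[of "{..<n}" "\<lambda>i. Rinv i * ip Om (v i) (v i)"] t by simp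
  hence "Rinv i * ip Om (v i) (v i) = 0" using i by simp
  hence "L2n Om (v i) = 0" using Rinv_pos[OF Om bd adm n i] by (simp add: L2n_def)
  thus ?thesis using L2n_eq_0[OF HdivD(1)[OF Om H0div_Hdiv[OF Om V_space_mem[OF v i]]]] by simp
 qed
 moreover have "zero_ae Om (p i)" if i: "i < n" for i
 proof -
  have pt: "p \<in> L2t Om n" by (rule P_space_L2t[OF Om bd adm n p])
  have "inverse (Max (Rinv ` {..<n}))*(\<Sum>i<n. ip Om (p i) (p i)) \<le> 0"
   using Qf_LM_bounds(2)[OF Om bd adm n pt] 0(3) P_inner_eq[OF Om bd adm n pt] by simp
  hence "\<not> 0 < (\<Sum>i<n. ip Om (p i) (p i))"
   using mult_pos_pos[OF \<rho>_pos[OF Om bd adm n], of "\<Sum>i<n. ip Om (p i) (p i)"] by linarith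
  moreover have "0 \<le> (\<Sum>i<n. ip Om (p i) (p i))" by (intro sum_nonneg) simp
  ultimately have "(\<Sum>i<n. ip Om (p i) (p i)) = 0" by linarith
  hence "ip Om (p i) (p i) = 0" using i by (subst (asm) sum_nonneg_eq_0_iff) auto
  hence "L2n Om (p i) = 0" by (simp add: L2n_def)
  thus ?thesis using L2n_eq_0[of "p i" Om] pt i by (simp add: L2t_def)
 qed
 ultimately show ?thesis by blast
qed

text \<open>The form is estimated by the sum E of the squared norms, the theorem uses the sum of the
  norms. Three terms would give the constant 3; 4 is taken for its simple square root.\<close>

lemma norm_sum_bounds:
 fixes u :: "real^'d => real^'d"
 assumes v: "v \<in> V_space Om n" and p: "p \<in> P_space Om n"
 defines "E \<equiv> U_inner Om lam u u + V_inner Om n lam Rinv ap am v v + P_inner Om n lam Rinv ap am p p"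
 shows "0 \<le> E" "norm_sum Om n lam Rinv ap am u v p \<le> 2 * sqrt E" "sqrt E \<le> norm_sum Om n lam Rinv ap am u v p"
proof -
 define a b c where "a = U_inner Om lam u u" and "b = V_inner Om n lam Rinv ap am v v" and "c = P_inner Om n lam Rinv ap am p p"
 have nn: "0 \<le> a" "0 \<le> b" "0 \<le> c"
  unfolding a_def b_def c_def
  by (rule U_inner_nonneg[OF Om bd adm n], rule V_inner_nonneg[OF Om bd adm n v], rule P_inner_nonneg[OF Om bd adm n p])
 have E: "E = a + b + c" by (simp add: E_def a_def b_def c_def)
 have N: "norm_sum Om n lam Rinv ap am u v p = sqrt a + sqrt b + sqrt c" by (simp add: norm_sum_def a_def b_def c_def)
 show "0 \<le> E" using nn E by simp
 show "sqrt E \<le> norm_sum Om n lam Rinv ap am u v p"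
  unfolding E N using sqrt_add_le_add_sqrt[of "a + b" c] sqrt_add_le_add_sqrt[of a b] nn by linarith
 have "(sqrt a + sqrt b + sqrt c)^2 \<le> 4 * E"
 proof -
  have "2*(sqrt a * sqrt b) \<le> a + b" "2*(sqrt a * sqrt c) \<le> a + c" "2*(sqrt b * sqrt c) \<le> b + c"
   using sum_squares_bound[of "sqrt a" "sqrt b"] sum_squares_bound[of "sqrt a" "sqrt c"] sum_squares_bound[of "sqrt b" "sqrt c"] nn
   by (simp_all add: mult.assoc)
  moreover have "(sqrt a + sqrt b + sqrt c)^2 = a + b + c + 2*(sqrt a * sqrt b) + 2*(sqrt a * sqrt c) + 2*(sqrt b * sqrt c)"
   using nn by (simp add: power2_eq_square algebra_simps)
  ultimately show ?thesis unfolding E using nn by simp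
 qed
 hence "sqrt a + sqrt b + sqrt c \<le> sqrt (4 * E)" by (rule real_le_rsqrt)
 thus "norm_sum Om n lam Rinv ap am u v p \<le> 2 * sqrt E" unfolding N by (simp add: real_sqrt_mult)
qed

end

theorem theorem3:
  fixes \<Omega> :: "(real^'d) set"
  assumes "CARD('d) = 2 \<or> CARD('d) = 3"
    and "bounded_lipschitz_domain \<Omega>"
  shows "\<exists>\<omega>::real. \<omega> > 0 \<and>
    (\<forall>(n::nat) (lam::real) (Rinv::nat \<Rightarrow> real) (ap::nat \<Rightarrow> real) (am::nat \<Rightarrow> nat \<Rightarrow> real).
      n \<ge> 1 \<longrightarrow> admissible n lam Rinv ap am \<longrightarrow>
      (INF (u, v, p) \<in> nonzero_triples \<Omega> n. SUP (w, z, q) \<in> nonzero_triples \<Omega> n.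
         ereal (A_form \<Omega> n lam Rinv ap am u v p w z q /
           (norm_sum \<Omega> n lam Rinv ap am u v p * norm_sum \<Omega> n lam Rinv ap am w z q)))
      \<ge> ereal \<omega>)"
proof -
 have \<Omega>: "open \<Omega>" "bounded \<Omega>" using assms(2) by (simp_all add: bounded_lipschitz_domain_def)
 obtain B where B: "B \<ge> 0" and infsup: "\<And>s. s \<in> L20 \<Omega> ==> \<exists>W. W \<in> U_space \<Omega> \<and> W \<in> H0div \<Omega> \<and>
  ip \<Omega> s (wd \<Omega> W) = (L2n \<Omega> s)^2 \<and> L2n \<Omega> (strain \<Omega> W) \<le> B * L2n \<Omega> s \<and> L2n \<Omega> W \<le> B * L2n \<Omega> s"
  by (rule inf_sup_condition[OF assms(2)], rule that)
 hence infsup': "\<forall>s\<in>L20 \<Omega>. \<exists>W. W \<in> U_space \<Omega> \<and> W \<in> H0div \<Omega> \<and>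
  ip \<Omega> s (wd \<Omega> W) = (L2n \<Omega> s)^2 \<and> L2n \<Omega> (strain \<Omega> W) \<le> B * L2n \<Omega> s \<and> L2n \<Omega> W \<le> B * L2n \<Omega> s"
  by (intro ballI infsup)
 define D where "D = real CARD('d)"
 define k where "k = min (1/(2 * D + 1)) (1/(B^2*(2 * D + 3) + 1))/2"
 define C where "C = 4 + 4*(1 + D) * B^2"
 have D: "0 \<le> D" by (simp add: D_def)
 have dpos: "0 < B^2*(2 * D + 3) + 1" using D by (intro add_nonneg_pos mult_nonneg_nonneg) auto
 have k: "0 < k" using D dpos by (simp add: k_def)
 have C: "0 < C" using D by (simp add: C_def add_pos_nonneg)
 \<comment> \<open>The form is at least k E, while the two norm sums are at most 2 sqrt E and 2 sqrt
   (C E). Both k and C depend on the dimension and on B only.\<close>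
 define \<omega> where "\<omega> = k/(4 * sqrt C)"
 have \<omega>: "0 < \<omega>" using k C by (simp add: \<omega>_def)
 show ?thesis
 proof (intro exI[of _ \<omega>] conjI \<omega> allI impI)
  fix n :: nat and lam :: real and Rinv ap :: "nat => real" and am :: "nat => nat => real"
  assume n: "n \<ge> 1" and adm: "admissible n lam Rinv ap am"
  let ?E = "\<lambda>u v p. U_inner \<Omega> lam u u + V_inner \<Omega> n lam Rinv ap am v v + P_inner \<Omega> n lam Rinv ap am p p"
  let ?N = "norm_sum \<Omega> n lam Rinv ap am"
  let ?A = "A_form \<Omega> n lam Rinv ap am"
  \<comment> \<open>One good test triple for each (u, v, p) bounds the supremum from below.\<close>
  have main: "\<exists>x\<in>nonzero_triples \<Omega> n. \<omega> \<le> (case x of (w, z, q) => ?A u v p w z q/(?N u v p * ?N w z q))"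
   if t: "(u, v, p) \<in> nonzero_triples \<Omega> n" for u v p
  proof -
   have u: "u \<in> U_space \<Omega>" and v: "v \<in> V_space \<Omega> n" and p: "p \<in> P_space \<Omega> n"
    and nz: "\<not> (zero_ae \<Omega> u \<and> (\<forall>i<n. zero_ae \<Omega> (v i)) \<and> (\<forall>i<n. zero_ae \<Omega> (p i)))"
    using t by (simp_all add: nonzero_triples_def)
   note b = norm_sum_bounds[where u = u, OF \<Omega> adm n v p]
   have Epos: "0 < ?E u v p"
   proof (rule ccontr)
    assume "\<not> 0 < ?E u v p"
    with b(1) have "?E u v p = 0" by (simp only: not_less order_class.order.eq_iff)
    from definite[OF \<Omega> adm n u v p this] nz show False by (rule notE[rotated])
   qed
   obtain w z q where wzq: "w \<in> U_space \<Omega>" "z \<in> V_space \<Omega> n" "q \<in> P_space \<Omega> n"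
    "k * ?E u v p \<le> ?A u v p w z q" "?E w z q \<le> C * ?E u v p"
    using main_estimate[OF \<Omega> adm n B infsup' u v p] unfolding k_def C_def D_def by (elim exE conjE)
   note b' = norm_sum_bounds[where u = w, OF \<Omega> adm n wzq(2,3)]
   have Apos: "0 < ?A u v p w z q" using mult_pos_pos[OF k Epos] wzq(4) by linarith
   have nz': "\<not> (zero_ae \<Omega> w \<and> (\<forall>i<n. zero_ae \<Omega> (z i)) \<and> (\<forall>i<n. zero_ae \<Omega> (q i)))"
   proof
    assume "zero_ae \<Omega> w \<and> (\<forall>i<n. zero_ae \<Omega> (z i)) \<and> (\<forall>i<n. zero_ae \<Omega> (q i))"
    hence "?A u v p w z q = 0"
     by (elim conjE) (rule A_form_zero[OF \<Omega> adm n wzq(1) _ wzq(2) _ wzq(3) _ u v p])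
    thus False using Apos by simp
   qed
   have E'pos: "0 < ?E w z q"
   proof (rule ccontr)
    assume "\<not> 0 < ?E w z q"
    with b'(1) have "?E w z q = 0" by (simp only: not_less order_class.order.eq_iff)
    from definite[OF \<Omega> adm n wzq(1,2,3) this] nz' show False by (rule notE[rotated])
   qed
   have Npos: "0 < ?N u v p" "0 < ?N w z q"
    using b(3) b'(3) Epos E'pos real_sqrt_gt_zero[OF Epos] real_sqrt_gt_zero[OF E'pos] by linarith+
   have "?N u v p * ?N w z q \<le> (2 * sqrt (?E u v p))*(2 * sqrt (?E w z q))"
    using b(1,2) b'(2) Npos by (intro mult_mono) auto
   also have "\<dots> \<le> (2 * sqrt (?E u v p))*(2 * sqrt (C * ?E u v p))"
    using wzq(5) b(1) by (intro mult_left_mono) auto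
   also have "\<dots> = 4 * sqrt C * ?E u v p" using b(1) by (simp add: real_sqrt_mult)
   finally have "\<omega>*(?N u v p * ?N w z q) \<le> \<omega>*(4 * sqrt C * ?E u v p)" using \<omega> by (intro mult_left_mono) auto
   also have "\<dots> = k * ?E u v p" using C by (simp add: \<omega>_def)
   also have "\<dots> \<le> ?A u v p w z q" by (rule wzq(4))
   finally have "\<omega> \<le> ?A u v p w z q/(?N u v p * ?N w z q)" using Npos by (simp add: pos_le_divide_eq)
   moreover have "(w, z, q) \<in> nonzero_triples \<Omega> n" using wzq(1-3) nz' by (simp add: nonzero_triples_def)
   ultimately show ?thesis by (intro bexI[of _ "(w, z, q)"]) simp_all
  qed
  show "ereal \<omega> \<le> (INF (u, v, p) \<in> nonzero_triples \<Omega> n. SUP (w, z, q) \<in> nonzero_triples \<Omega> n.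
     ereal (?A u v p w z q/(?N u v p * ?N w z q)))"
  proof (rule INF_greatest)
   fix x assume x: "x \<in> nonzero_triples \<Omega> n"
   obtain u v p where xu: "x = (u, v, p)" by (cases x)
   obtain y where y: "y \<in> nonzero_triples \<Omega> n" "\<omega> \<le> (case y of (w, z, q) => ?A u v p w z q/(?N u v p * ?N w z q))"
    using main[OF x[unfolded xu]] by (rule bexE)
   show "ereal \<omega> \<le> (case x of (u, v, p) => SUP (w, z, q) \<in> nonzero_triples \<Omega> n. ereal (?A u v p w z q/(?N u v p * ?N w z q)))"
    unfolding xu prod.case by (rule SUP_upper2[OF y(1)]) (use y(2) in \<open>simp add: split_beta\<close>)
  qed
 qed
qed

end
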